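(* Let $q=p^r$ be an odd prime power, $n\ge1$, and let $M$ be chosen uniformly at random from $\mathrm{Sp}(2n,q)$. Fix a strictly increasing sequence $b_1<\cdots<b_k$ of positive integers coprime to $p$. Then for any $a_1,\ldots,a_k\in\mathbb{F}_q$, $$\left|\mathbb{P}_{M\in\mathrm{Sp}(2n,q)}\big(\forall\,1\le i\le k:\ \mathrm{Tr}(M^{b_i})=a_i\big)-q^{-k}\right|\le q^{-\frac{n^2}{2b_k}}\,q^{\frac n2}\Big(1+\frac1{q^2-1}\Big)^n\binom{n-1+2b_k}{n}.$$
   Context: $\mathrm{Sp}(2n,q)=\{g\in\mathrm{GL}(2n,\mathbb{F}_q):g^tJg=J\}$ for a fixed invertible antisymmetric $2n\times2n$ matrix $J$ over $\mathbb{F}_q$, with uniform probability measure. *)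

theory Defs
  imports "Jordan_Normal_Form.Matrix" "Jordan_Normal_Form.Determinant"
begin

definition mat_trace :: "'a::comm_ring_1 mat \<Rightarrow> 'a" where
  "mat_trace A = (\<Sum>i<dim_row A. A $$ (i, i))"

definition symp_group :: "nat \<Rightarrow> 'a::field mat \<Rightarrow> 'a mat set" where
  "symp_group n J = {g \<in> carrier_mat (2*n) (2*n). invertible_mat g \<and> transpose_mat g * J * g = J}"

end

theory Submission
  imports Defs "HOL-Library.Cardinality" "HOL-Computational_Algebra.Computational_Algebra"
begin

text \<open>Fix an additive character \<open>\<psi>\<close> and \<open>t \<noteq> 0\<close>, and let \<open>e\<^sub>n\<close> be the average of
  \<open>\<psi> (\<Sum>\<^sub>i t\<^sub>i Tr M\<^sup>b\<^sup>i)\<close> over the symplectic group of rank \<open>n\<close>. Summing over pairs of a group element \<open>T\<close>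
  and a vector \<open>x\<close>, and sorting the pairs by the recurrence sequence
  \<open>i \<mapsto> \<omega>(x, (T + T\<^sup>-\<^sup>1)\<^sup>i x)\<close> together with the minimal polynomial of the radical of the cyclic space of
  \<open>x\<close>, Witt's theorem yields \<open>q\<^sup>2\<^sup>n e\<^sub>n = \<Sum>\<^sub>N C\<^sub>N e\<^bsub>n-N\<^esub>\<close>. The generating function of \<open>C\<close> factors as
  \<open>A(qu) B(u)\<close>, where \<open>A\<close> sums the values of \<open>\<psi>\<close> over monic polynomials and \<open>B\<close> does so with a quadratic
  twist. Translating the coefficients shows that \<open>A\<close> and \<open>B\<close> are polynomials of degree less than \<open>b\<close> and
  \<open>b + 2\<close>, \<open>b\<close> being the largest exponent with \<open>t \<noteq> 0\<close>. Hence \<open>e\<^sub>n\<close> is dominated by the solution of the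
  recursion with \<open>C\<close> replaced by \<open>(1 + q\<^sup>2 u)\<^sup>b\<^sup>-\<^sup>1 (1 + q u)\<^sup>b\<^sup>+\<^sup>1\<close>, which is a product of Euler products.
  The theorem follows by Fourier inversion over \<open>t\<close>.\<close>

section \<open>Linear maps and alternating forms over a finite field\<close>

text \<open>\<open>\<Lambda> = T + T^-1\<close> is used because it is self-adjoint for the form:
  \<open>\<omega> x (p(\<Lambda>) x)\<close> vanishes for every \<open>p\<close>, so the sequence
  that classifies a pair has to be \<open>\<omega> x (T \<Lambda>^i x)\<close>, and this one
  sequence fixes the whole Gram matrix of the orbit. If \<open>f\<close> is its minimal polynomial
  and \<open>h\<close> that of the radical, \<open>x\<close> has minimal polynomial
  \<open>Phi f * h\<close> with \<open>Phi f = z^deg f * f(z + 1/z)\<close>, while the quotient dual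
  to the radical contributes the reciprocal of \<open>h\<close> to the traces. The radical therefore
  brings in \<open>h * rstar h\<close>, a norm from \<open>F(z)\<close> to
  \<open>F(z + 1/z)\<close>; the obstacle is to count the \<open>h\<close> with a given norm. That
  count is the divisor sum of the quadratic character \<open>kappa\<close>, whence the twist in
  \<open>B\<close>; one factor \<open>A\<close> then cancels against the count of sequences, which
  leaves \<open>A(qu) B(u)\<close>. Coprimality of the exponents to \<open>p\<close> enters where a
  shift of one coefficient by \<open>e\<close> moves the power sum of index \<open>d\<close> by
  \<open>-d e\<close>. The degree bounds give \<open>b - 1\<close> and \<open>b + 1\<close> linear
  factors in the majorant, hence the \<open>2b\<close> in the binomial coefficient and in
  \<open>n^2/(2b)\<close>.\<close>

locale finite_field_space = vector_space scale
  for scale :: "'a::{field,finite} \<Rightarrow> 'b::ab_group_add \<Rightarrow> 'b" (infixr \<open>*s\<close> 75)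
begin

text \<open>Endomorphisms of a subspace are functions on the whole type, unconstrained off
  \<open>S\<close>, so that products and powers are plain composition and \<open>^^\<close>.\<close>

definition lin_on :: "'b set \<Rightarrow> ('b \<Rightarrow> 'b) \<Rightarrow> bool" where
  "lin_on S A \<longleftrightarrow> (\<forall>x\<in>S. A x \<in> S) \<and> (\<forall>x\<in>S. \<forall>y\<in>S. A (x + y) = A x + A y) \<and> (\<forall>c. \<forall>x\<in>S. A (c *s x) = c *s A x)"

lemma lin_onD:
  assumes "lin_on S A"
  shows "x \<in> S \<Longrightarrow> A x \<in> S" "x \<in> S \<Longrightarrow> y \<in> S \<Longrightarrow> A (x + y) = A x + A y" "x \<in> S \<Longrightarrow> A (c *s x) = c *s A x"
  using assms unfolding lin_on_def by auto

lemma lin_on_0: "lin_on S A \<Longrightarrow> subspace S \<Longrightarrow> A 0 = 0"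
  using lin_onD(3)[of S A 0 0] subspace_0 by auto

lemma lin_on_diff: "lin_on S A \<Longrightarrow> subspace S \<Longrightarrow> x \<in> S \<Longrightarrow> y \<in> S \<Longrightarrow> A (x - y) = A x - A y"
  using lin_onD(2)[of S A "x - y" y] subspace_diff[of S x y] by (simp add: algebra_simps)

lemma lin_on_sum:
  assumes "lin_on S A" "subspace S" "\<And>i. i \<in> I \<Longrightarrow> g i \<in> S"
  shows "A (\<Sum>i\<in>I. g i) = (\<Sum>i\<in>I. A (g i))"
  using assms(3)
proof (induction I rule: infinite_finite_induct)
  case (insert i I)
  then show ?case
    using lin_onD(2)[OF assms(1), of "g i" "\<Sum>i\<in>I. g i"] subspace_sum[OF assms(2), of I g] by auto
qed (use lin_on_0[OF assms(1,2)] in auto)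

lemma lin_on_comp: "lin_on S A \<Longrightarrow> lin_on S B \<Longrightarrow> lin_on S (A \<circ> B)"
  unfolding lin_on_def by auto

lemma lin_on_funpow: "lin_on S A \<Longrightarrow> lin_on S (A ^^ k)"
  by (induction k) (auto simp: lin_on_comp, simp add: lin_on_def)

lemma sum_rep:
  assumes "independent B" "finite B" "span B = S" "x \<in> S"
  shows "(\<Sum>b\<in>B. representation B x b *s b) = x"
  using sum_representation_eq[of B x B] assms by auto

lemma finite_basis_exists:
  assumes "subspace S" "finite S"
  obtains B where "independent B" "finite B" "span B = S" "card B = dim S" "B \<subseteq> S"
  by (metis assms basis_exists finite_subset span_subspace)

text \<open>An arbitrary finite basis is chosen; \<open>tr_basis_change\<close> shows that the
  choice does not matter for maps linear on \<open>S\<close>.\<close>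

definition tr :: "'b set \<Rightarrow> ('b \<Rightarrow> 'b) \<Rightarrow> 'a" where
  "tr S A = (let B = SOME B. independent B \<and> finite B \<and> span B = S in \<Sum>b\<in>B. representation B (A b) b)"

text \<open>Writing \<open>A b\<close> in the coordinates of \<open>C\<close> twice gives a triple
  sum; its sum over \<open>B\<close> multiplies the two base-change matrices, which are inverse to
  each other.\<close>

lemma tr_basis_change:
  assumes B: "independent B" "finite B" "span B = S" and C: "independent C" "finite C" "span C = S"
    and A: "lin_on S A"
  shows "(\<Sum>b\<in>B. representation B (A b) b) = (\<Sum>c\<in>C. representation C (A c) c)"
proof -
  have sub: "subspace S" using B(3) subspace_span by blast
  have BS: "b \<in> S" if "b \<in> B" for b using B(3) span_base that by auto
  have CS: "c \<in> S" if "c \<in> C" for c using C(3) span_base that by auto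
  note AS = lin_onD(1)[OF A]
  have rs: "representation D (\<Sum>c\<in>I. g c *s h c) e = (\<Sum>c\<in>I. g c * representation D (h c) e)"
    if "independent D" "span D = S" "\<And>c. c \<in> I \<Longrightarrow> h c \<in> S" for D I g e and h :: "'b \<Rightarrow> 'b"
  proof -
    have "representation D (\<Sum>c\<in>I. g c *s h c) = (\<lambda>e. \<Sum>c\<in>I. representation D (g c *s h c) e)"
      by (rule representation_sum) (use that subspace_scale[OF sub] in auto)
    moreover have "representation D (g c *s h c) e = g c * representation D (h c) e" if "c \<in> I" for c
      using representation_scale[OF \<open>independent D\<close>, of "h c" "g c"] that \<open>span D = S\<close> \<open>\<And>c. c \<in> I \<Longrightarrow> h c \<in> S\<close> by simp
    ultimately show ?thesis by simp
  qed
  have Ab: "representation B (A b) e = (\<Sum>c\<in>C. representation C b c * representation B (A c) e)" if "b \<in> B" for b e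
  proof -
    have "A b = A (\<Sum>c\<in>C. representation C b c *s c)"
      using sum_rep[OF C BS[OF that]] by simp
    also have "\<dots> = (\<Sum>c\<in>C. representation C b c *s A c)"
      by (subst lin_on_sum[OF A sub]) (auto simp: CS subspace_scale[OF sub] lin_onD(3)[OF A CS])
    finally show ?thesis using rs[OF B(1,3), of C A "representation C b" e] AS CS by simp
  qed
  have Ac: "representation B (A c) e = (\<Sum>d\<in>C. representation C (A c) d * representation B d e)" if "c \<in> C" for c e
    using rs[OF B(1,3), of C "\<lambda>d. d" "representation C (A c)" e] CS sum_rep[OF C AS[OF CS[OF that]]] by simp
  have "(\<Sum>b\<in>B. representation B (A b) b)
      = (\<Sum>b\<in>B. \<Sum>c\<in>C. \<Sum>d\<in>C. representation C (A c) d * (representation B d b * representation C b c))"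
    by (rule sum.cong[OF refl]) (simp add: Ab Ac sum_distrib_left mult.commute mult.left_commute)
  also have "\<dots> = (\<Sum>c\<in>C. \<Sum>b\<in>B. \<Sum>d\<in>C. representation C (A c) d * (representation B d b * representation C b c))"
    by (rule sum.swap)
  also have "\<dots> = (\<Sum>c\<in>C. \<Sum>d\<in>C. \<Sum>b\<in>B. representation C (A c) d * (representation B d b * representation C b c))"
    by (rule sum.cong[OF refl]) (rule sum.swap)
  also have "\<dots> = (\<Sum>c\<in>C. \<Sum>d\<in>C. representation C (A c) d * (if c = d then 1 else 0))"
  proof (intro sum.cong refl)
    fix c d assume cd: "c \<in> C" "d \<in> C"
    have "(\<Sum>b\<in>B. representation B d b * representation C b c) = representation C d c"
      using rs[OF C(1,3), of B "\<lambda>b. b" "representation B d" c] BS sum_rep[OF B CS[OF cd(2)]] by simp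
    also have "\<dots> = (if c = d then 1 else 0)" using representation_basis[OF C(1) cd(2)] by simp
    finally show "(\<Sum>b\<in>B. representation C (A c) d * (representation B d b * representation C b c))
        = representation C (A c) d * (if c = d then 1 else 0)"
      unfolding sum_distrib_left[symmetric] by simp
  qed
  finally show ?thesis using C(2) by (simp add: if_distrib cong: if_cong)
qed

lemma tr_eq:
  assumes B: "independent B" "finite B" "span B = S" and A: "lin_on S A"
  shows "tr S A = (\<Sum>b\<in>B. representation B (A b) b)"
proof -
  define C where "C = (SOME B. independent B \<and> finite B \<and> span B = S)"
  have "independent C \<and> finite C \<and> span C = S"
    unfolding C_def by (rule someI[of _ B]) (use B in auto)
  then show ?thesis
    unfolding tr_def Let_def using tr_basis_change[OF B _ _ _ A, of C] C_def by simp
qed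

lemma tr_cong:
  assumes "subspace S" "finite S" "lin_on S A" "\<And>x. x \<in> S \<Longrightarrow> A x = A' x"
  shows "tr S A = tr S A'"
proof -
  obtain B where B: "independent B" "finite B" "span B = S" "B \<subseteq> S" using finite_basis_exists[OF assms(1,2)] by metis
  have "lin_on S A'"
    unfolding lin_on_def
    by (simp add: assms(4)[symmetric] lin_onD[OF assms(3)] subspace_add[OF assms(1)] subspace_scale[OF assms(1)])
  then show ?thesis
    using assms B by (simp add: tr_eq[OF B(1-3)] subset_iff)
qed

text \<open>Coordinate functionals \<open>f i\<close> dual to the spanning family \<open>e i\<close> make it a basis.\<close>

lemma tr_dual:
  assumes I: "finite I" and e: "span (e ` I) = S" and A: "lin_on S A"
    and f: "\<And>i x y. i \<in> I \<Longrightarrow> x \<in> S \<Longrightarrow> y \<in> S \<Longrightarrow> f i (x + y) = f i x + f i y"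
      "\<And>i c x. i \<in> I \<Longrightarrow> x \<in> S \<Longrightarrow> f i (c *s x) = c * f i x"
    and d: "\<And>i j. i \<in> I \<Longrightarrow> j \<in> I \<Longrightarrow> f i (e j) = (if i = j then 1 else 0)"
  shows "independent (e ` I)" "inj_on e I" "tr S A = (\<Sum>i\<in>I. f i (A (e i)))"
proof -
  have sub: "subspace S" using e subspace_span by blast
  have eS: "e i \<in> S" if "i \<in> I" for i using e span_base that by auto
  show inj: "inj_on e I"
  proof (rule inj_onI)
    fix i j assume "i \<in> I" "j \<in> I" "e i = e j"
    then show "i = j" using d[of i i] d[of i j] by (auto split: if_splits)
  qed
  have fsum: "f i (\<Sum>j\<in>J. c j *s e j) = (\<Sum>j\<in>J. c j * f i (e j))" if "i \<in> I" "J \<subseteq> I" for i c J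
    using finite_subset[OF that(2) I] that(2)
  proof (induction J rule: finite_induct)
    case empty
    show ?case using f(2)[OF that(1), of 0 0] subspace_0[OF sub] by auto
  next
    case (insert j J)
    have "(\<Sum>j\<in>J. c j *s e j) \<in> S" using insert.prems eS sub by (auto intro!: subspace_sum subspace_scale)
    then show ?case using insert f that eS subspace_scale[OF sub] by simp
  qed
  show ind: "independent (e ` I)"
    unfolding dependent_finite[OF finite_imageI[OF I]]
  proof (rule notI, elim exE conjE bexE imageE)
    fix u v i assume s: "(\<Sum>v\<in>e ` I. u v *s v) = 0" and i: "i \<in> I" and v: "v = e i" "u v \<noteq> 0"
    have "(\<Sum>j\<in>I. u (e j) *s e j) = 0" using s inj by (simp add: sum.reindex)
    then have "f i 0 = (\<Sum>j\<in>I. u (e j) * f i (e j))" using fsum[of i I "\<lambda>j. u (e j)"] i by simp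
    also have "\<dots> = (\<Sum>j\<in>I. if i = j then u (e j) else 0)"
      by (rule sum.cong[OF refl]) (use d i in auto)
    also have "\<dots> = u (e i)" using i I by simp
    finally show False using f(2)[OF i, of 0 0] subspace_0[OF sub] v by auto
  qed
  have rep: "representation (e ` I) x (e i) = f i x" if "i \<in> I" "x \<in> S" for i x
  proof -
    have "x = (\<Sum>b\<in>e ` I. representation (e ` I) x b *s b)" using sum_rep[OF ind _ e that(2)] I by simp
    also have "\<dots> = (\<Sum>j\<in>I. representation (e ` I) x (e j) *s e j)" using inj by (simp add: sum.reindex)
    finally have "f i x = f i (\<Sum>j\<in>I. representation (e ` I) x (e j) *s e j)" by simp
    also have "\<dots> = (\<Sum>j\<in>I. representation (e ` I) x (e j) * f i (e j))"
      by (rule fsum) (use that in auto)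
    also have "\<dots> = (\<Sum>j\<in>I. if i = j then representation (e ` I) x (e j) else 0)"
      by (rule sum.cong[OF refl]) (use d that in auto)
    also have "\<dots> = representation (e ` I) x (e i)" using that I by simp
    finally show ?thesis by simp
  qed
  show "tr S A = (\<Sum>i\<in>I. f i (A (e i)))"
    using tr_eq[OF ind _ e A] I inj rep lin_onD(1)[OF A] eS by (simp add: sum.reindex)
qed

text \<open>A block triangular matrix: \<open>S1\<close> is invariant, the complement
  \<open>S2\<close> need not be, so its diagonal block is the compression
  \<open>\<pi> \<circ> A\<close>. Linearity of \<open>\<pi>\<close> comes from uniqueness of the
  decomposition.\<close>

lemma tr_split:
  assumes S: "finite S" "subspace S" "subspace S1" "subspace S2" "S1 \<subseteq> S" "S2 \<subseteq> S" "S1 \<inter> S2 \<subseteq> {0}"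
    and pr: "\<And>x. x \<in> S \<Longrightarrow> \<pi> x \<in> S2" "\<And>x. x \<in> S \<Longrightarrow> x - \<pi> x \<in> S1"
    and A: "lin_on S A" "\<And>x. x \<in> S1 \<Longrightarrow> A x \<in> S1"
  shows "tr S A = tr S1 A + tr S2 (\<pi> \<circ> A)"
proof -
  obtain B1 where B1: "independent B1" "finite B1" "span B1 = S1" "B1 \<subseteq> S1"
    using finite_basis_exists[OF S(3)] S by (metis finite_subset)
  obtain B2 where B2: "independent B2" "finite B2" "span B2 = S2" "B2 \<subseteq> S2"
    using finite_basis_exists[OF S(4)] S by (metis finite_subset)
  have uniq: "\<pi> x = y" if "x \<in> S" "y \<in> S2" "x - y \<in> S1" for x y
  proof -
    have "(x - y) - (x - \<pi> x) \<in> S1" using pr[OF that(1)] that subspace_diff[OF S(3)] by blast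
    moreover have "\<pi> x - y \<in> S2" using pr[OF that(1)] that subspace_diff[OF S(4)] by blast
    ultimately show ?thesis using S(7) by (auto simp: algebra_simps)
  qed
  have padd: "\<pi> (x + y) = \<pi> x + \<pi> y" if "x \<in> S" "y \<in> S" for x y
  proof (rule uniq)
    have e: "x + y - (\<pi> x + \<pi> y) = (x - \<pi> x) + (y - \<pi> y)" by simp
    show "x + y - (\<pi> x + \<pi> y) \<in> S1"
      unfolding e by (rule subspace_add[OF S(3) pr(2)[OF that(1)] pr(2)[OF that(2)]])
  qed (use that pr subspace_add[OF S(2)] subspace_add[OF S(4)] in auto)
  have psc: "\<pi> (c *s x) = c *s \<pi> x" if "x \<in> S" for x c
  proof (rule uniq)
    have "c *s x - c *s \<pi> x = c *s (x - \<pi> x)" by (simp add: scale_right_diff_distrib)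
    then show "c *s x - c *s \<pi> x \<in> S1" using pr(2)[OF that] subspace_scale[OF S(3)] by simp
  qed (use that pr subspace_scale[OF S(2)] subspace_scale[OF S(4)] in auto)
  have lin1: "lin_on S1 A" using A S(5) unfolding lin_on_def by blast
  have lin2: "lin_on S2 (\<pi> \<circ> A)"
    using lin_onD[OF A(1)] padd psc pr S(6) unfolding lin_on_def by (simp add: subset_iff)
  have disj: "B1 \<inter> B2 = {}"
    using S(7) B1 B2 dependent_zero by blast
  have indep: "independent (B1 \<union> B2)"
    unfolding dependent_finite[OF finite_UnI[OF B1(2) B2(2)]]
  proof clarify
    fix u v assume v: "v \<in> B1 \<union> B2" "u v \<noteq> 0" and s: "(\<Sum>v\<in>B1 \<union> B2. u v *s v) = 0"
    define x where "x = (\<Sum>v\<in>B1. u v *s v)"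
    define y where "y = (\<Sum>v\<in>B2. u v *s v)"
    have xy: "x + y = 0" using s sum.union_disjoint[OF B1(2) B2(2) disj, of "\<lambda>v. u v *s v"] by (simp add: x_def y_def)
    have x: "x \<in> S1" unfolding x_def using B1 S by (auto intro!: subspace_sum subspace_scale)
    have y: "y \<in> S2" unfolding y_def using B2 S by (auto intro!: subspace_sum subspace_scale)
    have "x = - y" using xy by (simp add: eq_neg_iff_add_eq_0)
    then have "x \<in> S2" using y subspace_neg[OF S(4)] by simp
    then have "x = 0" "y = 0" using x xy S(7) by auto
    then show False
      using independentD[OF B1(1) B1(2) subset_refl, of u v] independentD[OF B2(1) B2(2) subset_refl, of u v] v
      unfolding x_def y_def by blast
  qed
  have sp: "span (B1 \<union> B2) = S"
  proof
    show "span (B1 \<union> B2) \<subseteq> S" using B1 B2 S by (intro span_minimal) auto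
    show "S \<subseteq> span (B1 \<union> B2)"
    proof
      fix x assume x: "x \<in> S"
      have "(x - \<pi> x) \<in> span B1" "\<pi> x \<in> span B2" using pr[OF x] B1 B2 by auto
      then have "(x - \<pi> x) + \<pi> x \<in> span (B1 \<union> B2)"
        by (intro span_add) (use span_mono in blast)+
      then show "x \<in> span (B1 \<union> B2)" by simp
    qed
  qed
  have r1: "representation (B1 \<union> B2) x = representation B1 x" if "x \<in> S1" for x
    using representation_extend[OF indep, of x B1] that B1 by auto
  have r2: "representation (B1 \<union> B2) x = representation B2 x" if "x \<in> S2" for x
    using representation_extend[OF indep, of x B2] that B2 by auto
  have z: "representation B1 x b = 0" if "b \<in> B2" for x b
    using that disj representation_ne_zero by blast
  have e2: "representation (B1 \<union> B2) x b = representation B2 (\<pi> x) b" if "x \<in> S" "b \<in> B2" for x b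
  proof -
    have "representation (B1 \<union> B2) ((x - \<pi> x) + \<pi> x) b = representation (B1 \<union> B2) (x - \<pi> x) b + representation (B1 \<union> B2) (\<pi> x) b"
      by (subst representation_add[OF indep]) (use pr[OF that(1)] S sp in auto)
    then show ?thesis using r1 r2 z pr[OF that(1)] that by simp
  qed
  have "tr S A = (\<Sum>b\<in>B1. representation (B1 \<union> B2) (A b) b) + (\<Sum>b\<in>B2. representation (B1 \<union> B2) (A b) b)"
    using tr_eq[OF indep _ sp A(1)] B1(2) B2(2) disj by (simp add: sum.union_disjoint)
  also have "(\<Sum>b\<in>B1. representation (B1 \<union> B2) (A b) b) = tr S1 A"
    using tr_eq[OF B1(1-3) lin1] r1 A(2) B1 by (auto intro!: sum.cong)
  also have "(\<Sum>b\<in>B2. representation (B1 \<union> B2) (A b) b) = tr S2 (\<pi> \<circ> A)"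
    using tr_eq[OF B2(1-3) lin2] e2 lin_onD(1)[OF A(1)] B2(4) S(6) by (auto intro!: sum.cong)
  finally show ?thesis .
qed

lemma card_span:
  assumes "independent B" "finite B"
  shows "card (span B) = CARD('a) ^ card B" "finite (span B)"
proof -
  define f where "f = (\<lambda>u::'b \<Rightarrow> 'a. \<Sum>b\<in>B. u b *s b)"
  have "inj_on f (B \<rightarrow>\<^sub>E UNIV)"
  proof (rule inj_onI)
    fix u v assume u: "u \<in> B \<rightarrow>\<^sub>E UNIV" and v: "v \<in> B \<rightarrow>\<^sub>E UNIV" and e: "f u = f v"
    have "(\<Sum>b\<in>B. (u b - v b) *s b) = 0"
      using e by (simp add: f_def scale_left_diff_distrib sum_subtractf)
    then have "u b = v b" if "b \<in> B" for b
      using independentD[OF assms(1,2) subset_refl, of "\<lambda>b. u b - v b" b] that by simp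
    then show "u = v" using u v by (auto intro!: extensionalityI[of u B v] simp: PiE_def)
  qed
  moreover have "f ` (B \<rightarrow>\<^sub>E UNIV) = span B"
  proof -
    have "\<exists>v\<in>B \<rightarrow>\<^sub>E UNIV. f u = f v" for u
      by (rule bexI[of _ "restrict u B"]) (auto simp: f_def)
    then show ?thesis unfolding span_finite[OF assms(2)] f_def by blast
  qed
  ultimately have "bij_betw f (B \<rightarrow>\<^sub>E UNIV) (span B)" by (simp add: bij_betw_def)
  then show "card (span B) = CARD('a) ^ card B" "finite (span B)"
    using bij_betw_same_card[of f] card_funcsetE[OF assms(2), of "UNIV :: 'a set"]
      bij_betw_finite[of f] finite_PiE[OF assms(2), of "\<lambda>_. UNIV :: 'a set"] by auto
qed

definition nondeg :: "('b \<Rightarrow> 'b \<Rightarrow> 'a) \<Rightarrow> 'b set \<Rightarrow> bool" where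
  "nondeg \<omega> S \<longleftrightarrow> subspace S \<and> finite S \<and> (\<forall>x\<in>S. (\<forall>y\<in>S. \<omega> x y = 0) \<longrightarrow> x = 0)"

text \<open>Acting as the identity off \<open>S\<close> makes each isometry of \<open>S\<close> a
  unique function, so the group is a finite set closed under composition. Invertibility follows from
  nondegeneracy (\<open>Sp_bij\<close>).\<close>

definition Sp :: "('b \<Rightarrow> 'b \<Rightarrow> 'a) \<Rightarrow> 'b set \<Rightarrow> ('b \<Rightarrow> 'b) set" where
  "Sp \<omega> S = {T. lin_on S T \<and> (\<forall>x. x \<notin> S \<longrightarrow> T x = x) \<and> (\<forall>x\<in>S. \<forall>y\<in>S. \<omega> (T x) (T y) = \<omega> x y)}"

end

section \<open>Alternating forms, isometry groups and Witt's extension theorem\<close>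

locale alternating_form = finite_field_space scale
  for scale :: "'a::{field,finite} \<Rightarrow> 'b::ab_group_add \<Rightarrow> 'b" (infixr \<open>*s\<close> 75) +
  fixes \<omega> :: "'b \<Rightarrow> 'b \<Rightarrow> 'a"
  assumes add_left: "\<omega> (x + y) z = \<omega> x z + \<omega> y z"
    and add_right: "\<omega> z (x + y) = \<omega> z x + \<omega> z y"
    and scale_left: "\<omega> (c *s x) z = c * \<omega> x z"
    and scale_right: "\<omega> z (c *s x) = c * \<omega> z x"
    and alt: "\<omega> x x = 0"
    and two_nz: "(2::'a) \<noteq> 0"
begin

lemma skew: "\<omega> y x = - \<omega> x y"
  using alt[of "x + y"] alt[of x] alt[of y] by (simp add: add_left add_right eq_neg_iff_add_eq_0)

lemma zero_left [simp]: "\<omega> 0 x = 0" and zero_right [simp]: "\<omega> x 0 = 0"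
  using scale_left[of 0 0 x] scale_right[of x 0 0] by simp_all

lemma diff_left: "\<omega> (x - y) z = \<omega> x z - \<omega> y z" and diff_right: "\<omega> z (x - y) = \<omega> z x - \<omega> z y"
  using add_left[of "x - y" y z] add_right[of z "x - y" y] by simp_all

lemma sum_left: "\<omega> (\<Sum>i\<in>I. f i) z = (\<Sum>i\<in>I. \<omega> (f i) z)"
  and sum_right: "\<omega> z (\<Sum>i\<in>I. f i) = (\<Sum>i\<in>I. \<omega> z (f i))"
  by (induction I rule: infinite_finite_induct) (auto simp: add_left add_right)

lemma nondegD:
  assumes "nondeg \<omega> S"
  shows "subspace S" "finite S" "x \<in> S \<Longrightarrow> (\<And>y. y \<in> S \<Longrightarrow> \<omega> x y = 0) \<Longrightarrow> x = 0"
  using assms unfolding nondeg_def by blast+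

lemma orth_span:
  assumes "\<And>b. b \<in> B \<Longrightarrow> \<omega> b z = 0" "x \<in> span B"
  shows "\<omega> x z = 0"
  using assms(2) by (induction rule: span_induct_alt) (auto simp: add_left scale_left assms(1))

text \<open>The map \<open>z \<mapsto> (\<omega> b z)\<^sub>b\<close> is injective on \<open>S\<close>, and source and target have the same finite size.\<close>

lemma dual_vector:
  assumes S: "nondeg \<omega> S" and B: "independent B" "B \<subseteq> S"
  obtains z where "z \<in> S" "\<And>b. b \<in> B \<Longrightarrow> \<omega> b z = \<phi> b"
proof -
  obtain C where C: "B \<subseteq> C" "C \<subseteq> S" "independent C" "S \<subseteq> span C"
    using maximal_independent_subset_extend[OF B(2,1)] by metis
  have fC: "finite C" using C(2) nondegD(2)[OF S] finite_subset by blast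
  have sC: "span C = S" using C nondegD(1)[OF S] span_minimal by blast
  define f where "f = (\<lambda>z. restrict (\<lambda>b. \<omega> b z) C)"
  have "inj_on f S"
  proof (rule inj_onI)
    fix x y assume x: "x \<in> S" and y: "y \<in> S" and e: "f x = f y"
    have "\<omega> b (x - y) = 0" if "b \<in> C" for b
      using fun_cong[OF e, of b] that by (simp add: f_def diff_right)
    then have "\<omega> z (x - y) = 0" if "z \<in> S" for z
      using orth_span[of C "x - y" z] that sC by blast
    then have "\<omega> (x - y) z = 0" if "z \<in> S" for z using skew[of "x - y" z] that by simp
    then show "x = y" using nondegD(3)[OF S, of "x - y"] subspace_diff[OF nondegD(1)[OF S] x y] by simp
  qed
  then have "card (f ` S) = CARD('a) ^ card C" using card_image card_span(1)[OF C(3) fC] sC by metis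
  moreover have "f ` S \<subseteq> C \<rightarrow>\<^sub>E UNIV" by (auto simp: f_def)
  ultimately have "f ` S = C \<rightarrow>\<^sub>E UNIV"
    using card_subset_eq[of "C \<rightarrow>\<^sub>E (UNIV :: 'a set)" "f ` S"] card_funcsetE[OF fC, of "UNIV :: 'a set"]
      finite_PiE[OF fC, of "\<lambda>_. UNIV :: 'a set"] by simp
  then have "restrict \<phi> C \<in> f ` S" by auto
  then obtain z where z: "z \<in> S" "f z = restrict \<phi> C" by auto
  have "\<omega> b z = \<phi> b" if "b \<in> B" for b
    using fun_cong[OF z(2), of b] that C(1) by (auto simp: f_def)
  then show ?thesis using that z(1) by blast
qed

text \<open>As \<open>a\<close> lies outside \<open>span Z\<close>, some functional is 1 at
  \<open>a\<close> and 0 on a basis of that span; \<open>dual_vector\<close> represents it by a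
  vector.\<close>

lemma separation:
  assumes S: "nondeg \<omega> S" and Z: "Z \<subseteq> S" and a: "a \<in> S" "a \<notin> span Z"
  obtains t where "t \<in> S" "\<And>z. z \<in> Z \<Longrightarrow> \<omega> z t = 0" "\<omega> a t \<noteq> 0"
proof -
  obtain B where B: "B \<subseteq> Z" "independent B" "Z \<subseteq> span B"
    using maximal_independent_subset[of Z] by metis
  have aB: "a \<notin> span B" using a(2) B(1) span_mono by blast
  then have "independent (insert a B)" using B(2) independent_insertI by blast
  then obtain t where t: "t \<in> S" "\<And>b. b \<in> insert a B \<Longrightarrow> \<omega> b t = (if b = a then 1 else 0)"
    using dual_vector[OF S, of "insert a B" "\<lambda>b. if b = a then 1 else 0"] B(1) Z a by blast
  have "\<omega> b t = 0" if "b \<in> B" for b using t(2)[of b] that aB span_base by auto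
  then have "\<omega> z t = 0" if "z \<in> Z" for z using orth_span[of B t z] that B(3) by blast
  then show ?thesis using that t by fastforce
qed

lemma orth_projection:
  assumes U: "nondeg \<omega> U"
  obtains u where "u \<in> U" "\<And>w. w \<in> U \<Longrightarrow> \<omega> w u = \<omega> w z"
proof -
  obtain B where B: "independent B" "span B = U" "B \<subseteq> U"
    using finite_basis_exists[OF nondegD(1,2)[OF U]] by metis
  obtain u where u: "u \<in> U" "\<And>b. b \<in> B \<Longrightarrow> \<omega> b u = \<omega> b z"
    using dual_vector[OF U B(1,3), of "\<lambda>b. \<omega> b z"] by blast
  have "\<omega> w (u - z) = 0" if "w \<in> U" for w
    by (rule orth_span[of B]) (use u that B in \<open>auto simp: diff_right\<close>)
  then show ?thesis using that u(1) by (simp add: diff_right)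
qed

lemma SpD:
  assumes "T \<in> Sp \<omega> S"
  shows "lin_on S T" "x \<notin> S \<Longrightarrow> T x = x" "x \<in> S \<Longrightarrow> y \<in> S \<Longrightarrow> \<omega> (T x) (T y) = \<omega> x y"
    "x \<in> S \<Longrightarrow> T x \<in> S"
  using assms unfolding Sp_def lin_on_def by auto

lemma Sp_inj:
  assumes S: "nondeg \<omega> S" and T: "T \<in> Sp \<omega> S"
  shows "inj T"
proof (rule injI)
  fix x y assume e: "T x = T y"
  show "x = y"
  proof (cases "x \<in> S \<and> y \<in> S")
    case True
    have "\<omega> (x - y) z = 0" if "z \<in> S" for z
    proof -
      have "\<omega> (x - y) z = \<omega> (T (x - y)) (T z)"
        using SpD(3)[OF T, of "x - y" z] subspace_diff[OF nondegD(1)[OF S]] True that by simp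
      also have "T (x - y) = 0" using lin_on_diff[OF SpD(1)[OF T] nondegD(1)[OF S]] True e by simp
      finally show ?thesis by simp
    qed
    then show ?thesis using nondegD(3)[OF S, of "x - y"] subspace_diff[OF nondegD(1)[OF S]] True by simp
  next
    case False
    then show ?thesis using e SpD(2,4)[OF T] by metis
  qed
qed

lemma Sp_surj:
  assumes S: "nondeg \<omega> S" and T: "T \<in> Sp \<omega> S" and x: "x \<in> S"
  obtains y where "y \<in> S" "T y = x"
proof -
  have "T ` S = S"
    by (rule endo_inj_surj) (use nondegD(2)[OF S] SpD(4)[OF T] Sp_inj[OF S T] in \<open>auto simp: inj_on_def\<close>)
  then have "x \<in> T ` S" using x by simp
  then show ?thesis using that by blast
qed

lemma Sp_bij:
  assumes S: "nondeg \<omega> S" and T: "T \<in> Sp \<omega> S"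
  shows "bij T"
  using Sp_inj[OF S T] Sp_surj[OF S T] SpD(2)[OF T] unfolding bij_def surj_def by metis

lemma Sp_id: "id \<in> Sp \<omega> S" unfolding Sp_def lin_on_def by auto

lemma Sp_comp: "T \<in> Sp \<omega> S \<Longrightarrow> U \<in> Sp \<omega> S \<Longrightarrow> T \<circ> U \<in> Sp \<omega> S"
  unfolding Sp_def lin_on_def by auto

lemma Sp_funpow: "T \<in> Sp \<omega> S \<Longrightarrow> T ^^ k \<in> Sp \<omega> S"
  by (induction k) (use Sp_id Sp_comp in \<open>auto simp: id_def\<close>)

lemma Sp_inv:
  assumes S: "nondeg \<omega> S" and T: "T \<in> Sp \<omega> S"
  shows "inv_into UNIV T \<in> Sp \<omega> S"
proof -
  note b = Sp_bij[OF S T]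
  have iT: "inv_into UNIV T (T x) = x" for x using b by (simp add: bij_is_inj)
  have Ti: "T (inv_into UNIV T x) = x" for x using b by (simp add: bij_is_surj surj_f_inv_f)
  have mem: "inv_into UNIV T x \<in> S" if "x \<in> S" for x using Sp_surj[OF S T that] iT by metis
  have out: "inv_into UNIV T x = x" if "x \<notin> S" for x using SpD(2)[OF T that] iT by metis
  have "inv_into UNIV T (x + y) = inv_into UNIV T x + inv_into UNIV T y" if "x \<in> S" "y \<in> S" for x y
    using lin_onD(2)[OF SpD(1)[OF T] mem[OF that(1)] mem[OF that(2)]] Ti iT by metis
  moreover have "inv_into UNIV T (c *s x) = c *s inv_into UNIV T x" if "x \<in> S" for x c
    using lin_onD(3)[OF SpD(1)[OF T] mem[OF that(1)]] Ti iT by metis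
  moreover have "\<omega> (inv_into UNIV T x) (inv_into UNIV T y) = \<omega> x y" if "x \<in> S" "y \<in> S" for x y
    using SpD(3)[OF T mem[OF that(1)] mem[OF that(2)]] Ti by simp
  ultimately show ?thesis using mem out unfolding Sp_def lin_on_def by auto
qed

lemma finite_Sp:
  assumes "finite S" shows "finite (Sp \<omega> S)"
proof -
  have "inj_on (\<lambda>T. restrict T S) (Sp \<omega> S)"
  proof (rule inj_onI)
    fix T U assume "T \<in> Sp \<omega> S" "U \<in> Sp \<omega> S" "restrict T S = restrict U S"
    then show "T = U" using SpD(2) by (metis ext restrict_apply')
  qed
  moreover have "(\<lambda>T. restrict T S) ` Sp \<omega> S \<subseteq> S \<rightarrow>\<^sub>E S" using SpD(4) by auto
  ultimately show ?thesis using finite_PiE[OF assms, of "\<lambda>_. S"] assms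
    by (meson finite_imageD finite_subset)
qed

text \<open>The map is the symplectic transvection along \<open>b - a\<close>; since
  \<open>\<omega> a (b - a) = \<omega> a b\<close>, the chosen scalar moves \<open>a\<close> exactly
  onto \<open>b\<close>.\<close>

lemma transvection:
  assumes S: "subspace S" "a \<in> S" "b \<in> S" and n: "\<omega> a b \<noteq> 0"
  obtains g where "g \<in> Sp \<omega> S" "g a = b" "\<And>z. z \<in> S \<Longrightarrow> \<omega> z a = \<omega> z b \<Longrightarrow> g z = z"
proof -
  define g where "g = (\<lambda>y. if y \<in> S then y + (\<omega> y (b - a) / \<omega> a b) *s (b - a) else y)"
  have ba: "b - a \<in> S" using S subspace_diff by blast
  have "g \<in> Sp \<omega> S"
    unfolding Sp_def lin_on_def
  proof (intro CollectI conjI ballI allI impI)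
    fix x y assume x: "x \<in> S" and y: "y \<in> S"
    show "g (x + y) = g x + g y"
      using x y subspace_add[OF S(1)] by (simp add: g_def add_left add_divide_distrib scale_left_distrib)
    show "\<omega> (g x) (g y) = \<omega> x y"
      using x y skew[of "b - a" y] alt[of "b - a"]
      by (simp add: g_def add_left add_right scale_left scale_right)
  qed (use S ba subspace_add subspace_scale in \<open>auto simp: g_def scale_left scale_right_distrib\<close>)
  moreover have "g a = b" using S n by (simp add: g_def diff_right alt)
  moreover have "g z = z" if "z \<in> S" "\<omega> z a = \<omega> z b" for z using that by (simp add: g_def diff_right)
  ultimately show ?thesis using that by blast
qed

lemma witt_step:
  assumes S: "nondeg \<omega> S" and Z: "Z \<subseteq> S" and ab: "a \<in> S" "b \<in> S" "a \<notin> span Z" "b \<notin> span Z"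
    and e: "\<And>z. z \<in> Z \<Longrightarrow> \<omega> z a = \<omega> z b"
  obtains g where "g \<in> Sp \<omega> S" "g a = b" "\<And>z. z \<in> Z \<Longrightarrow> g z = z"
proof -
  note sub = nondegD(1)[OF S]
  consider "\<omega> a b \<noteq> 0" | "\<omega> a b = 0" by blast
  then show ?thesis
  proof cases
    case 1
    then show ?thesis using transvection[OF sub ab(1,2)] Z e that by (metis subsetD)
  next
    case 2
    obtain s where s: "s \<in> S" "\<And>z. z \<in> Z \<Longrightarrow> \<omega> z s = 0" "\<omega> a s \<noteq> 0" using separation[OF S Z ab(1,3)] by metis
    obtain r where r: "r \<in> S" "\<And>z. z \<in> Z \<Longrightarrow> \<omega> z r = 0" "\<omega> b r \<noteq> 0" using separation[OF S Z ab(2,4)] by metis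
    \<comment> \<open>No vector space is a union of two proper subspaces: if neither
      \<open>s\<close> nor \<open>r\<close> pairs nontrivially with both \<open>a\<close> and
      \<open>b\<close>, then \<open>s + r\<close> does.\<close>
    obtain t where t: "t \<in> S" "\<And>z. z \<in> Z \<Longrightarrow> \<omega> z t = 0" "\<omega> a t \<noteq> 0" "\<omega> b t \<noteq> 0"
    proof (cases "\<omega> b s = 0")
      case False
      then show ?thesis using s that by blast
    next
      case True
      show ?thesis
      proof (cases "\<omega> a r = 0")
        case False
        then show ?thesis using r that by blast
      next
        case True
        show ?thesis
          by (rule that[of "s + r"]) (use s r \<open>\<omega> b s = 0\<close> True subspace_add[OF sub] in \<open>auto simp: add_right\<close>)
      qed
    qed
    \<comment> \<open>Orthogonal \<open>a\<close> and \<open>b\<close> are joined by two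
      transvections through \<open>m\<close>, which pairs nontrivially with both and agrees with
      them against \<open>Z\<close>.\<close>
    define m where "m = a + t"
    have m: "m \<in> S" using t ab subspace_add[OF sub] by (simp add: m_def)
    have "\<omega> a m \<noteq> 0" "\<omega> m b \<noteq> 0"
      using t 2 skew[of t b] by (simp_all add: m_def add_left add_right alt)
    moreover obtain g where g: "g \<in> Sp \<omega> S" "g a = m" "\<And>z. z \<in> S \<Longrightarrow> \<omega> z a = \<omega> z m \<Longrightarrow> g z = z"
      using transvection[OF sub ab(1) m] calculation by metis
    moreover obtain h where h: "h \<in> Sp \<omega> S" "h m = b" "\<And>z. z \<in> S \<Longrightarrow> \<omega> z m = \<omega> z b \<Longrightarrow> h z = z"
      using transvection[OF sub m ab(2)] calculation by metis
    moreover have "\<omega> z m = \<omega> z a" if "z \<in> Z" for z using t(2)[OF that] by (simp add: m_def add_right)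
    ultimately have "(h \<circ> g) z = z" if "z \<in> Z" for z using that e Z by (simp add: subset_iff)
    then show ?thesis using that[of "h \<circ> g"] g h Sp_comp by simp
  qed
qed

text \<open>Witt's extension theorem by induction on the number of vectors: the isometry found so
  far is corrected by one that fixes the images already placed. Independence is stated step by step
  to match.\<close>

lemma witt:
  fixes m :: nat
  assumes S: "nondeg \<omega> S"
    and x: "\<And>i. i < m \<Longrightarrow> x i \<in> S" "\<And>i. i < m \<Longrightarrow> x i \<notin> span (x ` {..<i})"
    and y: "\<And>i. i < m \<Longrightarrow> y i \<in> S" "\<And>i. i < m \<Longrightarrow> y i \<notin> span (y ` {..<i})"
    and e: "\<And>i j. i < m \<Longrightarrow> j < m \<Longrightarrow> \<omega> (x i) (x j) = \<omega> (y i) (y j)"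
  shows "\<exists>g\<in>Sp \<omega> S. \<forall>i<m. g (x i) = y i"
  using x y e
proof (induction m)
  case 0
  then show ?case using Sp_id by blast
next
  case (Suc m)
  have "\<exists>g\<in>Sp \<omega> S. \<forall>i<m. g (x i) = y i" by (rule Suc.IH) (simp_all add: Suc.prems)
  then obtain g where g: "g \<in> Sp \<omega> S" "\<And>i. i < m \<Longrightarrow> g (x i) = y i" by blast
  note sub = nondegD(1)[OF S]
  have xS: "x ` {..<m} \<subseteq> S" using Suc.prems(1) by auto
  have img: "g ` span (x ` {..<m}) = span (y ` {..<m})"
  proof
    have "g v \<in> span (y ` {..<m}) \<and> v \<in> S" if "v \<in> span (x ` {..<m})" for v
      using that
    proof (induction rule: span_induct_alt)
      case base
      show ?case using lin_on_0[OF SpD(1)[OF g(1)] sub] subspace_0[OF sub] span_zero by simp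
    next
      case (step c a v)
      then obtain i where "i < m" "a = x i" by blast
      then have "a \<in> S" "g a \<in> span (y ` {..<m})" using xS g(2) span_base by auto
      then show ?case using step lin_onD(2,3)[OF SpD(1)[OF g(1)]] subspace_scale[OF sub] subspace_add[OF sub]
          span_add span_scale by simp
    qed
    then show "g ` span (x ` {..<m}) \<subseteq> span (y ` {..<m})" by blast
    have "v \<in> g ` span (x ` {..<m})" if "v \<in> span (y ` {..<m})" for v
      using that
    proof (induction rule: span_induct_alt)
      case base
      show ?case using lin_on_0[OF SpD(1)[OF g(1)] sub] span_zero[of "x ` {..<m}"] by (metis imageI)
    next
      case (step c a v)
      then obtain i u where i: "i < m" "a = y i" and u: "u \<in> span (x ` {..<m})" "v = g u" by blast
      have uS: "u \<in> S" using u(1) span_minimal[OF xS sub] by blast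
      have xi: "x i \<in> S" "x i \<in> span (x ` {..<m})" using xS i(1) span_base by auto
      have "g (c *s x i + u) = c *s a + v"
        using lin_onD(2,3)[OF SpD(1)[OF g(1)]] uS xi subspace_scale[OF sub] u i g(2) by simp
      then show ?case using span_add[OF span_scale[OF xi(2)] u(1)] by (metis imageI)
    qed
    then show "span (y ` {..<m}) \<subseteq> g ` span (x ` {..<m})" by blast
  qed
  have gx: "g (x m) \<notin> span (y ` {..<m})"
    using Suc.prems(2)[of m] img Sp_inj[OF S g(1)] by (auto dest: injD)
  obtain h where h: "h \<in> Sp \<omega> S" "h (g (x m)) = y m" "\<And>z. z \<in> y ` {..<m} \<Longrightarrow> h z = z"
  proof (rule witt_step[OF S _ _ _ gx])
    show "y ` {..<m} \<subseteq> S" "g (x m) \<in> S" "y m \<in> S" "y m \<notin> span (y ` {..<m})"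
      using Suc.prems SpD(4)[OF g(1)] by auto
    show "\<omega> z (g (x m)) = \<omega> z (y m)" if "z \<in> y ` {..<m}" for z
    proof -
      from that obtain i where i: "i < m" "z = y i" by blast
      then have "\<omega> z (g (x m)) = \<omega> (g (x i)) (g (x m))" using g(2) by simp
      also have "\<dots> = \<omega> (x i) (x m)" using SpD(3)[OF g(1)] Suc.prems(1) i by simp
      finally show ?thesis using Suc.prems(5) i by simp
    qed
  qed (use that in blast)
  have "(h \<circ> g) (x i) = y i" if "i < Suc m" for i
    using that g(2) h by (cases "i = m") auto
  then show ?case using Sp_comp[OF h(1) g(1)] by blast
qed

end

section \<open>Polynomials and power sums\<close>

definition polys_lt :: "nat \<Rightarrow> 'a::zero poly set" where
  "polys_lt n = {p. \<forall>i\<ge>n. coeff p i = 0}"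

lemma polys_lt_iff: "p \<in> polys_lt n \<longleftrightarrow> p = 0 \<or> degree p < n"
proof
  show "p = 0 \<or> degree p < n" if "p \<in> polys_lt n"
    using that unfolding polys_lt_def by (metis (mono_tags, lifting) leading_coeff_0_iff linorder_not_le mem_Collect_eq)
qed (auto simp: polys_lt_def coeff_eq_0)

lemma polys_lt_Suc: "polys_lt (Suc n) = (\<lambda>(a, p). pCons a p) ` (UNIV \<times> polys_lt n)"
proof (intro equalityI subsetI)
  fix p :: "'a poly" assume p: "p \<in> polys_lt (Suc n)"
  obtain a p' where e: "p = pCons a p'" by (cases p)
  have "coeff p' i = 0" if "i \<ge> n" for i
    using p that unfolding polys_lt_def e by (auto dest: spec[of _ "Suc i"])
  then show "p \<in> (\<lambda>(a, p). pCons a p) ` (UNIV \<times> polys_lt n)" unfolding e polys_lt_def by force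
next
  fix p :: "'a poly" assume "p \<in> (\<lambda>(a, p). pCons a p) ` (UNIV \<times> polys_lt n)"
  then show "p \<in> polys_lt (Suc n)" by (auto simp: polys_lt_def coeff_pCons split: nat.split)
qed

lemma finite_polys_lt: "finite (polys_lt n :: 'a::{zero,finite} poly set)"
proof (induction n)
  case 0
  have "polys_lt 0 = {0 :: 'a poly}" by (auto simp: polys_lt_def poly_eq_iff)
  then show ?case by simp
qed (simp add: polys_lt_Suc)

lemma card_polys_lt: "card (polys_lt n :: 'a::{zero,finite} poly set) = CARD('a) ^ n"
proof (induction n)
  case 0
  have "polys_lt 0 = {0 :: 'a poly}" by (auto simp: polys_lt_def poly_eq_iff)
  then show ?case by simp
next
  case (Suc n)
  have "inj_on (\<lambda>(a, p). pCons a p) (UNIV \<times> polys_lt n :: ('a \<times> 'a poly) set)" by (auto simp: inj_on_def)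
  then show ?case using Suc by (simp add: polys_lt_Suc card_image card_cartesian_product)
qed

text \<open>The monic generator of an ideal, characterised by divisibility. Minimal polynomials of
  vectors (\<open>mpol\<close>) and of sequences (\<open>smin\<close>) are both instances.\<close>

definition igen :: "'a::field poly set \<Rightarrow> 'a poly" where
  "igen I = (THE g. lead_coeff g = 1 \<and> (\<forall>p. p \<in> I \<longleftrightarrow> g dvd p))"

lemma monic_dvd_antisym:
  fixes g h :: "'a::field poly"
  assumes "g dvd h" "h dvd g" "lead_coeff g = 1" "lead_coeff h = 1"
  shows "g = h"
proof -
  obtain a where a: "h = g * a" using assms(1) by (auto simp: dvd_def)
  have nz: "h \<noteq> 0" "g \<noteq> 0" using assms by auto
  then have "a \<noteq> 0" "degree h = degree g"
    using a dvd_imp_degree_le[OF assms(1)] dvd_imp_degree_le[OF assms(2)] by auto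
  then have "degree a = 0" using a nz by (simp add: degree_mult_eq)
  then obtain c where c: "a = [:c:]" by (metis degree_eq_zeroE)
  have "lead_coeff h = lead_coeff g * lead_coeff a" using a by (simp only: lead_coeff_mult)
  then have "c = 1" using assms(3,4) c by simp
  then show ?thesis using a c by simp
qed

lemma igen:
  fixes I :: "'a::field poly set"
  assumes nz: "p0 \<in> I" "p0 \<noteq> 0" and diff: "\<And>p q. p \<in> I \<Longrightarrow> q \<in> I \<Longrightarrow> p - q \<in> I"
    and mult: "\<And>p q. p \<in> I \<Longrightarrow> q * p \<in> I"
  shows "lead_coeff (igen I) = 1" "p \<in> I \<longleftrightarrow> igen I dvd p"
proof -
  define g where "g = (ARG_MIN degree p. p \<in> I \<and> p \<noteq> 0)"
  have g: "g \<in> I" "g \<noteq> 0" "\<And>p. p \<in> I \<Longrightarrow> p \<noteq> 0 \<Longrightarrow> degree g \<le> degree p"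
    using arg_min_natI[of "\<lambda>p. p \<in> I \<and> p \<noteq> 0" p0 degree]
      arg_min_nat_le[of "\<lambda>p. p \<in> I \<and> p \<noteq> 0" _ degree] nz unfolding g_def by auto
  define h where "h = smult (inverse (lead_coeff g)) g"
  have h: "lead_coeff h = 1" "h \<in> I" "degree h = degree g"
    using g mult[of g "[:inverse (lead_coeff g):]"] by (auto simp: h_def)
  have dv: "p \<in> I \<longleftrightarrow> h dvd p" for p
  proof
    assume p: "p \<in> I"
    have "p mod h = p - (p div h) * h" by (simp add: minus_div_mult_eq_mod)
    then have "p mod h \<in> I" using diff[OF p mult[OF h(2)]] by simp
    moreover have "h \<noteq> 0" using h(1) by auto
    then have "p mod h = 0 \<or> degree (p mod h) < degree g"
      using degree_mod_less[of h p] h(3) by simp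
    ultimately have "p mod h = 0" using g(3)[of "p mod h"] by linarith
    then show "h dvd p" by (simp add: dvd_eq_mod_eq_0)
  next
    assume "h dvd p"
    then show "p \<in> I" using mult[OF h(2)] by (metis dvd_def mult.commute)
  qed
  have "lead_coeff (igen I) = 1 \<and> (\<forall>p. p \<in> I \<longleftrightarrow> igen I dvd p)"
    unfolding igen_def
  proof (rule theI[of _ h])
    show "g' = h" if "lead_coeff g' = 1 \<and> (\<forall>p. p \<in> I \<longleftrightarrow> g' dvd p)" for g'
      by (rule monic_dvd_antisym) (use that dv h in \<open>metis dvd_refl\<close>)+
  qed (use h dv in auto)
  then show "lead_coeff (igen I) = 1" "p \<in> I \<longleftrightarrow> igen I dvd p" by blast+
qed

text \<open>For \<open>H = \<Prod>(1 - r X)\<close> this is \<open>\<Sum> r X / (1 - r X)\<close>,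
  so its coefficient of index \<open>k \<ge> 1\<close> is the sum of the \<open>k\<close>-th powers
  of the \<open>r\<close>; the formula itself makes sense without a splitting field.\<close>

definition psums :: "'a::field fps \<Rightarrow> 'a fps" where
  "psums H = - (fps_X * fps_deriv H) * inverse H"

lemma psums_mult_eq: "fps_nth H 0 = 1 \<Longrightarrow> psums H * H = - (fps_X * fps_deriv H)"
  by (simp add: psums_def mult.assoc inverse_mult_eq_1)

lemma psums_mult:
  assumes "fps_nth G 0 = 1" "fps_nth H 0 = 1"
  shows "psums (G * H) = psums G + psums H"
proof -
  have "psums (G * H) * (G * H) = (psums G * G) * H + (psums H * H) * G"
    using assms by (simp add: psums_mult_eq) (simp add: algebra_simps)
  then have "(psums (G * H) - (psums G + psums H)) * (G * H) = 0" by (simp add: algebra_simps)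
  moreover have "G * H \<noteq> 0" using assms by (metis fps_mult_nth_0 fps_zero_nth mult_1 zero_neq_one)
  ultimately show ?thesis by simp
qed

text \<open>Newton's identities, read off from \<open>psums H * H = - X H'\<close>. They hold in
  every characteristic because nothing is divided.\<close>

lemma psums_nth:
  assumes "fps_nth H 0 = 1"
  shows "fps_nth (psums H) n = - of_nat n * fps_nth H n - (\<Sum>i<n. fps_nth (psums H) i * fps_nth H (n - i))"
proof -
  have "fps_nth (psums H * H) n = - of_nat n * fps_nth H n"
    unfolding psums_mult_eq[OF assms] by (cases n) (auto simp: algebra_simps)
  moreover have "fps_nth (psums H * H) n = (\<Sum>i<n. fps_nth (psums H) i * fps_nth H (n - i)) + fps_nth (psums H) n"
    by (simp add: fps_mult_nth atLeast0AtMost lessThan_Suc_atMost[symmetric] assms)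
  ultimately show ?thesis by (simp add: algebra_simps)
qed

lemma psums_unique:
  assumes H: "fps_nth H 0 = 1"
    and rec: "\<And>n. n \<ge> 1 \<Longrightarrow> t n = - of_nat n * fps_nth H n - (\<Sum>i=1..<n. t i * fps_nth H (n - i))"
  shows "n \<ge> 1 \<Longrightarrow> t n = fps_nth (psums H) n"
proof (induction n rule: less_induct)
  case (less n)
  have z: "fps_nth (psums H) 0 = 0" using psums_nth[OF H, of 0] by simp
  have "{..<n} = insert 0 {1..<n}" using less.prems by auto
  then have "(\<Sum>i<n. fps_nth (psums H) i * fps_nth H (n - i)) = (\<Sum>i=1..<n. fps_nth (psums H) i * fps_nth H (n - i))"
    by (simp add: z)
  also have "\<dots> = (\<Sum>i=1..<n. t i * fps_nth H (n - i))"
    by (rule sum.cong[OF refl]) (use less.IH in auto)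
  finally show ?case using rec[OF less.prems] psums_nth[OF H, of n] by simp
qed

text \<open>Newton's identity of index \<open>n\<close> involves only the coefficients up to
  \<open>n\<close> and earlier power sums.\<close>

lemma psums_cong:
  assumes "fps_nth G 0 = 1" "fps_nth H 0 = 1" "\<And>i. i \<le> n \<Longrightarrow> fps_nth G i = fps_nth H i"
  shows "fps_nth (psums G) n = fps_nth (psums H) n"
  using assms(3)
proof (induction n rule: less_induct)
  case (less n)
  then show ?case using psums_nth[OF assms(1), of n] psums_nth[OF assms(2), of n] by simp
qed

text \<open>Only the term of Newton's identity with the factor \<open>n\<close> sees the change.
  This factor is why exponents divisible by the characteristic are excluded.\<close>

lemma psums_perturb:
  assumes "fps_nth G 0 = 1" "fps_nth H 0 = 1" "\<And>i. i < n \<Longrightarrow> fps_nth G i = fps_nth H i"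
    "fps_nth G n = fps_nth H n + e" "n > 0"
  shows "fps_nth (psums G) n = fps_nth (psums H) n - of_nat n * e"
proof -
  have "fps_nth (psums G) i = fps_nth (psums H) i" if "i < n" for i
    by (rule psums_cong) (use assms that in auto)
  moreover have "fps_nth G (n - i) = fps_nth H (n - i)" if "0 < i" "i < n" for i using assms(3)[of "n - i"] that by simp
  moreover have z: "fps_nth (psums G) 0 = 0" "fps_nth (psums H) 0 = 0"
    using psums_nth[OF assms(1), of 0] psums_nth[OF assms(2), of 0] by auto
  ultimately have "(\<Sum>i<n. fps_nth (psums G) i * fps_nth G (n - i)) = (\<Sum>i<n. fps_nth (psums H) i * fps_nth H (n - i))"
    by (intro sum.cong refl) (metis lessThan_iff mult_zero_left not_gr_zero)
  then have "fps_nth (psums G) n - fps_nth (psums H) n = - of_nat n * (fps_nth H n + e) - - of_nat n * fps_nth H n"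
    using psums_nth[OF assms(1), of n] psums_nth[OF assms(2), of n] assms(4) by simp
  then show ?thesis by (simp add: algebra_simps)
qed

text \<open>\<open>pw h k\<close> is the sum of the \<open>k\<close>-th powers of the roots of the monic polynomial \<open>h\<close>.\<close>

definition pw :: "'a::field poly \<Rightarrow> nat \<Rightarrow> 'a" where
  "pw h k = fps_nth (psums (fps_of_poly (reflect_poly h))) k"

lemma pw_mult:
  assumes "lead_coeff g = 1" "lead_coeff h = 1"
  shows "pw (g * h) k = pw g k + pw h k"
  using psums_mult[of "fps_of_poly (reflect_poly g)" "fps_of_poly (reflect_poly h)"] assms
  by (simp add: pw_def reflect_poly_mult fps_of_poly_mult)

text \<open>The left side is the trace of multiplication by \<open>z^k\<close> on
  \<open>F[z]/(h)\<close>. These traces are shown to satisfy Newton's identities for the reversed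
  polynomial of \<open>h\<close>, which determine them.\<close>

lemma trace_mod_eq_pw:
  fixes h :: "'a::field poly"
  assumes h: "lead_coeff h = 1" and k: "k \<ge> 1"
  shows "(\<Sum>i<degree h. coeff (monom 1 (k + i) mod h) i) = pw h k"
proof -
  define j where "j = degree h"
  define r where "r = (\<lambda>a. coeff (reflect_poly h) a)"
  define \<tau> where "\<tau> = (\<lambda>p. \<Sum>i<j. coeff ((monom 1 i * p) mod h) i)"
  have r: "r a = (if a \<le> j then coeff h (j - a) else 0)" for a
    by (simp add: r_def coeff_reflect_poly j_def)
  have add: "\<tau> (p + p') = \<tau> p + \<tau> p'" for p p'
    by (simp add: \<tau>_def distrib_left poly_mod_add_left sum.distrib)
  have smu: "\<tau> (smult c p) = c * \<tau> p" for c p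
    by (simp add: \<tau>_def mod_smult_left sum_distrib_left)
  have z: "\<tau> 0 = 0" by (simp add: \<tau>_def)
  have sm: "\<tau> (\<Sum>a\<in>A. f a) = (\<Sum>a\<in>A. \<tau> (f a))" for A and f :: "nat \<Rightarrow> 'a poly"
    by (induction A rule: infinite_finite_induct) (auto simp: add z)
  \<comment> \<open>For \<open>k \<le> j\<close> this is the polynomial formed by the top
    \<open>k + 1\<close> coefficients of \<open>h\<close>. Its trace is computed directly; expanding
    the trace by linearity then gives Newton's identity.\<close>
  define H where "H = (\<lambda>k. \<Sum>a\<le>k. monom (r a) (k - a))"
  have small: "p mod h = p" if "degree p < j" for p using that mod_poly_less j_def by blast
  \<comment> \<open>As \<open>z^(j-k) * H k\<close> is \<open>h\<close> minus its low part,
    multiplication by \<open>H k\<close> has diagonal entries \<open>r k\<close> for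
    \<open>i < j - k\<close> and 0 afterwards. For \<open>k > j\<close> both sides vanish since
    \<open>h\<close> divides \<open>H k\<close>.\<close>
  have tH: "\<tau> (H k) = (of_nat j - of_nat k) * r k" for k
  proof (cases "k \<le> j")
    case True
    define L where "L = (\<Sum>b<j - k. monom (coeff h b) b)"
    have cH: "coeff (H k) c = (if c \<le> k then r (k - c) else 0)" for c
    proof -
      have "coeff (H k) c = (\<Sum>a\<le>k. if a = k - c \<and> c \<le> k then r a else 0)"
        unfolding H_def coeff_sum coeff_monom by (rule sum.cong) auto
      then show ?thesis by (auto simp: if_distrib cong: if_cong)
    qed
    have cL: "coeff L c = (if c < j - k then coeff h c else 0)" for c
      unfolding L_def coeff_sum coeff_monom by simp
    have hL: "monom 1 (j - k) * H k = h - L"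
    proof (rule poly_eqI)
      fix c
      show "coeff (monom 1 (j - k) * H k) c = coeff (h - L) c"
        using True by (auto simp: coeff_monom_mult cH cL r not_less j_def[symmetric] intro!: coeff_eq_0)
    qed
    have "coeff ((monom 1 i * H k) mod h) i = (if i < j - k then r k else 0)" if "i < j" for i
    proof (cases "i < j - k")
      case T: True
      have "monom 1 i * H k \<in> polys_lt j"
        using T unfolding polys_lt_def by (auto simp: coeff_monom_mult cH)
      then have "(monom 1 i * H k) mod h = monom 1 i * H k" using small polys_lt_iff by (metis mod_0)
      then show ?thesis using T by (simp add: coeff_monom_mult cH)
    next
      case F: False
      define c where "c = i - (j - k)"
      have "monom 1 i * H k = monom 1 c * (monom 1 (j - k) * H k)"
        using F by (simp add: c_def mult.assoc[symmetric] mult_monom)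
      also have "\<dots> = monom 1 c * h - monom 1 c * L" unfolding hL by (simp add: algebra_simps)
      finally have e: "(monom 1 i * H k) mod h = (- (monom 1 c * L)) mod h"
        by (simp add: poly_mod_diff_left poly_mod_minus_left)
      have "- (monom 1 c * L) \<in> polys_lt j"
        using F that unfolding polys_lt_def by (auto simp: coeff_monom_mult cL c_def)
      then have "(- (monom 1 c * L)) mod h = - (monom 1 c * L)" using small polys_lt_iff by (metis mod_0)
      then show ?thesis using F e by (auto simp: coeff_monom_mult cL c_def)
    qed
    then have "\<tau> (H k) = (\<Sum>i<j. if i < j - k then r k else 0)" by (simp add: \<tau>_def)
    also have "\<dots> = (\<Sum>i\<in>{..<j} \<inter> {i. i < j - k}. r k)" by (simp add: sum.If_cases)
    also have "{..<j} \<inter> {i. i < j - k} = {..<j - k}" by auto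
    finally show ?thesis using True by (simp add: of_nat_diff)
  next
    case False
    have "H k = monom 1 (k - j) * h"
    proof (rule poly_eqI)
      fix c
      have "coeff (H k) c = (\<Sum>a\<le>k. if a = k - c \<and> c \<le> k then r a else 0)"
        unfolding H_def coeff_sum coeff_monom by (rule sum.cong) auto
      then have "coeff (H k) c = (if c \<le> k then r (k - c) else 0)" by (auto simp: if_distrib cong: if_cong)
      then show "coeff (H k) c = coeff (monom 1 (k - j) * h) c"
        using False by (auto simp: coeff_monom_mult r j_def[symmetric] not_less intro!: coeff_eq_0 arg_cong[where f = "coeff h"])
    qed
    then show ?thesis using False by (simp add: \<tau>_def r mult.left_commute[of _ "monom 1 (k - j)"] mult.assoc[symmetric])
  qed
  have "\<tau> 1 = (\<Sum>i<j. 1)"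
    unfolding \<tau>_def by (rule sum.cong) (auto simp: small degree_monom_eq)
  then have t1: "\<tau> 1 = of_nat j" by simp
  have rec: "\<tau> (monom 1 n) = - of_nat n * r n - (\<Sum>i=1..<n. \<tau> (monom 1 i) * r (n - i))" if "n \<ge> 1" for n
  proof -
    have "H n = (\<Sum>a\<le>n. smult (r a) (monom 1 (n - a)))" by (simp add: H_def smult_monom)
    then have "\<tau> (H n) = (\<Sum>a\<le>n. r a * \<tau> (monom 1 (n - a)))" by (simp add: sm smu)
    also have "\<dots> = (\<Sum>i\<le>n. r (n - i) * \<tau> (monom 1 i))"
      by (rule sum.reindex_bij_witness[of _ "\<lambda>i. n - i" "\<lambda>i. n - i"]) auto
    also have "{..n} = insert 0 (insert n {1..<n})" using that by auto
    also have "(\<Sum>i\<in>insert 0 (insert n {1..<n}). r (n - i) * \<tau> (monom 1 i))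
        = r n * \<tau> 1 + (r 0 * \<tau> (monom 1 n) + (\<Sum>i=1..<n. r (n - i) * \<tau> (monom 1 i)))"
      using that by (simp add: monom_0 one_pCons)
    finally have "(of_nat j - of_nat n) * r n
        = r n * of_nat j + (\<tau> (monom 1 n) + (\<Sum>i=1..<n. r (n - i) * \<tau> (monom 1 i)))"
      using h by (simp only: tH t1) (simp add: r[of 0] j_def)
    then show ?thesis by (simp add: algebra_simps eq_neg_iff_add_eq_0)
  qed
  have "\<tau> (monom 1 k) = pw h k"
    unfolding pw_def
    by (rule psums_unique[OF _ _ k]) (use rec h in \<open>auto simp: r_def\<close>)
  then show ?thesis by (simp add: \<tau>_def j_def mult_monom add.commute)
qed

text \<open>\<open>zhom m f\<close> is \<open>z\<^sup>m f(z + 1/z)\<close>.\<close>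

primrec zhom :: "nat \<Rightarrow> 'a::field poly \<Rightarrow> 'a poly" where
  "zhom 0 f = [:coeff f 0:]"
| "zhom (Suc m) f = pCons 0 (zhom m f) + smult (coeff f (Suc m)) ([:1, 0, 1:] ^ Suc m)"

text \<open>\<open>Phi\<close> is multiplicative and maps the monic polynomials of degree
  \<open>m\<close> bijectively to the monic self-reciprocal ones of degree \<open>2 * m\<close>
  (\<open>Phi_mult\<close>, \<open>Phi_inj\<close>, \<open>Phi_surj\<close>).\<close>

definition Phi :: "'a::field poly \<Rightarrow> 'a poly" where "Phi f = zhom (degree f) f"

lemma zhom_add: "zhom m (f + g) = zhom m f + zhom m g"
  by (induction m) (simp_all add: smult_add_left algebra_simps)

lemma zhom_smult: "zhom m (smult c f) = smult c (zhom m f)"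
  by (induction m) (simp_all add: smult_add_right)

lemma zhom_0 [simp]: "zhom m 0 = 0"
  by (induction m) simp_all

lemma degree_p2: "degree ([:1, 0, 1:] ^ m :: 'a::field poly) = 2 * m"
  by (simp add: degree_power_eq)

lemma lead_p2: "coeff ([:1, 0, 1:] ^ m :: 'a::field poly) (2 * m) = 1"
  using lead_coeff_power[of "[:1, 0, 1:] :: 'a poly" m] by (simp add: degree_p2)

lemma pal_p2: "k \<le> 2 * m \<Longrightarrow> coeff ([:1, 0, 1:] ^ m :: 'a::field poly) (2 * m - k) = coeff ([:1, 0, 1:] ^ m) k"
proof -
  assume k: "k \<le> 2 * m"
  have "reflect_poly [:1, 0, 1 :: 'a:] = [:1, 0, 1:]" by (simp add: reflect_poly_def)
  then have "reflect_poly ([:1, 0, 1 :: 'a:] ^ m) = [:1, 0, 1:] ^ m" by (simp add: reflect_poly_power)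
  from arg_cong[OF this, of "\<lambda>p. coeff p k"] show ?thesis
    using k by (simp add: coeff_reflect_poly degree_p2)
qed

lemma zhom_props:
  shows degree_zhom: "degree (zhom m f) \<le> 2 * m"
    and coeff_zhom_0: "coeff (zhom m f) 0 = coeff f m"
    and coeff_zhom_top: "coeff (zhom m f) (2 * m) = coeff f m"
    and pal_zhom: "k \<le> 2 * m \<Longrightarrow> coeff (zhom m f) (2 * m - k) = coeff (zhom m f) k"
proof -
  have p0: "coeff ([:1, 0, 1:] ^ m :: 'a poly) 0 = 1" for m using pal_p2[of 0 m, where 'a = 'a] lead_p2[of m, where 'a = 'a] by simp
  show d: "degree (zhom m f) \<le> 2 * m" for m
  proof (induction m)
    case (Suc m)
    have "degree (pCons 0 (zhom m f)) \<le> 2 * Suc m" using Suc degree_pCons_le[of 0 "zhom m f"] by simp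
    moreover have "degree (smult (coeff f (Suc m)) ([:1, 0, 1:] ^ Suc m)) \<le> 2 * Suc m"
      by (metis degree_smult_le degree_p2)
    ultimately show ?case unfolding zhom.simps by (rule degree_add_le)
  qed simp
  show c0: "coeff (zhom m f) 0 = coeff f m" by (cases m) (simp_all add: p0 del: power_Suc)
  show pal: "k \<le> 2 * m \<Longrightarrow> coeff (zhom m f) (2 * m - k) = coeff (zhom m f) k" for k
  proof (induction m arbitrary: k)
    case (Suc m)
    have "coeff (pCons 0 (zhom m f)) (2 * Suc m - k) = coeff (pCons 0 (zhom m f)) k"
    proof -
      consider "k = 0" | "k = 2 * Suc m" | k' where "k = Suc k'" "k' \<le> 2 * m" using Suc.prems by (cases k) force+
      then show ?thesis
      proof cases
        case 1
        then show ?thesis using d[of m] by (simp add: coeff_eq_0)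
      next
        case 2
        then show ?thesis using d[of m] by (simp add: coeff_eq_0)
      next
        case 3
        then have "2 * Suc m - k = Suc (2 * m - k')" by auto
        then show ?thesis using 3 Suc.IH by simp
      qed
    qed
    then show ?case using pal_p2[where 'a = 'a, OF Suc.prems] by (simp del: power_Suc)
  qed simp
  show "coeff (zhom m f) (2 * m) = coeff f m" using pal[of 0] c0 by simp
qed

lemma zhom_surj:
  assumes "degree p \<le> 2 * m" "\<And>k. k \<le> 2 * m \<Longrightarrow> coeff p (2 * m - k) = coeff p k"
  shows "\<exists>f. degree f \<le> m \<and> zhom m f = p"
  using assms
proof (induction m arbitrary: p)
  case 0
  then obtain c where "p = [:c:]" by (auto elim: degree_eq_zeroE)
  then show ?case by (intro exI[of _ "[:c:]"]) simp
next
  case (Suc m)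
  \<comment> \<open>Subtracting \<open>c (1 + z^2)^(m+1)\<close> removes the constant term and, by
    symmetry, the top term; dividing by \<open>z\<close> leaves a palindrome of degree at most
    \<open>2 * m\<close>.\<close>
  define c where "c = coeff p 0"
  define p' where "p' = p - smult c ([:1, 0, 1:] ^ Suc m)"
  have pal: "coeff p' (2 * Suc m - k) = coeff p' k" if "k \<le> 2 * Suc m" for k
    using Suc.prems(2)[OF that] pal_p2[OF that, where 'a = 'a] by (simp add: p'_def del: power_Suc)
  have z: "coeff p' 0 = 0" using pal_p2[of 0 "Suc m", where 'a = 'a] lead_p2[of "Suc m", where 'a = 'a]
    by (simp add: p'_def c_def del: power_Suc)
  obtain a p1 where "p' = pCons a p1" by (cases p')
  then have p1: "p' = pCons 0 p1" using z by simp
  have dp': "degree p' \<le> 2 * Suc m"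
    unfolding p'_def using Suc.prems(1) degree_smult_le[of c "[:1, 0, 1:] ^ Suc m"] degree_p2[of "Suc m", where 'a = 'a]
    by (intro degree_diff_le) auto
  have pal1: "coeff p1 (2 * m - k) = coeff p1 k" if "k \<le> 2 * m" for k
    using pal[of "Suc k"] that p1 by (simp add: Suc_diff_le)
  have top: "coeff p1 (Suc (2 * m)) = 0" using pal[of 0] z p1 by simp
  have "degree p1 \<le> 2 * m"
  proof (rule degree_le, intro allI impI)
    fix i assume "2 * m < i"
    then have "i = Suc (2 * m) \<or> 2 * Suc m < Suc i" by arith
    then show "coeff p1 i = 0"
    proof
      assume "2 * Suc m < Suc i"
      then have "coeff p' (Suc i) = 0" using dp' by (intro coeff_eq_0) simp
      then show ?thesis using p1 by simp
    qed (use top in simp)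
  qed
  from Suc.IH[OF this pal1] obtain f where f: "degree f \<le> m" "zhom m f = p1" by blast
  have ext: "zhom k (f + monom c (Suc m)) = zhom k f" if "k \<le> m" for k using that by (induction k) auto
  have "zhom (Suc m) (f + monom c (Suc m)) = pCons 0 p1 + smult c ([:1, 0, 1:] ^ Suc m)"
    using f ext[of m] by (simp add: coeff_eq_0 del: power_Suc)
  also have "\<dots> = p" by (simp add: p1[symmetric] p'_def)
  finally show ?case using f(1) degree_monom_le[of c "Suc m"] by (intro exI[of _ "f + monom c (Suc m)"]) (auto intro!: degree_add_le)
qed

lemma zhom_inj: "zhom m f = 0 \<Longrightarrow> degree f \<le> m \<Longrightarrow> f = 0"
proof (induction m arbitrary: f)
  case 0
  then show ?case by (auto elim: degree_eq_zeroE)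
next
  case (Suc m)
  have c: "coeff f (Suc m) = 0" using coeff_zhom_0[of "Suc m" f] unfolding Suc.prems(1) by simp
  then have "degree f \<le> m" using Suc.prems(2) by (metis le_SucE le0 degree_0 leading_coeff_0_iff)
  moreover have "zhom m f = 0" using Suc.prems(1) c by simp
  ultimately show ?case using Suc.IH by blast
qed

lemma zhom_extend: "degree f \<le> m \<Longrightarrow> zhom (k + m) f = monom 1 k * zhom m f"
proof (induction k)
  case (Suc k)
  then show ?case by (simp add: coeff_eq_0 monom_Suc del: power_Suc)
qed simp

lemma zhom_pCons: "zhom (Suc m) (pCons a f) = smult a (monom 1 (Suc m)) + [:1, 0, 1:] * zhom m f"
proof (induction m)
  case 0
  then show ?case by (simp add: monom_Suc monom_0)
next
  case (Suc m)
  have "zhom (Suc (Suc m)) (pCons a f) = pCons 0 (zhom (Suc m) (pCons a f)) + smult (coeff f (Suc m)) ([:1, 0, 1:] ^ Suc (Suc m))"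
    by (simp only: zhom.simps coeff_pCons_Suc)
  also have "\<dots> = smult a (monom 1 (Suc (Suc m))) + [:1, 0, 1:] * (pCons 0 (zhom m f) + smult (coeff f (Suc m)) ([:1, 0, 1:] ^ Suc m))"
    unfolding Suc.IH by (simp add: monom_Suc[of _ "Suc m"] algebra_simps power_Suc del: monom_Suc)
  finally show ?case by simp
qed

lemma zhom_mult:
  "degree f \<le> m \<Longrightarrow> degree g \<le> n \<Longrightarrow> zhom (m + n) (f * g) = zhom m f * zhom n g"
proof (induction m arbitrary: f)
  case 0
  then obtain c where "f = [:c:]" by (auto elim: degree_eq_zeroE)
  then show ?case by (simp add: zhom_smult)
next
  case (Suc m)
  obtain a f' where f: "f = pCons a f'" by (cases f)
  have d: "degree f' \<le> m" using Suc.prems(1) by (cases "f' = 0") (auto simp: f)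
  have "zhom (Suc (m + n)) (f * g) = zhom (Suc m + n) (smult a g) + zhom (Suc (m + n)) (pCons 0 (f' * g))"
    by (simp add: f zhom_add del: zhom.simps)
  also have "\<dots> = smult a (monom 1 (Suc m) * zhom n g) + [:1, 0, 1:] * (zhom m f' * zhom n g)"
    unfolding zhom_smult zhom_extend[OF Suc.prems(2)] zhom_pCons Suc.IH[OF d Suc.prems(2)] by simp
  also have "\<dots> = zhom (Suc m) f * zhom n g" unfolding f zhom_pCons by (simp add: algebra_simps)
  finally show ?case by simp
qed

lemma Phi_mult: "f \<noteq> 0 \<Longrightarrow> g \<noteq> 0 \<Longrightarrow> Phi (f * g) = Phi f * Phi g"
  by (simp add: Phi_def degree_mult_eq zhom_mult)

lemma Phi_props:
  assumes "lead_coeff f = 1"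
  shows "degree (Phi f) = 2 * degree f" "lead_coeff (Phi f) = 1" "coeff (Phi f) 0 = 1" "reflect_poly (Phi f) = Phi f"
proof -
  have t: "coeff (Phi f) (2 * degree f) = 1" using coeff_zhom_top[of "degree f" f] assms by (simp add: Phi_def)
  show d: "degree (Phi f) = 2 * degree f"
    using degree_zhom[of "degree f" f] le_degree[of "Phi f" "2 * degree f"] t by (simp add: Phi_def)
  show "lead_coeff (Phi f) = 1" using t d by simp
  show "coeff (Phi f) 0 = 1" using coeff_zhom_0[of "degree f" f] assms by (simp add: Phi_def)
  show "reflect_poly (Phi f) = Phi f"
    by (rule poly_eqI) (use pal_zhom[of _ "degree f" f] d in \<open>auto simp: coeff_reflect_poly Phi_def coeff_eq_0\<close>)
qed

lemma Phi_inj: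
  assumes "lead_coeff f = 1" "lead_coeff g = 1" "Phi f = Phi g"
  shows "f = g"
proof -
  have d: "degree f = degree g" using Phi_props(1)[OF assms(1)] Phi_props(1)[OF assms(2)] assms(3) by simp
  then have "zhom (degree f) (f + smult (- 1) g) = 0"
    using assms(3) unfolding Phi_def by (simp only: zhom_add zhom_smult) simp
  moreover have "degree (f + smult (- 1) g) \<le> degree f" by (intro degree_add_le) (auto simp: d)
  ultimately have "f + smult (- 1) g = 0" by (rule zhom_inj)
  then show ?thesis by simp
qed

lemma Phi_surj:
  assumes "degree p = 2 * m" "lead_coeff p = 1" "reflect_poly p = p"
  obtains f where "lead_coeff f = 1" "degree f = m" "Phi f = p"
proof -
  have "coeff p (2 * m - k) = coeff p k" if "k \<le> 2 * m" for k
    using arg_cong[OF assms(3), of "\<lambda>p. coeff p k"] that assms(1) by (simp add: coeff_reflect_poly)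
  then obtain f where f: "degree f \<le> m" "zhom m f = p" using zhom_surj[of p m] assms(1) by auto
  have c: "coeff f m = 1" using coeff_zhom_top[of m f] f assms by simp
  then have "degree f = m" using f(1) le_degree[of f m] by simp
  then show ?thesis using that[of f] f c by (simp add: Phi_def)
qed

lemma poly_zhom: "z \<noteq> 0 \<Longrightarrow> poly (zhom m f) z = z ^ m * (\<Sum>i\<le>m. coeff f i * (z + inverse z) ^ i)"
proof (induction m)
  case (Suc m)
  have "1 + z * z = z * (z + inverse z)" using Suc.prems by (simp add: algebra_simps)
  then have "(1 + z * z) ^ Suc m = z ^ Suc m * (z + inverse z) ^ Suc m" by (simp only: power_mult_distrib)
  then show ?case using Suc by (simp add: poly_power algebra_simps del: power_Suc) (simp add: algebra_simps)
qed simp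

lemma poly_Phi: "z \<noteq> 0 \<Longrightarrow> poly (Phi f) z = z ^ degree f * poly f (z + inverse z)"
  using poly_zhom[of z "degree f" f] by (simp add: Phi_def poly_altdef[of f])

lemma zhom_monom: "i \<le> m \<Longrightarrow> zhom m (monom c i) = smult c (monom 1 (m - i) * [:1, 0, 1:] ^ i)"
proof -
  assume i: "i \<le> m"
  have z: "zhom k (monom c i) = 0" if "k < i" for k using that by (induction k) auto
  have "zhom i (monom c i) = smult c ([:1, 0, 1:] ^ i)"
    by (cases i) (use z in \<open>auto simp: monom_0 simp del: power_Suc\<close>)
  then show ?thesis using zhom_extend[of "monom c i" i "m - i"] i degree_monom_le[of c i] by simp
qed

section \<open>Linear recurrences and cyclic modules\<close>

text \<open>A sequence is treated as the linear functional on polynomials that sends the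
  \<open>i\<close>-th power of the variable to \<open>l i\<close>.\<close>

definition lam :: "(nat \<Rightarrow> 'a::field) \<Rightarrow> 'a poly \<Rightarrow> 'a" where
  "lam l p = (\<Sum>i\<le>degree p. coeff p i * l i)"

lemma lam_bound: "degree p \<le> n \<Longrightarrow> lam l p = (\<Sum>i\<le>n. coeff p i * l i)"
  unfolding lam_def by (intro sum.mono_neutral_left) (auto simp: coeff_eq_0)

lemma lam_add: "lam l (p + p') = lam l p + lam l p'"
proof -
  define n where "n = max (degree p) (degree p')"
  have "degree (p + p') \<le> n" "degree p \<le> n" "degree p' \<le> n" by (auto simp: n_def degree_add_le_max)
  then show ?thesis by (simp add: lam_bound[of _ n] distrib_right sum.distrib)
qed

lemma lam_diff: "lam l (p - p') = lam l p - lam l p'"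
  using lam_add[of l "p - p'" p'] by simp

lemma lam_0 [simp]: "lam l 0 = 0" by (simp add: lam_def)

text \<open>The polynomials whose whole ideal is killed by the functional, that is, the
  characteristic polynomials of the linear recurrences that \<open>l\<close> satisfies.\<close>

definition seq_ann :: "(nat \<Rightarrow> 'a::field) \<Rightarrow> 'a poly set" where
  "seq_ann l = {f. \<forall>g. lam l (f * g) = 0}"

definition smin :: "(nat \<Rightarrow> 'a::field) \<Rightarrow> 'a poly" where "smin l = igen (seq_ann l)"

lemma smin:
  assumes "f0 \<in> seq_ann l" "f0 \<noteq> 0"
  shows "lead_coeff (smin l) = 1" "f \<in> seq_ann l \<longleftrightarrow> smin l dvd f"
  unfolding smin_def
  by (rule igen[OF assms]; auto simp: seq_ann_def left_diff_distrib lam_diff mult.assoc mult.left_commute)+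

text \<open>The monic polynomial whose roots are the inverses of those of \<open>h\<close>, meant
  for \<open>h\<close> with nonzero constant term.\<close>

definition rstar :: "'a::field poly \<Rightarrow> 'a poly" where
  "rstar h = smult (inverse (coeff h 0)) (reflect_poly h)"

lemma rstar_props:
  assumes "lead_coeff h = 1" "coeff h 0 \<noteq> 0"
  shows "lead_coeff (rstar h) = 1" "degree (rstar h) = degree h" "coeff (rstar h) 0 \<noteq> 0"
  using assms by (auto simp: rstar_def coeff_reflect_poly degree_reflect_poly_eq)

text \<open>With \<open>\<Lambda> = T + 1/T\<close>, the powers of \<open>T\<close> are \<open>T\<^sup>k = A\<^sub>k(\<Lambda>) + B\<^sub>k(\<Lambda>) T\<close>.\<close>

primrec chebA :: "nat \<Rightarrow> 'a::field poly \<times> 'a poly" where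
  "chebA 0 = (1, 0)"
| "chebA (Suc k) = (- snd (chebA k), fst (chebA k) + pCons 0 (snd (chebA k)))"

context finite_field_space
begin

definition pact :: "('b \<Rightarrow> 'b) \<Rightarrow> 'a poly \<Rightarrow> 'b \<Rightarrow> 'b" where
  "pact T p x = (\<Sum>i\<le>degree p. coeff p i *s (T ^^ i) x)"

lemma pact_bound: "degree p \<le> n \<Longrightarrow> pact T p x = (\<Sum>i\<le>n. coeff p i *s (T ^^ i) x)"
  unfolding pact_def by (intro sum.mono_neutral_left) (auto simp: coeff_eq_0)

lemma pact_add: "pact T (p + p') x = pact T p x + pact T p' x"
proof -
  define n where "n = max (degree p) (degree p')"
  have "degree (p + p') \<le> n" "degree p \<le> n" "degree p' \<le> n" by (auto simp: n_def degree_add_le_max)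
  then show ?thesis by (simp add: pact_bound[of _ n] scale_left_distrib sum.distrib)
qed

lemma pact_smult: "pact T (smult c p) x = c *s pact T p x"
  by (simp add: pact_bound[OF degree_smult_le] pact_def[of T p] scale_sum_right)

lemma pact_0 [simp]: "pact T 0 x = 0" by (simp add: pact_def)

lemma pact_1 [simp]: "pact T 1 x = x" by (simp add: pact_def)

lemma pact_diff: "pact T (p - p') x = pact T p x - pact T p' x"
  using pact_add[of T "p - p'" p' x] by simp

lemma pact_uminus: "pact T (- p) x = - pact T p x"
  using pact_diff[of T 0 p x] by simp

lemma pact_monom: "pact T (monom c i) x = c *s (T ^^ i) x"
proof -
  have "pact T (monom c i) x = (\<Sum>k\<le>i. coeff (monom c i) k *s (T ^^ k) x)"
    by (rule pact_bound) (rule degree_monom_le)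
  also have "\<dots> = (\<Sum>k\<le>i. if k = i then c *s (T ^^ i) x else 0)" by (rule sum.cong) auto
  finally show ?thesis by simp
qed

end

section \<open>Cyclic subspaces and minimal polynomials of vectors\<close>

locale cyclic_action = finite_field_space scale
  for scale :: "'a::{field,finite} \<Rightarrow> 'b::ab_group_add \<Rightarrow> 'b" (infixr \<open>*s\<close> 75) +
  fixes S :: "'b set" and T :: "'b \<Rightarrow> 'b"
  assumes S: "subspace S" "finite S" and T: "lin_on S T"
begin

lemma funpow_mem: "x \<in> S \<Longrightarrow> (T ^^ i) x \<in> S"
  using lin_onD(1)[OF lin_on_funpow[OF T]] by blast

lemma pact_mem: "x \<in> S \<Longrightarrow> pact T p x \<in> S"
  unfolding pact_def by (intro subspace_sum[OF S(1)] subspace_scale[OF S(1)] funpow_mem)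

lemma pact_pCons: "x \<in> S \<Longrightarrow> pact T (pCons a p) x = a *s x + T (pact T p x)"
proof -
  assume x: "x \<in> S"
  have "pact T (pCons a p) x = (\<Sum>i\<le>Suc (degree p). coeff (pCons a p) i *s (T ^^ i) x)"
    by (rule pact_bound) (rule degree_pCons_le)
  also have "\<dots> = a *s x + (\<Sum>i\<le>degree p. coeff p i *s T ((T ^^ i) x))"
    by (simp add: sum.atMost_Suc_shift del: sum.atMost_Suc)
  also have "(\<Sum>i\<le>degree p. coeff p i *s T ((T ^^ i) x)) = T (pact T p x)"
    unfolding pact_def
    by (subst lin_on_sum[OF T S(1)]) (auto simp: subspace_scale[OF S(1)] funpow_mem[OF x] lin_onD(3)[OF T])
  finally show ?thesis .
qed

lemma pact_commute_map:
  assumes A: "lin_on S A" "\<And>z. z \<in> S \<Longrightarrow> A (T z) = T (A z)" and x: "x \<in> S"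
  shows "A (pact T p x) = pact T p (A x)"
proof (induction p)
  case (pCons a p)
  then show ?case
    using x lin_onD[OF A(1)] A(2) pact_mem subspace_scale[OF S(1)] lin_onD(1)[OF T] by (simp add: pact_pCons)
qed (use lin_on_0[OF A(1) S(1)] in simp)

lemma pact_T: "x \<in> S \<Longrightarrow> pact T p (T x) = T (pact T p x)"
  using pact_commute_map[OF T] by simp

lemma lin_on_pact: "lin_on S (pact T p)"
proof -
  have add: "pact T p (x + y) = pact T p x + pact T p y" if "x \<in> S" "y \<in> S" for x y
    using that lin_onD(2)[OF lin_on_funpow[OF T]] by (simp add: pact_def scale_right_distrib sum.distrib)
  have sc: "pact T p (c *s x) = c *s pact T p x" if "x \<in> S" for x c
    using that lin_onD(3)[OF lin_on_funpow[OF T]] by (simp add: pact_def scale_sum_right mult.commute)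
  show ?thesis unfolding lin_on_def using add sc pact_mem by blast
qed

lemma pact_mult: "x \<in> S \<Longrightarrow> pact T (p * p') x = pact T p (pact T p' x)"
proof (induction p)
  case (pCons a p)
  then show ?case by (simp add: pact_add pact_smult pact_pCons pact_mem)
qed simp

definition cyc :: "'b \<Rightarrow> 'b set" where "cyc x = range (\<lambda>p. pact T p x)"

definition mpol :: "'b \<Rightarrow> 'a poly" where "mpol x = igen {p. pact T p x = 0}"

lemma cyc_sub: "x \<in> S \<Longrightarrow> cyc x \<subseteq> S" using pact_mem by (auto simp: cyc_def)

lemma cycI: "pact T p x \<in> cyc x" by (auto simp: cyc_def)

lemma cyc_self: "x \<in> cyc x" using cycI[of 1 x] by simp

lemma subspace_cyc: "subspace (cyc x)"
proof (rule subspaceI)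
  show "0 \<in> cyc x" using cycI[of 0 x] by simp
  show "u + v \<in> cyc x" if "u \<in> cyc x" "v \<in> cyc x" for u v
    using that unfolding cyc_def by (auto simp: pact_add[symmetric])
  show "c *s u \<in> cyc x" if "u \<in> cyc x" for c u
    using that unfolding cyc_def by (auto simp: pact_smult[symmetric])
qed

lemma finite_cyc: "x \<in> S \<Longrightarrow> finite (cyc x)" using cyc_sub S(2) finite_subset by blast

lemma cyc_T: "x \<in> S \<Longrightarrow> u \<in> cyc x \<Longrightarrow> T u \<in> cyc x"
proof -
  assume x: "x \<in> S" and "u \<in> cyc x"
  then obtain p where "u = pact T p x" by (auto simp: cyc_def)
  then have "T u = pact T (pCons 0 p) x" using x by (simp add: pact_pCons)
  then show ?thesis using cycI by simp
qed

lemma cyc_least: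
  assumes x: "x \<in> S" and V: "subspace V" "x \<in> V" "\<And>u. u \<in> V \<Longrightarrow> T u \<in> V"
  shows "cyc x \<subseteq> V"
proof -
  have "(T ^^ i) x \<in> V" for i by (induction i) (use V in auto)
  then show ?thesis unfolding cyc_def pact_def by (auto intro!: subspace_sum[OF V(1)] subspace_scale[OF V(1)])
qed

lemma lin_on_cyc: "x \<in> S \<Longrightarrow> lin_on (cyc x) T"
  using cyc_T cyc_sub T unfolding lin_on_def by blast

lemma mpol:
  assumes x: "x \<in> S"
  shows "lead_coeff (mpol x) = 1" "pact T p x = 0 \<longleftrightarrow> mpol x dvd p"
proof -
  \<comment> \<open>Pigeonhole: there are at least \<open>2 ^ (card S + 1)\<close> such polynomials
    but only \<open>card S\<close> values, so some two differ by an annihilator of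
    \<open>x\<close>.\<close>
  have "\<not> inj_on (\<lambda>p. pact T p x) (polys_lt (card S + 1))"
  proof
    assume "inj_on (\<lambda>p. pact T p x) (polys_lt (card S + 1))"
    then have "card (polys_lt (card S + 1) :: 'a poly set) \<le> card S"
      by (rule card_inj_on_le) (use pact_mem[OF x] S in auto)
    moreover have "2 ^ (card S + 1) \<le> CARD('a) ^ (card S + 1)"
      by (rule power_mono) (use card_mono[of "UNIV :: 'a set" "{0, 1}"] in auto)
    moreover have "card S < 2 ^ (card S + 1)" using less_exp[of "card S + 1"] by linarith
    ultimately show False unfolding card_polys_lt by linarith
  qed
  then obtain p1 p2 where "p1 \<noteq> p2" "pact T p1 x = pact T p2 x" unfolding inj_on_def by blast
  then have p0: "p1 - p2 \<in> {p. pact T p x = 0}" "p1 - p2 \<noteq> 0" by (auto simp: pact_diff)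
  show "lead_coeff (mpol x) = 1" "pact T p x = 0 \<longleftrightarrow> mpol x dvd p"
    unfolding mpol_def
    using igen(1)[OF p0] igen(2)[OF p0, of p] x lin_on_0[OF lin_on_pact S(1)]
    by (auto simp: pact_diff pact_mult)
qed

lemma pact_mod: "x \<in> S \<Longrightarrow> pact T (p mod mpol x) x = pact T p x"
proof -
  assume x: "x \<in> S"
  have "p = mpol x * (p div mpol x) + p mod mpol x" by simp
  then have "pact T p x = pact T (mpol x * (p div mpol x)) x + pact T (p mod mpol x) x" by (metis pact_add)
  moreover have "pact T (mpol x * (p div mpol x)) x = 0" using mpol(2)[OF x] by simp
  ultimately show ?thesis by simp
qed

lemma pact_eq_iff: "x \<in> S \<Longrightarrow> pact T p x = pact T p' x \<longleftrightarrow> p mod mpol x = p' mod mpol x"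
  using mpol(2)[of x "p - p'"] by (simp add: pact_diff mod_eq_dvd_iff)

lemma mod_mpol_lt: "x \<in> S \<Longrightarrow> p mod mpol x \<in> polys_lt (degree (mpol x))"
proof -
  assume "x \<in> S"
  then have "mpol x \<noteq> 0" using mpol(1) by force
  then show ?thesis using degree_mod_less[of "mpol x" p] by (auto simp: polys_lt_iff)
qed

lemma mod_mpol_id: "p \<in> polys_lt (degree (mpol x)) \<Longrightarrow> p mod mpol x = p"
  by (auto simp: polys_lt_iff mod_poly_less)

lemma card_cyc: "x \<in> S \<Longrightarrow> card (cyc x) = CARD('a) ^ degree (mpol x)"
proof -
  assume x: "x \<in> S"
  have "bij_betw (\<lambda>p. pact T p x) (polys_lt (degree (mpol x))) (cyc x)"
    unfolding bij_betw_def
  proof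
    show "inj_on (\<lambda>p. pact T p x) (polys_lt (degree (mpol x)))"
      using pact_eq_iff[OF x] mod_mpol_id by (auto simp: inj_on_def)
    show "(\<lambda>p. pact T p x) ` polys_lt (degree (mpol x)) = cyc x"
    proof (intro equalityI subsetI)
      fix u assume "u \<in> cyc x"
      then obtain p where "u = pact T p x" by (auto simp: cyc_def)
      then show "u \<in> (\<lambda>p. pact T p x) ` polys_lt (degree (mpol x))"
        by (intro image_eqI[of _ _ "p mod mpol x"]) (simp_all add: pact_mod[OF x] mod_mpol_lt[OF x])
    qed (auto simp: cyc_def)
  qed
  then show ?thesis using bij_betw_same_card card_polys_lt by metis
qed

lemma cyc_span: "x \<in> S \<Longrightarrow> span ((\<lambda>i. (T ^^ i) x) ` {..<degree (mpol x)}) = cyc x"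
proof -
  assume x: "x \<in> S"
  let ?j = "degree (mpol x)"
  have mem: "(T ^^ i) x \<in> cyc x" for i using cycI[of "monom 1 i" x] by (simp add: pact_monom)
  have "pact T p x \<in> span ((\<lambda>i. (T ^^ i) x) ` {..<?j})" for p
  proof -
    define g where "g = p mod mpol x"
    have "pact T g x \<in> span ((\<lambda>i. (T ^^ i) x) ` {..<?j})"
      unfolding pact_def
    proof (rule span_sum)
      fix i assume i: "i \<in> {..degree g}"
      show "coeff g i *s (T ^^ i) x \<in> span ((\<lambda>i. (T ^^ i) x) ` {..<?j})" 
      proof (cases "i < ?j")
        case True
        then show ?thesis by (intro span_scale span_base) auto
      next
        case False
        then have "coeff g i = 0" using mod_mpol_lt[OF x, of p] by (simp add: polys_lt_def g_def)
        then show ?thesis using span_zero by simp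
      qed
    qed
    then show ?thesis using pact_mod[OF x] by (simp add: g_def)
  qed
  then have "cyc x \<subseteq> span ((\<lambda>i. (T ^^ i) x) ` {..<?j})" by (auto simp: cyc_def)
  moreover have "(\<lambda>i. (T ^^ i) x) ` {..<?j} \<subseteq> cyc x" using mem by blast
  ultimately show ?thesis using span_minimal[OF _ subspace_cyc] by (metis equalityI)
qed

text \<open>A relation among these vectors would give an annihilator of degree \<open>i\<close>. The
  stepwise form is the independence hypothesis of \<open>witt\<close>.\<close>

lemma cyc_new: "x \<in> S \<Longrightarrow> i < degree (mpol x) \<Longrightarrow> (T ^^ i) x \<notin> span ((\<lambda>k. (T ^^ k) x) ` {..<i})"
proof
  assume x: "x \<in> S" and i: "i < degree (mpol x)" and c: "(T ^^ i) x \<in> span ((\<lambda>k. (T ^^ k) x) ` {..<i})"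
  let ?V = "(\<lambda>p. pact T p x) ` polys_lt i"
  have "subspace ?V"
  proof (rule subspaceI)
    show "0 \<in> ?V" using image_eqI[of 0 "\<lambda>p. pact T p x" 0 "polys_lt i"] by (simp add: polys_lt_def)
    show "u + v \<in> ?V" if uv: "u \<in> ?V" "v \<in> ?V" for u v
    proof -
      from uv obtain p p' where "u = pact T p x" "v = pact T p' x" "p \<in> polys_lt i" "p' \<in> polys_lt i" by blast
      then show ?thesis by (intro image_eqI[of _ _ "p + p'"]) (auto simp: pact_add polys_lt_def)
    qed
    show "c *s u \<in> ?V" if u: "u \<in> ?V" for c u
    proof -
      from u obtain p where "u = pact T p x" "p \<in> polys_lt i" by blast
      then show ?thesis by (intro image_eqI[of _ _ "smult c p"]) (auto simp: pact_smult polys_lt_def)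
    qed
  qed
  moreover have "(T ^^ k) x \<in> ?V" if "k < i" for k
    by (rule image_eqI[of _ _ "monom 1 k"]) (use that in \<open>auto simp: pact_monom polys_lt_def\<close>)
  ultimately have "span ((\<lambda>k. (T ^^ k) x) ` {..<i}) \<subseteq> ?V" by (intro span_minimal) auto
  then obtain p where p: "p \<in> polys_lt i" "(T ^^ i) x = pact T p x" using c by blast
  have "pact T (monom 1 i - p) x = 0" using p by (simp add: pact_diff pact_monom)
  then have d: "mpol x dvd monom 1 i - p" using mpol(2)[OF x] by simp
  have "coeff (monom 1 i - p) i = 1" using p(1) by (simp add: polys_lt_def)
  then have "monom 1 i - p \<noteq> 0" by force
  then have "degree (mpol x) \<le> degree (monom 1 i - p)" using d dvd_imp_degree_le by blast
  also have "\<dots> \<le> i" using p(1) by (intro degree_le) (auto simp: polys_lt_def)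
  finally show False using i by simp
qed

lemma tr_cyc:
  assumes x: "x \<in> S" and k: "k \<ge> 1"
  shows "tr (cyc x) (T ^^ k) = pw (mpol x) k"
proof -
  \<comment> \<open>\<open>SOME\<close> picks a representing polynomial; its remainder modulo
    \<open>mpol x\<close> does not depend on the choice, so \<open>f i\<close> is the
    \<open>i\<close>-th coordinate in the basis \<open>x, T x, ...\<close>.\<close>
  define f where "f = (\<lambda>i u. coeff ((SOME p. pact T p x = u) mod mpol x) i)"
  have f: "f i (pact T p x) = coeff (p mod mpol x) i" for i p
  proof -
    have "pact T (SOME p'. pact T p' x = pact T p x) x = pact T p x" by (rule someI) simp
    then show ?thesis using pact_eq_iff[OF x] by (simp add: f_def)
  qed
  have e: "(T ^^ i) ((T ^^ k) x) = pact T (monom 1 (i + k)) x" for i k by (simp add: pact_monom funpow_add)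
  have "tr (cyc x) (T ^^ k) = (\<Sum>i<degree (mpol x). f i ((T ^^ k) ((T ^^ i) x)))"
  proof (rule tr_dual(3)[OF _ cyc_span[OF x] lin_on_funpow[OF lin_on_cyc[OF x]]])
    show "f i (u + v) = f i u + f i v" if "u \<in> cyc x" "v \<in> cyc x" for i u v
      using that unfolding cyc_def by (auto simp: f pact_add[symmetric] poly_mod_add_left)
    show "f i (c *s u) = c * f i u" if "u \<in> cyc x" for i c u
      using that unfolding cyc_def by (auto simp: f pact_smult[symmetric] mod_smult_left)
    show "f i ((T ^^ k) x) = (if i = k then 1 else 0)" if "k \<in> {..<degree (mpol x)}" for i k
    proof -
      have "(T ^^ k) x = pact T (monom 1 k) x" by (simp add: pact_monom)
      moreover have "monom 1 k mod mpol x = monom 1 k"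
        by (rule mod_mpol_id) (use that in \<open>auto simp: polys_lt_def\<close>)
      ultimately show ?thesis by (simp add: f)
    qed
  qed simp
  also have "\<dots> = (\<Sum>i<degree (mpol x). coeff (monom 1 (k + i) mod mpol x) i)" by (simp add: e f)
  also have "\<dots> = pw (mpol x) k" by (rule trace_mod_eq_pw[OF mpol(1)[OF x] k])
  finally show ?thesis .
qed

end

section \<open>The orbit of a vector under a symplectic map\<close>

lemma monic_dvd_eq:
  fixes g h :: "'a::field poly"
  assumes "g dvd h" "lead_coeff g = 1" "lead_coeff h = 1" "degree h = degree g"
  shows "g = h"
proof -
  obtain a where a: "h = g * a" using assms(1) by (auto simp: dvd_def)
  have "h \<noteq> 0" "g \<noteq> 0" using assms by auto
  then have "degree a = 0" using a assms(4) by (auto simp: degree_mult_eq)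
  then obtain c where c: "a = [:c:]" by (metis degree_eq_zeroE)
  have "lead_coeff h = lead_coeff g * lead_coeff a" using a by (simp only: lead_coeff_mult)
  then have "c = 1" using assms(2,3) c by simp
  then show ?thesis using a c by simp
qed

context alternating_form
begin

text \<open>\<open>T^-1\<close> is the adjoint of \<open>T\<close>, so their sum is self-adjoint
  (\<open>form_L\<close>); it also commutes with \<open>T\<close>.\<close>

definition Lop :: "('b \<Rightarrow> 'b) \<Rightarrow> 'b \<Rightarrow> 'b" where
  "Lop T = (\<lambda>z. T z + inv_into UNIV T z)"

text \<open>The factor \<open>T\<close> cannot be dropped: without it self-adjointness makes every
  entry zero (\<open>form_pL_self\<close>).\<close>

definition dl :: "('b \<Rightarrow> 'b) \<Rightarrow> 'b \<Rightarrow> nat \<Rightarrow> 'a" where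
  "dl T x = (\<lambda>i. \<omega> x (T ((Lop T ^^ i) x)))"

end

section \<open>The algebra generated by a symplectic map and its inverse\<close>

locale symplectic_map = alternating_form scale \<omega>
  for scale :: "'a::{field,finite} \<Rightarrow> 'b::ab_group_add \<Rightarrow> 'b" (infixr \<open>*s\<close> 75) and \<omega> +
  fixes S :: "'b set" and T :: "'b \<Rightarrow> 'b"
  assumes nS: "nondeg \<omega> S" and TSp: "T \<in> Sp \<omega> S"
begin

abbreviation T' where "T' \<equiv> inv_into UNIV T"
abbreviation L where "L \<equiv> Lop T"

lemma T'Sp: "T' \<in> Sp \<omega> S" by (rule Sp_inv[OF nS TSp])

lemma TT' [simp]: "T (T' z) = z" and T'T [simp]: "T' (T z) = z"
  using Sp_bij[OF nS TSp] by (simp_all add: bij_is_inj bij_is_surj surj_f_inv_f)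

lemma L_lin: "lin_on S L"
  using lin_onD[OF SpD(1)[OF TSp]] lin_onD[OF SpD(1)[OF T'Sp]] subspace_add[OF nondegD(1)[OF nS]]
  unfolding lin_on_def Lop_def by (auto simp: scale_right_distrib)

lemma LT: "z \<in> S \<Longrightarrow> L (T z) = T (L z)"
  using lin_onD(2)[OF SpD(1)[OF TSp], of z] lin_onD(2)[OF SpD(1)[OF TSp], of "T z" "T' z"] SpD(4)[OF TSp] SpD(4)[OF T'Sp]
  by (simp add: Lop_def)

lemma TL: "z \<in> S \<Longrightarrow> T (L z) = T (T z) + z"
  using lin_onD(2)[OF SpD(1)[OF TSp], of "T z" "T' z"] SpD(4)[OF TSp] SpD(4)[OF T'Sp] by (simp add: Lop_def)

sublocale ca: cyclic_action scale S T
  by unfold_locales (use nondegD[OF nS] SpD(1)[OF TSp] in auto)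

sublocale cL: cyclic_action scale S L
  by unfold_locales (use nondegD[OF nS] L_lin in auto)

sublocale ci: cyclic_action scale S T'
  by unfold_locales (use nondegD[OF nS] SpD(1)[OF T'Sp] in auto)

lemma T_mem: "z \<in> S \<Longrightarrow> T z \<in> S" and T'_mem: "z \<in> S \<Longrightarrow> T' z \<in> S" and L_mem: "z \<in> S \<Longrightarrow> L z \<in> S"
  using SpD(4)[OF TSp] SpD(4)[OF T'Sp] lin_onD(1)[OF L_lin] by auto

lemma form_T': "x \<in> S \<Longrightarrow> y \<in> S \<Longrightarrow> \<omega> (T' x) y = \<omega> x (T y)"
  using SpD(3)[OF TSp, of "T' x" y] T'_mem by simp

lemma form_T: "x \<in> S \<Longrightarrow> y \<in> S \<Longrightarrow> \<omega> (T x) y = \<omega> x (T' y)"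
  using SpD(3)[OF TSp, of x "T' y"] T'_mem by simp

lemma form_L: "x \<in> S \<Longrightarrow> y \<in> S \<Longrightarrow> \<omega> (L x) y = \<omega> x (L y)"
  by (simp add: Lop_def add_left add_right form_T form_T')

lemma form_pL: "x \<in> S \<Longrightarrow> y \<in> S \<Longrightarrow> \<omega> (pact L p x) y = \<omega> x (pact L p y)"
proof (induction p arbitrary: y)
  case (pCons a p)
  note x = pCons.prems(1) and y = pCons.prems(2)
  have "\<omega> (L (pact L p x)) y = \<omega> (pact L p x) (L y)" by (rule form_L[OF cL.pact_mem[OF x] y])
  also have "\<dots> = \<omega> x (L (pact L p y))" using pCons.IH[OF x L_mem[OF y]] cL.pact_T[OF y] by simp
  finally show ?case using x y by (simp add: cL.pact_pCons add_left add_right scale_left scale_right)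
qed simp

lemma form_pL_self: "x \<in> S \<Longrightarrow> \<omega> x (pact L p x) = 0"
proof -
  assume x: "x \<in> S"
  have "\<omega> x (pact L p x) = - \<omega> x (pact L p x)"
    using form_pL[OF x x, of p] skew[of x "pact L p x"] by simp
  then have "2 * \<omega> x (pact L p x) = 0" by (simp only: eq_neg_iff_add_eq_0 mult_2)
  then show ?thesis using two_nz by simp
qed

lemma T_pL: "x \<in> S \<Longrightarrow> T (pact L p x) = pact L p (T x)"
  using cL.pact_commute_map[OF SpD(1)[OF TSp], of x p] LT by simp

lemma lam_dl: "x \<in> S \<Longrightarrow> lam (dl T x) p = \<omega> x (T (pact L p x))"
proof -
  assume x: "x \<in> S"
  have "T (pact L p x) = (\<Sum>i\<le>degree p. coeff p i *s T ((L ^^ i) x))"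
    unfolding pact_def
    by (subst lin_on_sum[OF SpD(1)[OF TSp] nondegD(1)[OF nS]])
      (auto simp: subspace_scale[OF nondegD(1)[OF nS]] cL.funpow_mem[OF x] lin_onD(3)[OF SpD(1)[OF TSp]])
  then show ?thesis by (simp add: lam_def dl_def sum_right scale_right)
qed

text \<open>\<open>1 + z^2\<close> acts as \<open>T \<Lambda>\<close>, which turns
  \<open>zhom_pCons\<close> into the Horner step for polynomials in \<open>L\<close>.\<close>

lemma pact_zhom: "x \<in> S \<Longrightarrow> degree f \<le> m \<Longrightarrow> pact T (zhom m f) x = (T ^^ m) (pact L f x)"
proof (induction m arbitrary: f)
  case 0
  then obtain c where "f = [:c:]" by (auto elim: degree_eq_zeroE)
  then show ?case using 0 by (simp add: ca.pact_pCons cL.pact_pCons lin_on_0[OF SpD(1)[OF TSp] nondegD(1)[OF nS]]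
      lin_on_0[OF L_lin nondegD(1)[OF nS]])
next
  case (Suc m)
  obtain a f' where f: "f = pCons a f'" by (cases f)
  have d: "degree f' \<le> m" using Suc.prems(2) by (cases "f' = 0") (auto simp: f)
  note x = Suc.prems(1)
  note Tm = SpD(1)[OF Sp_funpow[OF TSp]]
  define y where "y = (T ^^ m) (pact L f' x)"
  have yS: "y \<in> S" unfolding y_def using lin_onD(1)[OF Tm] cL.pact_mem[OF x] by blast
  have p: "[:1, 0, 1:] = monom 1 0 + monom (1::'a) 2" by (simp add: monom_altdef numeral_2_eq_2)
  have "pact T (zhom (Suc m) f) x = a *s (T ^^ Suc m) x + pact T [:1, 0, 1:] (pact T (zhom m f') x)"
    unfolding f zhom_pCons by (simp add: pact_add pact_smult pact_monom ca.pact_mult[OF x] del: funpow.simps mult_pCons_left)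
  also have "pact T (zhom m f') x = y" using Suc.IH[OF x d] by (simp add: y_def)
  also have "pact T [:1, 0, 1:] y = T (L y)" unfolding p pact_add pact_monom using TL[OF yS] by (simp add: numeral_2_eq_2)
  also have "L y = (T ^^ m) (L (pact L f' x))"
  proof -
    have "L ((T ^^ k) z) = (T ^^ k) (L z)" if "z \<in> S" for k z
      by (induction k) (use that LT ca.funpow_mem in auto)
    then show ?thesis unfolding y_def using cL.pact_mem[OF x] by blast
  qed
  also have "a *s (T ^^ Suc m) x + T ((T ^^ m) (L (pact L f' x))) = (T ^^ Suc m) (pact L f x)"
    unfolding f cL.pact_pCons[OF x]
    using lin_onD(2,3)[OF SpD(1)[OF Sp_funpow[OF TSp, of "Suc m"]]] x L_mem[OF cL.pact_mem[OF x]]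
      subspace_scale[OF nondegD(1)[OF nS] x] by simp
  finally show ?case .
qed

end

section \<open>The cyclic space of a vector: its form, radical and minimal polynomial\<close>

locale symplectic_orbit = symplectic_map scale \<omega> S T
  for scale :: "'a::{field,finite} \<Rightarrow> 'b::ab_group_add \<Rightarrow> 'b" (infixr \<open>*s\<close> 75) and \<omega> S T +
  fixes x :: 'b
  assumes xS: "x \<in> S"
begin

abbreviation W where "W \<equiv> ca.cyc x"

text \<open>\<open>T^2 = T \<Lambda> - 1\<close>, hence the combinations of \<open>x\<close> and
  \<open>T x\<close> over polynomials in \<open>\<Lambda>\<close> are already stable under
  \<open>T\<close>.\<close>

lemma W_repr:
  assumes "u \<in> W"
  obtains c d where "u = pact L c x + pact L d (T x)"
proof -
  obtain p where p: "u = pact T p x" using assms by (auto simp: ca.cyc_def)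
  have "\<exists>c d. pact T p x = pact L c x + pact L d (T x)"
  proof (induction p)
    case 0
    show ?case by (rule exI[of _ 0], rule exI[of _ 0]) simp
  next
    case (pCons a p)
    then obtain c d where cd: "pact T p x = pact L c x + pact L d (T x)" by blast
    have m: "pact L c x \<in> S" "pact L d (T x) \<in> S" "pact L d x \<in> S" using cL.pact_mem xS T_mem by auto
    have "T (pact T p x) = T (pact L c x) + T (pact L d (T x))"
      unfolding cd using lin_onD(2)[OF SpD(1)[OF TSp]] m by blast
    also have "T (pact L d (T x)) = T (T (pact L d x))" using T_pL xS by simp
    also have "\<dots> = pact L d (L (T x)) - pact L d x"
      using TL[OF m(3)] T_pL[OF xS] cL.pact_T[OF xS] cL.pact_T[OF T_mem[OF xS]] LT[OF xS] T_pL[OF L_mem[OF xS]]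
      by (simp add: eq_diff_eq)
    also have "pact L d (L (T x)) = pact L (pCons 0 d) (T x)"
      using cL.pact_pCons[OF T_mem[OF xS], of 0 d] cL.pact_T[OF T_mem[OF xS]] by simp
    also have "T (pact L c x) = pact L c (T x)" using T_pL xS by simp
    finally have "pact T (pCons a p) x = pact L ([:a:] - d) x + pact L (c + pCons 0 d) (T x)"
      using xS lin_on_0[OF L_lin nondegD(1)[OF nS]]
      by (simp add: ca.pact_pCons pact_add pact_diff cL.pact_pCons[of x a 0] algebra_simps)
    then show ?case by blast
  qed
  then show ?thesis using that p by blast
qed

lemma W_T: "u \<in> W \<Longrightarrow> T u \<in> W" by (rule ca.cyc_T[OF xS])

lemma W_T_image: "T ` W = W"
  by (rule endo_inj_surj) (use ca.finite_cyc[OF xS] W_T Sp_inj[OF nS TSp] in \<open>auto simp: inj_on_def inj_def\<close>)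

lemma W_T': "u \<in> W \<Longrightarrow> T' u \<in> W"
  using W_T_image T'T by (metis imageE)

lemma W_pL: "u \<in> W \<Longrightarrow> pact L p u \<in> W"
proof -
  assume u: "u \<in> W"
  have uS: "u \<in> S" using u ca.cyc_sub[OF xS] by blast
  have "L v \<in> W" if "v \<in> W" for v
    using that W_T W_T' subspace_add[OF ca.subspace_cyc] by (simp add: Lop_def)
  then have "cL.cyc u \<subseteq> W" by (intro cL.cyc_least[OF uS ca.subspace_cyc u])
  then show ?thesis using cL.cycI by blast
qed

lemma W_combI: "pact L c x + pact L d (T x) \<in> W"
  using W_pL W_T ca.cyc_self subspace_add[OF ca.subspace_cyc] by blast

abbreviation l where "l \<equiv> dl T x"
definition f where "f = smin l"

text \<open>In the coordinates \<open>(c, d)\<close> the form of \<open>(c, d)\<close> and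
  \<open>(c', d')\<close> is \<open>lam l (c * d' - d * c')\<close>: the two remaining terms vanish
  because \<open>\<Lambda>\<close> is self-adjoint.\<close>

lemma form_comb:
  shows "\<omega> (pact L c x + pact L d (T x)) (pact L p x) = - lam l (d * p)"
    and "\<omega> (pact L c x + pact L d (T x)) (pact L p (T x)) = lam l (c * p)"
proof -
  note TxS = T_mem[OF xS]
  have 1: "\<omega> (pact L c y) (pact L p y) = 0" if "y \<in> S" for y c
    using form_pL[OF that, of "pact L p y" c] cL.pact_mem[OF that] form_pL_self[OF that, of "c * p"]
    by (simp add: cL.pact_mult[OF that])
  have 2: "\<omega> (pact L c x) (pact L p (T x)) = lam l (c * p)" for c p
    using form_pL[OF xS, of "pact L p (T x)" c] cL.pact_mem[OF TxS] lam_dl[OF xS, of "c * p"] T_pL[OF xS, of "c * p"]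
    by (simp add: cL.pact_mult[OF TxS])
  show "\<omega> (pact L c x + pact L d (T x)) (pact L p x) = - lam l (d * p)"
    using 1[OF xS, of c] 2[of p d] skew[of "pact L d (T x)" "pact L p x"] by (simp add: add_left mult.commute)
  show "\<omega> (pact L c x + pact L d (T x)) (pact L p (T x)) = lam l (c * p)"
    using 1[OF TxS, of d] 2[of c p] by (simp add: add_left)
qed

lemma f:
  shows f_monic: "lead_coeff f = 1" and f_dvd: "c \<in> seq_ann l \<longleftrightarrow> f dvd c"
proof -
  have "cL.mpol x \<in> seq_ann l"
    unfolding seq_ann_def
  proof (intro CollectI allI)
    fix g
    have "pact L (cL.mpol x * g) x = 0" using cL.mpol(2)[OF xS] by simp
    then show "lam l (cL.mpol x * g) = 0"
      using lam_dl[OF xS, of "cL.mpol x * g"] lin_on_0[OF SpD(1)[OF TSp] nondegD(1)[OF nS]] by simp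
  qed
  moreover have "cL.mpol x \<noteq> 0" using cL.mpol(1)[OF xS] by force
  ultimately show "lead_coeff f = 1" "c \<in> seq_ann l \<longleftrightarrow> f dvd c" unfolding f_def by (auto dest: smin)
qed

text \<open>\<open>f(\<Lambda>) x\<close> generates the radical of the form on \<open>W\<close>
  (\<open>R_eq\<close>); \<open>hR\<close> is thus the minimal polynomial of \<open>T\<close>
  there.\<close>

definition xR where "xR = pact L f x"
definition R where "R = ca.cyc xR"
definition hR where "hR = ca.mpol xR"

lemma xRS: "xR \<in> S" unfolding xR_def by (rule cL.pact_mem[OF xS])

text \<open>By \<open>form_comb\<close> a combination is orthogonal to \<open>W\<close> exactly if
  the functional kills all multiples of \<open>c\<close> and of \<open>d\<close>, which means
  divisibility by \<open>f\<close>; such combinations are the image of \<open>W\<close> under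
  \<open>f(\<Lambda>)\<close>.\<close>

lemma R_iff: "pact L c x + pact L d (T x) \<in> R \<longleftrightarrow> f dvd c \<and> f dvd d"
  and R_eq: "R = {u \<in> W. \<forall>w\<in>W. \<omega> u w = 0}"
proof -
  define Q where "Q = {u \<in> W. \<forall>w\<in>W. \<omega> u w = 0}"
  have 1: "pact L f w \<in> R" if w: "w \<in> W" for w
  proof -
    obtain p where p: "w = pact T p x" using w by (auto simp: ca.cyc_def)
    have "pact L f w = pact T p xR"
      unfolding p xR_def by (rule ca.pact_commute_map[OF cL.lin_on_pact _ xS]) (use T_pL in simp)
    then show ?thesis unfolding R_def using ca.cycI by simp
  qed
  have 2: "u \<in> Q" if u: "u \<in> R" for u
  proof -
    obtain p where p: "u = pact T p xR" using u by (auto simp: R_def ca.cyc_def)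
    obtain c d where cd: "pact T p x = pact L c x + pact L d (T x)" using W_repr[OF ca.cycI] by metis
    have m: "pact L c x \<in> S" "pact L d (T x) \<in> S" using cL.pact_mem xS T_mem by auto
    have "u = pact L f (pact T p x)"
      unfolding p xR_def by (rule ca.pact_commute_map[OF cL.lin_on_pact _ xS, symmetric]) (use T_pL in simp)
    also have "\<dots> = pact L (f * c) x + pact L (f * d) (T x)"
      unfolding cd using lin_onD(2)[OF cL.lin_on_pact m] cL.pact_mult xS T_mem by simp
    finally have ue: "u = pact L (f * c) x + pact L (f * d) (T x)" .
    have an: "lam l (f * c * e) = 0" for c e using f_dvd[of "f * c"] by (auto simp: seq_ann_def)
    have "\<omega> u w = 0" if w: "w \<in> W" for w
    proof -
      obtain c' d' where w': "w = pact L c' x + pact L d' (T x)" using W_repr[OF w] by metis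
      show ?thesis unfolding w' ue add_right form_comb an by simp
    qed
    moreover have "u \<in> W" unfolding ue by (rule W_combI)
    ultimately show ?thesis by (simp add: Q_def)
  qed
  have 3: "f dvd c \<and> f dvd d" if "pact L c x + pact L d (T x) \<in> Q" for c d
  proof -
    have "pact L p x \<in> W" "pact L p (T x) \<in> W" for p using W_combI[of p 0] W_combI[of 0 p] by auto
    then have "lam l (d * p) = 0" "lam l (c * p) = 0" for p
      using that form_comb[of c d p] unfolding Q_def by auto
    then show ?thesis using f_dvd by (auto simp: seq_ann_def)
  qed
  have 4: "pact L c x + pact L d (T x) \<in> R" if "f dvd c" "f dvd d" for c d
  proof -
    from that obtain c' d' where "c = f * c'" "d = f * d'" by (auto simp: dvd_def)
    then have "pact L c x + pact L d (T x) = pact L f (pact L c' x + pact L d' (T x))"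
      using lin_onD(2)[OF cL.lin_on_pact] cL.pact_mult cL.pact_mem xS T_mem by simp
    then show ?thesis using 1[OF W_combI] by simp
  qed
  show "pact L c x + pact L d (T x) \<in> R \<longleftrightarrow> f dvd c \<and> f dvd d" using 2 3 4 by blast
  show "R = {u \<in> W. \<forall>w\<in>W. \<omega> u w = 0}"
  proof (intro equalityI subsetI)
    fix u assume "u \<in> {u \<in> W. \<forall>w\<in>W. \<omega> u w = 0}"
    then have u: "u \<in> Q" "u \<in> W" by (auto simp: Q_def)
    obtain c d where cd: "u = pact L c x + pact L d (T x)" using W_repr[OF u(2)] by metis
    show "u \<in> R" using 3 4 u(1) unfolding cd by blast
  qed (use 2 Q_def in auto)
qed

text \<open>Remainders modulo \<open>f\<close> give a complement of \<open>R\<close> in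
  \<open>W\<close>; its size shows that \<open>W / R\<close> has dimension
  \<open>2 * degree f\<close>.\<close>

definition U where "U = (\<lambda>(c, d). pact L c x + pact L d (T x)) ` (polys_lt (degree f) \<times> polys_lt (degree f))"

lemma U_R: "u \<in> U \<Longrightarrow> u \<in> R \<Longrightarrow> u = 0"
proof -
  assume "u \<in> U" "u \<in> R"
  then obtain c d where cd: "c \<in> polys_lt (degree f)" "d \<in> polys_lt (degree f)" "u = pact L c x + pact L d (T x)"
    "f dvd c" "f dvd d" using R_iff by (auto simp: U_def)
  have "c = 0" "d = 0" using cd polys_lt_iff by (metis dvd_imp_degree_le leD)+
  then show "u = 0" using cd by simp
qed

lemma subspace_U: "subspace U"
proof (rule subspaceI)
  show "0 \<in> U" unfolding U_def by (rule image_eqI[of _ _ "(0, 0)"]) (auto simp: polys_lt_def)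
  show "u + v \<in> U" if uv: "u \<in> U" "v \<in> U" for u v
  proof -
    from uv obtain c d c' d' where "c \<in> polys_lt (degree f)" "d \<in> polys_lt (degree f)" "c' \<in> polys_lt (degree f)" "d' \<in> polys_lt (degree f)"
      "u = pact L c x + pact L d (T x)" "v = pact L c' x + pact L d' (T x)" unfolding U_def by auto
    then show ?thesis unfolding U_def
      by (intro image_eqI[of _ _ "(c + c', d + d')"]) (auto simp: polys_lt_def pact_add)
  qed
  show "k *s u \<in> U" if u: "u \<in> U" for k u
  proof -
    from u obtain c d where "c \<in> polys_lt (degree f)" "d \<in> polys_lt (degree f)"
      "u = pact L c x + pact L d (T x)" unfolding U_def by auto
    then show ?thesis unfolding U_def
      by (intro image_eqI[of _ _ "(smult k c, smult k d)"]) (auto simp: polys_lt_def pact_smult scale_right_distrib)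
  qed
qed

lemma U_W: "U \<subseteq> W" using W_combI by (auto simp: U_def)

lemma R_W: "R \<subseteq> W" using R_eq by blast

lemma subspace_R: "subspace R" unfolding R_def by (rule ca.subspace_cyc)

lemma W_decomp:
  assumes "w \<in> W"
  obtains u r where "u \<in> U" "r \<in> R" "w = u + r"
proof -
  obtain c d where cd: "w = pact L c x + pact L d (T x)" using W_repr[OF assms] by metis
  define c0 where "c0 = c mod f" 
  define d0 where "d0 = d mod f"
  have f0: "f \<noteq> 0" using f_monic by force
  have "c0 \<in> polys_lt (degree f)" "d0 \<in> polys_lt (degree f)"
    using degree_mod_less[OF f0] by (auto simp: c0_def d0_def polys_lt_iff)
  then have "pact L c0 x + pact L d0 (T x) \<in> U" by (auto simp: U_def)
  moreover have "pact L (c - c0) x + pact L (d - d0) (T x) \<in> R"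
    unfolding R_iff c0_def d0_def by (simp add: minus_mod_eq_mult_div)
  moreover have "w = (pact L c0 x + pact L d0 (T x)) + (pact L (c - c0) x + pact L (d - d0) (T x))"
    unfolding cd by (simp add: pact_diff)
  ultimately show ?thesis using that by blast
qed

lemma card_U: "card U = CARD('a) ^ (2 * degree f)"
proof -
  have "inj_on (\<lambda>(c, d). pact L c x + pact L d (T x)) (polys_lt (degree f) \<times> polys_lt (degree f))"
  proof (rule inj_onI, clarify)
    fix c d c' d' assume m: "c \<in> polys_lt (degree f)" "d \<in> polys_lt (degree f)" "c' \<in> polys_lt (degree f)" "d' \<in> polys_lt (degree f)"
      and e: "pact L c x + pact L d (T x) = pact L c' x + pact L d' (T x)"
    have "pact L (c - c') x + pact L (d - d') (T x) = (pact L c x + pact L d (T x)) - (pact L c' x + pact L d' (T x))"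
      by (simp add: pact_diff)
    then have "pact L (c - c') x + pact L (d - d') (T x) = 0" using e by simp
    then have "f dvd c - c'" "f dvd d - d'" using R_iff[of "c - c'" "d - d'"] subspace_0[OF subspace_R] by auto
    moreover have "c - c' \<in> polys_lt (degree f)" "d - d' \<in> polys_lt (degree f)" using m by (auto simp: polys_lt_def)
    ultimately have "c - c' = 0" "d - d' = 0" using polys_lt_iff by (metis dvd_imp_degree_le leD)+
    then show "c = c' \<and> d = d'" by simp
  qed
  then show ?thesis
    unfolding U_def by (simp add: card_image card_cartesian_product card_polys_lt power_add mult_2)
qed

lemma card_sum_direct:
  assumes "subspace A" "subspace B" "A \<inter> B \<subseteq> {0}"
  shows "card ((\<lambda>(u, v). u + v) ` (A \<times> B)) = card A * card B"
proof -
  have "inj_on (\<lambda>(u, v). u + v) (A \<times> B)"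
  proof (rule inj_onI, clarify)
    fix u v u' v' assume m: "u \<in> A" "v \<in> B" "u' \<in> A" "v' \<in> B" and e: "u + v = u' + v'"
    have "u - u' = v' - v" using e by (simp add: algebra_simps)
    moreover have "u - u' \<in> A" "v' - v \<in> B" using m assms subspace_diff by auto
    ultimately have "u - u' = 0" using assms(3) by auto
    then show "u = u' \<and> v = v'" using e by simp
  qed
  then show ?thesis by (simp add: card_image card_cartesian_product)
qed

text \<open>\<open>Phi f\<close> sends \<open>x\<close> to \<open>T^(degree f) xR\<close>, which
  \<open>hR\<close> kills, so the product is an annihilator; counting \<open>W\<close> as
  \<open>U + R\<close> shows that its degree is minimal.\<close>

lemma mpol_x: "ca.mpol x = Phi f * hR"
proof -
  have "W = (\<lambda>(u, v). u + v) ` (U \<times> R)"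
  proof (intro equalityI subsetI)
    fix w assume "w \<in> W"
    then obtain u r where "u \<in> U" "r \<in> R" "w = u + r" using W_decomp by metis
    then show "w \<in> (\<lambda>(u, v). u + v) ` (U \<times> R)" by (intro image_eqI[of _ _ "(u, r)"]) auto
  next
    fix w assume "w \<in> (\<lambda>(u, v). u + v) ` (U \<times> R)"
    then obtain u r where "u \<in> U" "r \<in> R" "w = u + r" by auto
    then show "w \<in> W" using U_W R_W subspace_add[OF ca.subspace_cyc] by blast
  qed
  then have "card W = card U * card R" using card_sum_direct[OF subspace_U subspace_R] U_R by auto
  moreover have "card W = CARD('a) ^ degree (ca.mpol x)" by (rule ca.card_cyc[OF xS])
  moreover have "card R = CARD('a) ^ degree hR" unfolding R_def hR_def by (rule ca.card_cyc[OF xRS])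
  moreover have "card {0, 1 :: 'a} \<le> CARD('a)" by (rule card_mono) auto
  ultimately have deg: "degree (ca.mpol x) = 2 * degree f + degree hR"
    by (simp add: card_U power_add[symmetric] power_inject_exp)
  have m: "lead_coeff (ca.mpol x) = 1" "lead_coeff hR = 1" unfolding hR_def by (auto intro: ca.mpol(1) xS xRS)
  have "pact T (Phi f * hR) x = pact T hR (pact T (Phi f) x)" by (metis ca.pact_mult[OF xS] mult.commute)
  also have "pact T (Phi f) x = (T ^^ degree f) xR" unfolding Phi_def xR_def by (rule pact_zhom[OF xS order_refl])
  also have "pact T hR ((T ^^ degree f) xR) = (T ^^ degree f) (pact T hR xR)"
    by (rule ca.pact_commute_map[OF SpD(1)[OF Sp_funpow[OF TSp]] _ xRS, symmetric]) (simp add: funpow_swap1)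
  also have "pact T hR xR = 0" unfolding hR_def using ca.mpol(2)[OF xRS] by simp
  also have "(T ^^ degree f) 0 = 0" by (rule lin_on_0[OF SpD(1)[OF Sp_funpow[OF TSp]] nondegD(1)[OF nS]])
  finally have "ca.mpol x dvd Phi f * hR" using ca.mpol(2)[OF xS] by simp
  moreover have "lead_coeff (Phi f * hR) = 1" using Phi_props(2)[OF f_monic] m(2) by (simp only: lead_coeff_mult) simp
  moreover have "degree (Phi f * hR) = degree (ca.mpol x)"
  proof -
    have "Phi f \<noteq> 0" "hR \<noteq> 0" using Phi_props(2)[OF f_monic] m(2) by force+
    then show ?thesis using Phi_props(1)[OF f_monic] deg by (simp add: degree_mult_eq)
  qed
  ultimately show ?thesis using monic_dvd_eq m(1) by blast
qed

end

section \<open>Traces along the flag defined by a cyclic space\<close>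

context alternating_form
begin

lemma orthogonal_decomposition:
  assumes S: "nondeg \<omega> S" and H: "nondeg \<omega> H" "H \<subseteq> S" and V: "V = {v\<in>S. \<forall>h\<in>H. \<omega> h v = 0}"
  obtains \<pi> where "\<And>z. z \<in> S \<Longrightarrow> \<pi> z \<in> V" "\<And>z. z \<in> S \<Longrightarrow> z - \<pi> z \<in> H"
    "\<And>x y. x \<in> S \<Longrightarrow> y \<in> S \<Longrightarrow> \<pi> (x + y) = \<pi> x + \<pi> y" "\<And>c x. x \<in> S \<Longrightarrow> \<pi> (c *s x) = c *s \<pi> x"
    "\<And>v. v \<in> V \<Longrightarrow> \<pi> v = v" "\<And>h. h \<in> H \<Longrightarrow> \<pi> h = 0"
    "nondeg \<omega> V" "card S = card H * card V" "H \<inter> V = {0}"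
proof -
  note sub = nondegD(1)[OF S] and subH = nondegD(1)[OF H(1)]
  have subV: "subspace V"
    unfolding V using sub subspace_add subspace_scale subspace_0
    by (intro subspaceI) (auto simp: add_right scale_right)
  have HV: "H \<inter> V = {0}"
  proof (intro equalityI subsetI)
    fix v assume v: "v \<in> H \<inter> V"
    have "v = 0"
    proof (rule nondegD(3)[OF H(1)])
      show "\<omega> v y = 0" if "y \<in> H" for y using v that skew[of v y] by (auto simp: V)
    qed (use v in simp)
    then show "v \<in> {0}" by simp
  qed (use subspace_0[OF subH] subspace_0[OF subV] in auto)
  have "\<exists>u. u \<in> V \<and> z - u \<in> H" if "z \<in> S" for z
  proof -
    obtain h where h: "h \<in> H" "\<And>w. w \<in> H \<Longrightarrow> \<omega> w h = \<omega> w z" using orth_projection[OF H(1)] by metis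
    then have "z - h \<in> V" using that H(2) subspace_diff[OF sub] by (auto simp: V diff_right)
    then show ?thesis using h(1) by (intro exI[of _ "z - h"]) simp
  qed
  then obtain \<pi> where \<pi>: "\<And>z. z \<in> S \<Longrightarrow> \<pi> z \<in> V" "\<And>z. z \<in> S \<Longrightarrow> z - \<pi> z \<in> H" by metis
  have uniq: "\<pi> z = u" if "z \<in> S" "u \<in> V" "z - u \<in> H" for z u
  proof -
    have "(z - u) - (z - \<pi> z) \<in> H" using \<pi>(2)[OF that(1)] that(3) subspace_diff[OF subH] by blast
    moreover have "\<pi> z - u \<in> V" using \<pi>(1)[OF that(1)] that(2) subspace_diff[OF subV] by blast
    moreover have "(z - u) - (z - \<pi> z) = \<pi> z - u" by simp
    ultimately have "\<pi> z - u \<in> H \<inter> V" by simp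
    then show ?thesis using HV by simp
  qed
  have VS: "V \<subseteq> S" by (auto simp: V)
  have add: "\<pi> (x + y) = \<pi> x + \<pi> y" if "x \<in> S" "y \<in> S" for x y
  proof (rule uniq)
    have e: "x + y - (\<pi> x + \<pi> y) = (x - \<pi> x) + (y - \<pi> y)" by simp
    show "x + y - (\<pi> x + \<pi> y) \<in> H"
      unfolding e by (rule subspace_add[OF subH \<pi>(2)[OF that(1)] \<pi>(2)[OF that(2)]])
  qed (use that \<pi> subspace_add[OF sub] subspace_add[OF subV] in auto)
  have sc: "\<pi> (c *s x) = c *s \<pi> x" if "x \<in> S" for c x
  proof (rule uniq)
    have e: "c *s x - c *s \<pi> x = c *s (x - \<pi> x)" by (simp add: scale_right_diff_distrib)
    show "c *s x - c *s \<pi> x \<in> H" unfolding e by (rule subspace_scale[OF subH \<pi>(2)[OF that]])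
  qed (use that \<pi> subspace_scale[OF sub] subspace_scale[OF subV] in auto)
  have piV: "\<pi> v = v" if "v \<in> V" for v
    by (rule uniq) (use that VS subspace_0[OF subH] in auto)
  have piH: "\<pi> h = 0" if "h \<in> H" for h
    by (rule uniq) (use that H(2) subspace_0[OF subV] in auto)
  have nV: "nondeg \<omega> V"
    unfolding nondeg_def
  proof (intro conjI ballI impI)
    show "finite V" using VS nondegD(2)[OF S] finite_subset by blast
    fix v assume v: "v \<in> V" and o: "\<forall>y\<in>V. \<omega> v y = 0"
    show "v = 0"
    proof (rule nondegD(3)[OF S])
      show "\<omega> v z = 0" if "z \<in> S" for z
      proof -
        have "\<omega> v ((z - \<pi> z) + \<pi> z) = 0"
          unfolding add_right using o \<pi>[OF that] v skew[of v "z - \<pi> z"] by (simp add: V)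
        then show ?thesis by simp
      qed
    qed (use v VS in blast)
  qed (rule subV)
  have "bij_betw (\<lambda>(h, v). h + v) (H \<times> V) S"
  proof (rule bij_betwI[where g = "\<lambda>z. (z - \<pi> z, \<pi> z)"])
    show "(\<lambda>(h, v). h + v) \<in> H \<times> V \<rightarrow> S" using H(2) VS subspace_add[OF sub] by auto
    show "(\<lambda>z. (z - \<pi> z, \<pi> z)) \<in> S \<rightarrow> H \<times> V" using \<pi> by auto
    fix p assume p: "p \<in> H \<times> V"
    then have hv: "fst p \<in> H" "snd p \<in> V" "fst p \<in> S" "snd p \<in> S" using H(2) VS by auto
    have "\<pi> (fst p + snd p) = snd p" using add[OF hv(3,4)] piH[OF hv(1)] piV[OF hv(2)] by simp
    then show "((case p of (h, v) \<Rightarrow> h + v) - \<pi> (case p of (h, v) \<Rightarrow> h + v), \<pi> (case p of (h, v) \<Rightarrow> h + v)) = p"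
      by (cases p) simp
  qed simp
  then have "card S = card H * card V" using bij_betw_same_card card_cartesian_product by metis
  then show ?thesis using that[of \<pi>] \<pi> add sc piV piH nV HV by blast
qed

end

context symplectic_map
begin

lemma coeff_mpol_0: "z \<in> S \<Longrightarrow> coeff (ca.mpol z) 0 \<noteq> 0"
proof
  assume z: "z \<in> S" and c: "coeff (ca.mpol z) 0 = 0"
  obtain a p where "ca.mpol z = pCons a p" by (cases "ca.mpol z")
  then have p: "ca.mpol z = pCons 0 p" using c by simp
  have nz: "p \<noteq> 0" using p ca.mpol(1)[OF z] by force
  have "T (pact T p z) = 0" using ca.pact_pCons[OF z, of 0 p] ca.mpol(2)[OF z, of "pCons 0 p"] p by simp
  then have "T (pact T p z) = T 0" using lin_on_0[OF SpD(1)[OF TSp] nondegD(1)[OF nS]] by simp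
  then have "pact T p z = 0" using Sp_inj[OF nS TSp] by (simp add: inj_eq)
  then have "ca.mpol z dvd p" using ca.mpol(2)[OF z] by simp
  then have "degree (pCons 0 p) \<le> degree p" using nz dvd_imp_degree_le p by metis
  then show False using nz by simp
qed

lemma funpow_cancel: "(T ^^ i) ((T' ^^ i) z) = z" "(T' ^^ i) ((T ^^ i) z) = z"
  by (induction i arbitrary: z) (simp_all add: funpow_swap1)

lemma cyc_inv_sub: "z \<in> S \<Longrightarrow> ci.cyc z \<subseteq> ca.cyc z"
proof (rule ci.cyc_least)
  assume z: "z \<in> S"
  have "T ` ca.cyc z = ca.cyc z"
    by (rule endo_inj_surj) (use ca.finite_cyc[OF z] ca.cyc_T[OF z] Sp_inj[OF nS TSp] in \<open>auto simp: inj_on_def inj_def\<close>)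
  then show "T' u \<in> ca.cyc z" if "u \<in> ca.cyc z" for u using that T'T by (metis imageE)
qed (auto simp: ca.subspace_cyc ca.cyc_self)

lemma cyc_sub_inv: "z \<in> S \<Longrightarrow> ca.cyc z \<subseteq> ci.cyc z"
proof (rule ca.cyc_least)
  assume z: "z \<in> S"
  have "T' ` ci.cyc z = ci.cyc z"
    by (rule endo_inj_surj) (use ci.finite_cyc[OF z] ci.cyc_T[OF z] Sp_inj[OF nS T'Sp] in \<open>auto simp: inj_on_def inj_def\<close>)
  then show "T u \<in> ci.cyc z" if "u \<in> ci.cyc z" for u using that TT' by (metis imageE)
qed (auto simp: ci.subspace_cyc ci.cyc_self)

lemma cyc_inv: "z \<in> S \<Longrightarrow> ci.cyc z = ca.cyc z"
  using cyc_inv_sub cyc_sub_inv by blast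

text \<open>Applying \<open>T'^r\<close> to \<open>h(T) z = 0\<close> reverses the coefficients of
  \<open>h\<close>. The degrees agree because \<open>T\<close> and \<open>T'\<close> generate the
  same cyclic space.\<close>

lemma mpol_inv: "z \<in> S \<Longrightarrow> ci.mpol z = rstar (ca.mpol z)"
proof -
  assume z: "z \<in> S"
  define h where "h = ca.mpol z"
  define r where "r = degree h"
  have h: "lead_coeff h = 1" "coeff h 0 \<noteq> 0" unfolding h_def using ca.mpol(1)[OF z] coeff_mpol_0[OF z] by auto
  have "pact T' (reflect_poly h) z = (\<Sum>i\<le>r. coeff h (r - i) *s (T' ^^ i) z)"
    using pact_bound[OF degree_reflect_poly_le, of T' h z] by (simp add: coeff_reflect_poly r_def)
  also have "\<dots> = (\<Sum>i\<le>r. coeff h i *s (T' ^^ (r - i)) z)"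
    by (rule sum.reindex_bij_witness[of _ "\<lambda>i. r - i" "\<lambda>i. r - i"]) auto
  also have "\<dots> = (\<Sum>i\<le>r. coeff h i *s (T' ^^ r) ((T ^^ i) z))"
  proof (rule sum.cong[OF refl])
    fix i assume "i \<in> {..r}"
    then have "(T' ^^ r) ((T ^^ i) z) = (T' ^^ (r - i)) ((T' ^^ i) ((T ^^ i) z))"
      using funpow_add[of "r - i" i T'] by (simp add: fun_eq_iff)
    then show "coeff h i *s (T' ^^ (r - i)) z = coeff h i *s (T' ^^ r) ((T ^^ i) z)" by (simp add: funpow_cancel)
  qed
  also have "\<dots> = (T' ^^ r) (pact T h z)"
    unfolding pact_def r_def[symmetric]
    by (subst lin_on_sum[OF SpD(1)[OF Sp_funpow[OF T'Sp]] nondegD(1)[OF nS]])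
      (auto simp: subspace_scale[OF nondegD(1)[OF nS]] ca.funpow_mem[OF z] lin_onD(3)[OF SpD(1)[OF Sp_funpow[OF T'Sp]]])
  also have "\<dots> = 0"
    using ca.mpol(2)[OF z, of h] lin_on_0[OF SpD(1)[OF Sp_funpow[OF T'Sp]] nondegD(1)[OF nS]] by (simp add: h_def)
  finally have "pact T' (rstar h) z = 0" by (simp add: rstar_def pact_smult)
  then have d: "ci.mpol z dvd rstar h" using ci.mpol(2)[OF z] by simp
  have "CARD('a) ^ degree (ci.mpol z) = CARD('a) ^ r"
    using ci.card_cyc[OF z] ca.card_cyc[OF z] cyc_inv[OF z] by (simp add: r_def h_def)
  moreover have "card {0, 1 :: 'a} \<le> CARD('a)" by (rule card_mono) auto
  ultimately have "degree (ci.mpol z) = r" by (simp add: power_inject_exp)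
  then show ?thesis
    using monic_dvd_eq[OF d ci.mpol(1)[OF z]] rstar_props[OF h] by (simp add: h_def r_def)
qed

end

context symplectic_orbit
begin

lemma T'_R: "u \<in> R \<Longrightarrow> T' u \<in> R" and T_R: "u \<in> R \<Longrightarrow> T u \<in> R"
  using ci.cyc_T[OF xRS, of u] ca.cyc_T[OF xRS, of u] cyc_inv[OF xRS] by (simp_all add: R_def)

text \<open>Traces are read along the flag \<open>W \<subseteq> R^perp \<subseteq> S\<close>. On
  \<open>W\<close> the map acts as \<open>T\<close>; on \<open>S / R^perp\<close>, the dual of
  \<open>R\<close>, its \<open>k\<close>-th power has the trace of \<open>T'^k\<close> on
  \<open>R\<close>; on \<open>R^perp / W\<close>, identified with \<open>V\<close>, it acts as
  \<open>m \<circ> y\<close>, where \<open>m\<close> depends on \<open>T1\<close> alone. Letting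
  \<open>y\<close> vary therefore averages over all of \<open>Sp \<omega> V\<close>.\<close>

lemma orbit_average:
  obtains V E where "nondeg \<omega> V" "V \<subseteq> S" "card S = CARD('a) ^ (2 * (degree f + degree hR)) * card V"
    "\<And>y. y \<in> Sp \<omega> V \<Longrightarrow> E y \<in> Sp \<omega> S" "\<And>y w. y \<in> Sp \<omega> V \<Longrightarrow> w \<in> W \<Longrightarrow> E y w = w"
    "\<And>T1. T1 \<in> Sp \<omega> S \<Longrightarrow> (\<And>w. w \<in> W \<Longrightarrow> T1 w = T w) \<Longrightarrow> \<exists>m\<in>Sp \<omega> V. \<forall>y\<in>Sp \<omega> V. \<forall>k\<ge>1.
      tr S ((T1 \<circ> E y) ^^ k) = pw (ca.mpol x) k + pw (rstar hR) k + tr V ((m \<circ> y) ^^ k)"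
proof -
  note sub = nondegD(1)[OF nS] and fin = nondegD(2)[OF nS]
  have WS: "W \<subseteq> S" by (rule ca.cyc_sub[OF xS])
  have RS: "R \<subseteq> S" using R_W WS by blast
  have fR: "finite R" using RS fin finite_subset by blast
  have subW: "subspace W" by (rule ca.subspace_cyc)
  obtain B where B: "independent B" "finite B" "span B = R" "B \<subseteq> R"
    using finite_basis_exists[OF subspace_R fR] by metis
  have RW0: "\<omega> r w = 0" "\<omega> w r = 0" if "r \<in> R" "w \<in> W" for r w
    using that R_eq skew[of w r] by auto
  \<comment> \<open>The vectors \<open>e b\<close> are dual to a basis of \<open>R\<close>, so that
    their span \<open>R'\<close> pairs perfectly with \<open>R\<close> and \<open>W + R'\<close>
    becomes nondegenerate.\<close>
  have "\<exists>z\<in>S. \<forall>b\<in>B. \<omega> b z = (if b = \<rho> then 1 else 0)" for \<rho>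
    using dual_vector[OF nS B(1), of "\<lambda>b. if b = \<rho> then 1 else 0"] B(4) RS by (metis (no_types, lifting) subset_trans)
  then obtain e where e: "\<And>\<rho>. e \<rho> \<in> S" "\<And>\<rho> b. b \<in> B \<Longrightarrow> \<omega> b (e \<rho>) = (if b = \<rho> then 1 else 0)" by metis
  define R' where "R' = span (e ` B)"
  have R'S: "R' \<subseteq> S" unfolding R'_def using e(1) sub by (intro span_minimal) auto
  have subR': "subspace R'" by (simp add: R'_def)
  have fR': "finite R'" using R'S fin finite_subset by blast
  have lid: "lin_on M id" for M by (simp add: lin_on_def)
  have R'basis: "independent (e ` B)" "inj_on e B"
    using tr_dual(1,2)[OF B(2) R'_def[symmetric] lid, of "\<lambda>b z. \<omega> b z"] e(2) by (auto simp: add_right scale_right)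
  have cR': "v = 0" if "v \<in> R'" "\<And>b. b \<in> B \<Longrightarrow> \<omega> b v = 0" for v
  proof -
    from that(1) have "v \<in> range (\<lambda>u. \<Sum>c\<in>e ` B. u c *s c)"
      using span_finite[OF finite_imageI[OF B(2)]] by (simp add: R'_def)
    then obtain u where u: "v = (\<Sum>c\<in>e ` B. u c *s c)" by blast
    then have v: "v = (\<Sum>c\<in>B. u (e c) *s e c)" using R'basis(2) by (simp add: sum.reindex)
    have "u (e b) = 0" if b: "b \<in> B" for b
    proof -
      have "\<omega> b v = (\<Sum>c\<in>B. if b = c then u (e c) else 0)"
        unfolding v sum_right by (rule sum.cong) (auto simp: scale_right e(2)[OF b])
      then show ?thesis using \<open>\<And>b. b \<in> B \<Longrightarrow> \<omega> b v = 0\<close>[OF b] b B(2) by simp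
    qed
    then show ?thesis unfolding v by simp
  qed
  have cR: "v = 0" if "v \<in> R" "\<And>b. b \<in> B \<Longrightarrow> \<omega> v (e b) = 0" for v
  proof -
    from that(1) have "v \<in> range (\<lambda>u. \<Sum>c\<in>B. u c *s c)" using span_finite[OF B(2)] B(3) by simp
    then obtain u where v: "v = (\<Sum>c\<in>B. u c *s c)" by blast
    have "u b = 0" if b: "b \<in> B" for b
    proof -
      have "\<omega> v (e b) = (\<Sum>c\<in>B. if b = c then u c else 0)"
        unfolding v sum_left by (rule sum.cong) (auto simp: scale_left e(2))
      then show ?thesis using \<open>\<And>b. b \<in> B \<Longrightarrow> \<omega> v (e b) = 0\<close>[OF b] b B(2) by simp
    qed
    then show ?thesis unfolding v by simp
  qed
  have RperpB: "\<omega> r z = 0" if "\<And>b. b \<in> B \<Longrightarrow> \<omega> b z = 0" "r \<in> R" for r z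
    using orth_span[of B z r] that B(3) by blast
  have WR': "W \<inter> R' \<subseteq> {0}" using cR' RW0 B(4) by blast
  define H where "H = (\<lambda>(w, v). w + v) ` (W \<times> R')"
  have HI: "w + v \<in> H" if "w \<in> W" "v \<in> R'" for w v using that by (force simp: H_def)
  have WH: "W \<subseteq> H" using HI[OF _ subspace_0[OF subR']] by auto
  have R'H: "R' \<subseteq> H" using HI[OF subspace_0[OF subW]] by auto
  have HS: "H \<subseteq> S" using WS R'S subspace_add[OF sub] by (auto simp: H_def)
  have subH: "subspace H"
  proof (rule subspaceI)
    show "0 \<in> H" using WH subspace_0[OF subW] by blast
    show "u + v \<in> H" if uv: "u \<in> H" "v \<in> H" for u v
    proof -
      from uv obtain a b c d where "u = a + b" "v = c + d" "a \<in> W" "b \<in> R'" "c \<in> W" "d \<in> R'" unfolding H_def by auto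
      then show ?thesis using HI[of "a + c" "b + d"] subspace_add[OF subW] subspace_add[OF subR'] by (simp add: add_ac)
    qed
    show "c *s u \<in> H" if u: "u \<in> H" for c u
    proof -
      from u obtain a b where "u = a + b" "a \<in> W" "b \<in> R'" unfolding H_def by auto
      then show ?thesis using HI[of "c *s a" "c *s b"] subspace_scale[OF subW] subspace_scale[OF subR']
        by (simp add: scale_right_distrib)
    qed
  qed
  have Hsplit: "\<eta> \<in> W" if \<eta>: "\<eta> \<in> H" "\<And>b. b \<in> B \<Longrightarrow> \<omega> b \<eta> = 0" for \<eta>
  proof -
    from \<eta>(1) obtain w v where wv: "\<eta> = w + v" "w \<in> W" "v \<in> R'" unfolding H_def by auto
    have "\<omega> b v = 0" if "b \<in> B" for b
      using \<eta>(2)[OF that] RW0(1)[of b w] wv that B(4) by (auto simp: add_right)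
    then have "v = 0" using cR'[OF wv(3)] by blast
    then show ?thesis using wv by simp
  qed
  have nH: "nondeg \<omega> H"
    unfolding nondeg_def
  proof (intro conjI ballI impI)
    show "finite H" using HS fin finite_subset by blast
    fix \<eta> assume \<eta>: "\<eta> \<in> H" and o: "\<forall>y\<in>H. \<omega> \<eta> y = 0"
    have "\<omega> b \<eta> = 0" if "b \<in> B" for b
    proof -
      have "b \<in> H" using that B(4) R_W WH by blast
      then show ?thesis using o skew[of b \<eta>] by simp
    qed
    then have "\<eta> \<in> W" by (rule Hsplit[OF \<eta>])
    then have "\<eta> \<in> R" using R_eq o WH by blast
    moreover have "\<omega> \<eta> (e b) = 0" if "b \<in> B" for b
      using o R'H span_base[of "e b" "e ` B"] that by (auto simp: R'_def)
    ultimately show "\<eta> = 0" using cR by blast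
  qed (rule subH)
  define V where "V = {v\<in>S. \<forall>h\<in>H. \<omega> h v = 0}"
  obtain \<pi> where \<pi>: "\<And>z. z \<in> S \<Longrightarrow> \<pi> z \<in> V" "\<And>z. z \<in> S \<Longrightarrow> z - \<pi> z \<in> H"
    "\<And>x y. x \<in> S \<Longrightarrow> y \<in> S \<Longrightarrow> \<pi> (x + y) = \<pi> x + \<pi> y" "\<And>c x. x \<in> S \<Longrightarrow> \<pi> (c *s x) = c *s \<pi> x"
    "\<And>v. v \<in> V \<Longrightarrow> \<pi> v = v" "\<And>h. h \<in> H \<Longrightarrow> \<pi> h = 0"
    "nondeg \<omega> V" "card S = card H * card V" "H \<inter> V = {0}"
    by (rule orthogonal_decomposition[OF nS nH HS V_def]) (rule that)
  have VS: "V \<subseteq> S" by (auto simp: V_def)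
  have subV: "subspace V" by (rule nondegD(1)[OF \<pi>(7)])
  have HV0: "\<omega> h v = 0" "\<omega> v h = 0" if "h \<in> H" "v \<in> V" for h v using that skew[of v h] by (auto simp: V_def)
  \<comment> \<open>Isometries of \<open>V\<close> are extended by the identity on \<open>H\<close>,
    in particular on \<open>W\<close>.\<close>
  define E where "E = (\<lambda>y z. if z \<in> S then (z - \<pi> z) + y (\<pi> z) else z)"
  have ESp: "E y \<in> Sp \<omega> S" if y: "y \<in> Sp \<omega> V" for y
  proof -
    have mem: "E y z \<in> S" if "z \<in> S" for z
    proof -
      have "z - \<pi> z \<in> S" "y (\<pi> z) \<in> S" using \<pi>(1,2)[OF that] SpD(4)[OF y] HS VS by auto
      then show ?thesis using subspace_add[OF sub] that by (simp add: E_def)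
    qed
    have ad: "E y (u + v) = E y u + E y v" if "u \<in> S" "v \<in> S" for u v
      using that \<pi>(1,3) lin_onD(2)[OF SpD(1)[OF y]] subspace_add[OF sub] by (simp add: E_def)
    have sc: "E y (c *s u) = c *s E y u" if "u \<in> S" for c u
      using that \<pi>(1,4) lin_onD(3)[OF SpD(1)[OF y]] subspace_scale[OF sub]
      by (simp add: E_def scale_right_distrib scale_right_diff_distrib)
    have "\<omega> (E y u) (E y v) = \<omega> u v" if uv: "u \<in> S" "v \<in> S" for u v
    proof -
      have m: "\<pi> u \<in> V" "\<pi> v \<in> V" "u - \<pi> u \<in> H" "v - \<pi> v \<in> H" "y (\<pi> u) \<in> V" "y (\<pi> v) \<in> V"
        using \<pi>(1,2) uv SpD(4)[OF y] by auto
      have "\<omega> (E y u) (E y v) = \<omega> (u - \<pi> u) (v - \<pi> v) + \<omega> (\<pi> u) (\<pi> v)"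
        using uv m SpD(3)[OF y m(1,2)] HV0[OF m(3) m(6)] HV0[OF m(4) m(5)] by (simp add: E_def add_left add_right)
      also have "\<dots> = \<omega> ((u - \<pi> u) + \<pi> u) ((v - \<pi> v) + \<pi> v)"
        unfolding add_left add_right using HV0[OF m(3) m(2)] HV0[OF m(4) m(1)] by simp
      finally show ?thesis by simp
    qed
    then show ?thesis unfolding Sp_def lin_on_def using mem ad sc by (auto simp: E_def)
  qed
  have EH: "E y h = h" if y: "y \<in> Sp \<omega> V" and h: "h \<in> H" for y h
    using h HS \<pi>(6)[OF h] lin_on_0[OF SpD(1)[OF y] subV] by (auto simp: E_def)
  have EV: "E y v = y v" if y: "y \<in> Sp \<omega> V" and v: "v \<in> V" for y v
    using v VS \<pi>(5)[OF v] by (auto simp: E_def)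
  have cardS: "card S = CARD('a) ^ (2 * (degree f + degree hR)) * card V"
  proof -
    have "card R' = CARD('a) ^ card B" using card_span(1)[OF R'basis(1)] B(2) card_image[OF R'basis(2)] by (simp add: R'_def)
    also have "\<dots> = card R" using card_span(1)[OF B(1,2)] B(3) by simp
    also have "\<dots> = CARD('a) ^ degree hR" unfolding R_def hR_def by (rule ca.card_cyc[OF xRS])
    finally have R': "card R' = CARD('a) ^ degree hR" .
    have nz: "Phi f \<noteq> 0" "hR \<noteq> 0" using Phi_props(2)[OF f_monic] ca.mpol(1)[OF xRS] by (force simp: hR_def)+
    have "card W = CARD('a) ^ (2 * degree f + degree hR)"
      using ca.card_cyc[OF xS] nz Phi_props(1)[OF f_monic] by (simp add: mpol_x degree_mult_eq)
    then have "card H = CARD('a) ^ (2 * degree f + degree hR) * CARD('a) ^ degree hR"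
      unfolding H_def using card_sum_direct[OF subW subR' WR'] R' by simp
    moreover have "2 * degree f + degree hR + degree hR = 2 * (degree f + degree hR)" by simp
    ultimately have "card H = CARD('a) ^ (2 * (degree f + degree hR))" by (simp only: power_add[symmetric])
    then show ?thesis using \<pi>(8) by simp
  qed
  \<comment> \<open>The orthogonal space of \<open>R\<close> splits as \<open>W\<close> plus
    \<open>V\<close>, and \<open>R'\<close> is a complement of it in \<open>S\<close>.\<close>
  define S1 where "S1 = {z\<in>S. \<forall>r\<in>R. \<omega> r z = 0}"
  have subS1: "subspace S1"
    unfolding S1_def using sub subspace_add subspace_scale subspace_0
    by (intro subspaceI) (auto simp: add_right scale_right)
  have RH: "R \<subseteq> H" using R_W WH by blast
  have WS1: "W \<subseteq> S1" using WS RW0 by (auto simp: S1_def)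
  have VS1: "V \<subseteq> S1" using VS HV0 RH by (auto simp: S1_def)
  have piS1: "z - \<pi> z \<in> W" if "z \<in> S1" for z
  proof (rule Hsplit)
    have z: "z \<in> S" using that by (simp add: S1_def)
    then show "z - \<pi> z \<in> H" by (rule \<pi>(2))
    show "\<omega> b (z - \<pi> z) = 0" if "b \<in> B" for b
    proof -
      have "b \<in> R" "b \<in> H" using that B(4) RH by auto
      then show ?thesis using \<open>z \<in> S1\<close> HV0(1)[OF _ \<pi>(1)[OF z]] by (simp add: S1_def diff_right)
    qed
  qed
  have main: "\<exists>m\<in>Sp \<omega> V. \<forall>y\<in>Sp \<omega> V. \<forall>k\<ge>1.
      tr S ((T1 \<circ> E y) ^^ k) = pw (ca.mpol x) k + pw (rstar hR) k + tr V ((m \<circ> y) ^^ k)"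
    if T1: "T1 \<in> Sp \<omega> S" and T1W: "\<And>w. w \<in> W \<Longrightarrow> T1 w = T w" for T1
  proof -
    \<comment> \<open>\<open>T1 v\<close> is orthogonal to \<open>T1 W = W\<close>, so subtracting
      its \<open>V\<close>-part leaves a vector of \<open>W\<close> orthogonal to \<open>W\<close>,
      hence of \<open>R\<close>.\<close>
    have T1V: "T1 v - \<pi> (T1 v) \<in> R" if v: "v \<in> V" for v
    proof -
      have vS: "v \<in> S" using v VS by blast
      have T1S: "T1 v \<in> S" using SpD(4)[OF T1 vS] .
      have o: "\<omega> w (T1 v) = 0" if w: "w \<in> W" for w
      proof -
        have w': "T' w \<in> W" by (rule W_T'[OF w])
        have "\<omega> w (T1 v) = \<omega> (T1 (T' w)) (T1 v)" using T1W[OF w'] by simp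
        also have "\<dots> = \<omega> (T' w) v" by (rule SpD(3)[OF T1]) (use w' WS vS in auto)
        also have "\<dots> = 0" using HV0 w' WH v by blast
        finally show ?thesis .
      qed
      have "T1 v \<in> S1" using T1S o R_W by (auto simp: S1_def)
      then have W: "T1 v - \<pi> (T1 v) \<in> W" by (rule piS1)
      have "\<omega> w (T1 v - \<pi> (T1 v)) = 0" if "w \<in> W" for w
        using o[OF that] HV0(1)[OF _ \<pi>(1)[OF T1S]] WH that by (auto simp: diff_right)
      then have "\<omega> (T1 v - \<pi> (T1 v)) w = 0" if "w \<in> W" for w
        using that skew[of "T1 v - \<pi> (T1 v)" w] by simp
      then show ?thesis using R_eq W by blast
    qed
    define m where "m = (\<lambda>v. if v \<in> V then \<pi> (T1 v) else v)"
    have mSp: "m \<in> Sp \<omega> V"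
    proof -
      have T1S: "T1 v \<in> S" if "v \<in> V" for v using SpD(4)[OF T1] that VS by blast
      have "\<omega> (\<pi> (T1 u)) (\<pi> (T1 v)) = \<omega> u v" if uv: "u \<in> V" "v \<in> V" for u v
      proof -
        define r s where "r = T1 u - \<pi> (T1 u)" and "s = T1 v - \<pi> (T1 v)"
        have rs: "r \<in> R" "s \<in> R" using T1V uv by (auto simp: r_def s_def)
        have 0: "\<omega> r (\<pi> (T1 v)) = 0" "\<omega> (\<pi> (T1 u)) s = 0" "\<omega> r s = 0"
          using HV0 RH rs \<pi>(1)[OF T1S[OF uv(1)]] \<pi>(1)[OF T1S[OF uv(2)]] RW0[of r s] R_W by blast+
        have "u \<in> S" "v \<in> S" using uv VS by auto
        then have "\<omega> u v = \<omega> (T1 u) (T1 v)" using SpD(3)[OF T1] by simp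
        also have "\<dots> = \<omega> (r + \<pi> (T1 u)) (s + \<pi> (T1 v))" by (simp add: r_def s_def)
        finally show ?thesis unfolding add_left add_right using 0 by simp
      qed
      moreover have "\<pi> (T1 (u + v)) = \<pi> (T1 u) + \<pi> (T1 v)" if "u \<in> V" "v \<in> V" for u v
        using lin_onD(2)[OF SpD(1)[OF T1], of u v] \<pi>(3) T1S that VS by (auto simp: subset_iff)
      moreover have "\<pi> (T1 (c *s u)) = c *s \<pi> (T1 u)" if "u \<in> V" for c u
        using lin_onD(3)[OF SpD(1)[OF T1], of u] \<pi>(4) T1S that VS by (auto simp: subset_iff)
      ultimately show ?thesis
        unfolding Sp_def lin_on_def m_def using \<pi>(1) T1S subspace_add[OF subV] subspace_scale[OF subV] by auto
    qed
    show ?thesis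
    proof (intro bexI[OF _ mSp] ballI allI impI)
      fix y and k :: nat assume y: "y \<in> Sp \<omega> V" and k: "k \<ge> 1"
      define A where "A = T1 \<circ> E y"
      have ASp: "A \<in> Sp \<omega> S" unfolding A_def by (rule Sp_comp[OF T1 ESp[OF y]])
      have AkSp: "A ^^ i \<in> Sp \<omega> S" for i by (rule Sp_funpow[OF ASp])
      have AW: "A w = T w" if "w \<in> W" for w using that EH[OF y] WH T1W by (auto simp: A_def)
      have AkW: "(A ^^ i) w = (T ^^ i) w \<and> (T ^^ i) w \<in> W" if "w \<in> W" for w i
        by (induction i) (use that AW W_T in auto)
      have AkR: "(A ^^ i) ((T' ^^ i) r) = r" "(T' ^^ i) r \<in> R" if "r \<in> R" for r i
      proof -
        show m: "(T' ^^ i) r \<in> R" by (induction i) (use that T'_R in auto)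
        have "(T' ^^ i) r \<in> W" using m R_W by blast
        then show "(A ^^ i) ((T' ^^ i) r) = r" using AkW by (simp add: funpow_cancel)
      qed
      have AkS1: "(A ^^ i) z \<in> S1" if z: "z \<in> S1" for z i
      proof -
        have "\<omega> r ((A ^^ i) z) = 0" if r: "r \<in> R" for r
        proof -
          have "\<omega> r ((A ^^ i) z) = \<omega> ((A ^^ i) ((T' ^^ i) r)) ((A ^^ i) z)" using AkR(1)[OF r] by simp
          also have "\<dots> = \<omega> ((T' ^^ i) r) z"
            by (rule SpD(3)[OF AkSp]) (use AkR(2)[OF r] RS z in \<open>auto simp: S1_def\<close>)
          also have "\<dots> = 0" using AkR(2)[OF r] z by (auto simp: S1_def)
          finally show ?thesis .
        qed
        then show ?thesis using SpD(4)[OF AkSp] z by (auto simp: S1_def)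
      qed
      \<comment> \<open>The projection onto \<open>R'\<close> along \<open>S1\<close>, written in
        dual bases.\<close>
      define p2 where "p2 = (\<lambda>z. \<Sum>b\<in>B. \<omega> b z *s e b)"
      have p2R': "p2 z \<in> R'" for z
        unfolding p2_def R'_def by (intro span_sum span_scale span_base) auto
      have p2c: "\<omega> b (p2 z) = \<omega> b z" if "b \<in> B" for b z
      proof -
        have "\<omega> b (p2 z) = (\<Sum>c\<in>B. if b = c then \<omega> c z else 0)"
          unfolding p2_def sum_right by (rule sum.cong) (auto simp: scale_right e(2)[OF that])
        then show ?thesis using that B(2) by simp
      qed
      have p2S1: "z - p2 z \<in> S1" if "z \<in> S" for z
      proof -
        have "z - p2 z \<in> S" using subspace_diff[OF sub that] p2R' R'S by blast
        moreover have "\<omega> r (z - p2 z) = 0" if "r \<in> R" for r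
          by (rule RperpB[OF _ that]) (simp add: diff_right p2c)
        ultimately show ?thesis by (simp add: S1_def)
      qed
      have "tr S (A ^^ k) = tr S1 (A ^^ k) + tr R' (p2 \<circ> A ^^ k)"
      proof (rule tr_split[OF fin sub subS1 subR' _ R'S _ p2R' p2S1 SpD(1)[OF AkSp] AkS1])
        show "S1 \<subseteq> S" by (auto simp: S1_def)
        show "S1 \<inter> R' \<subseteq> {0}" using cR' B(4) by (auto simp: S1_def)
      qed auto
      also have "tr R' (p2 \<circ> A ^^ k) = (\<Sum>b\<in>B. \<omega> b ((A ^^ k) (e b)))"
      proof -
        have lin: "lin_on R' (p2 \<circ> A ^^ k)"
          using lin_onD[OF SpD(1)[OF AkSp]] R'S p2R' unfolding lin_on_def p2_def
          by (auto simp: add_right scale_right scale_left_distrib sum.distrib scale_sum_right subset_iff)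
        have "tr R' (p2 \<circ> A ^^ k) = (\<Sum>b\<in>B. \<omega> b ((p2 \<circ> A ^^ k) (e b)))"
          by (rule tr_dual(3)[OF B(2) R'_def[symmetric] lin]) (auto simp: add_right scale_right e(2))
        also have "\<dots> = (\<Sum>b\<in>B. \<omega> b ((A ^^ k) (e b)))" by (rule sum.cong) (auto simp: p2c)
        finally show ?thesis .
      qed
      \<comment> \<open>Moving \<open>A^k\<close> across the form turns it into its inverse on
        \<open>R\<close>, where \<open>A\<close> agrees with \<open>T\<close>; the result is the
        trace of \<open>T'^k\<close> on \<open>R\<close> in dual bases.\<close>
      also have "\<dots> = (\<Sum>b\<in>B. \<omega> ((T' ^^ k) b) (e b))"
      proof (rule sum.cong[OF refl])
        fix b assume "b \<in> B"
        then have b: "b \<in> R" using B(4) by blast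
        have "\<omega> b ((A ^^ k) (e b)) = \<omega> ((A ^^ k) ((T' ^^ k) b)) ((A ^^ k) (e b))" using AkR(1)[OF b] by simp
        also have "\<dots> = \<omega> ((T' ^^ k) b) (e b)" by (rule SpD(3)[OF AkSp]) (use AkR(2)[OF b] RS e(1) in auto)
        finally show "\<omega> b ((A ^^ k) (e b)) = \<omega> ((T' ^^ k) b) (e b)" .
      qed
      also have "\<dots> = tr R (T' ^^ k)"
      proof -
        have linR: "lin_on R (T' ^^ k)"
          using lin_onD[OF SpD(1)[OF Sp_funpow[OF T'Sp]]] RS AkR(2) unfolding lin_on_def by (auto simp: subset_iff)
        have "tr R (T' ^^ k) = (\<Sum>b\<in>B. \<omega> ((T' ^^ k) (id b)) (e b))"
          by (rule tr_dual(3)[OF B(2) _ linR]) (use B(3) in \<open>auto simp: add_left scale_left e(2)\<close>)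
        then show ?thesis by simp
      qed
      also have "\<dots> = pw (rstar hR) k"
        using ci.tr_cyc[OF xRS k] cyc_inv[OF xRS] mpol_inv[OF xRS] by (simp add: R_def hR_def)
      also have "tr S1 (A ^^ k) = tr W (A ^^ k) + tr V (\<pi> \<circ> A ^^ k)"
      proof (rule tr_split[OF _ subS1 subW subV WS1 VS1])
        show "finite S1" using fin by (simp add: S1_def)
        show "W \<inter> V \<subseteq> {0}" using WH \<pi>(9) by blast
        show "lin_on S1 (A ^^ k)"
          using lin_onD[OF SpD(1)[OF AkSp]] AkS1 unfolding lin_on_def by (auto simp: S1_def)
      qed (use \<pi>(1) piS1 AkW in \<open>auto simp: S1_def\<close>)
      also have "tr W (A ^^ k) = pw (ca.mpol x) k"
      proof -
        have linW: "lin_on W (T ^^ k)" by (rule lin_on_funpow[OF ca.lin_on_cyc[OF xS]])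
        have "tr W (T ^^ k) = tr W (A ^^ k)"
          by (rule tr_cong[OF subW ca.finite_cyc[OF xS] linW]) (use AkW in auto)
        then show ?thesis using ca.tr_cyc[OF xS k] by simp
      qed
      also have "tr V (\<pi> \<circ> A ^^ k) = tr V ((m \<circ> y) ^^ k)"
      proof -
        have mySp: "(m \<circ> y) ^^ i \<in> Sp \<omega> V" for i by (rule Sp_funpow[OF Sp_comp[OF mSp y]])
        \<comment> \<open>Modulo \<open>R\<close>, which \<open>T\<close> preserves, the powers of
          \<open>A\<close> on \<open>V\<close> are those of \<open>m \<circ> y\<close>; the final
          projection removes the \<open>R\<close>-part.\<close>
        have diff: "(A ^^ i) v - ((m \<circ> y) ^^ i) v \<in> R" if v: "v \<in> V" for v i
        proof (induction i)
          case 0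
          show ?case using subspace_0[OF subspace_R] by simp
        next
          case (Suc i)
          define u r where "u = ((m \<circ> y) ^^ i) v" and "r = (A ^^ i) v - u"
          have u: "u \<in> V" unfolding u_def by (rule SpD(4)[OF mySp v])
          have r: "r \<in> R" unfolding r_def u_def by (rule Suc.IH)
          have yu: "y u \<in> V" by (rule SpD(4)[OF y u])
          have m: "r \<in> S" "u \<in> S" "r \<in> W" using r u RS VS R_W by auto
          have "A ((A ^^ i) v) = A (r + u)" by (simp add: r_def)
          also have "\<dots> = A r + A u" by (rule lin_onD(2)[OF SpD(1)[OF ASp] m(1,2)])
          also have "A u = T1 (y u)" by (simp add: A_def EV[OF y u])
          also have "A r = T r" by (rule AW[OF m(3)])
          finally have "(A ^^ Suc i) v = T r + T1 (y u)" by simp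
          moreover have "((m \<circ> y) ^^ Suc i) v = m (y u)" by (simp add: u_def)
          moreover have "m (y u) = \<pi> (T1 (y u))" using yu by (simp add: m_def)
          ultimately have e: "(A ^^ Suc i) v - ((m \<circ> y) ^^ Suc i) v = T r + (T1 (y u) - \<pi> (T1 (y u)))" by simp
          show ?case unfolding e by (rule subspace_add[OF subspace_R T_R[OF r] T1V[OF yu]])
        qed
        have eq: "((m \<circ> y) ^^ k) v = (\<pi> \<circ> A ^^ k) v" if v: "v \<in> V" for v
        proof -
          define u r where "u = ((m \<circ> y) ^^ k) v" and "r = (A ^^ k) v - u"
          have u: "u \<in> V" unfolding u_def by (rule SpD(4)[OF mySp v])
          have r: "r \<in> R" unfolding r_def u_def by (rule diff[OF v])
          have "\<pi> ((A ^^ k) v) = \<pi> (r + u)" by (simp add: r_def)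
          also have "\<dots> = u"
          proof -
            have "r \<in> S" "u \<in> S" "r \<in> H" using r u RS VS RH by auto
            then show ?thesis using \<pi>(3)[of r u] \<pi>(6)[of r] \<pi>(5)[OF u] by simp
          qed
          finally show ?thesis by (simp add: u_def)
        qed
        show ?thesis
          by (rule tr_cong[OF subV nondegD(2)[OF \<pi>(7)] SpD(1)[OF mySp], symmetric]) (rule eq)
      qed
      finally show "tr S ((T1 \<circ> E y) ^^ k) = pw (ca.mpol x) k + pw (rstar hR) k + tr V ((m \<circ> y) ^^ k)"
        unfolding A_def by (simp only: add_ac)
    qed
  qed
  show ?thesis
    by (rule that[OF \<pi>(7) VS cardS ESp _ main]) (use EH WH in blast)+
qed

end

section \<open>Monic polynomials over a finite field\<close>

definition monics :: "nat \<Rightarrow> 'a::field poly set" where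
  "monics m = {f. degree f = m \<and> lead_coeff f = 1}"

definition mdiv :: "'a::field poly \<Rightarrow> 'a poly set" where
  "mdiv f = {g. lead_coeff g = 1 \<and> g dvd f}"

lemma monics_eq: "monics m = (\<lambda>p. monom 1 m + p) ` polys_lt m"
proof (intro equalityI subsetI)
  fix f :: "'a poly" assume f: "f \<in> monics m"
  have "f - monom 1 m \<in> polys_lt m"
    using f unfolding monics_def polys_lt_def by (auto simp: coeff_eq_0 le_less)
  then show "f \<in> (\<lambda>p. monom 1 m + p) ` polys_lt m" by (intro image_eqI[of _ _ "f - monom 1 m"]) auto
next
  fix f :: "'a poly" assume "f \<in> (\<lambda>p. monom 1 m + p) ` polys_lt m"
  then obtain p where p: "p \<in> polys_lt m" "f = monom 1 m + p" by auto
  have c: "coeff f m = 1" using p by (simp add: polys_lt_def)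
  have "degree f \<le> m" using p by (intro degree_le) (auto simp: polys_lt_def)
  then have "degree f = m" using c le_degree[of f m] by simp
  then show "f \<in> monics m" using c by (simp add: monics_def)
qed

lemma finite_monics: "finite (monics m :: 'a::{field,finite} poly set)"
  by (simp add: monics_eq finite_polys_lt)

lemma card_monics: "card (monics m :: 'a::{field,finite} poly set) = CARD('a) ^ m"
  by (simp add: monics_eq card_image card_polys_lt)

lemma monics_translate:
  assumes "p \<in> polys_lt m"
  shows "(\<Sum>f\<in>monics m. F (f + p)) = (\<Sum>f\<in>monics m. F f)"
proof (rule sum.reindex_bij_witness[of _ "\<lambda>f. f - p" "\<lambda>f. f + p"])
  show "f + p \<in> monics m" "f - p \<in> monics m" if "f \<in> monics m" for f
  proof -
    from that obtain r where r: "r \<in> polys_lt m" "f = monom 1 m + r" by (auto simp: monics_eq)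
    have "r + p \<in> polys_lt m" "r - p \<in> polys_lt m" using r(1) assms by (auto simp: polys_lt_def)
    then show "f + p \<in> monics m" "f - p \<in> monics m"
      unfolding monics_eq r(2) by (auto intro: image_eqI[of _ _ "r + p"] image_eqI[of _ _ "r - p"])
  qed
qed auto

lemma monics_0: "monics 0 = {1}"
  by (auto simp: monics_def one_pCons elim!: degree_eq_zeroE)

lemma monics_mult: "f \<in> monics m \<Longrightarrow> g \<in> monics n \<Longrightarrow> f * g \<in> monics (m + n)"
proof -
  assume f: "f \<in> monics m" and g: "g \<in> monics n"
  then have "f \<noteq> 0" "g \<noteq> 0" by (auto simp: monics_def)
  moreover have "lead_coeff (f * g) = lead_coeff f * lead_coeff g" by (rule lead_coeff_mult)
  ultimately show ?thesis using f g unfolding monics_def by (auto simp: degree_mult_eq)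
qed

lemma monic_div:
  fixes f g :: "'a::field poly"
  assumes "lead_coeff f = 1" "lead_coeff g = 1" "g dvd f"
  shows "lead_coeff (f div g) = 1" "degree f = degree g + degree (f div g)" "g * (f div g) = f"
proof -
  show e: "g * (f div g) = f" using assms(3) by simp
  have "lead_coeff f = lead_coeff g * lead_coeff (f div g)" by (metis e lead_coeff_mult)
  then show "lead_coeff (f div g) = 1" using assms by simp
  have "f \<noteq> 0" using assms by force
  then have "g \<noteq> 0" "f div g \<noteq> 0" using e by auto
  then show "degree f = degree g + degree (f div g)" using e by (metis degree_mult_eq)
qed

lemma finite_mdiv: "f \<noteq> 0 \<Longrightarrow> finite (mdiv f :: 'a::{field,finite} poly set)"
  by (rule finite_subset[of _ "\<Union>m\<le>degree f. monics m"])
    (auto simp: mdiv_def monics_def finite_monics[unfolded monics_def] dvd_imp_degree_le)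

text \<open>A monic \<open>f\<close> with a monic divisor is a pair of monic factors, so Dirichlet
  convolution becomes multiplication of generating series graded by degree.\<close>

lemma monics_convolution:
  fixes a c :: "'a::{field,finite} poly \<Rightarrow> 'b::comm_semiring_0"
  shows "(\<Sum>s\<le>m. (\<Sum>g\<in>monics s. a g) * (\<Sum>e\<in>monics (m - s). c e)) = (\<Sum>f\<in>monics m. \<Sum>g\<in>mdiv f. a g * c (f div g))"
proof -
  have nz: "f \<noteq> 0" if "f \<in> monics m" for f :: "'a poly" and m using that by (auto simp: monics_def)
  have "(\<Sum>s\<le>m. (\<Sum>g\<in>monics s. a g) * (\<Sum>e\<in>monics (m - s). c e))
      = (\<Sum>s\<le>m. \<Sum>(g, e)\<in>monics s \<times> monics (m - s). a g * c e)"
    by (simp add: sum_product sum.cartesian_product)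
  also have "\<dots> = (\<Sum>(s, g, e)\<in>Sigma {..m} (\<lambda>s. monics s \<times> monics (m - s)). a g * c e)"
    by (subst sum.Sigma) (auto simp: finite_monics)
  also have "\<dots> = (\<Sum>(f, g)\<in>Sigma (monics m) mdiv. a g * c (f div g))"
  proof (rule sum.reindex_bij_witness[of _ "\<lambda>(f, g). (degree g, g, f div g)" "\<lambda>(s, g, e). (g * e, g)"])
    fix z assume "z \<in> Sigma {..m} (\<lambda>s. monics s \<times> monics (m - s) :: ('a poly \<times> 'a poly) set)"
    then obtain s g e where z: "z = (s, g, e)" "s \<le> m" "g \<in> monics s" "e \<in> monics (m - s)" by auto
    show "(case case z of (s, g, e) \<Rightarrow> (g * e, g) of (f, g) \<Rightarrow> (degree g, g, f div g)) = z"
      "(case case z of (s, g, e) \<Rightarrow> (g * e, g) of (f, g) \<Rightarrow> a g * c (f div g)) = (case z of (s, g, e) \<Rightarrow> a g * c e)"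
      using z nz[OF z(3)] by (auto simp: monics_def)
    show "(case z of (s, g, e) \<Rightarrow> (g * e, g)) \<in> Sigma (monics m) mdiv"
      using z monics_mult[OF z(3,4)] by (auto simp: mdiv_def monics_def)
  next
    fix z assume "z \<in> Sigma (monics m) (mdiv :: 'a poly \<Rightarrow> 'a poly set)"
    then obtain f g where z: "z = (f, g)" "f \<in> monics m" "g \<in> mdiv f" by auto
    note d = monic_div[of f g]
    show "(case z of (f, g) \<Rightarrow> (degree g, g, f div g)) \<in> Sigma {..m} (\<lambda>s. monics s \<times> monics (m - s))"
      "(case case z of (f, g) \<Rightarrow> (degree g, g, f div g) of (s, g, e) \<Rightarrow> (g * e, g)) = z"
      using z d by (auto simp: mdiv_def monics_def)
  qed
  also have "\<dots> = (\<Sum>f\<in>monics m. \<Sum>g\<in>mdiv f. a g * c (f div g))"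
    by (rule sum.Sigma[symmetric]) (auto simp: finite_monics finite_mdiv nz)
  finally show ?thesis .
qed

lemma lam_monom: "lam l (monom c i) = c * l i"
proof -
  have "lam l (monom c i) = (\<Sum>k\<le>i. coeff (monom c i) k * l k)" by (rule lam_bound) (rule degree_monom_le)
  also have "\<dots> = (\<Sum>k\<le>i. if k = i then c * l i else 0)" by (rule sum.cong) auto
  finally show ?thesis by simp
qed

text \<open>Linear recurrent sequences annihilated by \<open>f\<close> are the functionals on \<open>F[w]/(f)\<close>.\<close>

lemma card_seq_ann:
  fixes f :: "'a::{field,finite} poly"
  assumes f: "f \<in> monics m"
  shows "card {l. f \<in> seq_ann l} = CARD('a) ^ m" "finite {l. f \<in> seq_ann l}"
proof -
  have f0: "f \<noteq> 0" and df: "degree f = m" using f by (auto simp: monics_def)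
  have md: "p mod f \<in> polys_lt m" for p using degree_mod_less[OF f0, of p] df by (auto simp: polys_lt_iff)
  define ev where "ev = (\<lambda>(u::nat \<Rightarrow> 'a) i. \<Sum>c<m. u c * coeff (monom 1 i mod f) c)"
  have lin: "lam (ev u) p = (\<Sum>c<m. u c * coeff (p mod f) c)" for u p
  proof -
    have "p mod f = (\<Sum>i\<le>degree p. smult (coeff p i) (monom 1 i)) mod f"
      by (subst poly_as_sum_of_monoms[of p, symmetric]) (simp add: smult_monom)
    also have "\<dots> = (\<Sum>i\<le>degree p. smult (coeff p i) (monom 1 i mod f))"
    proof -
      have "(\<Sum>i\<in>I. smult (coeff p i) (monom 1 i)) mod f = (\<Sum>i\<in>I. smult (coeff p i) (monom 1 i mod f))" for I
        by (induction I rule: infinite_finite_induct) (auto simp: poly_mod_add_left mod_smult_left)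
      then show ?thesis .
    qed
    finally have "coeff (p mod f) c = (\<Sum>i\<le>degree p. coeff p i * coeff (monom 1 i mod f) c)" for c
      by (simp add: coeff_sum)
    then show ?thesis
      by (simp add: lam_def ev_def sum_distrib_left mult.left_commute sum.swap[of _ "{..<m}"])
  qed
  have "bij_betw ev ({..<m} \<rightarrow>\<^sub>E UNIV) {l. f \<in> seq_ann l}"
    unfolding bij_betw_def
  proof
    show "inj_on ev ({..<m} \<rightarrow>\<^sub>E UNIV)"
    proof (rule inj_onI)
      fix u v assume u: "u \<in> {..<m} \<rightarrow>\<^sub>E UNIV" and v: "v \<in> {..<m} \<rightarrow>\<^sub>E UNIV" and e: "ev u = ev v"
      have val: "ev u i = u i" if "i < m" for u i
      proof -
        have "monom 1 i mod f = monom 1 i"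
          by (rule mod_poly_less) (use that df degree_monom_le[of "1::'a" i] in simp)
        then have "ev u i = (\<Sum>c<m. if c = i then u c else 0)"
          unfolding ev_def by (intro sum.cong) auto
        then show ?thesis using that by simp
      qed
      show "u = v"
      proof
        fix i show "u i = v i"
        proof (cases "i < m")
          case True
          then show ?thesis using val[OF True, of u] val[OF True, of v] fun_cong[OF e, of i] by simp
        next
          case False
          then show ?thesis using PiE_arb[OF u, of i] PiE_arb[OF v, of i] by simp
        qed
      qed
    qed
    show "ev ` ({..<m} \<rightarrow>\<^sub>E UNIV) = {l. f \<in> seq_ann l}"
    proof (intro equalityI subsetI)
      fix l assume "l \<in> ev ` ({..<m} \<rightarrow>\<^sub>E UNIV)"
      then obtain u where "l = ev u" by blast
      then show "l \<in> {l. f \<in> seq_ann l}" by (simp add: seq_ann_def lin)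
    next
      fix l assume l: "l \<in> {l. f \<in> seq_ann l}"
      have le: "l = ev (restrict l {..<m})"
      proof
        fix i
        have "monom 1 i = f * (monom 1 i div f) + monom 1 i mod f" by simp
        then have "lam l (monom 1 i) = lam l (f * (monom 1 i div f)) + lam l (monom 1 i mod f)" by (metis lam_add)
        also have "lam l (f * (monom 1 i div f)) = 0" using l by (simp add: seq_ann_def)
        also have "lam l (monom 1 i mod f) = (\<Sum>c\<le>m. coeff (monom 1 i mod f) c * l c)"
          by (rule lam_bound) (use degree_mod_less[OF f0, of "monom 1 i"] df in auto)
        also have "\<dots> = (\<Sum>c<m. coeff (monom 1 i mod f) c * l c)"
          using md[of "monom 1 i"] by (simp add: lessThan_Suc_atMost[symmetric] polys_lt_def)
        also have "\<dots> = ev (restrict l {..<m}) i"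
          unfolding ev_def by (rule sum.cong) auto
        finally show "l i = ev (restrict l {..<m}) i" by (simp add: lam_monom)
      qed
      show "l \<in> ev ` ({..<m} \<rightarrow>\<^sub>E UNIV)" by (subst le) (rule imageI, metis restrict_PiE_iff UNIV_I)
    qed
  qed
  then show "card {l. f \<in> seq_ann l} = CARD('a) ^ m" "finite {l. f \<in> seq_ann l}"
    using bij_betw_same_card[of ev] card_funcsetE[of "{..<m}" "UNIV :: 'a set"]
      bij_betw_finite[of ev] finite_PiE[of "{..<m}" "\<lambda>_. UNIV :: 'a set"] by auto
qed

section \<open>Reciprocal polynomials, norms and the splitting of primes\<close>

lemma rstar_mult: "rstar (g * h) = rstar g * rstar h"
  by (simp add: rstar_def reflect_poly_mult coeff_mult_0 mult.commute)

lemma rstar_rstar: "lead_coeff h = 1 \<Longrightarrow> coeff h 0 \<noteq> 0 \<Longrightarrow> rstar (rstar h) = h"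
  by (simp add: rstar_def reflect_poly_smult)

lemma rstar_Phi: "lead_coeff f = 1 \<Longrightarrow> rstar (Phi f) = Phi f"
  by (simp add: rstar_def Phi_props)

lemma rstar_dvd: "g dvd h \<Longrightarrow> rstar g dvd rstar h"
  by (auto simp: dvd_def rstar_mult)

text \<open>With \<open>w = z + 1/z\<close>, these are the \<open>h\<close> whose norm
  \<open>h(z) h(1/z)\<close> from \<open>F(z)\<close> to \<open>F(w)\<close> equals
  \<open>f(w)\<close> up to a constant; the equation is written after clearing powers of
  \<open>z\<close>.\<close>

definition norm_fib :: "'a::field poly \<Rightarrow> 'a poly set" where
  "norm_fib f = {h. lead_coeff h = 1 \<and> coeff h 0 \<noteq> 0 \<and> h * rstar h = Phi f}"

lemma norm_exists:
  assumes h: "lead_coeff h = 1" "coeff h 0 \<noteq> 0"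
  obtains f where "lead_coeff f = 1" "degree f = degree h" "h \<in> norm_fib f"
proof -
  note r = rstar_props[OF h]
  have nz: "h \<noteq> 0" "rstar h \<noteq> 0" using h r by auto
  have "reflect_poly (h * rstar h) = h * rstar h"
    using h by (simp add: reflect_poly_mult rstar_def reflect_poly_smult mult.commute)
  moreover have "degree (h * rstar h) = 2 * degree h" using nz r by (simp add: degree_mult_eq)
  moreover have "lead_coeff (h * rstar h) = 1" using h r by (simp only: lead_coeff_mult) simp
  ultimately obtain f where "lead_coeff f = 1" "degree f = degree h" "Phi f = h * rstar h"
    using Phi_surj by metis
  then show ?thesis using that h by (simp add: norm_fib_def)
qed

lemma norm_fib_degree: "h \<in> norm_fib f \<Longrightarrow> lead_coeff f = 1 \<Longrightarrow> degree h = degree f"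
proof -
  assume h: "h \<in> norm_fib f" and f: "lead_coeff f = 1"
  note r = rstar_props[of h]
  have "h \<noteq> 0" "rstar h \<noteq> 0" using h r by (auto simp: norm_fib_def)
  moreover have "Phi f = h * rstar h" using h by (simp add: norm_fib_def)
  ultimately have "2 * degree f = degree h + degree (rstar h)"
    using Phi_props(1)[OF f] by (simp add: degree_mult_eq)
  then show ?thesis using r h by (simp add: norm_fib_def)
qed

lemma finite_norm_fib: "lead_coeff f = 1 \<Longrightarrow> finite (norm_fib f :: 'a::{field,finite} poly set)"
proof (rule finite_subset[OF subsetI finite_monics[of "degree f"]])
  fix h assume "lead_coeff f = 1" "h \<in> norm_fib f"
  then show "h \<in> monics (degree f)" using norm_fib_degree[of h f] by (auto simp: monics_def norm_fib_def)
qed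

text \<open>A quotient of self-reciprocal polynomials is self-reciprocal, hence again of the form
  \<open>Phi e\<close>.\<close>

lemma dvd_Phi_split:
  assumes f: "lead_coeff f = 1" "lead_coeff g = 1" and d: "Phi g dvd Phi f"
  obtains e where "lead_coeff e = 1" "f = g * e"
proof -
  obtain p where p: "Phi f = Phi g * p" using d by (auto simp: dvd_def)
  have nz: "Phi f \<noteq> 0" "Phi g \<noteq> 0" using Phi_props(2)[OF f(1)] Phi_props(2)[OF f(2)] by auto
  then have p0: "p \<noteq> 0" using p by auto
  have "degree (Phi f) = degree (Phi g) + degree p" using p nz p0 by (simp add: degree_mult_eq)
  then have dp: "degree p = 2 * (degree f - degree g)" using Phi_props(1)[OF f(1)] Phi_props(1)[OF f(2)] by simp
  have "lead_coeff (Phi f) = lead_coeff (Phi g) * lead_coeff p" using p by (simp only: lead_coeff_mult)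
  then have lp: "lead_coeff p = 1" using Phi_props(2)[OF f(1)] Phi_props(2)[OF f(2)] by simp
  have "Phi g * reflect_poly p = reflect_poly (Phi g * p)" by (simp only: reflect_poly_mult Phi_props(4)[OF f(2)])
  also have "\<dots> = Phi g * p" by (simp only: p[symmetric] Phi_props(4)[OF f(1)])
  finally have "Phi g * reflect_poly p = Phi g * p" .
  then have "reflect_poly p = p" using nz(2) by (metis mult_left_cancel)
  then obtain e where e: "lead_coeff e = 1" "Phi e = p" using Phi_surj[OF dp lp] by metis
  have g0: "g \<noteq> 0" and e0: "e \<noteq> 0" using f e by auto
  have "lead_coeff (g * e) = 1" using f(2) e(1) by (simp only: lead_coeff_mult) simp
  then have "f = g * e" using Phi_inj[OF f(1)] Phi_mult[OF g0 e0] p e by simp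
  then show ?thesis using that e by blast
qed

lemma irreducible_factor:
  fixes f :: "'a::field poly"
  assumes "degree f > 0"
  obtains P where "irreducible P" "lead_coeff P = 1" "P dvd f" "degree P > 0"
proof -
  define g where "g = (ARG_MIN degree p. p dvd f \<and> degree p > 0)"
  have g: "g dvd f" "degree g > 0" "\<And>p. p dvd f \<Longrightarrow> degree p > 0 \<Longrightarrow> degree g \<le> degree p"
    using arg_min_natI[of "\<lambda>p. p dvd f \<and> degree p > 0" f degree]
      arg_min_nat_le[of "\<lambda>p. p dvd f \<and> degree p > 0" _ degree] assms unfolding g_def by auto
  have g0: "g \<noteq> 0" using g(2) by auto
  define P where "P = smult (inverse (lead_coeff g)) g"
  have P: "lead_coeff P = 1" "P dvd f" "degree P = degree g" "P \<noteq> 0"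
    using g g0 by (auto simp: P_def smult_dvd)
  have "irreducible P"
  proof (rule irreducibleI)
    show "P \<noteq> 0" by fact
    show "\<not> P dvd 1" using P(3,4) g(2) by (simp add: is_unit_iff_degree)
    fix a c assume ac: "P = a * c"
    have "degree a = 0 \<or> degree c = 0"
    proof (rule ccontr)
      assume "\<not> (degree a = 0 \<or> degree c = 0)"
      moreover have "degree P = degree a + degree c" using ac P(4) by (auto simp: degree_mult_eq)
      moreover have "a dvd f" using ac P(2) by (metis dvd_mult_left)
      ultimately show False using g(3)[of a] P(3) by simp
    qed
    then show "a dvd 1 \<or> c dvd 1" using ac P(4) by (auto simp: is_unit_iff_degree)
  qed
  then show ?thesis using that P g(2) by auto
qed

lemma irreducible_dvd_monic:
  fixes P Q :: "'a::field poly"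
  assumes "irreducible Q" "P dvd Q" "lead_coeff P = 1" "lead_coeff Q = 1" "degree P > 0"
  shows "P = Q"
proof -
  obtain c where c: "Q = P * c" using assms(2) by (auto simp: dvd_def)
  have "P \<noteq> 0" using assms(3) by auto
  then have "\<not> P dvd 1" using assms(5) by (simp add: is_unit_iff_degree)
  then have "c dvd 1" using irreducibleD[OF assms(1) c] by blast
  moreover have "P \<noteq> 0" "c \<noteq> 0" using c assms by auto
  ultimately have "degree Q = degree P" using c by (auto simp: degree_mult_eq is_unit_iff_degree)
  then show ?thesis using monic_dvd_eq[OF assms(2-4)] by simp
qed

lemma irreducible_root:
  fixes Q :: "'a::field poly"
  assumes "irreducible Q" "lead_coeff Q = 1" "poly Q c = 0"
  shows "Q = [:-c, 1:]"
  using irreducible_dvd_monic[OF assms(1), of "[:-c, 1:]"] assms by (simp add: poly_eq_0_iff_dvd)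

lemma prime_type:
  fixes P :: "'a::field poly"
  assumes P: "irreducible P" "lead_coeff P = 1" and two: "(2::'a) \<noteq> 0"
  obtains (split) Q where "irreducible Q" "lead_coeff Q = 1" "coeff Q 0 \<noteq> 0" "rstar Q \<noteq> Q" "Phi P = Q * rstar Q"
  | (inert) "irreducible (Phi P)"
  | (ramified) c where "c = 1 \<or> c = -1" "P = [:- 2 * c, 1:]" "Phi P = [:- c, 1:] * [:- c, 1:]"
proof -
  have "degree P \<noteq> 0" using P by (metis irreducible_def is_unit_iff_degree leading_coeff_0_iff)
  then have "degree (Phi P) > 0" using Phi_props(1)[OF P(2)] by simp
  then obtain Q where Q: "irreducible Q" "lead_coeff Q = 1" "Q dvd Phi P" "degree Q > 0" by (rule irreducible_factor)
  obtain e where e: "Phi P = Q * e" using Q(3) by (auto simp: dvd_def)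
  have "coeff Q 0 * coeff e 0 = 1" using Phi_props(3)[OF P(2)] e by (simp add: coeff_mult_0)
  then have Q0: "coeff Q 0 \<noteq> 0" by auto
  note r = rstar_props[OF Q(2) Q0]
  have eq: "P = f" if f: "lead_coeff f = 1" "Phi f dvd Phi P" "degree f > 0" for f
  proof -
    obtain g where "P = f * g" using dvd_Phi_split[OF P(2) f(1,2)] by metis
    then show ?thesis using irreducible_dvd_monic[OF P(1) _ f(1) P(2) f(3)] by simp
  qed
  show ?thesis
  proof (cases "rstar Q = Q")
    case False
    have "rstar Q dvd Phi P" using rstar_dvd[OF Q(3)] rstar_Phi[OF P(2)] by simp
    then obtain e' where e': "Phi P = rstar Q * e'" by (auto simp: dvd_def)
    have pr: "prime_elem Q" by (rule field_poly_irreducible_imp_prime[OF Q(1)])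
    have "\<not> Q dvd rstar Q" using monic_dvd_eq[of Q "rstar Q"] Q(2) r False by auto
    then have "Q dvd e'" using prime_elem_dvd_multD[OF pr] Q(3) e' by metis
    then have d: "Q * rstar Q dvd Phi P" using e' by (metis dvd_refl mult.commute mult_dvd_mono)
    obtain f where f: "lead_coeff f = 1" "degree f = degree Q" "Q \<in> norm_fib f" using norm_exists[OF Q(2) Q0] by metis
    then have "Phi f = Q * rstar Q" by (simp add: norm_fib_def)
    then have "Phi P = Q * rstar Q" using eq[of f] f d Q(4) by simp
    then show ?thesis using split Q Q0 False by blast
  next
    case True
    have refl: "reflect_poly Q = smult (coeff Q 0) Q"
      using arg_cong[OF True, of "smult (coeff Q 0)"] Q0 by (simp add: rstar_def)
    \<comment> \<open>\<open>Q\<close> equals its reversal up to \<open>coeff Q 0\<close>; at a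
      point with \<open>z = 1/z\<close> this forces a root or fixes \<open>coeff Q 0\<close>, and
      both points together make the degree even.\<close>
    have ev: "poly Q z = 0 \<or> coeff Q 0 = z ^ degree Q" if z: "z = 1 \<or> z = -1" for z
    proof -
      have "poly (reflect_poly Q) z = z ^ degree Q * poly Q (inverse z)" by (rule poly_reflect_poly_nz) (use z in auto)
      moreover have "inverse z = z" using z by auto
      ultimately show ?thesis using refl by auto
    qed
    show ?thesis
    proof (cases "poly Q 1 = 0 \<or> poly Q (-1) = 0")
      case True
      then obtain c :: 'a where c: "c = 1 \<or> c = -1" "poly Q c = 0" by auto
      have Qc: "Q = [:-c, 1:]" by (rule irreducible_root[OF Q(1,2) c(2)])
      have ic: "c \<noteq> 0" "c + inverse c = 2 * c" using c by auto
      have "poly (Phi P) c = 0" using e c(2) by simp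
      then have "poly P (2 * c) = 0" using poly_Phi[OF ic(1), of P] ic by simp
      then have Pc: "P = [:- 2 * c, 1:]" using irreducible_root[OF P, of "2 * c"] by simp
      have "Phi P = [:- c, 1:] * [:- c, 1:]" using c(1) unfolding Pc Phi_def by auto
      then show ?thesis using ramified c(1) Pc by blast
    next
      case False
      have "coeff Q 0 = 1" "coeff Q 0 = (-1) ^ degree Q" using ev[of 1] ev[of "-1"] False by auto
      then have s: "(-1 :: 'a) ^ degree Q = 1" by simp
      have "even (degree Q)"
      proof (rule ccontr)
        assume "odd (degree Q)"
        then have "(1::'a) = - 1" using s by simp
        then have "(1::'a) + 1 = 0" by (simp only: eq_neg_iff_add_eq_0)
        then show False using two by simp
      qed
      then obtain m where m: "degree Q = 2 * m" by auto
      have "reflect_poly Q = Q" using refl \<open>coeff Q 0 = 1\<close> by simp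
      then obtain f where f: "lead_coeff f = 1" "degree f = m" "Phi f = Q" using Phi_surj[OF m Q(2)] by metis
      then have "P = f" using eq[of f] Q(3,4) m by simp
      then show ?thesis using inert Q(1) f(3) by simp
    qed
  qed
qed

section \<open>The norm equation and a quadratic character\<close>

definition rho :: "'a::field poly \<Rightarrow> int" where "rho f = int (card (norm_fib f))"

text \<open>The convention 0 when \<open>P\<close> does not divide \<open>f\<close> gives the
  recursion in \<open>P\<close> a single form.\<close>

definition rho_div :: "'a::field poly \<Rightarrow> 'a poly \<Rightarrow> int" where
  "rho_div P f = (if P dvd f then rho (f div P) else 0)"

lemma norm_fib_1: "norm_fib (1 :: 'a::field poly) = {1}"
proof -
  have "Phi 1 = (1 :: 'a poly)" by (simp add: Phi_def one_pCons)
  moreover have "h = 1" if "lead_coeff h = 1" "coeff h 0 \<noteq> 0" "h * rstar h = 1" for h :: "'a poly"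
  proof -
    have "h dvd 1" using that(3) by (metis dvd_triv_left)
    moreover have "h \<noteq> 0" using that(1) by auto
    ultimately have "degree h = 0" by (simp add: is_unit_iff_degree)
    then obtain c where "h = [:c:]" by (auto elim: degree_eq_zeroE)
    then show ?thesis using that(1) by (simp add: one_pCons)
  qed
  ultimately show ?thesis by (auto simp: norm_fib_def rstar_def)
qed

lemma norm_fib_mult:
  assumes "g \<in> norm_fib f" "h \<in> norm_fib f'" "f \<noteq> 0" "f' \<noteq> 0"
  shows "g * h \<in> norm_fib (f * f')"
proof -
  have "lead_coeff (g * h) = lead_coeff g * lead_coeff h" by (rule lead_coeff_mult)
  then show ?thesis using assms by (simp add: norm_fib_def rstar_mult coeff_mult_0 Phi_mult mult_ac)
qed

lemma norm_fib_cancel: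
  assumes g: "g \<in> norm_fib f" and gh: "g * h \<in> norm_fib (f * f')" and f: "lead_coeff f = 1" "lead_coeff f' = 1"
  shows "h \<in> norm_fib f'"
proof -
  have nz: "f \<noteq> 0" "f' \<noteq> 0" "Phi f \<noteq> 0" using f Phi_props(2)[OF f(1)] by auto
  have "lead_coeff (g * h) = lead_coeff g * lead_coeff h" by (rule lead_coeff_mult)
  then have 1: "lead_coeff h = 1" "coeff h 0 \<noteq> 0" using g gh by (auto simp: norm_fib_def coeff_mult_0)
  have gg: "g * rstar g = Phi f" and ghgh: "(g * h) * rstar (g * h) = Phi f * Phi f'"
    using g gh Phi_mult[OF nz(1,2)] by (auto simp: norm_fib_def)
  have "Phi f * (h * rstar h) = (g * h) * rstar (g * h)" by (simp only: gg[symmetric] rstar_mult mult_ac)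
  then have "Phi f * (h * rstar h) = Phi f * Phi f'" using ghgh by simp
  then show ?thesis using 1 nz(3) by (simp add: norm_fib_def)
qed

lemma rstar_norm_fib: "h \<in> norm_fib f \<Longrightarrow> rstar h \<in> norm_fib f"
  using rstar_props[of h] rstar_rstar[of h] by (auto simp: norm_fib_def mult.commute)

text \<open>Solutions for \<open>P * f\<close> are divisible by \<open>Q\<close> or by
  \<open>rstar Q\<close>; those divisible by both are \<open>Phi P\<close> times a solution for
  \<open>f div P\<close>, and inclusion-exclusion gives the formula.\<close>

lemma rho_split:
  fixes f :: "'a::{field,finite} poly"
  assumes f: "lead_coeff f = 1" and P: "lead_coeff P = 1"
    and Q: "irreducible Q" "lead_coeff Q = 1" "coeff Q 0 \<noteq> 0" "rstar Q \<noteq> Q" "Phi P = Q * rstar Q"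
  shows "rho (P * f) = 2 * rho f - rho_div P f"
proof -
  have f0: "f \<noteq> 0" and P0: "P \<noteq> 0" and Q0: "Q \<noteq> 0" using f P Q by auto
  have Pf: "lead_coeff (P * f) = 1" using f P by (simp only: lead_coeff_mult) simp
  have QP: "Q \<in> norm_fib P" using Q by (simp add: norm_fib_def)
  note rQP = rstar_norm_fib[OF QP]
  have rQ0: "rstar Q \<noteq> 0" using rstar_props(1)[OF Q(2,3)] by auto
  have pr: "prime_elem Q" by (rule field_poly_irreducible_imp_prime[OF Q(1)])
  have nd: "\<not> Q dvd rstar Q" using monic_dvd_eq[of Q "rstar Q"] Q rstar_props[OF Q(2,3)] by auto
  define A where "A = (\<lambda>h. Q * h) ` norm_fib f"
  define B where "B = (\<lambda>h. rstar Q * h) ` norm_fib f"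
  have fin: "finite A" "finite B" using finite_norm_fib[OF f] by (auto simp: A_def B_def)
  have cA: "int (card A) = rho f" "int (card B) = rho f"
    unfolding A_def B_def rho_def using Q0 rQ0 by (auto simp: card_image inj_on_def)
  have AB: "norm_fib (P * f) = A \<union> B"
  proof (intro equalityI subsetI)
    fix h assume h: "h \<in> norm_fib (P * f)"
    then have "h * rstar h = Q * rstar Q * Phi f" using Q P0 f0 by (simp add: norm_fib_def Phi_mult)
    then have "Q dvd h * rstar h" by (metis dvd_triv_left mult.assoc)
    then have "Q dvd h \<or> Q dvd rstar h" using pr prime_elem_dvd_mult_iff by blast
    then show "h \<in> A \<union> B"
    proof
      assume "Q dvd h"
      then obtain h' where "h = Q * h'" by (auto simp: dvd_def)
      then show ?thesis using norm_fib_cancel[OF QP _ P f] h by (auto simp: A_def)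
    next
      assume "Q dvd rstar h"
      then have "rstar Q dvd h" using rstar_dvd[of Q "rstar h"] rstar_rstar[of h] h by (simp add: norm_fib_def)
      then obtain h' where "h = rstar Q * h'" by (auto simp: dvd_def)
      then show ?thesis using norm_fib_cancel[OF rQP _ P f] h by (auto simp: B_def)
    qed
  qed (use norm_fib_mult[OF QP _ P0 f0] norm_fib_mult[OF rQP _ P0 f0] in \<open>auto simp: A_def B_def\<close>)
  have "int (card (A \<inter> B)) = rho_div P f"
  proof -
    have *: "\<exists>h2. h = Q * rstar Q * h2 \<and> P dvd f \<and> h2 \<in> norm_fib (f div P)" if h: "h \<in> A \<inter> B" for h
    proof -
      obtain h1 h1' where h1: "h = Q * h1" "h1 \<in> norm_fib f" and h1': "h = rstar Q * h1'" "h1' \<in> norm_fib f"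
        using h unfolding A_def B_def by blast
      have "Q dvd rstar Q * h1'" using h1 h1' by (metis dvd_triv_left)
      then have "Q dvd h1'" using prime_elem_dvd_multD[OF pr] nd by blast
      then obtain h2 where h2: "h1' = Q * h2" by (auto simp: dvd_def)
      have "h1' * rstar h1' = Phi f" using h1'(2) by (simp add: norm_fib_def)
      then have "Phi P * (h2 * rstar h2) = Phi f" unfolding h2 rstar_mult Q(5) by (simp add: mult_ac)
      then have "Phi P dvd Phi f" by (metis dvd_triv_left)
      then obtain e where e: "lead_coeff e = 1" "f = P * e" using dvd_Phi_split[OF f P] by metis
      have "h2 \<in> norm_fib e" using norm_fib_cancel[OF QP _ P e(1)] h1'(2) h2 e(2) by simp
      then show ?thesis using h1' h2 e P0 by (intro exI[of _ h2]) (simp add: mult_ac)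
    qed
    show ?thesis
    proof (cases "P dvd f")
      case False
      then have "A \<inter> B = {}" using * by blast
      then show ?thesis using False by (simp add: rho_div_def)
    next
      case True
      then obtain e where e: "f = P * e" by (auto simp: dvd_def)
      have le: "lead_coeff e = 1" using monic_div(1)[OF f P True] e P0 by simp
      have e0: "e \<noteq> 0" using le by auto
      have "A \<inter> B = (\<lambda>h. Q * rstar Q * h) ` norm_fib e"
      proof (intro equalityI subsetI)
        fix h assume "h \<in> A \<inter> B"
        then show "h \<in> (\<lambda>h. Q * rstar Q * h) ` norm_fib e" using *[of h] e P0 by auto
      next
        fix h assume "h \<in> (\<lambda>h. Q * rstar Q * h) ` norm_fib e"
        then obtain h2 where h2: "h = Q * (rstar Q * h2)" "h = rstar Q * (Q * h2)" "h2 \<in> norm_fib e"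
          by (auto simp: mult_ac)
        have "rstar Q * h2 \<in> norm_fib f" "Q * h2 \<in> norm_fib f"
          using norm_fib_mult[OF rQP h2(3) P0 e0] norm_fib_mult[OF QP h2(3) P0 e0] e by auto
        then show "h \<in> A \<inter> B" using h2 unfolding A_def B_def by blast
      qed
      moreover have "inj_on (\<lambda>h. Q * rstar Q * h) (norm_fib e)" using Q0 rQ0 by (auto simp: inj_on_def)
      ultimately show ?thesis using True e P0 by (simp add: card_image rho_div_def rho_def)
    qed
  qed
  moreover have "card A + card B = card (A \<union> B) + card (A \<inter> B)" by (rule card_Un_Int[OF fin])
  ultimately show ?thesis using cA AB by (simp add: rho_def)
qed

text \<open>The self-reciprocal prime \<open>Phi P\<close> divides \<open>h\<close>, hence its
  square divides \<open>h * rstar h\<close>; so \<open>P\<close> divides \<open>f\<close>, and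
  division of \<open>h\<close> by \<open>Phi P\<close> is a bijection.\<close>

lemma rho_inert:
  fixes f :: "'a::{field,finite} poly"
  assumes f: "lead_coeff f = 1" and P: "lead_coeff P = 1" and Q: "irreducible (Phi P)"
  shows "rho (P * f) = rho_div P f"
proof -
  have f0: "f \<noteq> 0" and P0: "P \<noteq> 0" using f P by auto
  define Q where "Q = Phi P"
  have Q0: "Q \<noteq> 0" "rstar Q = Q" using Phi_props(2)[OF P] rstar_Phi[OF P] by (auto simp: Q_def)
  have pr: "prime_elem Q" unfolding Q_def by (rule field_poly_irreducible_imp_prime[OF Q])
  have *: "\<exists>h2. h = Q * h2 \<and> P dvd f \<and> h2 \<in> norm_fib (f div P)" if h: "h \<in> norm_fib (P * f)" for h
  proof -
    have hh: "h * rstar h = Q * Phi f" using h P0 f0 by (simp add: norm_fib_def Phi_mult Q_def)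
    then have "Q dvd h * rstar h" by (metis dvd_triv_left)
    then have "Q dvd h \<or> Q dvd rstar h" using pr prime_elem_dvd_mult_iff by blast
    then have "Q dvd h"
      using rstar_dvd[of Q "rstar h"] rstar_rstar[of h] h Q0(2) by (auto simp: norm_fib_def)
    then obtain h2 where h2: "h = Q * h2" by (auto simp: dvd_def)
    have "Q * (Q * (h2 * rstar h2)) = Q * Phi f" using hh unfolding h2 rstar_mult Q0(2) by (simp add: mult_ac)
    then have e1: "Q * (h2 * rstar h2) = Phi f" using Q0 by simp
    then have "Phi P dvd Phi f" unfolding Q_def by (metis dvd_triv_left)
    then obtain e where e: "lead_coeff e = 1" "f = P * e" using dvd_Phi_split[OF f P] by metis
    have e0: "e \<noteq> 0" using e by auto
    have "Q * (h2 * rstar h2) = Q * Phi e" using e1 e(2) P0 e0 by (simp add: Phi_mult Q_def)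
    then have e2: "h2 * rstar h2 = Phi e" using Q0 by simp
    have "lead_coeff h = lead_coeff Q * lead_coeff h2" unfolding h2 by (rule lead_coeff_mult)
    then have "lead_coeff h2 = 1" "coeff h2 0 \<noteq> 0"
      using h h2 Phi_props(2)[OF P] by (auto simp: norm_fib_def coeff_mult_0 Q_def)
    then have "h2 \<in> norm_fib e" using e2 by (simp add: norm_fib_def)
    then show ?thesis using h2 e P0 by auto
  qed
  show ?thesis
  proof (cases "P dvd f")
    case False
    then have "norm_fib (P * f) = {}" using * by blast
    then show ?thesis using False by (simp add: rho_div_def rho_def)
  next
    case True
    then obtain e where e: "f = P * e" by (auto simp: dvd_def)
    have le: "lead_coeff e = 1" using monic_div(1)[OF f P True] e P0 by simp
    have e0: "e \<noteq> 0" using le by auto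
    have "norm_fib (P * f) = (\<lambda>h. Q * h) ` norm_fib e"
    proof (intro equalityI subsetI)
      fix h assume "h \<in> norm_fib (P * f)"
      then show "h \<in> (\<lambda>h. Q * h) ` norm_fib e" using *[of h] e P0 by auto
    next
      fix h assume "h \<in> (\<lambda>h. Q * h) ` norm_fib e"
      then obtain h2 where h2: "h = Q * h2" "h2 \<in> norm_fib e" by auto
      have "lead_coeff h = lead_coeff Q * lead_coeff h2" unfolding h2 by (rule lead_coeff_mult)
      moreover have "Phi (P * f) = Q * Q * Phi e" using e P0 e0 by (simp add: Phi_mult Q_def mult_ac)
      ultimately show "h \<in> norm_fib (P * f)"
        using h2 Phi_props(2,3)[OF P] Q0(2) by (simp add: norm_fib_def rstar_mult coeff_mult_0 Q_def mult_ac)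
    qed
    moreover have "inj_on (\<lambda>h. Q * h) (norm_fib e)" using Q0 by (auto simp: inj_on_def)
    ultimately show ?thesis using True e P0 by (simp add: card_image rho_div_def rho_def)
  qed
qed

text \<open>\<open>z - c\<close> is its own reciprocal and divides every solution for
  \<open>P * f\<close>. Together the split, inert and ramified cases read
  \<open>(1 + k) * rho f - k * rho_div P f\<close> with \<open>k\<close> equal to 1, -1 and
  0.\<close>

lemma rho_ramified:
  fixes f :: "'a::{field,finite} poly"
  assumes f: "lead_coeff f = 1" and P: "lead_coeff P = 1" and c: "c = 1 \<or> c = -1"
    and Q: "Phi P = [:-c, 1:] * [:-c, 1:]"
  shows "rho (P * f) = rho f"
proof -
  have f0: "f \<noteq> 0" and P0: "P \<noteq> 0" using f P by auto
  define Q where "Q = [:-c, 1:]"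
  have rQ: "rstar Q = Q" using c by (auto simp: rstar_def Q_def reflect_poly_def)
  have QP: "Q \<in> norm_fib P" using c Q rQ by (auto simp: norm_fib_def Q_def)
  have "norm_fib (P * f) = (\<lambda>h. Q * h) ` norm_fib f"
  proof (intro equalityI subsetI)
    fix h assume h: "h \<in> norm_fib (P * f)"
    have hh: "h * rstar h = Q * (Q * Phi f)"
      using h P0 f0 Q by (simp add: norm_fib_def Phi_mult Q_def[symmetric] mult_ac del: mult_pCons_left)
    have "poly (h * rstar h) c = 0" unfolding hh by (simp add: Q_def)
    then have "poly h c = 0 \<or> poly (rstar h) c = 0" by simp
    moreover have "poly (rstar h) c = 0 \<Longrightarrow> poly h c = 0"
      using poly_reflect_poly_nz[of c h] c h by (auto simp: rstar_def norm_fib_def)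
    ultimately have "Q dvd h" by (auto simp: Q_def poly_eq_0_iff_dvd)
    then obtain h' where h': "h = Q * h'" by (auto simp: dvd_def)
    then show "h \<in> (\<lambda>h. Q * h) ` norm_fib f" using norm_fib_cancel[OF QP _ P f, of h'] h by auto
  qed (use norm_fib_mult[OF QP _ P0 f0] in auto)
  moreover have "Q \<noteq> 0" by (simp add: Q_def)
  then have "inj_on (\<lambda>h. Q * h) (norm_fib f)" by (auto simp: inj_on_def)
  ultimately show ?thesis by (simp add: card_image rho_def)
qed

section \<open>The quadratic character and its divisor sum\<close>

definition eta :: "'a::field \<Rightarrow> int" where
  "eta x = (if x = 0 then 0 else if \<exists>y. x = y\<^sup>2 then 1 else - 1)"

lemma card_square_roots:
  fixes x :: "'a::{field,finite}"
  assumes two: "(2::'a) \<noteq> 0"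
  shows "int (card {y. y\<^sup>2 = x}) = 1 + eta x"
proof -
  consider "x = 0" | y where "y \<noteq> 0" "x = y\<^sup>2" | "x \<noteq> 0" "\<nexists>y. x = y\<^sup>2" by (metis zero_power2)
  then show ?thesis
  proof cases
    case 1
    then show ?thesis by (simp add: eta_def)
  next
    case (2 y)
    have "{z. z\<^sup>2 = x} = {y, -y}" using 2 by (auto simp: power2_eq_iff)
    moreover have "y \<noteq> - y"
    proof
      assume "y = - y"
      then have "y + y = 0" by (simp only: eq_neg_iff_add_eq_0)
      then have "2 * y = 0" by (simp only: mult_2)
      then show False using two 2 by simp
    qed
    ultimately show ?thesis using 2 by (auto simp: eta_def)
  next
    case 3
    then have "{y. y\<^sup>2 = x} = {}" by auto
    then show ?thesis using 3 by (simp only: card.empty) (auto simp: eta_def)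
  qed
qed

lemma sum_eta:
  assumes two: "(2::'a::{field,finite}) \<noteq> 0"
  shows "(\<Sum>x\<in>(UNIV :: 'a set). eta x) = 0"
proof -
  have "int (card (\<Union>x\<in>(UNIV :: 'a set). {y. y\<^sup>2 = x})) = (\<Sum>x\<in>(UNIV :: 'a set). int (card {y. y\<^sup>2 = x}))"
    by (subst card_UN_disjoint) auto
  moreover have "(\<Union>x\<in>(UNIV :: 'a set). {y. y\<^sup>2 = x}) = UNIV" by auto
  ultimately show ?thesis by (simp add: card_square_roots[OF two] sum.distrib)
qed

text \<open>Multiplication by a non-square permutes \<open>F\<^sup>*\<close> and maps squares to non-squares; by \<open>sum_eta\<close>
  both classes have the same size, so non-squares go to squares.\<close>

lemma eta_mult:
  fixes x y :: "'a::{field,finite}"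
  assumes two: "(2::'a) \<noteq> 0"
  shows "eta (x * y) = eta x * eta y"
proof -
  define Q where "Q = {x::'a. eta x = 1}"
  define R where "R = {x::'a. eta x = -1}"
  have card: "card Q = card R"
  proof -
    have "(\<Sum>x\<in>(UNIV :: 'a set). eta x) = (\<Sum>x\<in>UNIV. (if x \<in> Q then 1 else 0) - (if x \<in> R then 1 else 0))"
      by (rule sum.cong) (auto simp: Q_def R_def eta_def)
    then show ?thesis using sum_eta[OF two] by (simp add: sum_subtractf sum.If_cases)
  qed
  have QI: "x \<in> Q \<longleftrightarrow> x \<noteq> 0 \<and> (\<exists>y. x = y\<^sup>2)" and RI: "x \<in> R \<longleftrightarrow> x \<noteq> 0 \<and> \<not> (\<exists>y. x = y\<^sup>2)" for x
    by (auto simp: Q_def R_def eta_def)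
  have QQ: "x * y \<in> Q" if "x \<in> Q" "y \<in> Q" for x y using that unfolding QI by (metis mult_eq_0_iff power_mult_distrib)
  have RQ: "x * y \<in> R" if x: "x \<in> R" and y: "y \<in> Q" for x y
  proof -
    obtain z where z: "y = z\<^sup>2" "y \<noteq> 0" using y QI by blast
    have "\<not> (\<exists>w. x * y = w\<^sup>2)"
    proof
      assume "\<exists>w. x * y = w\<^sup>2"
      then obtain w where "x * y = w\<^sup>2" by blast
      then have "x = (w / z)\<^sup>2" using z by (simp add: power_divide field_simps)
      then show False using x RI by blast
    qed
    then show ?thesis using x z RI by auto
  qed
  have RR: "x * y \<in> Q" if x: "x \<in> R" and y: "y \<in> R" for x y
  proof -
    have x0: "x \<noteq> 0" using x RI by blast
    have "(\<lambda>z. x * z) ` Q \<subseteq> R" using RQ x by auto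
    moreover have "card ((\<lambda>z. x * z) ` Q) = card R" using x0 card by (simp add: card_image inj_on_def)
    ultimately have im: "(\<lambda>z. x * z) ` Q = R" by (intro card_subset_eq) auto
    show ?thesis
    proof (rule ccontr)
      assume "x * y \<notin> Q"
      then have "x * y \<in> R" using QI RI x0 y by auto
      then obtain z where "z \<in> Q" "x * y = x * z" using im by blast
      then have "y \<in> Q" using x0 by simp
      then show False using y QI RI by blast
    qed
  qed
  have e: "x = 0 \<or> x \<in> Q \<or> x \<in> R" for x using QI RI by blast
  have q: "eta z = 1" if "z \<in> Q" for z using that by (simp add: Q_def)
  have r: "eta z = -1" if "z \<in> R" for z using that by (simp add: R_def)
  have QR: "x * y \<in> R" if "x \<in> Q" "y \<in> R" for x y using RQ[OF that(2,1)] by (simp add: mult.commute)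
  have z: "eta (0::'a) = 0" by (simp add: eta_def)
  show ?thesis
    using e[of x] e[of y]
    by (elim disjE) (simp_all add: z q r q[OF QQ] r[OF RQ] r[OF QR] q[OF RR])
qed

lemma eta_square: "x \<noteq> 0 \<Longrightarrow> eta (x\<^sup>2) = 1"
  by (auto simp: eta_def)

text \<open>The quadratic symbol attached to \<open>z^2 - w z + 1\<close>, of discriminant
  \<open>w^2 - 4\<close>: for a monic prime \<open>f\<close> the norm of \<open>w^2 - 4\<close>
  modulo \<open>f\<close> is \<open>f(2) f(-2)\<close>.\<close>

definition kappa :: "'a::field poly \<Rightarrow> int" where
  "kappa f = eta (poly f 2 * poly f (-2))"

definition tau :: "'a::field poly \<Rightarrow> int" where
  "tau f = (\<Sum>g\<in>mdiv f. kappa g)"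

definition tau_div :: "'a::field poly \<Rightarrow> 'a poly \<Rightarrow> int" where
  "tau_div P f = (if P dvd f then tau (f div P) else 0)"

lemma kappa_mult: "(2::'a::{field,finite}) \<noteq> 0 \<Longrightarrow> kappa (f * g) = kappa f * kappa (g :: 'a poly)"
  by (simp add: kappa_def eta_mult[symmetric] mult_ac)

text \<open>A divisor of \<open>P * f\<close> divides \<open>f\<close> or is \<open>P\<close> times
  a divisor of \<open>f\<close>, and both happen for \<open>P\<close> times a divisor of
  \<open>f div P\<close>. As \<open>kappa\<close> is multiplicative, this is the relation found for
  \<open>rho\<close>.\<close>

lemma tau_hecke:
  fixes f :: "'a::{field,finite} poly"
  assumes f: "lead_coeff f = 1" and P: "irreducible P" "lead_coeff P = 1" and two: "(2::'a) \<noteq> 0"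
  shows "tau (P * f) = (1 + kappa P) * tau f - kappa P * tau_div P f"
proof -
  have f0: "f \<noteq> 0" and P0: "P \<noteq> 0" using f P by auto
  have pr: "prime_elem P" by (rule field_poly_irreducible_imp_prime[OF P(1)])
  define A where "A = mdiv f"
  define B where "B = (\<lambda>g. P * g) ` mdiv f"
  have fin: "finite A" "finite B" using finite_mdiv[OF f0] by (auto simp: A_def B_def)
  have mP: "P * g \<in> mdiv (P * h) \<longleftrightarrow> g \<in> mdiv h" for g h
  proof -
    have "lead_coeff (P * g) = lead_coeff g" using P(2) by (simp only: lead_coeff_mult) simp
    then show ?thesis using P0 by (simp add: mdiv_def)
  qed
  have "mdiv (P * f) = A \<union> B"
  proof (intro equalityI subsetI)
    fix g assume g: "g \<in> mdiv (P * f)"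
    show "g \<in> A \<union> B"
    proof (cases "P dvd g")
      case True
      then obtain h where "g = P * h" by (auto simp: dvd_def)
      then show ?thesis using g mP by (auto simp: B_def)
    next
      case False
      obtain h where h: "P * f = g * h" using g by (auto simp: mdiv_def dvd_def)
      then have "P dvd g * h" by (metis dvd_triv_left)
      then have "P dvd h" using prime_elem_dvd_multD[OF pr] False by blast
      then obtain h' where "h = P * h'" by (auto simp: dvd_def)
      then have "P * f = P * (g * h')" using h by (simp add: mult_ac)
      then have "f = g * h'" using P0 by simp
      then show ?thesis using g by (auto simp: A_def mdiv_def)
    qed
  qed (use mP in \<open>auto simp: A_def B_def mdiv_def\<close>)
  moreover have "A \<inter> B = (if P dvd f then (\<lambda>g. P * g) ` mdiv (f div P) else {})"
  proof (cases "P dvd f")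
    case False
    then have "A \<inter> B = {}" by (auto simp: A_def B_def mdiv_def dest: dvd_mult_left)
    then show ?thesis using False by simp
  next
    case True
    then obtain e where e: "f = P * e" by (auto simp: dvd_def)
    have "A \<inter> B = (\<lambda>g. P * g) ` mdiv e"
    proof (intro equalityI subsetI)
      fix g assume "g \<in> A \<inter> B"
      then obtain h where "g = P * h" "P * h \<in> mdiv (P * e)" by (auto simp: A_def B_def e)
      then show "g \<in> (\<lambda>g. P * g) ` mdiv e" using mP by auto
    next
      fix g assume "g \<in> (\<lambda>g. P * g) ` mdiv e"
      then obtain h where h: "g = P * h" "h \<in> mdiv e" by auto
      have "h \<in> mdiv f" using h(2) by (auto simp: mdiv_def e)
      moreover have "P * h \<in> mdiv f" using h(2) mP e by simp
      ultimately show "g \<in> A \<inter> B" using h unfolding A_def B_def by blast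
    qed
    then show ?thesis using True e P0 by simp
  qed
  moreover have sP: "(\<Sum>g\<in>(\<lambda>g. P * g) ` M. kappa g) = kappa P * (\<Sum>g\<in>M. kappa g)" for M
    using P0 by (subst sum.reindex) (auto simp: inj_on_def kappa_mult[OF two] sum_distrib_left)
  ultimately have "tau (P * f) + kappa P * tau_div P f = tau f + kappa P * tau f"
    using sum.union_inter[OF fin, of kappa]
    by (cases "P dvd f") (simp_all add: tau_def tau_div_def A_def B_def)
  then show ?thesis by (simp add: algebra_simps)
qed

text \<open>Adding multiples of \<open>w + 2\<close> leaves \<open>f(-2)\<close> alone and moves
  \<open>f(2)\<close> through the whole field, over which \<open>eta\<close> sums to zero.\<close>

lemma sum_kappa_zero:
  fixes W :: "'a::{field,finite} poly \<Rightarrow> complex"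
  assumes two: "(2::'a) \<noteq> 0" and m: "m \<ge> 2"
    and W: "\<And>f e. f \<in> monics m \<Longrightarrow> W (f + smult e [:2, 1:]) = W f"
  shows "(\<Sum>f\<in>monics m. of_int (kappa f) * W f) = 0"
proof -
  have four: "(4::'a) \<noteq> 0" using two mult_eq_0_iff[of "2::'a" 2] by simp
  \<comment> \<open>Division by 4, the value of \<open>w + 2\<close> at 2, makes \<open>e\<close>
    the change of \<open>f(2)\<close>.\<close>
  define p where "p = (\<lambda>e::'a. smult (e / 4) [:2, 1:])"
  have p: "p e \<in> polys_lt m" "poly (p e) 2 = e" "poly (p e) (-2) = 0" for e
  proof -
    show "p e \<in> polys_lt m" using m by (auto simp: p_def polys_lt_iff)
    have "poly [:2, 1:] (2::'a) = 4" "poly [:2, 1:] (-2::'a) = 0" by simp_all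
    then show "poly (p e) 2 = e" "poly (p e) (-2) = 0" unfolding p_def poly_smult using four by simp_all
  qed
  have Wp: "W (f + p e) = W f" if "f \<in> monics m" for f e unfolding p_def by (rule W[OF that])
  have shift: "(\<Sum>e\<in>UNIV. eta (x + e)) = 0" for x :: 'a
  proof -
    have "(\<Sum>e\<in>UNIV. eta (x + e)) = (\<Sum>e\<in>(UNIV :: 'a set). eta e)"
      by (rule sum.reindex_bij_witness[of _ "\<lambda>e. e - x" "\<lambda>e. x + e"]) auto
    then show ?thesis using sum_eta[OF two] by simp
  qed
  have "of_nat CARD('a) * (\<Sum>f\<in>monics m. of_int (kappa f) * W f)
      = (\<Sum>e\<in>(UNIV::'a set). \<Sum>f\<in>monics m. of_int (kappa f) * W f)" by simp
  also have "\<dots> = (\<Sum>e\<in>(UNIV::'a set). \<Sum>f\<in>monics m. of_int (kappa (f + p e)) * W (f + p e))"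
    by (rule sum.cong[OF refl], rule monics_translate[OF p(1), symmetric])
  also have "\<dots> = (\<Sum>f\<in>monics m. \<Sum>e\<in>(UNIV::'a set). of_int (kappa (f + p e)) * W (f + p e))"
    by (rule sum.swap)
  also have "\<dots> = (\<Sum>f\<in>monics m. \<Sum>e\<in>(UNIV::'a set). of_int (eta (poly f 2 + e)) * (of_int (eta (poly f (-2))) * W f))"
    by (intro sum.cong refl) (simp add: kappa_def p Wp eta_mult[OF two])
  also have "\<dots> = 0"
  proof (rule sum.neutral, rule ballI)
    fix f :: "'a poly"
    have "(\<Sum>e\<in>(UNIV::'a set). of_int (eta (poly f 2 + e)) * (of_int (eta (poly f (-2))) * W f))
        = of_int (\<Sum>e\<in>UNIV. eta (poly f 2 + e)) * (of_int (eta (poly f (-2))) * W f)"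
      by (simp only: sum_distrib_right of_int_sum)
    then show "(\<Sum>e\<in>(UNIV::'a set). of_int (eta (poly f 2 + e)) * (of_int (eta (poly f (-2))) * W f)) = 0"
      by (simp only: shift) simp
  qed
  finally show ?thesis by simp
qed

lemma sum_kappa_1:
  assumes two: "(2::'a::{field,finite}) \<noteq> 0"
  shows "(\<Sum>f\<in>(monics 1 :: 'a poly set). kappa f) = -1"
proof -
  have four: "(4::'a) \<noteq> 0" using two mult_eq_0_iff[of "2::'a" 2] by simp
  have "(\<Sum>f\<in>(monics 1 :: 'a poly set). kappa f) = (\<Sum>c\<in>(UNIV :: 'a set). eta (c\<^sup>2 - 4))"
  proof (rule sum.reindex_bij_witness[of _ "\<lambda>c. [:- c, 1:]" "\<lambda>f. - coeff f 0"])
    fix f :: "'a poly" assume f: "f \<in> monics 1"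
    obtain a g where "f = pCons a g" by (cases f)
    then have "f = [:a, 1:]" using f by (auto simp: monics_def degree_pCons_eq_if one_pCons elim!: degree_eq_zeroE split: if_splits)
    then show "[:- (- coeff f 0), 1:] = f" "eta ((- coeff f 0)\<^sup>2 - 4) = kappa f"
      by (auto simp: kappa_def power2_eq_square algebra_simps)
  qed (auto simp: monics_def)
  moreover have "(\<Sum>c\<in>(UNIV :: 'a set). 1 + eta (c\<^sup>2 - 4)) = int CARD('a) - 1"
  proof -
    have "(\<Sum>c\<in>(UNIV :: 'a set). 1 + eta (c\<^sup>2 - 4)) = (\<Sum>c\<in>(UNIV :: 'a set). int (card {y. y\<^sup>2 = c\<^sup>2 - 4}))"
      by (simp add: card_square_roots[OF two])
    also have "\<dots> = int (card (SIGMA c:(UNIV :: 'a set). {y. y\<^sup>2 = c\<^sup>2 - 4}))" by (simp add: card_SigmaI)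
    \<comment> \<open>The hyperbola \<open>(c - y) (c + y) = 4\<close> is parametrised by the
      nonzero element \<open>u = c - y\<close>, so it has \<open>q - 1\<close> points.\<close>
    also have "card (SIGMA c:(UNIV :: 'a set). {y. y\<^sup>2 = c\<^sup>2 - 4}) = card (UNIV - {0 :: 'a})"
    proof (rule bij_betw_same_card[OF bij_betw_byWitness[where f = "\<lambda>(c, y). c - y" and f' = "\<lambda>u::'a. ((u + 4 / u) / 2, (4 / u - u) / 2)"]])
      have key: "c - y \<noteq> 0 \<and> 4 / (c - y) = c + y" if "y\<^sup>2 = c\<^sup>2 - 4" for c y :: 'a
      proof -
        have "(c - y) * (c + y) = 4" using that by (simp add: power2_eq_square algebra_simps)
        moreover from this have "c - y \<noteq> 0" using four by auto
        ultimately show ?thesis by (simp add: field_simps)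
      qed
      show "\<forall>a\<in>SIGMA c:(UNIV :: 'a set). {y. y\<^sup>2 = c\<^sup>2 - 4}. (\<lambda>u. ((u + 4 / u) / 2, (4 / u - u) / 2)) (case a of (c, y) \<Rightarrow> c - y) = a"
      proof
        fix a assume a: "a \<in> (SIGMA c:(UNIV :: 'a set). {y. y\<^sup>2 = c\<^sup>2 - 4})"
        obtain c y where cy: "a = (c, y)" by (cases a)
        then have "y\<^sup>2 = c\<^sup>2 - 4" using a by simp
        then have "4 / (c - y) = c + y" using key by blast
        moreover have "(c - y + (c + y)) / 2 = c" "(c + y - (c - y)) / 2 = y" using two by (simp_all add: field_simps)
        ultimately show "(\<lambda>u. ((u + 4 / u) / 2, (4 / u - u) / 2)) (case a of (c, y) \<Rightarrow> c - y) = a" by (simp add: cy)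
      qed
      show "\<forall>a'\<in>UNIV - {0}. (case ((a' + 4 / a') / 2, (4 / a' - a') / 2) of (c, y) \<Rightarrow> c - y) = (a' :: 'a)"
        using two four by (auto simp: field_simps)
      show "(\<lambda>(c, y). c - y) ` (SIGMA c:UNIV. {y. y\<^sup>2 = c\<^sup>2 - 4}) \<subseteq> UNIV - {0 :: 'a}" using key by auto
      show "(\<lambda>u. ((u + 4 / u) / 2, (4 / u - u) / 2)) ` (UNIV - {0}) \<subseteq> (SIGMA c:UNIV. {y :: 'a. y\<^sup>2 = c\<^sup>2 - 4})"
      proof (rule image_subsetI)
        fix u :: 'a assume "u \<in> UNIV - {0}"
        then have u: "u \<noteq> 0" by simp
        have A: "(v - u) / 2 - (u + v) / 2 = - u" "(v - u) / 2 + (u + v) / 2 = v" for v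
          using two four by (simp_all add: field_simps)
        have "((4 / u - u) / 2)\<^sup>2 - ((u + 4 / u) / 2)\<^sup>2 = ((4 / u - u) / 2 - (u + 4 / u) / 2) * ((4 / u - u) / 2 + (u + 4 / u) / 2)"
          by (simp add: power2_eq_square algebra_simps)
        also have "(4 / u - u) / 2 - (u + 4 / u) / 2 = - u" by (rule A)
        also have "(4 / u - u) / 2 + (u + 4 / u) / 2 = 4 / u" by (rule A)
        also have "- u * (4 / u) = - 4" using u by simp
        finally have "((4 / u - u) / 2)\<^sup>2 = ((u + 4 / u) / 2)\<^sup>2 - 4" by (simp add: algebra_simps)
        then show "((u + 4 / u) / 2, (4 / u - u) / 2) \<in> (SIGMA c:UNIV. {y :: 'a. y\<^sup>2 = c\<^sup>2 - 4})"
          by (intro SigmaI CollectI UNIV_I)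
      qed
    qed
    finally show ?thesis by (simp add: card_Diff_singleton of_nat_diff)
  qed
  ultimately show ?thesis by (simp add: sum.distrib)
qed

lemma kappa_1: "kappa (1 :: 'a::field poly) = 1"
  using eta_square[of "1::'a"] by (simp add: kappa_def)

text \<open>In other words, the L-series of \<open>kappa\<close> is \<open>1 - u\<close>: degree 1
  is the hyperbola count, and higher degrees cancel by translation.\<close>

lemma sum_kappa:
  assumes two: "(2::'a::{field,finite}) \<noteq> 0"
  shows "(\<Sum>f\<in>(monics m :: 'a poly set). kappa f) = (if m = 0 then 1 else if m = 1 then - 1 else 0)"
proof -
  consider "m = 0" | "m = 1" | "m \<ge> 2" by linarith
  then show ?thesis
  proof cases
    case 1
    then show ?thesis by (simp add: monics_0 kappa_1)
  next
    case 2
    then show ?thesis using sum_kappa_1[OF two] by simp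
  next
    case 3
    have "of_int (\<Sum>f\<in>(monics m :: 'a poly set). kappa f) = (0::complex)"
      using sum_kappa_zero[OF two 3, of "\<lambda>_. 1"] by simp
    then show ?thesis using 3 by (simp only: of_int_eq_0_iff) simp
  qed
qed

definition units :: "nat \<Rightarrow> 'a::field poly set" where
  "units m = {h \<in> monics m. coeff h 0 \<noteq> 0}"

text \<open>Every \<open>h\<close> with nonzero constant term has exactly one norm: existence is
  \<open>norm_exists\<close>, uniqueness is injectivity of \<open>Phi\<close>.\<close>

lemma sum_units:
  fixes F :: "'a::{field,finite} poly \<Rightarrow> 'b::comm_monoid_add"
  shows "(\<Sum>h\<in>units m. F h) = (\<Sum>f\<in>monics m. \<Sum>h\<in>norm_fib f. F h)"
proof -
  have "(\<Sum>f\<in>monics m. \<Sum>h\<in>norm_fib f. F h) = (\<Sum>(f, h)\<in>Sigma (monics m) norm_fib. F h)"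
  proof (rule sum.Sigma[OF finite_monics])
    show "\<forall>f\<in>monics m. finite (norm_fib f :: 'a poly set)"
      by (auto simp: monics_def intro: finite_norm_fib)
  qed
  also have "\<dots> = (\<Sum>h\<in>units m. F h)"
  proof (rule sum.reindex_bij_witness[of _ "\<lambda>h. (SOME f. lead_coeff f = 1 \<and> h \<in> norm_fib f, h)" snd])
    fix a assume "a \<in> Sigma (monics m) (norm_fib :: 'a poly \<Rightarrow> 'a poly set)"
    then obtain f h where a: "a = (f, h)" "f \<in> monics m" "h \<in> norm_fib f" by auto
    have "(SOME f. lead_coeff f = 1 \<and> h \<in> norm_fib f) = f"
    proof (rule some_equality)
      show "lead_coeff f = 1 \<and> h \<in> norm_fib f" using a by (auto simp: monics_def)
      show "g = f" if "lead_coeff g = 1 \<and> h \<in> norm_fib g" for g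
        using that a Phi_inj[of g f] by (auto simp: norm_fib_def monics_def)
    qed
    then show "(SOME f. lead_coeff f = 1 \<and> snd a \<in> norm_fib f, snd a) = a" by (simp add: a)
    show "snd a \<in> units m" using a norm_fib_degree[OF a(3)] by (auto simp: units_def monics_def norm_fib_def)
    show "F (snd a) = (case a of (f, h) \<Rightarrow> F h)" by (simp add: a)
  next
    fix h :: "'a poly" assume h: "h \<in> units m"
    then have "lead_coeff h = 1" "coeff h 0 \<noteq> 0" "degree h = m" by (auto simp: units_def monics_def)
    then obtain f where f: "lead_coeff f = 1" "degree f = m" "h \<in> norm_fib f" using norm_exists by metis
    define g where "g = (SOME f. lead_coeff f = 1 \<and> h \<in> norm_fib f)"
    have "lead_coeff g = 1 \<and> h \<in> norm_fib g" unfolding g_def by (rule someI[of _ f]) (use f in blast)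
    then have "g \<in> monics m" "h \<in> norm_fib g" using norm_fib_degree[of h g] \<open>degree h = m\<close> by (auto simp: monics_def)
    then show "(SOME f. lead_coeff f = 1 \<and> h \<in> norm_fib f, h) \<in> Sigma (monics m) norm_fib" by (simp add: g_def)
  qed simp
  finally show ?thesis by simp
qed

lemma card_units: "int (card (units m :: 'a::{field,finite} poly set)) = (if m = 0 then 1 else int CARD('a) ^ m - int CARD('a) ^ (m - 1))"
proof (cases m)
  case 0
  have "units 0 = {1 :: 'a poly}" by (auto simp: units_def monics_0)
  then show ?thesis using 0 by simp
next
  case (Suc n)
  have "units m = monics m - pCons 0 ` (monics n :: 'a poly set)"
  proof (intro equalityI subsetI)
    fix h :: "'a poly" assume h: "h \<in> units m"
    then show "h \<in> monics m - pCons 0 ` monics n" by (auto simp: units_def)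
  next
    fix h :: "'a poly" assume h: "h \<in> monics m - pCons 0 ` monics n"
    obtain a g where hg: "h = pCons a g" by (cases h)
    have "a \<noteq> 0"
    proof
      assume "a = 0"
      moreover from this have "g \<in> monics n" using h hg Suc by (auto simp: monics_def split: if_splits)
      ultimately show False using h hg by auto
    qed
    then show "h \<in> units m" using h hg by (simp add: units_def)
  qed
  moreover have "pCons 0 ` monics n \<subseteq> (monics m :: 'a poly set)" using Suc by (auto simp: monics_def)
  moreover have "card (pCons 0 ` (monics n :: 'a poly set)) = CARD('a) ^ n"
    by (subst card_image) (auto simp: inj_on_def card_monics)
  ultimately have "card (units m :: 'a poly set) = CARD('a) ^ m - CARD('a) ^ n"
    by (simp add: card_Diff_subset finite_monics card_monics)
  moreover have "CARD('a) ^ n \<le> CARD('a) ^ m" using Suc by (intro power_increasing) (auto simp: Suc_leI card_gt_0_iff)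
  ultimately show ?thesis using Suc by (simp add: of_nat_diff)
qed

text \<open>For \<open>m \<ge> 1\<close> both sides are \<open>q^m - q^(m-1)\<close>: the right one
  counts polynomials with nonzero constant term, the left one has the series
  \<open>(1 - u) / (1 - q u)\<close>.\<close>

lemma sum_tau_rho:
  assumes two: "(2::'a::{field,finite}) \<noteq> 0"
  shows "(\<Sum>f\<in>(monics m :: 'a poly set). tau f) = (\<Sum>f\<in>(monics m :: 'a poly set). rho f)"
proof -
  have "(\<Sum>f\<in>(monics m :: 'a poly set). rho f) = (if m = 0 then 1 else int CARD('a) ^ m - int CARD('a) ^ (m - 1))"
    using sum_units[of "\<lambda>_::'a poly. 1::int" m] card_units[of m, where 'a = 'a] by (simp add: rho_def)
  moreover have "(\<Sum>f\<in>(monics m :: 'a poly set). tau f) = (\<Sum>s\<le>m. (\<Sum>g\<in>(monics s :: 'a poly set). kappa g) * int CARD('a) ^ (m - s))"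
    using monics_convolution[of kappa "\<lambda>_::'a poly. 1::int" m] by (simp add: tau_def card_monics)
  moreover have "\<dots> = (if m = 0 then 1 else int CARD('a) ^ m - int CARD('a) ^ (m - 1))"
  proof (cases m)
    case (Suc n)
    have "{..m} = insert 0 (insert 1 {2..m})" using Suc by auto
    then show ?thesis using Suc by (simp add: sum_kappa[OF two])
  qed (simp add: sum_kappa[OF two])
  ultimately show ?thesis by (simp only:)
qed

text \<open>Quadratic reciprocity between \<open>F[w]\<close> and \<open>F[z]\<close>. Both sides satisfy the Hecke relations, so
  only primes matter; there \<open>tau P \<ge> rho P\<close>, and the sums over each degree agree.\<close>

theorem tau_eq_rho:
  fixes f :: "'a::{field,finite} poly"
  assumes two: "(2::'a) \<noteq> 0" and f: "lead_coeff f = 1"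
  shows "tau f = rho f"
  using f
proof (induction "degree f" arbitrary: f rule: less_induct)
  case less
  define m where "m = degree f"
  have m1: "mdiv 1 = {1 :: 'a poly}"
  proof -
    have "g = 1" if "lead_coeff g = 1" "g dvd 1" for g :: "'a poly"
      using monic_dvd_antisym[of g 1] that by simp
    then show ?thesis by (auto simp: mdiv_def)
  qed
  have t1: "rho (1 :: 'a poly) = 1" "tau (1 :: 'a poly) = 1"
    by (auto simp: tau_def m1 rho_def norm_fib_1 kappa_1)
  have nonunit: "degree P > 0" if "irreducible P" for P :: "'a poly"
    using that by (metis irreducible_def is_unit_iff_degree neq0_conv)
  have IH: "tau g = rho g" if "degree g < m" "lead_coeff g = 1" for g :: "'a poly"
    using less.hyps that by (simp add: m_def)
  have prime_div1: "\<not> P dvd 1" if "irreducible P" for P :: "'a poly" using that by (simp add: irreducible_def)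
  have tP: "tau P = 1 + kappa P" if P: "irreducible P" "lead_coeff P = 1" for P :: "'a poly"
    using tau_hecke[OF _ P two, of 1] t1 prime_div1[OF P(1)] by (simp add: tau_div_def)
  \<comment> \<open>A composite \<open>g\<close> has a prime factor \<open>P\<close> of smaller
    degree, for which the induction hypothesis gives \<open>kappa P = rho P - 1\<close>; so
    \<open>tau\<close> and \<open>rho\<close> obey the same relation at \<open>P\<close>.\<close>
  have composite: "tau g = rho g" if g: "g \<in> monics m" "m > 0" "\<not> irreducible g" for g :: "'a poly"
  proof -
    have g': "degree g = m" "lead_coeff g = 1" using g by (auto simp: monics_def)
    obtain P where P: "irreducible P" "lead_coeff P = 1" "P dvd g" "degree P > 0"
      using irreducible_factor[of g] g' g(2) by metis
    define h where "h = g div P"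
    note d = monic_div[OF g'(2) P(2,3), folded h_def]
    have P0: "P \<noteq> 0" using P by auto
    have dh: "degree h < m" using d g' P by simp
    have "degree P < m"
    proof (rule ccontr)
      assume "\<not> degree P < m"
      then have "degree g = degree P" using d g' by simp
      then have "P = g" using monic_dvd_eq[OF P(3,2) g'(2)] by simp
      then show False using P g by simp
    qed
    then have k: "1 + kappa P = rho P" using tP[OF P(1,2)] IH P(2) by simp
    have tdiv: "tau_div P h = rho_div P h"
    proof (cases "P dvd h")
      case True
      have "degree (h div P) < m" using monic_div(2)[OF d(1) P(2) True] dh by simp
      then show ?thesis using IH monic_div(1)[OF d(1) P(2) True] True by (simp add: tau_div_def rho_div_def)
    qed (simp add: tau_div_def rho_div_def)
    have "tau g = (1 + kappa P) * tau h - kappa P * tau_div P h"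
      using tau_hecke[OF d(1) P(1,2) two] d(3) by simp
    moreover have "kappa P = rho P - 1" using k by simp
    ultimately have tg: "tau g = rho P * rho h - (rho P - 1) * rho_div P h"
      using IH[OF dh d(1)] tdiv by simp
    have n1: "rho_div P 1 = 0" using prime_div1[OF P(1)] by (simp add: rho_div_def)
    show ?thesis
    proof (cases rule: prime_type[OF P(1,2) two])
      case (1 Q)
      have "rho P = 2" using rho_split[OF _ P(2) 1, of 1] n1 t1 by simp
      then show ?thesis using tg rho_split[OF d(1) P(2) 1] d(3) by simp
    next
      case 2
      have "rho P = 0" using rho_inert[OF _ P(2) 2, of 1] n1 by simp
      then show ?thesis using tg rho_inert[OF d(1) P(2) 2] d(3) by simp
    next
      case (3 c)
      have "rho P = 1" using rho_ramified[OF _ P(2) 3(1,3), of 1] t1 by simp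
      then show ?thesis using tg rho_ramified[OF d(1) P(2) 3(1,3)] d(3) by simp
    qed
  qed
  \<comment> \<open>An inequality is enough. In the inert case it holds because \<open>kappa\<close>
    is at least -1, so no non-square has to be exhibited.\<close>
  have prime: "rho P \<le> tau P" if P: "P \<in> monics m" "irreducible P" for P :: "'a poly"
  proof -
    have lP: "lead_coeff P = 1" using P by (auto simp: monics_def)
    have n1: "rho_div P 1 = 0" using prime_div1[OF P(2)] by (simp add: rho_div_def)
    have pe: "poly P 2 = poly (Phi P) 1" "poly P (-2) * (-1) ^ degree P = poly (Phi P) (-1)"
      using poly_Phi[of 1 P] poly_Phi[of "-1" P] by (simp_all add: mult.commute)
    show ?thesis
    proof (cases rule: prime_type[OF P(2) lP two])
      case (1 Q)
      have rP: "rho P = 2" using rho_split[OF _ lP 1, of 1] n1 t1 by simp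
      have rt: "poly Q c \<noteq> 0" if c: "c = 1 \<or> c = -1" for c
      proof
        assume "poly Q c = 0"
        then have "Q = [:-c, 1:]" by (rule irreducible_root[OF 1(1,2)])
        then have "rstar Q = Q" using c by (auto simp: rstar_def reflect_poly_def)
        then show False using 1(4) by simp
      qed
      have ev: "poly (rstar Q) c = c ^ degree Q * poly Q c / coeff Q 0" if c: "c = 1 \<or> c = -1" for c
        using poly_reflect_poly_nz[of c Q] c by (auto simp: rstar_def field_simps)
      have dQ: "degree P = degree Q"
        using norm_fib_degree[of Q P] 1 lP by (simp add: norm_fib_def)
      \<comment> \<open>\<open>P(2)\<close> and, up to sign, \<open>P(-2)\<close> are the values of
        \<open>Phi P = Q * rstar Q\<close> at 1 and -1. The signs cancel, and their product becomes
        the square of \<open>y\<close>.\<close>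
      define y where "y = poly Q 1 * poly Q (-1) / coeff Q 0"
      have s: "(-1 :: 'a) ^ degree Q * (-1) ^ degree Q = 1" by (simp add: power_mult_distrib[symmetric])
      have "poly P (-2) = poly P (-2) * ((-1) ^ degree Q * (-1) ^ degree Q)" by (simp add: s)
      also have "\<dots> = (-1) ^ degree Q * poly (Phi P) (-1)"
        unfolding pe(2)[symmetric] dQ by (simp only: mult_ac)
      also have "\<dots> = ((-1) ^ degree Q * (-1) ^ degree Q) * (poly Q (-1) * poly Q (-1) / coeff Q 0)"
        unfolding 1(5) using ev[of "-1"] by simp
      finally have "poly P (-2) = poly Q (-1) * poly Q (-1) / coeff Q 0" by (simp only: s mult_1)
      moreover have "poly P 2 = poly Q 1 * poly Q 1 / coeff Q 0" unfolding pe(1) 1(5) using ev[of 1] by simp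
      ultimately have "poly P 2 * poly P (-2) = y\<^sup>2" by (simp add: y_def power2_eq_square)
      moreover have "y \<noteq> 0" using rt[of 1] rt[of "-1"] 1(3) by (simp add: y_def)
      ultimately have "kappa P = 1" by (simp add: kappa_def eta_square)
      then show ?thesis using tP[OF P(2) lP] rP by simp
    next
      case 2
      have "rho P = 0" using rho_inert[OF _ lP 2, of 1] n1 by simp
      moreover have "kappa P \<ge> -1" by (simp add: kappa_def eta_def)
      ultimately show ?thesis using tP[OF P(2) lP] by simp
    next
      case (3 c)
      have "rho P = 1" using rho_ramified[OF _ lP 3(1,3), of 1] t1 by simp
      moreover have "kappa P = 0" using 3(1,2) by (auto simp: kappa_def eta_def)
      ultimately show ?thesis using tP[OF P(2) lP] by simp
    qed
  qed
  show ?case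
  proof (cases "m = 0")
    case True
    then have "f \<in> monics 0" using less.prems by (simp add: m_def monics_def)
    then have "f = 1" by (simp add: monics_0)
    then show ?thesis using t1 by simp
  next
    case False
    \<comment> \<open>Nonnegative differences with sum zero all vanish, so the inequality at primes
      of degree \<open>m\<close> is an equality.\<close>
    have nn: "tau g - rho g \<ge> 0" if "g \<in> monics m" for g :: "'a poly"
      using composite[OF that] prime[OF that] False by (cases "irreducible g") auto
    have "(\<Sum>g\<in>(monics m :: 'a poly set). tau g - rho g) = 0"
      using sum_tau_rho[OF two, of m] by (simp add: sum_subtractf)
    then have "\<forall>g\<in>(monics m :: 'a poly set). tau g - rho g = 0"
      using sum_nonneg_eq_0_iff[OF finite_monics, of m "\<lambda>g. tau g - rho g"] nn by blast
    moreover have "f \<in> monics m" using less.prems by (simp add: monics_def m_def)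
    ultimately show ?thesis by force
  qed
qed

section \<open>Character sums over orbit data\<close>

definition recurrences :: "nat \<Rightarrow> (nat \<Rightarrow> 'a::field) set" where
  "recurrences s = {l. (\<exists>f\<in>seq_ann l. f \<noteq> 0) \<and> degree (smin l) = s}"

text \<open>The invariants that a pair \<open>(T, x)\<close> can have, described without reference
  to a form. That all of them of size at most \<open>n\<close> occur follows by counting in
  \<open>EE_recursion\<close>.\<close>

definition data :: "((nat \<Rightarrow> 'a::field) \<times> 'a poly) set" where
  "data = {(l, h). (\<exists>f\<in>seq_ann l. f \<noteq> 0) \<and> lead_coeff h = 1 \<and> coeff h 0 \<noteq> 0}"

text \<open>Half the codimension of the space \<open>V\<close> that is left over in
  \<open>orbit_average\<close>.\<close>

definition dsize :: "(nat \<Rightarrow> 'a::field) \<times> 'a poly \<Rightarrow> nat" where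
  "dsize = (\<lambda>(l, h). degree (smin l) + degree h)"

lemma smin_monic: "l \<in> recurrences s \<Longrightarrow> smin l \<in> monics s"
  unfolding recurrences_def monics_def using smin(1) by blast

lemma finite_recurrences: "finite (recurrences s :: (nat \<Rightarrow> 'a::{field,finite}) set)"
proof (rule finite_subset)
  show "recurrences s \<subseteq> (\<Union>g\<in>monics s. {l :: nat \<Rightarrow> 'a. g \<in> seq_ann l})"
  proof
    fix l :: "nat \<Rightarrow> 'a" assume l: "l \<in> recurrences s"
    then obtain f where f: "f \<in> seq_ann l" "f \<noteq> 0" unfolding recurrences_def by blast
    have "smin l \<in> seq_ann l" using smin(2)[OF f, of "smin l"] by simp
    then show "l \<in> (\<Union>g\<in>monics s. {l. g \<in> seq_ann l})" using smin_monic[OF l] by blast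
  qed
  show "finite (\<Union>g\<in>monics s. {l :: nat \<Rightarrow> 'a. g \<in> seq_ann l})"
    by (intro finite_UN_I finite_monics) (rule card_seq_ann(2))
qed

lemma finite_units: "finite (units m :: 'a::{field,finite} poly set)"
  by (simp add: units_def finite_monics)

lemma finite_data: "finite {\<delta> \<in> (data :: ((nat \<Rightarrow> 'a::{field,finite}) \<times> 'a poly) set). dsize \<delta> \<le> n}"
proof (rule finite_subset)
  show "{\<delta> \<in> data. dsize \<delta> \<le> n} \<subseteq> (\<Union>s\<le>n. recurrences s) \<times> (\<Union>s\<le>n. units s :: 'a poly set)"
  proof
    fix \<delta> :: "(nat \<Rightarrow> 'a) \<times> 'a poly" assume \<delta>: "\<delta> \<in> {\<delta> \<in> data. dsize \<delta> \<le> n}"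
    obtain l h where d: "\<delta> = (l, h)" by (cases \<delta>)
    have "l \<in> recurrences (degree (smin l))" "h \<in> units (degree h)"
      using \<delta> unfolding d data_def recurrences_def units_def monics_def by simp_all
    moreover have "degree (smin l) \<le> n" "degree h \<le> n" using \<delta> unfolding d dsize_def by simp_all
    ultimately show "\<delta> \<in> (\<Union>s\<le>n. recurrences s) \<times> (\<Union>s\<le>n. units s)" unfolding d by blast
  qed
  show "finite ((\<Union>s\<le>n. recurrences s) \<times> (\<Union>s\<le>n. units s) :: ((nat \<Rightarrow> 'a) \<times> 'a poly) set)"
    by (intro finite_cartesian_product finite_UN_I finite_atMost finite_recurrences finite_units)
qed

section \<open>Generating series of character values and their factorisation\<close>

locale additive_character =
  fixes \<psi> :: "'a::{field,finite} \<Rightarrow> complex" and K :: nat and t :: "nat \<Rightarrow> 'a" and b :: "nat \<Rightarrow> nat"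
  assumes psi_add: "\<psi> (u + v) = \<psi> u * \<psi> v" and psi_0: "\<psi> 0 = 1" and psi_norm: "cmod (\<psi> u) = 1"
    and b_pos: "i < K \<Longrightarrow> b i \<ge> 1" and two_nz: "(2::'a) \<noteq> 0"
begin

definition X :: "'a poly \<Rightarrow> complex" where "X h = \<psi> (\<Sum>i<K. t i * pw h (b i))"

definition Y :: "'a poly \<Rightarrow> complex" where "Y f = X (Phi f)"

text \<open>The character of the part of the trace that an orbit determines: the minimal polynomial
  on the cyclic space, and \<open>rstar h\<close> on the dual of the radical.\<close>

definition XX :: "(nat \<Rightarrow> 'a) \<times> 'a poly \<Rightarrow> complex" where
  "XX = (\<lambda>(l, h). \<psi> (\<Sum>i<K. t i * (pw (Phi (smin l) * h) (b i) + pw (rstar h) (b i))))"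

definition Af :: "complex fps" where "Af = Abs_fps (\<lambda>m. \<Sum>f\<in>monics m. Y f)"
definition Aq :: "complex fps" where "Aq = Abs_fps (\<lambda>m. of_nat (CARD('a) ^ m) * fps_nth Af m)"
definition Bf :: "complex fps" where "Bf = Abs_fps (\<lambda>m. \<Sum>f\<in>monics m. of_int (kappa f) * Y f)"
definition Df :: "complex fps" where "Df = Abs_fps (\<lambda>s. \<Sum>l\<in>recurrences s. Y (smin l))"
definition Gf :: "complex fps" where "Gf = Abs_fps (\<lambda>m. \<Sum>h\<in>units m. X h * X (rstar h))"
definition Cf :: "complex fps" where "Cf = Abs_fps (\<lambda>N. \<Sum>\<delta>\<in>{\<delta> \<in> data. dsize \<delta> = N}. XX \<delta>)"

lemma X_mult: "lead_coeff g = 1 \<Longrightarrow> lead_coeff h = 1 \<Longrightarrow> X (g * h) = X g * X h"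
  by (simp add: X_def pw_mult distrib_left sum.distrib psi_add)

lemma Y_mult: "lead_coeff f = 1 \<Longrightarrow> lead_coeff g = 1 \<Longrightarrow> Y (f * g) = Y f * Y g"
proof -
  assume f: "lead_coeff f = 1" and g: "lead_coeff g = 1"
  then have "f \<noteq> 0" "g \<noteq> 0" by auto
  then show ?thesis using X_mult[OF Phi_props(2)[OF f] Phi_props(2)[OF g]] by (simp add: Y_def Phi_mult)
qed

lemma Y_div: "f \<in> monics m \<Longrightarrow> g \<in> mdiv f \<Longrightarrow> Y g * Y (f div g) = Y f"
  using Y_mult[of g "f div g"] monic_div[of f g] by (auto simp: monics_def mdiv_def)

text \<open>Summed over the divisors \<open>g\<close> of \<open>f\<close>, the sequences with
  minimal polynomial \<open>g\<close> are the \<open>q^m\<close> functionals on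
  \<open>F[w]/(f)\<close>; multiplication by \<open>Af\<close> performs this divisor sum.\<close>

lemma DA: "Df * Af = Aq"
proof (rule fps_ext)
  fix m
  define nl where "nl = (\<lambda>g :: 'a poly. card {l. (\<exists>f\<in>seq_ann l. f \<noteq> 0) \<and> smin l = g})"
  have D: "(\<Sum>l\<in>recurrences s. Y (smin l)) = (\<Sum>g\<in>monics s. Y g * of_nat (nl g))" for s
  proof -
    have "(\<Sum>l\<in>recurrences s. Y (smin l)) = (\<Sum>g\<in>monics s. \<Sum>l\<in>{l \<in> recurrences s. smin l = g}. Y (smin l))"
      by (rule sum.group[symmetric]) (use finite_recurrences finite_monics smin_monic in auto)
    also have "\<dots> = (\<Sum>g\<in>monics s. Y g * of_nat (nl g))"
    proof (rule sum.cong[OF refl])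
      fix g :: "'a poly" assume "g \<in> monics s"
      then have "{l \<in> recurrences s. smin l = g} = {l. (\<exists>f\<in>seq_ann l. f \<noteq> 0) \<and> smin l = g}"
        by (auto simp: recurrences_def monics_def)
      then show "(\<Sum>l\<in>{l \<in> recurrences s. smin l = g}. Y (smin l)) = Y g * of_nat (nl g)"
        by (simp add: nl_def mult.commute)
    qed
    finally show ?thesis .
  qed
  have nl: "(\<Sum>g\<in>mdiv f. nl g) = CARD('a) ^ m" if f: "f \<in> monics m" for f :: "'a poly"
  proof -
    have f0: "f \<noteq> 0" using f by (auto simp: monics_def)
    have U: "{l. f \<in> seq_ann l} = (\<Union>g\<in>mdiv f. {l. (\<exists>f\<in>seq_ann l. f \<noteq> 0) \<and> smin l = g})"
    proof (intro equalityI subsetI)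
      fix l assume "l \<in> {l. f \<in> seq_ann l}"
      then have "f \<in> seq_ann l" by simp
      then have "lead_coeff (smin l) = 1" "smin l dvd f" "\<exists>f\<in>seq_ann l. f \<noteq> 0"
        using smin(1)[of f l] smin(2)[of f l f] f0 by auto
      then show "l \<in> (\<Union>g\<in>mdiv f. {l. (\<exists>f\<in>seq_ann l. f \<noteq> 0) \<and> smin l = g})" by (auto simp: mdiv_def)
    next
      fix l assume "l \<in> (\<Union>g\<in>mdiv f. {l. (\<exists>f\<in>seq_ann l. f \<noteq> 0) \<and> smin l = g})"
      then obtain f0 where "f0 \<in> seq_ann l" "f0 \<noteq> 0" "smin l dvd f" by (auto simp: mdiv_def)
      then show "l \<in> {l. f \<in> seq_ann l}" using smin(2)[of f0 l f] by simp
    qed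
    have "card {l. f \<in> seq_ann l} = (\<Sum>g\<in>mdiv f. nl g)"
      unfolding U nl_def
    proof (rule card_UN_disjoint)
      show "\<forall>g\<in>mdiv f. finite {l. (\<exists>f\<in>seq_ann l. f \<noteq> 0) \<and> smin l = g}"
      proof
        fix g assume "g \<in> mdiv f"
        then have "{l. (\<exists>f\<in>seq_ann l. f \<noteq> 0) \<and> smin l = g} \<subseteq> {l. f \<in> seq_ann l}" unfolding U by blast
        then show "finite {l. (\<exists>f\<in>seq_ann l. f \<noteq> 0) \<and> smin l = g}"
          using card_seq_ann(2)[OF f] finite_subset by blast
      qed
    qed (use finite_mdiv[OF f0] in auto)
    then show ?thesis using card_seq_ann(1)[OF f] by simp
  qed
  have "fps_nth (Df * Af) m = (\<Sum>s\<le>m. (\<Sum>g\<in>monics s. Y g * of_nat (nl g)) * (\<Sum>e\<in>monics (m - s). Y e))"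
    by (simp add: fps_mult_nth Df_def Af_def D atLeast0AtMost)
  also have "\<dots> = (\<Sum>f\<in>monics m. \<Sum>g\<in>mdiv f. Y g * of_nat (nl g) * Y (f div g))" by (rule monics_convolution)
  also have "\<dots> = (\<Sum>f\<in>monics m. \<Sum>g\<in>mdiv f. Y f * of_nat (nl g))"
    by (intro sum.cong refl) (simp add: Y_div[symmetric] mult_ac)
  also have "\<dots> = (\<Sum>f\<in>monics m. Y f * of_nat (CARD('a) ^ m))"
    by (rule sum.cong[OF refl]) (simp add: nl[symmetric] sum_distrib_left)
  also have "\<dots> = fps_nth Aq m" by (simp add: Aq_def Af_def sum_distrib_left mult.commute)
  finally show "fps_nth (Df * Af) m = fps_nth Aq m" .
qed

text \<open>The divisor sum of \<open>kappa\<close> is \<open>tau f = rho f\<close>, the number of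
  \<open>h\<close> of norm \<open>f\<close>, and each of them satisfies
  \<open>X h * X (rstar h) = Y f\<close>.\<close>

lemma BA: "Bf * Af = Gf"
proof (rule fps_ext)
  fix m
  have "fps_nth (Bf * Af) m = (\<Sum>s\<le>m. (\<Sum>g\<in>monics s. of_int (kappa g) * Y g) * (\<Sum>e\<in>monics (m - s). Y e))"
    by (simp add: fps_mult_nth Bf_def Af_def atLeast0AtMost)
  also have "\<dots> = (\<Sum>f\<in>monics m. \<Sum>g\<in>mdiv f. of_int (kappa g) * Y g * Y (f div g))" by (rule monics_convolution)
  also have "\<dots> = (\<Sum>f\<in>monics m. \<Sum>h\<in>norm_fib f. X h * X (rstar h))"
  proof (rule sum.cong[OF refl])
    fix f :: "'a poly" assume f: "f \<in> monics m"
    then have lf: "lead_coeff f = 1" by (auto simp: monics_def)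
    have "(\<Sum>g\<in>mdiv f. of_int (kappa g) * Y g * Y (f div g)) = (\<Sum>g\<in>mdiv f. of_int (kappa g) * Y f)"
      by (rule sum.cong[OF refl]) (simp add: Y_div[OF f, symmetric] mult.assoc)
    also have "\<dots> = of_int (tau f) * Y f" by (simp add: tau_def sum_distrib_right)
    also have "\<dots> = (\<Sum>h\<in>norm_fib f. Y f)" by (simp add: tau_eq_rho[OF two_nz lf] rho_def)
    also have "\<dots> = (\<Sum>h\<in>norm_fib f. X h * X (rstar h))"
    proof (rule sum.cong[OF refl])
      fix h assume "h \<in> norm_fib f"
      then have h: "lead_coeff h = 1" "coeff h 0 \<noteq> 0" "h * rstar h = Phi f" by (auto simp: norm_fib_def)
      then show "Y f = X h * X (rstar h)" using X_mult[OF h(1) rstar_props(1)[OF h(1,2)]] by (simp add: Y_def)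
    qed
    finally show "(\<Sum>g\<in>mdiv f. of_int (kappa g) * Y g * Y (f div g)) = (\<Sum>h\<in>norm_fib f. X h * X (rstar h))" .
  qed
  also have "\<dots> = fps_nth Gf m" by (simp add: Gf_def sum_units)
  finally show "fps_nth (Bf * Af) m = fps_nth Gf m" .
qed

lemma DG: "Df * Gf = Cf"
proof (rule fps_ext)
  fix N
  have XX: "XX (l, h) = Y (smin l) * (X h * X (rstar h))" if l: "l \<in> recurrences s" and h: "lead_coeff h = 1" for l h s
  proof -
    have m: "lead_coeff (Phi (smin l)) = 1" using smin_monic[OF l] Phi_props(2) by (auto simp: monics_def)
    show ?thesis
      using X_mult[OF m h] by (simp add: XX_def X_def Y_def psi_add distrib_left sum.distrib mult.assoc)
  qed
  have "fps_nth (Df * Gf) N = (\<Sum>s\<le>N. \<Sum>(l, h)\<in>recurrences s \<times> units (N - s). Y (smin l) * (X h * X (rstar h)))"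
    by (simp add: fps_mult_nth Df_def Gf_def atLeast0AtMost sum_product sum.cartesian_product)
  also have "\<dots> = (\<Sum>s\<le>N. \<Sum>(l, h)\<in>recurrences s \<times> units (N - s). XX (l, h))"
    by (intro sum.cong refl) (auto simp: XX units_def monics_def)
  also have "\<dots> = (\<Sum>(s, l, h)\<in>Sigma {..N} (\<lambda>s. recurrences s \<times> units (N - s)). XX (l, h))"
    by (rule sum.Sigma) (auto simp: finite_recurrences finite_units)
  also have "\<dots> = (\<Sum>\<delta>\<in>{\<delta> \<in> data. dsize \<delta> = N}. XX \<delta>)"
    by (rule sum.reindex_bij_witness[of _ "\<lambda>\<delta>. (degree (smin (fst \<delta>)), \<delta>)" snd])
      (auto simp: data_def dsize_def recurrences_def units_def monics_def)
  finally show "fps_nth (Df * Gf) N = fps_nth Cf N" by (simp add: Cf_def)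
qed

text \<open>\<open>Cf = Df * Gf = Df * Af * Bf\<close>, so \<open>Af\<close> is absorbed without
  having to be inverted.\<close>

theorem C_factorisation: "Cf = Aq * Bf"
  by (metis BA DA DG mult.assoc mult.commute)

lemma sum_data: "(\<Sum>\<delta>\<in>{\<delta> \<in> data. dsize \<delta> \<le> n}. XX \<delta> * e (n - dsize \<delta>)) = (\<Sum>N\<le>n. fps_nth Cf N * e (n - N))"
proof -
  have "(\<Sum>\<delta>\<in>{\<delta> \<in> data. dsize \<delta> \<le> n}. XX \<delta> * e (n - dsize \<delta>))
      = (\<Sum>N\<le>n. \<Sum>\<delta>\<in>{\<delta> \<in> {\<delta> \<in> data. dsize \<delta> \<le> n}. dsize \<delta> = N}. XX \<delta> * e (n - dsize \<delta>))"
    by (rule sum.group[symmetric]) (use finite_data in auto)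
  also have "\<dots> = (\<Sum>N\<le>n. fps_nth Cf N * e (n - N))"
  proof (rule sum.cong[OF refl])
    fix N assume "N \<in> {..n}"
    then have "{\<delta> \<in> {\<delta> \<in> data. dsize \<delta> \<le> n}. dsize \<delta> = N} = {\<delta> \<in> (data :: ((nat \<Rightarrow> 'a) \<times> 'a poly) set). dsize \<delta> = N}" by auto
    then show "(\<Sum>\<delta>\<in>{\<delta> \<in> {\<delta> \<in> data. dsize \<delta> \<le> n}. dsize \<delta> = N}. XX \<delta> * e (n - dsize \<delta>)) = fps_nth Cf N * e (n - N)"
      by (simp add: Cf_def sum_distrib_right)
  qed
  finally show ?thesis .
qed

lemma norm_Y: "cmod (Y f) = 1" by (simp add: Y_def X_def psi_norm)

lemma norm_A: "cmod (fps_nth Af m) \<le> real CARD('a) ^ m"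
proof -
  have "cmod (fps_nth Af m) \<le> (\<Sum>f\<in>(monics m :: 'a poly set). cmod (Y f))" unfolding Af_def by (simp add: norm_sum)
  then show ?thesis by (simp add: norm_Y card_monics)
qed

lemma norm_B: "cmod (fps_nth Bf m) \<le> real CARD('a) ^ m"
proof -
  have "cmod (fps_nth Bf m) \<le> (\<Sum>f\<in>(monics m :: 'a poly set). cmod (of_int (kappa f) * Y f))"
    unfolding Bf_def by (simp add: norm_sum)
  also have "\<dots> \<le> (\<Sum>f\<in>(monics m :: 'a poly set). 1)"
    by (rule sum_mono) (simp add: norm_mult norm_Y kappa_def eta_def)
  finally show ?thesis by (simp add: card_monics)
qed

lemma pw_Phi: "lead_coeff f = 1 \<Longrightarrow> pw (Phi f) k = fps_nth (psums (fps_of_poly (Phi f))) k"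
  by (simp add: pw_def Phi_props(4))

text \<open>\<open>Phi f\<close> equals its reversal, so its power sum of index \<open>b i\<close>
  depends only on its coefficients up to \<open>b i\<close>.\<close>

lemma Y_perturb:
  assumes f: "f \<in> monics m" and p: "p \<in> polys_lt m"
    and c: "\<And>i k. i < K \<Longrightarrow> t i \<noteq> 0 \<Longrightarrow> k \<le> b i \<Longrightarrow> coeff (zhom m p) k = 0"
  shows "Y (f + p) = Y f"
proof -
  have fp: "f + p \<in> monics m"
    using f p unfolding monics_eq polys_lt_def by (force simp: algebra_simps)
  have l: "lead_coeff f = 1" "lead_coeff (f + p) = 1" using f fp by (auto simp: monics_def)
  have e: "Phi (f + p) = Phi f + zhom m p" using f fp by (simp add: Phi_def monics_def zhom_add)
  have "t i * pw (Phi (f + p)) (b i) = t i * pw (Phi f) (b i)" if i: "i < K" for i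
  proof (cases "t i = 0")
    case False
    have "fps_nth (psums (fps_of_poly (Phi (f + p)))) (b i) = fps_nth (psums (fps_of_poly (Phi f))) (b i)"
      by (rule psums_cong) (use Phi_props(3)[OF l(1)] Phi_props(3)[OF l(2)] c[OF i False] in \<open>auto simp: e\<close>)
    then show ?thesis by (simp only: pw_Phi[OF l(1)] pw_Phi[OF l(2)])
  qed simp
  then have "(\<Sum>i<K. t i * pw (Phi (f + p)) (b i)) = (\<Sum>i<K. t i * pw (Phi f) (b i))"
    by (intro sum.cong) auto
  then show ?thesis by (simp only: Y_def X_def)
qed

text \<open>Multiples of \<open>w + 2\<close> change \<open>Phi f\<close> only from degree
  \<open>m - 1\<close> on, which exceeds every active exponent; hence the offset 2.
  \<open>sum_kappa_zero\<close> then applies.\<close>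

lemma B_zero:
  assumes "\<And>i. i < K \<Longrightarrow> t i \<noteq> 0 \<Longrightarrow> b i \<le> d" "m \<ge> d + 2"
  shows "fps_nth Bf m = 0"
proof -
  have "(\<Sum>f\<in>monics m. of_int (kappa f) * Y f) = 0"
  proof (rule sum_kappa_zero[OF two_nz])
    show "m \<ge> 2" using assms(2) by simp
    fix f :: "'a poly" and e :: 'a assume f: "f \<in> monics m"
    have p: "smult e [:2, 1:] = monom (2 * e) 0 + monom e 1" by (simp add: monom_altdef)
    show "Y (f + smult e [:2, 1:]) = Y f"
    proof (rule Y_perturb[OF f])
      show "smult e [:2, 1:] \<in> polys_lt m" using assms(2) unfolding p polys_lt_def by auto
      fix i k assume "i < K" "t i \<noteq> 0" "k \<le> b i"
      then have "k < m - 1" using assms(1)[of i] assms(2) by linarith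
      moreover have "zhom m (smult e [:2, 1:]) = smult (2 * e) (monom 1 m) + smult e (monom 1 (m - 1) * [:1, 0, 1:])"
        unfolding p zhom_add using assms(2) zhom_monom[of 0 m "2 * e"] zhom_monom[of 1 m e] by simp
      ultimately show "coeff (zhom m (smult e [:2, 1:])) k = 0"
        by (simp add: coeff_monom_mult del: mult_pCons_right)
    qed
  qed
  then show ?thesis by (simp add: Bf_def)
qed

text \<open>Translation by a multiple of \<open>w^(m-d)\<close>, with \<open>d\<close> the largest
  active exponent, first touches \<open>Phi f\<close> in degree \<open>d\<close>. It multiplies the
  character sum by \<open>\<psi> u\<close>, so the sum vanishes.\<close>

lemma A_zero:
  assumes i0: "i0 < K" "t i0 \<noteq> 0" "\<And>i. i < K \<Longrightarrow> i \<noteq> i0 \<Longrightarrow> t i \<noteq> 0 \<Longrightarrow> b i < b i0" "of_nat (b i0) \<noteq> (0::'a)"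
    and nt: "\<psi> u \<noteq> 1" and m: "m \<ge> b i0"
  shows "fps_nth Af m = 0"
proof -
  define d where "d = b i0"
  have d: "d \<ge> 1" "of_nat d \<noteq> (0::'a)" "m \<ge> d" using b_pos[OF i0(1)] i0(4) m by (auto simp: d_def)
  \<comment> \<open>Chosen so that the change \<open>- d * e\<close> of the power sum, multiplied by
    \<open>t i0\<close>, is \<open>u\<close>; this is where \<open>d\<close> must be invertible in
    the field.\<close>
  define e where "e = - (u / (t i0 * of_nat d))"
  define p where "p = monom e (m - d)"
  have p: "p \<in> polys_lt m" using d unfolding p_def polys_lt_def by auto
  have c: "coeff (zhom m p) k = (if k = d then e else 0)" if k: "k \<le> d" for k
  proof -
    have z: "zhom m p = smult e (monom 1 d * [:1, 0, 1:] ^ (m - d))"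
      unfolding p_def using zhom_monom[of "m - d" m e] d by simp
    have "coeff ([:1, 0, 1:] ^ (m - d) :: 'a poly) 0 = 1"
      using pal_p2[of 0 "m - d", where 'a = 'a] lead_p2[of "m - d", where 'a = 'a] by simp
    then show ?thesis unfolding z using k by (simp add: coeff_monom_mult)
  qed
  have shift: "Y (f + p) = \<psi> u * Y f" if f: "f \<in> monics m" for f
  proof -
    have fp: "f + p \<in> monics m"
      using f p unfolding monics_eq polys_lt_def by (force simp: algebra_simps)
    have l: "lead_coeff f = 1" "lead_coeff (f + p) = 1" using f fp by (auto simp: monics_def)
    have ee: "Phi (f + p) = Phi f + zhom m p" using f fp by (simp add: Phi_def monics_def zhom_add)
    have "t i * pw (Phi (f + p)) (b i) = t i * pw (Phi f) (b i) + (if i = i0 then u else 0)" if i: "i < K" for i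
    proof -
      consider "t i = 0" | "i = i0" | "t i \<noteq> 0" "i \<noteq> i0" by blast
      then show ?thesis
      proof cases
        case 1
        then show ?thesis using i0(2) by auto
      next
        case 2
        have "fps_nth (psums (fps_of_poly (Phi (f + p)))) d = fps_nth (psums (fps_of_poly (Phi f))) d - of_nat d * e"
          by (rule psums_perturb) (use Phi_props(3)[OF l(1)] Phi_props(3)[OF l(2)] c d in \<open>auto simp: ee\<close>)
        then have "pw (Phi (f + p)) d = pw (Phi f) d - of_nat d * e" by (simp only: pw_Phi[OF l(1)] pw_Phi[OF l(2)])
        moreover have "t i0 * (of_nat d * e) = - u" using i0(2) d by (simp add: e_def)
        ultimately show ?thesis using 2 by (simp add: d_def right_diff_distrib)
      next
        case 3
        then have "b i < d" using i0(3)[OF i] by (simp add: d_def)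
        then have "fps_nth (psums (fps_of_poly (Phi (f + p)))) (b i) = fps_nth (psums (fps_of_poly (Phi f))) (b i)"
          by (intro psums_cong) (use Phi_props(3)[OF l(1)] Phi_props(3)[OF l(2)] c in \<open>auto simp: ee\<close>)
        then show ?thesis using 3 by (simp only: pw_Phi[OF l(1)] pw_Phi[OF l(2)]) simp
      qed
    qed
    then have "(\<Sum>i<K. t i * pw (Phi (f + p)) (b i)) = (\<Sum>i<K. t i * pw (Phi f) (b i)) + u"
      using i0(1) by (simp add: sum.distrib)
    then show ?thesis by (simp add: Y_def X_def psi_add mult.commute)
  qed
  have "(\<Sum>f\<in>monics m. Y f) = (\<Sum>f\<in>monics m. Y (f + p))" by (rule monics_translate[OF p, symmetric])
  also have "\<dots> = \<psi> u * (\<Sum>f\<in>monics m. Y f)" by (simp add: shift sum_distrib_left)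
  finally have "(1 - \<psi> u) * (\<Sum>f\<in>monics m. Y f) = 0" by (simp add: left_diff_distrib)
  then show ?thesis using nt by (simp add: Af_def)
qed

end

text \<open>The factorisation is applied to the trivial character with \<open>K = 0\<close>: then
  \<open>Cf\<close> is \<open>(1 - u) / (1 - q^2 u)\<close>, whose partial sums telescope to
  \<open>q^(2n)\<close>.\<close>

lemma card_data:
  assumes two: "(2::'a::{field,finite}) \<noteq> 0"
  shows "card {\<delta> \<in> (data :: ((nat \<Rightarrow> 'a) \<times> 'a poly) set). dsize \<delta> \<le> n} = CARD('a) ^ (2 * n)"
proof -
  interpret c: additive_character "\<lambda>_::'a. 1" 0 "\<lambda>_. 0" "\<lambda>_. Suc 0"
    by unfold_locales (use two in auto)
  define q where "q = (of_nat CARD('a) :: complex)"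
  have A: "fps_nth c.Aq m = q ^ (2 * m)" for m
    by (simp add: c.Aq_def c.Af_def c.Y_def c.X_def card_monics q_def power_add[symmetric] mult_2)
  have B: "fps_nth c.Bf m = (if m = 0 then 1 else if m = 1 then - 1 else 0)" for m
  proof -
    have "fps_nth c.Bf m = of_int (\<Sum>f\<in>(monics m :: 'a poly set). kappa f)" by (simp add: c.Bf_def c.Y_def c.X_def)
    then show ?thesis unfolding sum_kappa[OF two] by simp
  qed
  have C: "fps_nth c.Cf N = (if N = 0 then 1 else q ^ (2 * N) - q ^ (2 * (N - 1)))" for N
  proof (cases N)
    case 0
    then show ?thesis by (simp add: c.C_factorisation A B)
  next
    case (Suc k)
    have "fps_nth c.Cf N = (\<Sum>i\<le>N. fps_nth c.Aq (N - i) * fps_nth c.Bf i)"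
      unfolding c.C_factorisation fps_mult_nth atLeast0AtMost
      by (rule sum.reindex_bij_witness[of _ "\<lambda>i. N - i" "\<lambda>i. N - i"]) auto
    also have "{..N} = insert 0 (insert 1 {2..N})" using Suc by auto
    finally show ?thesis using Suc by (simp add: A B)
  qed
  have "of_nat (card {\<delta> \<in> (data :: ((nat \<Rightarrow> 'a) \<times> 'a poly) set). dsize \<delta> \<le> n}) = (\<Sum>N\<le>n. fps_nth c.Cf N)"
    using c.sum_data[of "\<lambda>_. 1" n] by (simp add: c.XX_def)
  also have "\<dots> = q ^ (2 * n)"
    by (induction n) (simp_all add: C)
  finally have "of_nat (card {\<delta> \<in> (data :: ((nat \<Rightarrow> 'a) \<times> 'a poly) set). dsize \<delta> \<le> n}) = (of_nat (CARD('a) ^ (2 * n)) :: complex)"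
    by (simp add: q_def)
  then show ?thesis by (simp only: of_nat_eq_iff)
qed

section \<open>Majorising the recursion\<close>

definition fscale :: "'a::comm_ring_1 \<Rightarrow> 'a fps \<Rightarrow> 'a fps" where
  "fscale c F = Abs_fps (\<lambda>n. c ^ n * fps_nth F n)"

lemma fscale_nth [simp]: "fps_nth (fscale c F) n = c ^ n * fps_nth F n"
  by (simp add: fscale_def)

lemma fscale_mult: "fscale c (F * G) = fscale c F * fscale c G"
proof (rule fps_ext)
  fix n
  have "c ^ n * (\<Sum>i=0..n. fps_nth F i * fps_nth G (n - i))
      = (\<Sum>i=0..n. (c ^ i * fps_nth F i) * (c ^ (n - i) * fps_nth G (n - i)))"
    unfolding sum_distrib_left
  proof (rule sum.cong[OF refl])
    fix i assume "i \<in> {0..n}"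
    then have "c ^ n = c ^ i * c ^ (n - i)" by (simp add: power_add[symmetric])
    then show "c ^ n * (fps_nth F i * fps_nth G (n - i)) = c ^ i * fps_nth F i * (c ^ (n - i) * fps_nth G (n - i))"
      by (simp add: mult_ac)
  qed
  then show "fps_nth (fscale c (F * G)) n = fps_nth (fscale c F * fscale c G) n" by (simp add: fps_mult_nth)
qed

lemma fscale_power: "fscale c (F ^ k) = fscale c F ^ k"
  by (induction k) (simp_all add: fscale_mult, simp add: fps_eq_iff)

text \<open>Nonnegativity of \<open>F\<close> is included so that domination passes to
  products.\<close>

definition fdom :: "real fps \<Rightarrow> real fps \<Rightarrow> bool" where
  "fdom F G \<longleftrightarrow> (\<forall>n. 0 \<le> fps_nth F n \<and> fps_nth F n \<le> fps_nth G n)"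

lemma fdom_mult: "fdom F G \<Longrightarrow> fdom F' G' \<Longrightarrow> fdom (F * F') (G * G')"
proof -
  assume F: "fdom F G" and F': "fdom F' G'"
  show ?thesis
    unfolding fdom_def fps_mult_nth
  proof (intro allI conjI)
    fix n
    show "0 \<le> (\<Sum>i=0..n. fps_nth F i * fps_nth F' (n - i))"
      using F F' by (intro sum_nonneg mult_nonneg_nonneg) (auto simp: fdom_def)
    show "(\<Sum>i=0..n. fps_nth F i * fps_nth F' (n - i)) \<le> (\<Sum>i=0..n. fps_nth G i * fps_nth G' (n - i))"
      using F F' by (intro sum_mono mult_mono) (auto simp: fdom_def intro: order_trans)
  qed
qed

lemma fdom_power: "fdom F G \<Longrightarrow> fdom (F ^ k) (G ^ k)"
proof (induction k)
  case 0
  then show ?case by (simp add: fdom_def)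
qed (simp add: fdom_mult)

definition geo :: "real \<Rightarrow> real fps" where "geo x = Abs_fps (\<lambda>n. x ^ n)"

lemma geo_power: "fps_nth (geo x ^ Suc k) n = of_nat ((n + k) choose n) * x ^ n"
proof (induction k arbitrary: n)
  case 0
  then show ?case by (simp add: geo_def)
next
  case (Suc k)
  have "fps_nth (geo x ^ Suc (Suc k)) n = (\<Sum>i=0..n. fps_nth (geo x ^ Suc k) i * fps_nth (geo x) (n - i))"
    by (subst power_Suc2) (rule fps_mult_nth)
  also have "\<dots> = (\<Sum>i=0..n. of_nat ((i + k) choose i) * x ^ n)"
  proof (rule sum.cong[OF refl])
    fix i assume "i \<in> {0..n}"
    then have "x ^ n = x ^ i * x ^ (n - i)" by (simp add: power_add[symmetric])
    then show "fps_nth (geo x ^ Suc k) i * fps_nth (geo x) (n - i) = of_nat ((i + k) choose i) * x ^ n"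
      unfolding Suc.IH by (simp add: geo_def mult_ac)
  qed
  also have "\<dots> = of_nat (\<Sum>i\<le>n. (k + i) choose i) * x ^ n"
    by (simp add: sum_distrib_right atLeast0AtMost add.commute)
  also have "(\<Sum>i\<le>n. (k + i) choose i) = Suc (k + n) choose n" by (rule sum_choose_lower)
  finally show ?case by (simp add: add.commute)
qed

lemma binomial_fps: "fps_nth ((1 + fps_const c * fps_X) ^ k) n = of_nat (k choose n) * (c::'a::comm_ring_1) ^ n"
proof (induction k arbitrary: n)
  case 0
  then show ?case by (cases n) auto
next
  case (Suc k)
  define F where "F = (1 + fps_const c * fps_X) ^ k"
  have F: "(1 + fps_const c * fps_X) ^ Suc k = F + fps_const c * (fps_X * F)"
    by (simp add: F_def distrib_right mult.assoc)
  have IH: "fps_nth F n = of_nat (k choose n) * c ^ n" for n unfolding F_def by (rule Suc.IH)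
  show ?case
  proof (cases n)
    case 0
    then show ?thesis unfolding F by (simp add: IH)
  next
    case (Suc m)
    then show ?thesis unfolding F
      by (simp add: IH[of m] IH[of "Suc m"] fps_mult_left_const_nth distrib_right del: fps_mult_fps_X_commute)
  qed
qed

context
  fixes q :: real
  assumes q: "q > 1"
begin

text \<open>Euler's product \<open>\<Prod>\<^sub>i (1 + q\<^sup>-\<^sup>2\<^sup>i u)\<close>.\<close>

primrec euler_coeff :: "nat \<Rightarrow> real" where
  "euler_coeff 0 = 1"
| "euler_coeff (Suc m) = euler_coeff m * (q\<^sup>2 / (q ^ (2 * Suc m) - 1))"

definition euler :: "real fps" where "euler = Abs_fps euler_coeff"

lemma q_pow_gt: "m \<ge> 1 \<Longrightarrow> q ^ m > 1"
  using q by (simp add: one_less_power)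

lemma euler_coeff_pos: "euler_coeff m > 0"
  by (induction m) (use q q_pow_gt in \<open>simp_all del: mult_Suc_right power_Suc\<close>)

text \<open>Rescaling by \<open>q^2\<close> adds one factor to the product; on coefficients this is
  \<open>(q^(2m) - 1) e_m = q^2 e_(m-1)\<close>, the recursion defining
  \<open>euler_coeff\<close>.\<close>

lemma euler_functional: "fscale (q\<^sup>2) (fscale c euler) = (1 + fps_const (c * q\<^sup>2) * fps_X) * fscale c euler"
proof (rule fps_ext)
  fix n
  show "fps_nth (fscale (q\<^sup>2) (fscale c euler)) n = fps_nth ((1 + fps_const (c * q\<^sup>2) * fps_X) * fscale c euler) n"
  proof (cases n)
    case 0
    then show ?thesis by (simp add: distrib_right mult.assoc)
  next
    case (Suc m)
    have g: "q ^ (2 * Suc m) - 1 \<noteq> 0" using q_pow_gt[of "2 * Suc m"] by simp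
    have "q ^ (2 * Suc m) * euler_coeff (Suc m) = euler_coeff (Suc m) + (q ^ (2 * Suc m) - 1) * euler_coeff (Suc m)"
      by (simp only: left_diff_distrib mult_1 add_diff_eq add_diff_cancel_left')
    also have "(q ^ (2 * Suc m) - 1) * euler_coeff (Suc m) = q\<^sup>2 * euler_coeff m"
      using g by (simp del: mult_Suc_right power_Suc)
    finally have "(q\<^sup>2) ^ Suc m * (c ^ Suc m * euler_coeff (Suc m)) = c ^ Suc m * (euler_coeff (Suc m) + q\<^sup>2 * euler_coeff m)"
      by (simp only: power_mult[symmetric] mult.left_commute)
    moreover have "(c * q\<^sup>2) * (c ^ m * euler_coeff m) = c ^ Suc m * (q\<^sup>2 * euler_coeff m)" by simp
    moreover have "c ^ Suc m * (euler_coeff (Suc m) + q\<^sup>2 * euler_coeff m) = c ^ Suc m * euler_coeff (Suc m) + c ^ Suc m * (q\<^sup>2 * euler_coeff m)"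
      by (rule distrib_left)
    moreover have "fps_nth (fscale (q\<^sup>2) (fscale c euler)) (Suc m) = (q\<^sup>2) ^ Suc m * (c ^ Suc m * euler_coeff (Suc m))"
      by (simp add: euler_def del: euler_coeff.simps power_Suc)
    moreover have "fps_nth ((1 + fps_const (c * q\<^sup>2) * fps_X) * fscale c euler) (Suc m)
        = c ^ Suc m * euler_coeff (Suc m) + (c * q\<^sup>2) * (c ^ m * euler_coeff m)"
      by (simp add: distrib_right mult.assoc euler_def del: euler_coeff.simps power_Suc)
    ultimately show ?thesis unfolding Suc by (simp only:)
  qed
qed

definition sfac :: real where "sfac = 1 + 1 / (q\<^sup>2 - 1)"

lemma sfac: "sfac = q\<^sup>2 / (q\<^sup>2 - 1)" "sfac > 0"
proof -
  have "q\<^sup>2 > 1" using q_pow_gt[of 2] by simp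
  then show "sfac = q\<^sup>2 / (q\<^sup>2 - 1)" "sfac > 0" by (auto simp: sfac_def field_simps add_pos_pos)
qed

text \<open>Each quotient \<open>q^2 / (q^(2m+2) - 1)\<close> is at most \<open>q^(-2m)\<close>
  times \<open>q^2 / (q^2 - 1)\<close>; the latter is \<open>sfac\<close>, the source of
  \<open>1 + 1/(q^2 - 1)\<close> in the result.\<close>

lemma euler_coeff_le: "euler_coeff m \<le> sfac ^ m * q powr (- (real m * (real m - 1)))"
proof (induction m)
  case 0
  then show ?case using q by simp
next
  case (Suc m)
  have q2: "q\<^sup>2 > 1" using q_pow_gt[of 2] by simp
  have "q\<^sup>2 / (q ^ (2 * Suc m) - 1) \<le> sfac * q powr (- (2 * real m))"
  proof -
    have pw: "q powr (- (2 * real m)) = 1 / q ^ (2 * m)" using q by (simp add: powr_minus_divide powr_realpow[symmetric])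
    have "q ^ (2 * m) * (q\<^sup>2 - 1) \<le> q ^ (2 * Suc m) - 1"
      using q one_le_power[of q "2 * m"] by (simp add: algebra_simps power2_eq_square)
    then have "q\<^sup>2 / (q ^ (2 * Suc m) - 1) \<le> q\<^sup>2 / (q ^ (2 * m) * (q\<^sup>2 - 1))"
      using q q2 q_pow_gt[of "2 * Suc m"] by (intro divide_left_mono mult_pos_pos) (auto simp del: mult_Suc_right power_Suc)
    then show ?thesis unfolding pw sfac(1) by (simp add: mult.commute)
  qed
  then have "euler_coeff (Suc m) \<le> (sfac ^ m * q powr (- (real m * (real m - 1)))) * (sfac * q powr (- (2 * real m)))"
    unfolding euler_coeff.simps
    by (intro mult_mono Suc.IH) (use q euler_coeff_pos[of m] q_pow_gt[of "2 * Suc m"] sfac(2) in \<open>auto simp del: mult_Suc_right power_Suc\<close>)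
  also have "\<dots> = sfac ^ Suc m * (q powr (- (real m * (real m - 1))) * q powr (- (2 * real m)))" by simp
  also have "q powr (- (real m * (real m - 1))) * q powr (- (2 * real m)) = q powr (- (real (Suc m) * (real (Suc m) - 1)))"
    unfolding powr_add[symmetric] by (rule arg_cong[where f = "\<lambda>x. q powr x"]) (simp add: algebra_simps)
  finally show ?case .
qed

text \<open>Each factor \<open>1 + q^2 u\<close> of \<open>Chat\<close> is produced by one
  \<open>euler(u)\<close> and each factor \<open>1 + q u\<close> by one \<open>euler(u/q)\<close>,
  so this product solves the majorising recursion.\<close>

definition Fhat :: "nat \<Rightarrow> real fps" where
  "Fhat \<beta> = euler ^ (\<beta> - 1) * fscale (1 / q) euler ^ (\<beta> + 1)"

definition Chat :: "nat \<Rightarrow> real fps" where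
  "Chat \<beta> = (1 + fps_const (q\<^sup>2) * fps_X) ^ (\<beta> - 1) * (1 + fps_const q * fps_X) ^ (\<beta> + 1)"

lemma Fhat_functional: "fscale (q\<^sup>2) (Fhat \<beta>) = Chat \<beta> * Fhat \<beta>"
proof -
  have 1: "fscale (q\<^sup>2) euler = (1 + fps_const (q\<^sup>2) * fps_X) * euler"
  proof -
    have "fscale 1 euler = euler" by (simp add: fps_eq_iff)
    then show ?thesis using euler_functional[of 1] by simp
  qed
  have 2: "fscale (q\<^sup>2) (fscale (1 / q) euler) = (1 + fps_const q * fps_X) * fscale (1 / q) euler"
    using euler_functional[of "1 / q"] q by (simp add: power2_eq_square)
  show ?thesis unfolding Fhat_def Chat_def fscale_mult fscale_power 1 2 power_mult_distrib by (simp only: mult_ac)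
qed

lemma Fhat_0: "fps_nth (Fhat \<beta>) 0 = 1"
  by (simp add: Fhat_def fps_power_zeroth euler_def)

lemma Chat_0: "fps_nth (Chat \<beta>) 0 = 1"
  by (simp add: Chat_def fps_power_zeroth)

text \<open>\<open>\<alpha>\<close> is the slope at \<open>n\<close> of the convex function bounding the exponent, and \<open>\<beta>A\<close>, \<open>\<beta>B\<close> are its
  tangent intercepts for the two kinds of Euler factors.\<close>

lemma Fhat_bound_tangent:
  fixes \<alpha> \<beta>A \<beta>B :: real
  assumes A: "\<And>m::nat. \<alpha> * m - \<beta>A \<le> real m * (real m - 1)" and B: "\<And>m::nat. \<alpha> * m - \<beta>B \<le> real m * real m"
    and \<beta>: "\<beta> \<ge> 1"
  shows "fps_nth (Fhat \<beta>) n \<le> q powr (- (\<alpha> * n - real (\<beta> - 1) * \<beta>A - real (\<beta> + 1) * \<beta>B))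
    * sfac ^ n * real ((n + 2 * \<beta> - 1) choose n)"
proof -
  \<comment> \<open>Replacing the quadratic exponents by tangents bounds every Euler factor by a
    constant times a geometric series in \<open>x\<close>; the \<open>2 * \<beta>\<close> geometric
    series multiply to a binomial coefficient.\<close>
  define x where "x = sfac * q powr (- \<alpha>)"
  have xn: "x ^ n = sfac ^ n * q powr (- (\<alpha> * n))" for n
    using q by (simp add: x_def power_mult_distrib powr_realpow[symmetric] powr_powr)
  have dA: "fdom euler (fps_const (q powr \<beta>A) * geo x)"
    unfolding fdom_def
  proof (intro allI conjI)
    fix m
    have "euler_coeff m \<le> sfac ^ m * q powr (- (real m * (real m - 1)))" by (rule euler_coeff_le)
    also have "\<dots> \<le> sfac ^ m * q powr (\<beta>A - \<alpha> * m)"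
      using A[of m] q sfac(2) by (intro mult_left_mono) auto
    also have "\<dots> = q powr \<beta>A * x ^ m" unfolding xn by (simp add: powr_diff powr_minus field_simps)
    finally show "fps_nth euler m \<le> fps_nth (fps_const (q powr \<beta>A) * geo x) m" by (simp add: euler_def geo_def)
    show "0 \<le> fps_nth euler m" using euler_coeff_pos[of m] by (simp add: euler_def)
  qed
  have dB: "fdom (fscale (1 / q) euler) (fps_const (q powr \<beta>B) * geo x)"
    unfolding fdom_def
  proof (intro allI conjI)
    fix m
    have pq: "(1 / q) ^ m = q powr (- real m)" using q by (simp add: powr_minus_divide powr_realpow power_one_over)
    have "(1 / q) ^ m * euler_coeff m \<le> q powr (- real m) * (sfac ^ m * q powr (- (real m * (real m - 1))))"
      unfolding pq by (intro mult_left_mono euler_coeff_le) simp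
    also have "\<dots> = sfac ^ m * (q powr (- real m) * q powr (- (real m * (real m - 1))))" by simp
    also have "q powr (- real m) * q powr (- (real m * (real m - 1))) = q powr (- (real m * real m))"
      unfolding powr_add[symmetric] by (rule arg_cong[where f = "\<lambda>x. q powr x"]) (simp add: algebra_simps)
    also have "sfac ^ m * q powr (- (real m * real m)) \<le> sfac ^ m * q powr (\<beta>B - \<alpha> * m)"
      using B[of m] q sfac(2) by (intro mult_left_mono) auto
    also have "\<dots> = q powr \<beta>B * x ^ m" unfolding xn by (simp add: powr_diff powr_minus field_simps)
    finally show "fps_nth (fscale (1 / q) euler) m \<le> fps_nth (fps_const (q powr \<beta>B) * geo x) m"
      by (simp add: euler_def geo_def)
    show "0 \<le> fps_nth (fscale (1 / q) euler) m" using euler_coeff_pos[of m] q by (simp add: euler_def)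
  qed
  define P where "P = q powr (real (\<beta> - 1) * \<beta>A) * q powr (real (\<beta> + 1) * \<beta>B)"
  have "fdom (Fhat \<beta>) ((fps_const (q powr \<beta>A) * geo x) ^ (\<beta> - 1) * (fps_const (q powr \<beta>B) * geo x) ^ (\<beta> + 1))"
    unfolding Fhat_def by (intro fdom_mult fdom_power dA dB)
  also have "(fps_const (q powr \<beta>A) * geo x) ^ (\<beta> - 1) * (fps_const (q powr \<beta>B) * geo x) ^ (\<beta> + 1)
      = fps_const P * geo x ^ Suc (2 * \<beta> - 1)"
  proof -
    have "(\<beta> - 1) + (\<beta> + 1) = Suc (2 * \<beta> - 1)" using \<beta> by simp
    then have "geo x ^ (\<beta> - 1) * geo x ^ (\<beta> + 1) = geo x ^ Suc (2 * \<beta> - 1)" by (simp only: power_add[symmetric])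
    moreover have "(q powr \<beta>A) ^ (\<beta> - 1) * (q powr \<beta>B) ^ (\<beta> + 1) = P"
      using q unfolding P_def by (simp add: powr_realpow[symmetric] powr_powr mult.commute del: power_Suc)
    ultimately show ?thesis
      by (simp only: power_mult_distrib fps_const_power mult_ac fps_const_mult[symmetric]) (simp only: mult_ac fps_const_mult)
  qed
  finally have "fps_nth (Fhat \<beta>) n \<le> P * (real ((n + (2 * \<beta> - 1)) choose n) * x ^ n)"
    by (simp only: fdom_def fps_mult_left_const_nth geo_power)
  also have "\<dots> = (P * q powr (- (\<alpha> * n))) * sfac ^ n * real ((n + 2 * \<beta> - 1) choose n)"
    using \<beta> unfolding xn by simp
  also have "P * q powr (- (\<alpha> * n)) = q powr (- (\<alpha> * n - real (\<beta> - 1) * \<beta>A - real (\<beta> + 1) * \<beta>B))"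
    unfolding P_def powr_add[symmetric] by (rule arg_cong[where f = "\<lambda>x. q powr x"]) simp
  finally show ?thesis .
qed

lemma Fhat_bound:
  assumes \<beta>: "\<beta> \<ge> 1"
  shows "fps_nth (Fhat \<beta>) n \<le> q powr (- (real n ^ 2) / (2 * real \<beta>)) * q powr (real n / 2)
    * sfac ^ n * real ((n + 2 * \<beta> - 1) choose n)"
proof -
  \<comment> \<open>In the exponent, \<open>n\<close> is distributed over \<open>2 * \<beta>\<close>
    factors and convexity favours equal shares. The tangents are therefore taken near
    \<open>i\<close>, with slope \<open>2 * i\<close> or \<open>2 * i + 1\<close> according to the
    remainder.\<close>
  define i \<rho> where "i = n div (2 * \<beta>)" and "\<rho> = n mod (2 * \<beta>)"
  have n: "n = 2 * \<beta> * i + \<rho>" and \<rho>: "\<rho> < 2 * \<beta>" using \<beta> by (auto simp: i_def \<rho>_def)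
  define G where "G = - (real n ^ 2) / (2 * real \<beta>) + real n / 2"
  have G: "G = - (real n * (real n - \<beta>) / (2 * \<beta>))"
    using \<beta> by (simp add: G_def field_simps power2_eq_square)
  \<comment> \<open>A product of two consecutive integers is never negative, so at integers the line
    through two neighbouring points of a parabola is still a lower bound.\<close>
  have sq: "(real m - real j) * (real m - real j - 1) \<ge> 0" for m j :: nat
  proof (cases "m \<le> j")
    case True
    then show ?thesis by (intro mult_nonpos_nonpos) auto
  next
    case False
    then have "real m \<ge> real j + 1" by linarith
    then show ?thesis by (intro mult_nonneg_nonneg) auto
  qed
  have "\<exists>(\<alpha>::real) (\<beta>A::real) (\<beta>B::real). (\<forall>m::nat. \<alpha> * m - \<beta>A \<le> real m * (real m - 1)) \<and> (\<forall>m::nat. \<alpha> * m - \<beta>B \<le> real m * real m)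
      \<and> - (\<alpha> * n - real (\<beta> - 1) * \<beta>A - real (\<beta> + 1) * \<beta>B) \<le> G"
  proof (cases "\<rho> \<le> \<beta>")
    case True
    \<comment> \<open>Slope \<open>2 * i\<close> touches \<open>m (m - 1)\<close> at
      \<open>i\<close> and \<open>i + 1\<close>, and \<open>m^2\<close> at \<open>i\<close>.\<close>
    have 1: "2 * real i * m - (real i ^ 2 + real i) \<le> real m * (real m - 1)" for m :: nat
      using sq[of m i] by (simp add: algebra_simps power2_eq_square)
    have 2: "2 * real i * m - real i ^ 2 \<le> real m * real m" for m :: nat
      using zero_le_power2[of "real m - real i"] by (simp add: algebra_simps power2_eq_square)
    have "real \<rho> * (real \<rho> - \<beta>) / (2 * \<beta>) \<le> 0" using True by (intro divide_nonpos_nonneg mult_nonneg_nonpos) auto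
    moreover have "real n * (real n - \<beta>) / (2 * \<beta>) = 2 * \<beta> * real i ^ 2 + 2 * i * \<rho> - \<beta> * i + real \<rho> * (real \<rho> - \<beta>) / (2 * \<beta>)"
      using \<beta> unfolding n by (simp add: field_simps power2_eq_square)
    moreover have "2 * real i * n - real (\<beta> - 1) * (real i ^ 2 + real i) - real (\<beta> + 1) * real i ^ 2 = 2 * \<beta> * real i ^ 2 + 2 * i * \<rho> - \<beta> * i + i"
      using \<beta> unfolding n by (simp add: of_nat_diff algebra_simps power2_eq_square)
    ultimately have "- (2 * real i * n - real (\<beta> - 1) * (real i ^ 2 + real i) - real (\<beta> + 1) * real i ^ 2) \<le> G"
      unfolding G by linarith
    then show ?thesis using 1 2 by blast
  next
    case False
    \<comment> \<open>Slope \<open>2 * i + 1\<close> touches \<open>m (m - 1)\<close> at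
      \<open>i + 1\<close>, and \<open>m^2\<close> at \<open>i\<close> and
      \<open>i + 1\<close>.\<close>
    have 1: "(2 * real i + 1) * m - (real i + 1) ^ 2 \<le> real m * (real m - 1)" for m :: nat
      using zero_le_power2[of "real m - real i - 1"] by (simp add: algebra_simps power2_eq_square)
    have 2: "(2 * real i + 1) * m - (real i ^ 2 + real i) \<le> real m * real m" for m :: nat
      using sq[of m i] by (simp add: algebra_simps power2_eq_square)
    have "real \<rho> * (real \<rho> - \<beta>) \<le> 2 * \<beta> * (real \<rho> - \<beta>)" using False \<rho> by (intro mult_right_mono) auto
    then have "real \<rho> * (real \<rho> - \<beta>) / (2 * \<beta>) \<le> real \<rho> - \<beta>" using \<beta> by (simp add: field_simps)
    moreover have "real n * (real n - \<beta>) / (2 * \<beta>) = 2 * \<beta> * real i ^ 2 + 2 * i * \<rho> - \<beta> * i + real \<rho> * (real \<rho> - \<beta>) / (2 * \<beta>)"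
      using \<beta> unfolding n by (simp add: field_simps power2_eq_square)
    moreover have "(2 * real i + 1) * n - real (\<beta> - 1) * (real i + 1) ^ 2 - real (\<beta> + 1) * (real i ^ 2 + real i)
        = 2 * \<beta> * real i ^ 2 + 2 * i * \<rho> + \<rho> + i - \<beta> * i - \<beta> + 1"
      using \<beta> unfolding n by (simp add: of_nat_diff algebra_simps power2_eq_square)
    ultimately have "- ((2 * real i + 1) * n - real (\<beta> - 1) * (real i + 1) ^ 2 - real (\<beta> + 1) * (real i ^ 2 + real i)) \<le> G"
      unfolding G by linarith
    then show ?thesis using 1 2 by blast
  qed
  then obtain \<alpha> \<beta>A \<beta>B :: real where ab: "\<And>m::nat. \<alpha> * m - \<beta>A \<le> real m * (real m - 1)" "\<And>m::nat. \<alpha> * m - \<beta>B \<le> real m * real m"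
    "- (\<alpha> * n - real (\<beta> - 1) * \<beta>A - real (\<beta> + 1) * \<beta>B) \<le> G" by blast
  have "fps_nth (Fhat \<beta>) n \<le> q powr (- (\<alpha> * n - real (\<beta> - 1) * \<beta>A - real (\<beta> + 1) * \<beta>B)) * sfac ^ n * real ((n + 2 * \<beta> - 1) choose n)"
    by (rule Fhat_bound_tangent[OF ab(1,2) \<beta>])
  also have "\<dots> \<le> q powr G * sfac ^ n * real ((n + 2 * \<beta> - 1) choose n)"
    using ab(3) q sfac(2) by (intro mult_right_mono) auto
  also have "q powr G = q powr (- (real n ^ 2) / (2 * real \<beta>)) * q powr (real n / 2)"
    unfolding G_def by (rule powr_add)
  finally show ?thesis .
qed

text \<open>The term \<open>N = 0\<close> contains \<open>e n\<close> itself and is moved to the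
  left, where the factor \<open>q^(2n) - 1\<close> is positive. \<open>Fhat_functional\<close> has
  the same shape with nonnegative terms, so the bound follows by induction.\<close>

lemma recursion_bound:
  fixes e :: "nat \<Rightarrow> complex" and A B :: "complex fps"
  assumes rec: "\<And>n. of_real (q ^ (2 * n)) * e n = (\<Sum>N\<le>n. fps_nth (fscale (of_real q) A * B) N * e (n - N))"
    and e0: "e 0 = 1" and c0: "fps_nth A 0 = 1" "fps_nth B 0 = 1"
    and A: "\<And>m. cmod (fps_nth A m) \<le> q ^ m" "\<And>m. m \<ge> \<beta> \<Longrightarrow> fps_nth A m = 0"
    and B: "\<And>m. cmod (fps_nth B m) \<le> q ^ m" "\<And>m. m \<ge> \<beta> + 2 \<Longrightarrow> fps_nth B m = 0"
  shows "cmod (e n) \<le> fps_nth (Fhat \<beta>) n"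
proof (induction n rule: less_induct)
  case (less n)
  define C where "C = fscale (of_real q) A * B"
  \<comment> \<open>A polynomial of degree at most \<open>k\<close> with coefficients of modulus at
    most \<open>q^m\<close> is dominated by \<open>(1 + q u)^k\<close>, since the binomial
    coefficients in range are at least 1; for \<open>A(qu)\<close> the base is
    \<open>q^2\<close>.\<close>
  have CC: "cmod (fps_nth C N) \<le> fps_nth (Chat \<beta>) N" for N
  proof -
    have a: "cmod (of_real q ^ m * fps_nth A m) \<le> of_nat ((\<beta> - 1) choose m) * (q\<^sup>2) ^ m" for m
    proof (cases "m \<ge> \<beta>")
      case False
      have "cmod (of_real q ^ m * fps_nth A m) \<le> q ^ m * q ^ m"
        using q A(1)[of m] by (simp add: norm_mult norm_power)
      also have "\<dots> = 1 * (q\<^sup>2) ^ m" by (simp add: power_mult[symmetric] power_add[symmetric] mult_2)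
      also have "\<dots> \<le> of_nat ((\<beta> - 1) choose m) * (q\<^sup>2) ^ m"
        using False by (intro mult_right_mono) (auto simp: Suc_le_eq)
      finally show ?thesis .
    qed (simp add: A(2))
    have b: "cmod (fps_nth B m) \<le> of_nat ((\<beta> + 1) choose m) * q ^ m" for m
    proof (cases "m \<ge> \<beta> + 2")
      case False
      have "cmod (fps_nth B m) \<le> 1 * q ^ m" using B(1)[of m] by simp
      also have "\<dots> \<le> of_nat ((\<beta> + 1) choose m) * q ^ m"
        using False q zero_less_binomial[of m "\<beta> + 1"] by (intro mult_right_mono) (auto simp: Suc_le_eq)
      finally show ?thesis .
    qed (use q in \<open>simp add: B(2)\<close>)
    have "cmod (fps_nth C N) \<le> (\<Sum>i=0..N. cmod (of_real q ^ i * fps_nth A i * fps_nth B (N - i)))"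
      unfolding C_def fps_mult_nth fscale_nth by (rule norm_sum)
    also have "\<dots> \<le> (\<Sum>i=0..N. (of_nat ((\<beta> - 1) choose i) * (q\<^sup>2) ^ i) * (of_nat ((\<beta> + 1) choose (N - i)) * q ^ (N - i)))"
      unfolding norm_mult[of "_ * _"] using a b by (intro sum_mono mult_mono) auto
    also have "\<dots> = fps_nth (Chat \<beta>) N" by (simp only: Chat_def fps_mult_nth binomial_fps)
    finally show ?thesis .
  qed
  show ?case
  proof (cases "n = 0")
    case True
    then show ?thesis by (simp add: e0 Fhat_0)
  next
    case False
    have qn: "q ^ (2 * n) > 1" using q_pow_gt[of "2 * n"] False by simp
    have s: "{..n} = insert 0 {1..n}" using False by auto
    have C0: "fps_nth C 0 = 1" by (simp add: C_def c0)
    have "of_real (q ^ (2 * n)) * e n = e n + (\<Sum>N=1..n. fps_nth C N * e (n - N))"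
      using rec[of n] unfolding C_def[symmetric] s by (simp add: C0)
    then have "of_real (q ^ (2 * n) - 1) * e n = (\<Sum>N=1..n. fps_nth C N * e (n - N))" by (simp add: algebra_simps)
    then have "(q ^ (2 * n) - 1) * cmod (e n) = cmod (\<Sum>N=1..n. fps_nth C N * e (n - N))"
      using qn by (metis abs_of_nonneg diff_ge_0_iff_ge less_imp_le norm_mult norm_of_real)
    also have "\<dots> \<le> (\<Sum>N=1..n. cmod (fps_nth C N * e (n - N)))" by (rule norm_sum)
    also have "\<dots> \<le> (\<Sum>N=1..n. fps_nth (Chat \<beta>) N * fps_nth (Fhat \<beta>) (n - N))"
      unfolding norm_mult using less.IH
      by (intro sum_mono mult_mono CC) (auto intro: order_trans[OF norm_ge_zero CC])
    also have "\<dots> = (q ^ (2 * n) - 1) * fps_nth (Fhat \<beta>) n"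
    proof -
      have "q ^ (2 * n) * fps_nth (Fhat \<beta>) n = (\<Sum>N\<le>n. fps_nth (Chat \<beta>) N * fps_nth (Fhat \<beta>) (n - N))"
        using arg_cong[OF Fhat_functional[of \<beta>], of "\<lambda>F. fps_nth F n"]
        by (simp add: fps_mult_nth power_mult atLeast0AtMost)
      also have "\<dots> = fps_nth (Fhat \<beta>) n + (\<Sum>N=1..n. fps_nth (Chat \<beta>) N * fps_nth (Fhat \<beta>) (n - N))"
        unfolding s by (simp add: Chat_0)
      finally show ?thesis by (simp add: algebra_simps)
    qed
    finally show ?thesis using qn by simp
  qed
qed

end

section \<open>The recursion for symplectic character sums\<close>

context alternating_form
begin

text \<open>This is \<open>hR\<close> written out without the orbit locale, so that it can be
  compared for different pairs (\<open>dh_eq\<close>).\<close>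

definition dh :: "('b \<Rightarrow> 'b) \<Rightarrow> 'b \<Rightarrow> 'a poly" where
  "dh T x = igen {p. pact T p (pact (Lop T) (smin (dl T x)) x) = 0}"

end

context symplectic_map
begin

lemma funpow_cheb: "z \<in> S \<Longrightarrow> (T ^^ k) z = pact L (fst (chebA k)) z + pact L (snd (chebA k)) (T z)"
proof (induction k)
  case (Suc k)
  define A B where "A = fst (chebA k :: 'a poly \<times> 'a poly)" and "B = snd (chebA k :: 'a poly \<times> 'a poly)"
  note z = Suc.prems and Tz = T_mem[OF Suc.prems]
  have m: "pact L A z \<in> S" "pact L B (T z) \<in> S" using cL.pact_mem z Tz by auto
  have "(T ^^ Suc k) z = T (pact L A z + pact L B (T z))" using Suc by (simp add: A_def B_def)
  also have "\<dots> = pact L A (T z) + T (pact L B (T z))"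
    using lin_onD(2)[OF SpD(1)[OF TSp] m] T_pL[OF z] by simp
  also have "T (pact L B (T z)) = pact L B (T (T z))" by (rule T_pL[OF Tz])
  also have "T (T z) = L (T z) - z" by (simp add: Lop_def)
  also have "pact L B (L (T z) - z) = L (pact L B (T z)) - pact L B z"
    using lin_on_diff[OF cL.lin_on_pact nondegD(1)[OF nS] L_mem[OF Tz] z] cL.pact_T[OF Tz] by simp
  finally have "(T ^^ Suc k) z = pact L A (T z) + (pact L (pCons 0 B) (T z) - pact L B z)"
    by (simp add: cL.pact_pCons[OF Tz])
  then show ?case by (simp add: A_def[symmetric] B_def[symmetric] pact_uminus pact_add)
qed simp

lemma gram_cheb: "z \<in> S \<Longrightarrow> \<omega> z ((T ^^ k) z) = lam (dl T z) (snd (chebA k))"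
  using form_pL_self[of z "fst (chebA k)"] T_pL[of z] lam_dl[of z "snd (chebA k)"]
  by (simp add: funpow_cheb add_right)

text \<open>For an isometry the products depend only on \<open>k - i\<close>, and in
  \<open>T^k = A_k(\<Lambda>) + B_k(\<Lambda>) T\<close> only the second part pairs nontrivially
  with \<open>z\<close>. So \<open>dl\<close> determines the Gram matrix of the orbit.\<close>

lemma gram: "z \<in> S \<Longrightarrow> i \<le> k \<Longrightarrow> \<omega> ((T ^^ i) z) ((T ^^ k) z) = lam (dl T z) (snd (chebA (k - i)))"
proof -
  assume z: "z \<in> S" and i: "i \<le> k"
  have "(T ^^ k) z = (T ^^ i) ((T ^^ (k - i)) z)" using i funpow_add[of i "k - i" T] by (simp add: fun_eq_iff)
  then have "\<omega> ((T ^^ i) z) ((T ^^ k) z) = \<omega> z ((T ^^ (k - i)) z)"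
    using SpD(3)[OF Sp_funpow[OF TSp] z] ca.funpow_mem[OF z] by simp
  then show ?thesis using gram_cheb[OF z] by simp
qed

end

context symplectic_orbit
begin

lemma dh_eq: "dh T x = hR"
  by (simp add: dh_def hR_def ca.mpol_def xR_def f_def)

end

context alternating_form
begin

text \<open>Equal data give equal minimal polynomials (\<open>mpol_x\<close>) and equal Gram
  matrices (\<open>gram\<close>), so \<open>witt\<close> applies to the first \<open>j\<close> orbit
  vectors, which span the cyclic space.\<close>

lemma orbit_transitive:
  assumes A: "symplectic_orbit scale \<omega> S T x" and B: "symplectic_orbit scale \<omega> S U y"
    and l: "dl T x = dl U y" and h: "dh T x = dh U y"
  obtains g where "g \<in> Sp \<omega> S" "\<And>p. g (pact T p x) = pact U p y"
proof -
  interpret A: symplectic_orbit scale \<omega> S T x by (rule A)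
  interpret B: symplectic_orbit scale \<omega> S U y by (rule B)
  have mp: "A.ca.mpol x = B.ca.mpol y"
    using l h by (simp add: A.mpol_x B.mpol_x A.dh_eq[symmetric] B.dh_eq[symmetric] A.f_def B.f_def)
  define j where "j = degree (A.ca.mpol x)"
  have gr: "\<omega> ((T ^^ i) x) ((T ^^ k) x) = \<omega> ((U ^^ i) y) ((U ^^ k) y)" for i k
  proof (cases "i \<le> k")
    case True
    then show ?thesis using A.gram[OF A.xS] B.gram[OF B.xS] l by simp
  next
    case False
    then show ?thesis
      using A.gram[OF A.xS, of k i] B.gram[OF B.xS, of k i] l
        skew[of "(T ^^ i) x" "(T ^^ k) x"] skew[of "(U ^^ i) y" "(U ^^ k) y"] by simp
  qed
  have "\<exists>g\<in>Sp \<omega> S. \<forall>i<j. g ((T ^^ i) x) = (U ^^ i) y"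
    by (rule witt[OF A.nS]) (use A.ca.funpow_mem[OF A.xS] B.ca.funpow_mem[OF B.xS] A.ca.cyc_new[OF A.xS] B.ca.cyc_new[OF B.xS] mp gr in \<open>auto simp: j_def\<close>)
  then obtain g where g: "g \<in> Sp \<omega> S" "\<And>i. i < j \<Longrightarrow> g ((T ^^ i) x) = (U ^^ i) y" by blast
  have "g (pact T p x) = pact U p y" for p
  proof -
    define r where "r = p mod A.ca.mpol x"
    have "g (pact T r x) = (\<Sum>i\<le>degree r. g (coeff r i *s (T ^^ i) x))"
      unfolding pact_def
      by (rule lin_on_sum[OF SpD(1)[OF g(1)] nondegD(1)[OF A.nS]])
        (intro subspace_scale[OF nondegD(1)[OF A.nS]] A.ca.funpow_mem[OF A.xS])
    also have "\<dots> = (\<Sum>i\<le>degree r. coeff r i *s (U ^^ i) y)"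
    proof (rule sum.cong[OF refl])
      fix i assume "i \<in> {..degree r}"
      have e: "g (coeff r i *s (T ^^ i) x) = coeff r i *s g ((T ^^ i) x)"
        by (rule lin_onD(3)[OF SpD(1)[OF g(1)] A.ca.funpow_mem[OF A.xS]])
      show "g (coeff r i *s (T ^^ i) x) = coeff r i *s (U ^^ i) y"
      proof (cases "i < j")
        case True
        then show ?thesis using e g(2) by simp
      next
        case False
        then have "coeff r i = 0" using A.ca.mod_mpol_lt[OF A.xS, of p] by (simp add: polys_lt_def r_def j_def)
        then show ?thesis using e by simp
      qed
    qed
    finally have "g (pact T r x) = pact U r y" by (simp add: pact_def)
    then show ?thesis using A.ca.pact_mod[OF A.xS, of p] B.ca.pact_mod[OF B.xS, of p] mp by (simp add: r_def)
  qed
  then show ?thesis using that g(1) by blast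
qed

text \<open>The relation \<open>U g = g T\<close> on the cyclic space passes to the inverses, to
  \<open>Lop\<close> and to polynomials in them, hence to both invariants.\<close>

lemma orbit_transport:
  assumes A: "symplectic_orbit scale \<omega> S T x" and U: "U \<in> Sp \<omega> S" and g: "g \<in> Sp \<omega> S"
    and c: "\<And>p. U (g (pact T p x)) = g (T (pact T p x))"
  shows "g (pact T p x) = pact U p (g x)" "dl U (g x) = dl T x" "dh U (g x) = dh T x"
proof -
  interpret A: symplectic_orbit scale \<omega> S T x by (rule A)
  interpret B: symplectic_map scale \<omega> S U by unfold_locales (use A.nS U in auto)
  have gx: "g w \<in> S" if "w \<in> A.W" for w using SpD(4)[OF g] that A.ca.cyc_sub[OF A.xS] by blast
  have WS: "w \<in> S" if "w \<in> A.W" for w using that A.ca.cyc_sub[OF A.xS] by blast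
  have c': "U (g w) = g (T w)" if "w \<in> A.W" for w using that c by (auto simp: A.ca.cyc_def)
  have ci: "B.T' (g w) = g (A.T' w)" if "w \<in> A.W" for w
    using c'[OF A.W_T'[OF that]] B.T'T by (metis A.TT')
  have cL: "Lop U (g w) = g (Lop T w)" if "w \<in> A.W" for w
    using c'[OF that] ci[OF that] lin_onD(2)[OF SpD(1)[OF g], of "T w" "A.T' w"] WS A.W_T[OF that] A.W_T'[OF that]
    by (simp add: Lop_def)
  have LW: "Lop T w \<in> A.W" if "w \<in> A.W" for w using A.W_pL[OF that, of "monom 1 1"] by (simp add: pact_monom)
  have cLi: "(Lop U ^^ i) (g w) = g ((Lop T ^^ i) w) \<and> (Lop T ^^ i) w \<in> A.W" if "w \<in> A.W" for w i
    by (induction i) (use that cL LW in auto)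
  have cTi: "(U ^^ i) (g w) = g ((T ^^ i) w) \<and> (T ^^ i) w \<in> A.W" if "w \<in> A.W" for w i
    by (induction i) (use that c' A.W_T in auto)
  have gs: "g (\<Sum>i\<in>I. k i *s v i) = (\<Sum>i\<in>I. k i *s g (v i))" if "\<And>i. i \<in> I \<Longrightarrow> v i \<in> A.W" for I k and v :: "nat \<Rightarrow> 'b"
    using that WS by (subst lin_on_sum[OF SpD(1)[OF g] nondegD(1)[OF A.nS]])
      (auto simp: subspace_scale[OF nondegD(1)[OF A.nS]] lin_onD(3)[OF SpD(1)[OF g]])
  have pT: "g (pact T p w) = pact U p (g w)" if "w \<in> A.W" for p w
    unfolding pact_def using gs cTi[OF that] by simp
  have pL: "g (pact (Lop T) p w) = pact (Lop U) p (g w)" if "w \<in> A.W" for p w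
    unfolding pact_def using gs cLi[OF that] by simp
  note x = A.ca.cyc_self[of x]
  show "g (pact T p x) = pact U p (g x)" by (rule pT[OF x])
  show dl: "dl U (g x) = dl T x"
  proof
    fix i
    have "dl U (g x) i = \<omega> (g x) (g (T ((Lop T ^^ i) x)))"
      using cLi[OF x, of i] c' by (simp add: dl_def)
    also have "\<dots> = dl T x i"
      unfolding dl_def by (rule SpD(3)[OF g A.xS]) (use cLi[OF x, of i] A.W_T WS in blast)
    finally show "dl U (g x) i = dl T x i" .
  qed
  have g0: "g w = 0 \<longleftrightarrow> w = 0" for w
    using lin_on_0[OF SpD(1)[OF g] nondegD(1)[OF A.nS]] Sp_inj[OF A.nS g] by (metis injD)
  have "pact U p (pact (Lop U) (smin (dl T x)) (g x)) = g (pact T p (pact (Lop T) (smin (dl T x)) x))" for p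
    using pL[OF x] pT[OF A.W_pL[OF x]] by simp
  then show "dh U (g x) = dh T x" unfolding dh_def dl using g0 by simp
qed

lemma tr_conj:
  assumes S: "nondeg \<omega> S" and g: "g \<in> Sp \<omega> S" and A: "lin_on S A"
  shows "tr S (g \<circ> A \<circ> inv_into UNIV g) = tr S A"
proof -
  interpret g: symplectic_map scale \<omega> S g by unfold_locales (use S g in auto)
  obtain B where B: "independent B" "finite B" "span B = S" "B \<subseteq> S"
    using finite_basis_exists[OF nondegD(1,2)[OF S]] by metis
  have lin: "lin_on S (g \<circ> A \<circ> g.T')"
    by (intro lin_on_comp A SpD(1)[OF g] SpD(1)[OF g.T'Sp])
  have sp: "span (g ` B) = S"
  proof
    show "span (g ` B) \<subseteq> S" by (intro span_minimal nondegD(1)[OF S]) (use B(4) g.T_mem in blast)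
    show "S \<subseteq> span (g ` B)"
    proof
      fix z assume z: "z \<in> S"
      have "z = g (\<Sum>b\<in>B. representation B (g.T' z) b *s b)"
        using sum_rep[OF B(1-3) g.T'_mem[OF z]] by simp
      also have "\<dots> = (\<Sum>b\<in>B. representation B (g.T' z) b *s g b)"
        using B(4) by (subst lin_on_sum[OF SpD(1)[OF g] nondegD(1)[OF S]])
          (auto simp: subspace_scale[OF nondegD(1)[OF S]] subset_iff lin_onD(3)[OF SpD(1)[OF g]])
      also have "\<dots> \<in> span (g ` B)" by (intro span_sum span_scale span_base) auto
      finally show "z \<in> span (g ` B)" .
    qed
  qed
  have "tr S (g \<circ> A \<circ> g.T') = (\<Sum>b\<in>B. representation B (g.T' ((g \<circ> A \<circ> g.T') (g b))) b)"
  proof (rule tr_dual(3)[OF B(2) sp lin])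
    fix i u v assume "u \<in> S" "v \<in> S"
    then show "representation B (g.T' (u + v)) i = representation B (g.T' u) i + representation B (g.T' v) i"
      using lin_onD(2)[OF SpD(1)[OF g.T'Sp]] representation_add[OF B(1)] g.T'_mem B(3) by simp
  next
    fix i c u assume "u \<in> S"
    then show "representation B (g.T' (c *s u)) i = c * representation B (g.T' u) i"
      using lin_onD(3)[OF SpD(1)[OF g.T'Sp]] representation_scale[OF B(1)] g.T'_mem B(3) by simp
  next
    fix i j assume "i \<in> B" "j \<in> B"
    then show "representation B (g.T' (g j)) i = (if i = j then 1 else 0)"
      using representation_basis[OF B(1)] by auto
  qed
  also have "\<dots> = tr S A" using tr_eq[OF B(1-3) A] by simp
  finally show ?thesis .
qed

lemma conj_funpow:
  assumes "bij g"
  shows "(g \<circ> A \<circ> inv_into UNIV g) ^^ k = g \<circ> (A ^^ k) \<circ> inv_into UNIV g"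
proof (induction k)
  case 0
  then show ?case using assms by (auto simp: fun_eq_iff bij_is_surj surj_f_inv_f)
next
  case (Suc k)
  then show ?case using assms by (auto simp: fun_eq_iff bij_is_inj)
qed

end

section \<open>Averages of the trace character over data classes\<close>

locale trace_character = alternating_form scale \<omega> + additive_character \<psi> K t b
  for scale :: "'a::{field,finite} \<Rightarrow> 'b::ab_group_add \<Rightarrow> 'b" (infixr \<open>*s\<close> 75) and \<omega>
    and \<psi> :: "'a \<Rightarrow> complex" and K t b
begin

definition chi :: "'b set \<Rightarrow> ('b \<Rightarrow> 'b) \<Rightarrow> complex" where
  "chi S T = \<psi> (\<Sum>i<K. t i * tr S (T ^^ b i))"

definition EE :: "'b set \<Rightarrow> complex" where
  "EE S = (\<Sum>T\<in>Sp \<omega> S. chi S T) / of_nat (card (Sp \<omega> S))"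

lemma chi_conj:
  assumes "nondeg \<omega> S" "g \<in> Sp \<omega> S" "T \<in> Sp \<omega> S"
  shows "chi S (g \<circ> T \<circ> inv_into UNIV g) = chi S T"
  using assms unfolding chi_def conj_funpow[OF Sp_bij[OF assms(1,2)]]
  by (simp add: tr_conj SpD(1) Sp_funpow)

lemma card_Sp_pos: "finite S \<Longrightarrow> card (Sp \<omega> S) > 0"
  using finite_Sp Sp_id card_gt_0_iff by blast

text \<open>Both sides count the triples \<open>(T, x, g)\<close> where \<open>g\<close> carries the given orbit to the orbit of
  \<open>x\<close> under \<open>T\<close>; by Witt's theorem every \<open>(T, x)\<close> with the given data occurs.\<close>

lemma sum_over_data_class:
  fixes F :: "('b \<Rightarrow> 'b) \<Rightarrow> complex"
  assumes O: "symplectic_orbit scale \<omega> S T x"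
    and F: "\<And>g U. g \<in> Sp \<omega> S \<Longrightarrow> U \<in> Sp \<omega> S \<Longrightarrow> F (g \<circ> U \<circ> inv_into UNIV g) = F U"
  defines "\<Omega> \<equiv> {(U, y). U \<in> Sp \<omega> S \<and> y \<in> S \<and> dl U y = dl T x \<and> dh U y = dh T x}"
    and "M \<equiv> {U \<in> Sp \<omega> S. \<forall>p. U (pact T p x) = T (pact T p x)}"
  shows "of_nat (card M) * (\<Sum>(U, y)\<in>\<Omega>. F U) = of_nat (card (Sp \<omega> S)) * (\<Sum>U\<in>M. F U)"
proof -
  interpret O: symplectic_orbit scale \<omega> S T x by (rule O)
  have fS: "finite S" using nondegD(2)[OF O.nS] .
  have fSp: "finite (Sp \<omega> S)" by (rule finite_Sp[OF fS])
  define G where "G = (\<lambda>(U, y). {g \<in> Sp \<omega> S. \<forall>p. g (pact T p x) = pact U p y})"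
  have f\<Omega>: "finite \<Omega>" by (rule finite_subset[of _ "Sp \<omega> S \<times> S"]) (use fSp fS in \<open>auto simp: \<Omega>_def\<close>)
  have so: "symplectic_orbit scale \<omega> S U y" if "U \<in> Sp \<omega> S" "y \<in> S" for U y
    by unfold_locales (use O.nS that in auto)
  have Tp: "T (pact T p x) = pact T (pCons 0 p) x" for p by (simp add: O.ca.pact_pCons[OF O.xS])
  have cardG: "card (G \<tau>) = card M" if \<tau>: "\<tau> \<in> \<Omega>" for \<tau>
  proof -
    obtain U y where Uy: "\<tau> = (U, y)" "U \<in> Sp \<omega> S" "y \<in> S" "dl T x = dl U y" "dh T x = dh U y"
      using \<tau> by (auto simp: \<Omega>_def)
    obtain g where g: "g \<in> Sp \<omega> S" "\<And>p. g (pact T p x) = pact U p y"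
      using orbit_transitive[OF O so[OF Uy(2,3)] Uy(4,5)] by metis
    interpret g: symplectic_map scale \<omega> S g by unfold_locales (use O.nS g in auto)
    \<comment> \<open>Two choices of \<open>g\<close> differ by an isometry fixing the cyclic space
      pointwise; these isometries are the \<open>T^-1 V\<close> with \<open>V\<close> in
      \<open>M\<close>.\<close>
    have "bij_betw (\<lambda>V. g \<circ> O.T' \<circ> V) M (G \<tau>)"
    proof (rule bij_betwI[where g = "\<lambda>s. T \<circ> g.T' \<circ> s"])
      show "(\<lambda>V. g \<circ> O.T' \<circ> V) \<in> M \<rightarrow> G \<tau>"
        using g Sp_comp[OF Sp_comp[OF g(1) O.T'Sp]] by (auto simp: M_def G_def Uy(1))
      show "(\<lambda>s. T \<circ> g.T' \<circ> s) \<in> G \<tau> \<rightarrow> M"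
        using g(2) g.T'T Sp_comp[OF Sp_comp[OF O.TSp g.T'Sp]] by (auto simp: M_def G_def Uy(1)) (metis g.T'T)
    qed (auto simp: fun_eq_iff)
    then show ?thesis using bij_betw_same_card by metis
  qed
  have Op: "symplectic_orbit scale \<omega> S U x" if "U \<in> M" for U using so that O.xS by (auto simp: M_def)
  have "of_nat (card M) * (\<Sum>(U, y)\<in>\<Omega>. F U) = (\<Sum>\<tau>\<in>\<Omega>. \<Sum>g\<in>G \<tau>. F (fst \<tau>))"
    by (simp add: cardG sum_distrib_left case_prod_beta)
  also have "\<dots> = (\<Sum>(\<tau>, g)\<in>Sigma \<Omega> G. F (fst \<tau>))"
    by (rule sum.Sigma) (use f\<Omega> fSp in \<open>auto simp: G_def\<close>)
  \<comment> \<open>Conjugating by \<open>g\<close> moves \<open>(U, y)\<close> back to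
    \<open>x\<close>, where the conjugate agrees with \<open>T\<close> on the cyclic space;
    \<open>g\<close> and that element of \<open>M\<close> determine the triple.\<close>
  also have "\<dots> = (\<Sum>(g, U)\<in>Sp \<omega> S \<times> M. F U)"
  proof (rule sum.reindex_bij_witness[of _ "\<lambda>(g, U). ((g \<circ> U \<circ> inv_into UNIV g, g x), g)"
        "\<lambda>(\<tau>, g). (g, inv_into UNIV g \<circ> fst \<tau> \<circ> g)"])
    fix a assume a: "a \<in> Sigma \<Omega> G"
    obtain U y g where e: "a = ((U, y), g)" by (metis prod.exhaust)
    have U: "U \<in> Sp \<omega> S" "y \<in> S" and g: "g \<in> Sp \<omega> S" "\<And>p. g (pact T p x) = pact U p y"
      using a by (auto simp: e \<Omega>_def G_def)
    interpret g: symplectic_map scale \<omega> S g by unfold_locales (use O.nS g in auto)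
    interpret U: symplectic_orbit scale \<omega> S U y by (rule so[OF U])
    have gx: "g x = y" using g(2)[of 1] by simp
    show "(case case a of (\<tau>, g) \<Rightarrow> (g, inv_into UNIV g \<circ> fst \<tau> \<circ> g) of
        (g, U) \<Rightarrow> ((g \<circ> U \<circ> inv_into UNIV g, g x), g)) = a"
      using gx by (simp add: e fun_eq_iff)
    have "(g.T' \<circ> U \<circ> g) (pact T p x) = T (pact T p x)" for p
    proof -
      have "U (g (pact T p x)) = g (T (pact T p x))"
        unfolding g(2) Tp by (simp add: U.ca.pact_pCons[OF U.xS])
      then show ?thesis by simp
    qed
    then show "(case a of (\<tau>, g) \<Rightarrow> (g, inv_into UNIV g \<circ> fst \<tau> \<circ> g)) \<in> Sp \<omega> S \<times> M"
      using g(1) Sp_comp[OF Sp_comp[OF g.T'Sp U(1)] g(1)] by (auto simp: e M_def)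
    show "(case case a of (\<tau>, g) \<Rightarrow> (g, inv_into UNIV g \<circ> fst \<tau> \<circ> g) of (g, U) \<Rightarrow> F U)
        = (case a of (\<tau>, g) \<Rightarrow> F (fst \<tau>))"
    proof -
      have "F (g.T' \<circ> U \<circ> inv_into UNIV g.T') = F U" by (rule F[OF g.T'Sp U(1)])
      moreover have "inv_into UNIV g.T' = g" using Sp_bij[OF O.nS g(1)] by (simp add: inv_inv_eq)
      ultimately show ?thesis by (simp add: e)
    qed
  next
    fix a assume a: "a \<in> Sp \<omega> S \<times> M"
    obtain g U where e: "a = (g, U)" by (metis prod.exhaust)
    have g: "g \<in> Sp \<omega> S" and U: "U \<in> Sp \<omega> S" "\<And>p. U (pact T p x) = T (pact T p x)"
      using a by (auto simp: e M_def)
    interpret g: symplectic_map scale \<omega> S g by unfold_locales (use O.nS g in auto)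
    show "(case case a of (g, U) \<Rightarrow> ((g \<circ> U \<circ> inv_into UNIV g, g x), g) of
        (\<tau>, g) \<Rightarrow> (g, inv_into UNIV g \<circ> fst \<tau> \<circ> g)) = a"
      by (simp add: e fun_eq_iff)
    define V where "V = g \<circ> U \<circ> g.T'"
    have V: "V \<in> Sp \<omega> S" unfolding V_def by (intro Sp_comp g U(1) g.T'Sp)
    have c: "V (g (pact T p x)) = g (T (pact T p x))" for p using U(2) by (simp add: V_def)
    note tp = orbit_transport[OF O V g c]
    show "(case a of (g, U) \<Rightarrow> ((g \<circ> U \<circ> inv_into UNIV g, g x), g)) \<in> Sigma \<Omega> G"
      unfolding e prod.case V_def[symmetric] using V tp g g.T_mem[OF O.xS] by (simp add: \<Omega>_def G_def)
  qed
  also have "\<dots> = (\<Sum>g\<in>Sp \<omega> S. \<Sum>U\<in>M. F U)" by (rule sum.cartesian_product[symmetric])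
  finally show ?thesis by simp
qed

text \<open>The sum over the class reduces to the set \<open>M\<close> of isometries that agree with
  \<open>T\<close> on the cyclic space. \<open>M\<close> is stable under right multiplication by
  \<open>E y\<close>, and averaging over \<open>y\<close> splits \<open>chi\<close> into a constant
  and the average over \<open>V\<close>.\<close>

lemma data_class:
  assumes O: "symplectic_orbit scale \<omega> S T x"
  defines "\<Omega> \<equiv> {(U, y). U \<in> Sp \<omega> S \<and> y \<in> S \<and> dl U y = dl T x \<and> dh U y = dh T x}"
    and "N \<equiv> degree (smin (dl T x)) + degree (dh T x)"
  obtains V where "nondeg \<omega> V" "card S = CARD('a) ^ (2 * N) * card V" "V \<subseteq> S"
    "card \<Omega> = card (Sp \<omega> S)"
    "(\<Sum>(U, y)\<in>\<Omega>. chi S U) = of_nat (card (Sp \<omega> S)) * XX (dl T x, dh T x) * EE V"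
proof -
  interpret O: symplectic_orbit scale \<omega> S T x by (rule O)
  have fS: "finite S" using nondegD(2)[OF O.nS] .
  have fSp: "finite (Sp \<omega> S)" by (rule finite_Sp[OF fS])
  define M where "M = {U \<in> Sp \<omega> S. \<forall>p. U (pact T p x) = T (pact T p x)}"
  have fM: "finite M" using fSp by (simp add: M_def)
  have "T \<in> M" using O.TSp by (simp add: M_def)
  then have cM: "(of_nat (card M) :: complex) \<noteq> 0" using fM by auto
  \<comment> \<open>The constant function shows that each class has as many elements as the group,
    whatever the data.\<close>
  have one: "of_nat (card M) * of_nat (card \<Omega>) = (of_nat (card (Sp \<omega> S)) * of_nat (card M) :: complex)"
    using sum_over_data_class[OF O, of "\<lambda>_. 1"] by (simp add: \<Omega>_def M_def case_prod_beta)
  then have "(of_nat (card \<Omega>) :: complex) = of_nat (card (Sp \<omega> S))" using cM by simp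
  then have c\<Omega>: "card \<Omega> = card (Sp \<omega> S)" by simp
  obtain V E where V: "nondeg \<omega> V" "V \<subseteq> S" "card S = CARD('a) ^ (2 * (degree O.f + degree O.hR)) * card V"
    and E: "\<And>y. y \<in> Sp \<omega> V \<Longrightarrow> E y \<in> Sp \<omega> S" "\<And>y w. y \<in> Sp \<omega> V \<Longrightarrow> w \<in> O.W \<Longrightarrow> E y w = w"
    and av: "\<And>T1. T1 \<in> Sp \<omega> S \<Longrightarrow> (\<And>w. w \<in> O.W \<Longrightarrow> T1 w = T w) \<Longrightarrow> \<exists>m\<in>Sp \<omega> V. \<forall>y\<in>Sp \<omega> V. \<forall>k\<ge>1.
      tr S ((T1 \<circ> E y) ^^ k) = pw (O.ca.mpol x) k + pw (rstar O.hR) k + tr V ((m \<circ> y) ^^ k)"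
  proof (rule O.orbit_average)
    fix V E
    assume a: "nondeg \<omega> V" "V \<subseteq> S" "card S = CARD('a) ^ (2 * (degree O.f + degree O.hR)) * card V"
      "\<And>y. y \<in> Sp \<omega> V \<Longrightarrow> E y \<in> Sp \<omega> S" "\<And>y w. y \<in> Sp \<omega> V \<Longrightarrow> w \<in> O.W \<Longrightarrow> E y w = w"
      "\<And>T1. T1 \<in> Sp \<omega> S \<Longrightarrow> (\<And>w. w \<in> O.W \<Longrightarrow> T1 w = T w) \<Longrightarrow> \<exists>m\<in>Sp \<omega> V. \<forall>y\<in>Sp \<omega> V. \<forall>k\<ge>1.
      tr S ((T1 \<circ> E y) ^^ k) = pw (O.ca.mpol x) k + pw (rstar O.hR) k + tr V ((m \<circ> y) ^^ k)"
    show thesis by (rule that[OF a])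
  qed
  define cx where "cx = XX (dl T x, dh T x)"
  have cx: "cx = \<psi> (\<Sum>i<K. t i * (pw (O.ca.mpol x) (b i) + pw (rstar O.hR) (b i)))"
    by (simp add: cx_def XX_def O.mpol_x O.f_def O.dh_eq)
  have inner: "(\<Sum>y\<in>Sp \<omega> V. chi S (U \<circ> E y)) = cx * (\<Sum>y\<in>Sp \<omega> V. chi V y)" if U: "U \<in> M" for U
  proof -
    have "U w = T w" if "w \<in> O.W" for w using U that by (auto simp: M_def O.ca.cyc_def)
    then obtain m where m: "m \<in> Sp \<omega> V" "\<And>y k. y \<in> Sp \<omega> V \<Longrightarrow> k \<ge> 1 \<Longrightarrow>
        tr S ((U \<circ> E y) ^^ k) = pw (O.ca.mpol x) k + pw (rstar O.hR) k + tr V ((m \<circ> y) ^^ k)"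
      using av[of U] U unfolding M_def by blast
    interpret m: symplectic_map scale \<omega> V m by unfold_locales (use V m in auto)
    have "chi S (U \<circ> E y) = cx * chi V (m \<circ> y)" if y: "y \<in> Sp \<omega> V" for y
    proof -
      have "(\<Sum>i<K. t i * tr S ((U \<circ> E y) ^^ b i))
          = (\<Sum>i<K. t i * (pw (O.ca.mpol x) (b i) + pw (rstar O.hR) (b i))) + (\<Sum>i<K. t i * tr V ((m \<circ> y) ^^ b i))"
        unfolding sum.distrib[symmetric]
      proof (rule sum.cong[OF refl])
        fix i assume "i \<in> {..<K}"
        then have "b i \<ge> 1" using b_pos by simp
        from m(2)[OF y this] show "t i * tr S ((U \<circ> E y) ^^ b i)
            = t i * (pw (O.ca.mpol x) (b i) + pw (rstar O.hR) (b i)) + t i * tr V ((m \<circ> y) ^^ b i)"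
          by (simp only: distrib_left)
      qed
      then show ?thesis unfolding chi_def cx by (simp add: psi_add)
    qed
    then have "(\<Sum>y\<in>Sp \<omega> V. chi S (U \<circ> E y)) = cx * (\<Sum>y\<in>Sp \<omega> V. chi V (m \<circ> y))"
      by (simp add: sum_distrib_left)
    also have "(\<Sum>y\<in>Sp \<omega> V. chi V (m \<circ> y)) = (\<Sum>y\<in>Sp \<omega> V. chi V y)"
      by (rule sum.reindex_bij_witness[of _ "\<lambda>y. m.T' \<circ> y" "\<lambda>y. m \<circ> y"])
        (auto simp: fun_eq_iff intro: Sp_comp m(1) m.T'Sp)
    finally show ?thesis .
  qed
  have shift: "(\<Sum>U\<in>M. chi S (U \<circ> E y)) = (\<Sum>U\<in>M. chi S U)" if y: "y \<in> Sp \<omega> V" for y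
  proof -
    interpret y: symplectic_map scale \<omega> S "E y" by unfold_locales (use O.nS E(1)[OF y] in auto)
    have fixW: "E y (pact T p x) = pact T p x" for p using E(2)[OF y] O.ca.cycI by blast
    then have fixW': "y.T' (pact T p x) = pact T p x" for p by (metis y.T'T)
    show ?thesis
      by (rule sum.reindex_bij_witness[of _ "\<lambda>U. U \<circ> y.T'" "\<lambda>U. U \<circ> E y"])
        (auto simp: fun_eq_iff M_def fixW fixW' intro: Sp_comp E(1)[OF y] y.T'Sp)
  qed
  have cV: "card (Sp \<omega> V) > 0" by (rule card_Sp_pos[OF nondegD(2)[OF V(1)]])
  have "of_nat (card (Sp \<omega> V)) * (\<Sum>U\<in>M. chi S U) = (\<Sum>y\<in>Sp \<omega> V. \<Sum>U\<in>M. chi S (U \<circ> E y))"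
    by (simp add: shift)
  also have "\<dots> = (\<Sum>U\<in>M. \<Sum>y\<in>Sp \<omega> V. chi S (U \<circ> E y))" by (rule sum.swap)
  also have "\<dots> = of_nat (card M) * (cx * (\<Sum>y\<in>Sp \<omega> V. chi V y))" by (simp add: inner)
  also have "(\<Sum>y\<in>Sp \<omega> V. chi V y) = of_nat (card (Sp \<omega> V)) * EE V" using cV by (simp add: EE_def)
  finally have sM: "(\<Sum>U\<in>M. chi S U) = of_nat (card M) * cx * EE V" using cV by simp
  have "of_nat (card M) * (\<Sum>(U, y)\<in>\<Omega>. chi S U) = of_nat (card (Sp \<omega> S)) * (\<Sum>U\<in>M. chi S U)"
    using sum_over_data_class[OF O, of "chi S"] chi_conj[OF O.nS] by (simp add: \<Omega>_def M_def)
  then have "(\<Sum>(U, y)\<in>\<Omega>. chi S U) = of_nat (card (Sp \<omega> S)) * cx * EE V" using sM cM by simp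
  then show ?thesis using that[of V] V c\<Omega> by (simp add: cx_def N_def O.f_def O.dh_eq)
qed

text \<open>Every data class with \<open>dsize \<delta> \<le> n\<close> is realised, because there are exactly \<open>q\<^sup>2\<^sup>n\<close> of
  them and each realised class accounts for \<open>|Sp|\<close> of the \<open>q\<^sup>2\<^sup>n |Sp|\<close> pairs.\<close>

lemma EE_recursion:
  assumes S: "nondeg \<omega> S" "card S = CARD('a) ^ (2 * n)"
    and IH: "\<And>m V. m < n \<Longrightarrow> nondeg \<omega> V \<Longrightarrow> card V = CARD('a) ^ (2 * m) \<Longrightarrow> EE V = e m"
    and en: "e n = EE S"
  shows "of_nat (CARD('a) ^ (2 * n)) * e n = (\<Sum>\<delta>\<in>{\<delta> \<in> data. dsize \<delta> \<le> n}. XX \<delta> * e (n - dsize \<delta>))"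
proof -
  have fS: "finite S" using nondegD(2)[OF S(1)] .
  have fSp: "finite (Sp \<omega> S)" by (rule finite_Sp[OF fS])
  have cSp: "card (Sp \<omega> S) > 0" by (rule card_Sp_pos[OF fS])
  have q2: "CARD('a) > 1"
  proof -
    have "card {0, 1 :: 'a} \<le> CARD('a)" by (rule card_mono) auto
    then show ?thesis by simp
  qed
  define P where "P = Sp \<omega> S \<times> S"
  define D where "D = (\<lambda>(U, y). (dl U y, dh U y)) ` P"
  define \<Omega> where "\<Omega> = (\<lambda>\<delta>. {p \<in> P. (\<lambda>(U, y). (dl U y, dh U y)) p = \<delta>})"
  have fP: "finite P" using fSp fS by (simp add: P_def)
  have so: "symplectic_orbit scale \<omega> S U y" if "U \<in> Sp \<omega> S" "y \<in> S" for U y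
    by unfold_locales (use S that in auto)
  have cls: "\<delta> \<in> data \<and> dsize \<delta> \<le> n \<and> card (\<Omega> \<delta>) = card (Sp \<omega> S) \<and>
      (\<Sum>(U, y)\<in>\<Omega> \<delta>. chi S U) = of_nat (card (Sp \<omega> S)) * (XX \<delta> * e (n - dsize \<delta>))" if \<delta>: "\<delta> \<in> D" for \<delta>
  proof -
    obtain T x where Tx: "T \<in> Sp \<omega> S" "x \<in> S" and d: "\<delta> = (dl T x, dh T x)" using \<delta> by (auto simp: D_def P_def)
    interpret O: symplectic_orbit scale \<omega> S T x by (rule so[OF Tx])
    have \<Omega>: "\<Omega> \<delta> = {(U, y). U \<in> Sp \<omega> S \<and> y \<in> S \<and> dl U y = dl T x \<and> dh U y = dh T x}"
      by (auto simp: \<Omega>_def P_def d)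
    obtain V where V: "nondeg \<omega> V" "card S = CARD('a) ^ (2 * (degree (smin (dl T x)) + degree (dh T x))) * card V" "V \<subseteq> S"
      "card (\<Omega> \<delta>) = card (Sp \<omega> S)"
      "(\<Sum>(U, y)\<in>\<Omega> \<delta>. chi S U) = of_nat (card (Sp \<omega> S)) * XX (dl T x, dh T x) * EE V"
      by (rule data_class[OF so[OF Tx], folded \<Omega>]) (rule that)
    have "O.f \<noteq> 0" "O.f \<in> seq_ann (dl T x)" using O.f_monic O.f_dvd[of O.f] by force+
    moreover have "lead_coeff O.hR = 1" "coeff O.hR 0 \<noteq> 0"
      unfolding O.hR_def by (rule O.ca.mpol(1)[OF O.xRS], rule O.coeff_mpol_0[OF O.xRS])
    ultimately have dat: "\<delta> \<in> data" by (auto simp: data_def d O.dh_eq)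
    define N where "N = dsize \<delta>"
    have cS: "CARD('a) ^ (2 * n) = CARD('a) ^ (2 * N) * card V"
      using V(2) S(2) by (simp add: N_def dsize_def d)
    have "0 \<in> V" using subspace_0[OF nondegD(1)[OF V(1)]] .
    then have cV: "card V > 0" using nondegD(2)[OF V(1)] card_gt_0_iff by blast
    have N: "N \<le> n"
    proof (rule ccontr)
      assume "\<not> N \<le> n"
      then have "CARD('a) ^ (2 * n) < CARD('a) ^ (2 * N)" using q2 by (intro power_strict_increasing) auto
      also have "\<dots> \<le> CARD('a) ^ (2 * N) * card V" using cV by simp
      finally show False using cS by simp
    qed
    have "CARD('a) ^ (2 * n) = CARD('a) ^ (2 * N) * CARD('a) ^ (2 * (n - N))"
    proof -
      have "2 * N + 2 * (n - N) = 2 * n" using N by simp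
      then show ?thesis by (simp only: power_add[symmetric])
    qed
    then have cV': "card V = CARD('a) ^ (2 * (n - N))" using cS q2 by simp
    \<comment> \<open>For \<open>N = 0\<close> the space \<open>V\<close> is all of
      \<open>S\<close>, outside the range of \<open>IH\<close>; this is the purpose of the
      assumption \<open>en\<close>.\<close>
    have "EE V = e (n - N)"
    proof (cases "N = 0")
      case True
      then have "V = S" using card_subset_eq[OF fS V(3)] cV' S(2) by simp
      then show ?thesis using True en by simp
    next
      case False
      then show ?thesis using IH[OF _ V(1) cV'] N by simp
    qed
    then show ?thesis using dat N V(4,5) unfolding N_def by (simp add: d)
  qed
  have fD: "finite D" using fP by (simp add: D_def)
  have "card P = (\<Sum>\<delta>\<in>D. card (\<Omega> \<delta>))"
    using sum.group[OF fP fD, of "\<lambda>(U, y). (dl U y, dh U y)" "\<lambda>_. 1::nat"] by (simp add: D_def \<Omega>_def)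
  also have "\<dots> = card D * card (Sp \<omega> S)" using cls by simp
  finally have "card D = CARD('a) ^ (2 * n)"
    using cSp S(2) by (simp add: P_def card_cartesian_product)
  then have "card D = card {\<delta> \<in> (data :: ((nat \<Rightarrow> 'a) \<times> 'a poly) set). dsize \<delta> \<le> n}"
    by (simp only: card_data[OF two_nz])
  then have D: "D = {\<delta> \<in> data. dsize \<delta> \<le> n}"
    using card_subset_eq[OF finite_data, of D] cls by blast
  have "of_nat (CARD('a) ^ (2 * n)) * (\<Sum>T\<in>Sp \<omega> S. chi S T) = (\<Sum>T\<in>Sp \<omega> S. \<Sum>x\<in>S. chi S T)"
    by (simp add: S(2) sum_distrib_left)
  also have "\<dots> = (\<Sum>(T, x)\<in>P. chi S T)" unfolding P_def by (rule sum.cartesian_product)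
  also have "\<dots> = (\<Sum>\<delta>\<in>D. \<Sum>(T, x)\<in>\<Omega> \<delta>. chi S T)"
    using sum.group[OF fP fD, of "\<lambda>(U, y). (dl U y, dh U y)" "\<lambda>(T, x). chi S T"] by (simp add: D_def \<Omega>_def)
  also have "\<dots> = of_nat (card (Sp \<omega> S)) * (\<Sum>\<delta>\<in>D. XX \<delta> * e (n - dsize \<delta>))"
    using cls by (simp add: sum_distrib_left)
  finally have "of_nat (CARD('a) ^ (2 * n)) * EE S = (\<Sum>\<delta>\<in>D. XX \<delta> * e (n - dsize \<delta>))"
    using cSp by (simp add: EE_def divide_simps mult.commute)
  then show ?thesis using D en by simp
qed

section \<open>Solving the recursion and bounding its solution\<close>

lemma fps_nth_0: "fps_nth Af 0 = 1" "fps_nth Bf 0 = 1" "fps_nth Cf 0 = 1"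
proof -
  have "Y 1 = Y 1 * Y 1" using Y_mult[of 1 1] by simp
  moreover have "Y 1 \<noteq> 0" using norm_Y[of 1] by auto
  ultimately have Y1: "Y 1 = 1" by simp
  have k: "kappa (1 :: 'a poly) = 1" using sum_kappa[OF two_nz, of 0] by (simp add: monics_0)
  show A: "fps_nth Af 0 = 1" and B: "fps_nth Bf 0 = 1" by (simp_all add: Af_def Bf_def monics_0 Y1 k)
  show "fps_nth Cf 0 = 1" by (simp add: C_factorisation Aq_def A B)
qed

text \<open>The recursion solved for its highest term, which is possible because \<open>Cf\<close>
  has constant term 1 and \<open>q^(2n)\<close> differs from 1.\<close>

fun ee :: "nat \<Rightarrow> complex" where
  "ee n = (if n = 0 then 1
    else (\<Sum>N\<in>{1..n}. fps_nth Cf N * ee (n - N)) / (of_nat (CARD('a) ^ (2 * n)) - 1))"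

declare ee.simps [simp del]

lemma CARD_gt_1: "CARD('a) > 1"
proof -
  have "card {0, 1 :: 'a} \<le> CARD('a)" by (rule card_mono) auto
  then show ?thesis by simp
qed

lemma CARD_pow_gt_1: "n > 0 \<Longrightarrow> CARD('a) ^ (2 * n) > 1"
  by (intro one_less_power CARD_gt_1) simp

lemma ee_unique:
  assumes n: "n > 0" and r: "of_nat (CARD('a) ^ (2 * n)) * c = (\<Sum>N\<le>n. fps_nth Cf N * (ee(n := c)) (n - N))"
  shows "c = ee n"
proof -
  define Q where "Q = (of_nat (CARD('a) ^ (2 * n)) :: complex)"
  have Q1: "Q - 1 \<noteq> 0"
  proof
    assume "Q - 1 = 0"
    then have "Q = of_nat 1" by simp
    then have "CARD('a) ^ (2 * n) = 1" unfolding Q_def of_nat_eq_iff .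
    then show False using CARD_pow_gt_1[OF n] by linarith
  qed
  have s: "{..n} = insert 0 {1..n}" by auto
  have "Q * c = c + (\<Sum>N\<in>{1..n}. fps_nth Cf N * (ee(n := c)) (n - N))"
    using r unfolding s Q_def[symmetric] by (simp add: fps_nth_0)
  also have "(\<Sum>N\<in>{1..n}. fps_nth Cf N * (ee(n := c)) (n - N)) = (\<Sum>N\<in>{1..n}. fps_nth Cf N * ee (n - N))"
    using n by (intro sum.cong) auto
  finally have "(Q - 1) * c = (\<Sum>N\<in>{1..n}. fps_nth Cf N * ee (n - N))" by (simp add: left_diff_distrib)
  then have "c = (\<Sum>N\<in>{1..n}. fps_nth Cf N * ee (n - N)) / (Q - 1)" using Q1 by (simp add: nonzero_eq_divide_eq mult.commute)
  then show ?thesis using n by (simp only: ee.simps[of n] Q_def[symmetric]) simp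
qed

lemma ee_recursion: "of_nat (CARD('a) ^ (2 * n)) * ee n = (\<Sum>N\<le>n. fps_nth Cf N * ee (n - N))"
proof (cases "n = 0")
  case True
  then show ?thesis by (simp add: fps_nth_0)
next
  case False
  define Q where "Q = (of_nat (CARD('a) ^ (2 * n)) :: complex)"
  have Q1: "Q - 1 \<noteq> 0"
  proof
    assume "Q - 1 = 0"
    then have "Q = of_nat 1" by simp
    then have "CARD('a) ^ (2 * n) = 1" unfolding Q_def of_nat_eq_iff .
    then show False using CARD_pow_gt_1[of n] False by linarith
  qed
  have s: "{..n} = insert 0 {1..n}" by auto
  have "ee n = (\<Sum>N\<in>{1..n}. fps_nth Cf N * ee (n - N)) / (Q - 1)"
    using False by (simp only: ee.simps[of n] Q_def[symmetric]) simp
  then have "(Q - 1) * ee n = (\<Sum>N\<in>{1..n}. fps_nth Cf N * ee (n - N))" using Q1 by simp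
  then show ?thesis unfolding s Q_def[symmetric] by (simp add: fps_nth_0 algebra_simps)
qed

lemma EE_trivial:
  assumes S: "nondeg \<omega> S" "card S = 1"
  shows "EE S = 1"
proof -
  have sub: "subspace S" using nondegD(1)[OF S(1)] .
  have S0: "S = {0}" using S(2) subspace_0[OF sub] by (auto simp: card_1_singleton_iff)
  have "Sp \<omega> S = {id}"
  proof (intro equalityI subsetI)
    fix T assume T: "T \<in> Sp \<omega> S"
    have "T x = x" for x
      using SpD(2)[OF T, of x] lin_on_0[OF SpD(1)[OF T] sub] by (cases "x = 0") (auto simp: S0)
    then show "T \<in> {id}" by auto
  qed (use Sp_id in auto)
  moreover have "chi S id = 1"
  proof -
    have "tr S A = 0" if A: "lin_on S A" for A
      using tr_eq[of "{}" S A] A by (simp add: S0 independent_empty)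
    then have "tr S (id ^^ k) = 0" for k
      using lin_on_funpow[of S id k] by (simp add: lin_on_def)
    then show ?thesis by (simp add: chi_def psi_0)
  qed
  ultimately show ?thesis by (simp add: EE_def)
qed

lemma EE_eq_ee: "nondeg \<omega> S \<Longrightarrow> card S = CARD('a) ^ (2 * n) \<Longrightarrow> EE S = ee n"
proof (induction n arbitrary: S rule: less_induct)
  case (less n)
  show ?case
  proof (cases "n = 0")
    case True
    then show ?thesis using EE_trivial less.prems by (simp add: ee.simps)
  next
    case False
    \<comment> \<open>That \<open>EE S\<close> equals \<open>ee n\<close> is still to be shown, so
      the value at \<open>n\<close> is patched in and \<open>ee_unique\<close> removes the
      patch.\<close>
    define e where "e = ee(n := EE S)"
    have en: "e n = EE S" by (simp add: e_def)
    have "of_nat (CARD('a) ^ (2 * n)) * e n = (\<Sum>\<delta>\<in>{\<delta> \<in> data. dsize \<delta> \<le> n}. XX \<delta> * e (n - dsize \<delta>))"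
      by (rule EE_recursion[where e = e, OF less.prems _ en]) (use less.IH in \<open>simp add: e_def\<close>)
    then show ?thesis
      unfolding sum_data en using ee_unique[of n "EE S"] False unfolding e_def by blast
  qed
qed

text \<open>\<open>Af\<close> and \<open>Bf\<close> vanish a fortiori beyond any
  \<open>\<beta>\<close> that is at least the largest active exponent \<open>b i0\<close>; hence one
  \<open>\<beta>\<close> serves all \<open>t\<close>.\<close>

lemma EE_bound:
  assumes i0: "i0 < K" "t i0 \<noteq> 0" "\<And>i. i < K \<Longrightarrow> i \<noteq> i0 \<Longrightarrow> t i \<noteq> 0 \<Longrightarrow> b i < b i0" "of_nat (b i0) \<noteq> (0::'a)"
    and u: "\<psi> u \<noteq> 1" and \<beta>: "b i0 \<le> \<beta>"
    and S: "nondeg \<omega> S" "card S = CARD('a) ^ (2 * n)"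
  shows "cmod (EE S) \<le> real CARD('a) powr (- (real n ^ 2) / (2 * real \<beta>)) * real CARD('a) powr (real n / 2)
    * (1 + 1 / (real CARD('a) ^ 2 - 1)) ^ n * real ((n + 2 * \<beta> - 1) choose n)"
proof -
  have q: "real CARD('a) > 1"
    using CARD_gt_1 by simp
  have Aq: "Aq = fscale (of_real (real CARD('a))) Af"
    by (rule fps_ext) (simp add: Aq_def)
  have "cmod (ee n) \<le> fps_nth (Fhat (real CARD('a)) \<beta>) n"
  proof (rule recursion_bound[OF q, of ee Af Bf])
    show "of_real (real CARD('a) ^ (2 * n)) * ee n
        = (\<Sum>N\<le>n. fps_nth (fscale (of_real (real CARD('a))) Af * Bf) N * ee (n - N))" for n
      using ee_recursion[of n] unfolding C_factorisation Aq by simp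
    show "ee 0 = 1" by (simp add: ee.simps)
    show "fps_nth Af m = 0" if "m \<ge> \<beta>" for m
      by (rule A_zero[OF i0 u]) (use that \<beta> in auto)
    have "b i \<le> \<beta>" if "i < K" "t i \<noteq> 0" for i
      using i0(3)[OF that(1) _ that(2)] \<beta> by (cases "i = i0") auto
    then show "fps_nth Bf m = 0" if "m \<ge> \<beta> + 2" for m
      using B_zero[of \<beta> m] that by blast
  qed (simp_all add: fps_nth_0 norm_A norm_B)
  also have "\<dots> \<le> real CARD('a) powr (- (real n ^ 2) / (2 * real \<beta>)) * real CARD('a) powr (real n / 2)
    * sfac (real CARD('a)) ^ n * real ((n + 2 * \<beta> - 1) choose n)"
    by (rule Fhat_bound[OF q]) (use b_pos[OF i0(1)] \<beta> in simp)
  finally show ?thesis unfolding EE_eq_ee[OF S] sfac_def[OF q] .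
qed

end

section \<open>Matrices as operators\<close>

text \<open>The symplectic space is realised on the polynomials of degree less than \<open>m\<close>, the coefficients
  being the coordinates. Elements of \<open>Sp\<close> are by convention the identity outside the space, hence the
  second case of \<open>matop\<close>.\<close>

definition coords :: "nat \<Rightarrow> 'a::zero poly \<Rightarrow> 'a vec" where
  "coords m p = vec m (coeff p)"

definition of_coords :: "'a::zero vec \<Rightarrow> 'a poly" where
  "of_coords v = Poly (list_of_vec v)"

definition matop :: "nat \<Rightarrow> 'a::field mat \<Rightarrow> 'a poly \<Rightarrow> 'a poly" where
  "matop m M p = (if p \<in> polys_lt m then of_coords (M *\<^sub>v coords m p) else p)"

definition bil :: "nat \<Rightarrow> 'a::field mat \<Rightarrow> 'a poly \<Rightarrow> 'a poly \<Rightarrow> 'a" where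
  "bil m A x y = (\<Sum>i<m. \<Sum>j<m. coeff x i * A $$ (i, j) * coeff y j)"

lemma coords_carrier [simp]: "coords m p \<in> carrier_vec m" "dim_vec (coords m p) = m"
  by (simp_all add: coords_def)

lemma coeff_of_coords: "v \<in> carrier_vec m \<Longrightarrow> coeff (of_coords v) i = (if i < m then v $ i else 0)"
  by (auto simp: of_coords_def nth_default_def list_of_vec_index)

lemma of_coords_polys_lt: "v \<in> carrier_vec m \<Longrightarrow> of_coords v \<in> polys_lt m"
  by (simp add: polys_lt_def coeff_of_coords)

lemma coords_of_coords: "v \<in> carrier_vec m \<Longrightarrow> coords m (of_coords v) = v"
  by (intro eq_vecI) (auto simp: coords_def coeff_of_coords)

lemma of_coords_coords: "p \<in> polys_lt m \<Longrightarrow> of_coords (coords m p) = p"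
proof (intro poly_eqI)
  fix i assume "p \<in> polys_lt m"
  then show "coeff (of_coords (coords m p)) i = coeff p i"
    unfolding coeff_of_coords[OF coords_carrier(1)] by (auto simp: coords_def polys_lt_def)
qed

lemma coeff_matop:
  assumes "M \<in> carrier_mat m m" "p \<in> polys_lt m"
  shows "coeff (matop m M p) i = (if i < m then \<Sum>j<m. M $$ (i, j) * coeff p j else 0)"
proof -
  have c: "M *\<^sub>v coords m p \<in> carrier_vec m" using assms by simp
  show ?thesis
    unfolding matop_def if_P[OF assms(2)] coeff_of_coords[OF c]
    using assms(1) by (simp add: scalar_prod_def coords_def atLeast0LessThan)
qed

lemma matop_polys_lt: "M \<in> carrier_mat m m \<Longrightarrow> p \<in> polys_lt m \<Longrightarrow> matop m M p \<in> polys_lt m"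
  by (simp add: polys_lt_def coeff_matop)

lemma matop_mult:
  assumes "M \<in> carrier_mat m m" "N \<in> carrier_mat m m"
  shows "matop m (M * N) = matop m M \<circ> matop m N"
proof
  fix p
  show "matop m (M * N) p = (matop m M \<circ> matop m N) p"
  proof (cases "p \<in> polys_lt m")
    case True
    have N: "N *\<^sub>v coords m p \<in> carrier_vec m" using assms(2) by simp
    have "(M * N) *\<^sub>v coords m p = M *\<^sub>v (N *\<^sub>v coords m p)"
      by (rule assoc_mult_mat_vec[OF assms]) simp
    then show ?thesis using True by (simp add: matop_def coords_of_coords[OF N] of_coords_polys_lt[OF N])
  qed (simp add: matop_def)
qed

lemma matop_one: "matop m (1\<^sub>m m) = id"
  by (rule ext) (simp add: matop_def of_coords_coords)

lemma matop_pow: "M \<in> carrier_mat m m \<Longrightarrow> matop m (M ^\<^sub>m k) = matop m M ^^ k"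
proof (induction k)
  case 0
  then show ?case by (simp add: matop_one)
next
  case (Suc k)
  have "matop m (M ^\<^sub>m Suc k) = matop m M ^^ k \<circ> matop m M"
    using Suc by (simp add: matop_mult[OF pow_carrier_mat])
  then show ?case by (simp only: funpow_Suc_right)
qed

lemma matop_inj:
  fixes M N :: "'a::field mat"
  assumes "M \<in> carrier_mat m m" "N \<in> carrier_mat m m" "matop m M = matop m N"
  shows "M = N"
proof (rule eq_matI)
  fix i j assume ij: "i < dim_row N" "j < dim_col N"
  then have j: "j < m" and i: "i < m" using assms by auto
  have e: "monom (1::'a) j \<in> polys_lt m" using j by (simp add: polys_lt_def)
  have "coeff (matop m L (monom 1 j)) i = L $$ (i, j)" if "L \<in> carrier_mat m m" for L :: "'a mat"
    using i j by (simp add: coeff_matop[OF that e] if_distrib[of "\<lambda>x. _ * x"] sum.delta cong: if_cong)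
  from this[OF assms(1)] this[OF assms(2)] show "M $$ (i, j) = N $$ (i, j)" using assms(3) by simp
qed (use assms in auto)

lemma bil_add_left: "bil m A (x + y) z = bil m A x z + bil m A y z"
  and bil_add_right: "bil m A z (x + y) = bil m A z x + bil m A z y"
  by (simp_all add: bil_def distrib_left distrib_right sum.distrib)

lemma bil_smult_left: "bil m A (smult c x) z = c * bil m A x z"
  and bil_smult_right: "bil m A z (smult c x) = c * bil m A z x"
  by (simp_all add: bil_def sum_distrib_left mult_ac)

lemma bil_monom: "i < m \<Longrightarrow> j < m \<Longrightarrow> bil m A (monom 1 i) (monom 1 j) = A $$ (i, j)"
proof -
  assume ij: "i < m" "j < m"
  have "bil m A (monom 1 i) (monom 1 j) = (\<Sum>i'<m. if i' = i then \<Sum>j'<m. if j' = j then A $$ (i, j) else 0 else 0)"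
    unfolding bil_def
  proof (rule sum.cong[OF refl])
    fix i'
    show "(\<Sum>j'<m. coeff (monom 1 i) i' * A $$ (i', j') * coeff (monom 1 j) j')
      = (if i' = i then \<Sum>j'<m. if j' = j then A $$ (i, j) else 0 else 0)"
    proof (cases "i' = i")
      case True
      show ?thesis unfolding True if_P[OF refl] by (rule sum.cong[OF refl]) auto
    qed auto
  qed
  also have "\<dots> = A $$ (i, j)" using ij by simp
  finally show ?thesis .
qed

lemma bil_eq_scalar_prod:
  "A \<in> carrier_mat m m \<Longrightarrow> bil m A x y = coords m x \<bullet> (A *\<^sub>v coords m y)"
  by (simp add: bil_def scalar_prod_def coords_def atLeast0LessThan sum_distrib_left mult.assoc)

lemma bil_congruence:
  assumes "M \<in> carrier_mat m m" "A \<in> carrier_mat m m" "x \<in> polys_lt m" "y \<in> polys_lt m"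
  shows "bil m (transpose_mat M * A * M) x y = bil m A (matop m M x) (matop m M y)"
proof -
  have v: "M *\<^sub>v coords m z \<in> carrier_vec m" for z using assms(1) by simp
  have c: "coords m (matop m M z) = M *\<^sub>v coords m z" if "z \<in> polys_lt m" for z
    using that by (simp add: matop_def coords_of_coords[OF v])
  have Av: "A *\<^sub>v (M *\<^sub>v coords m y) \<in> carrier_vec m" using assms(2) v by simp
  have "(transpose_mat M * A * M) *\<^sub>v coords m y = transpose_mat M *\<^sub>v (A *\<^sub>v (M *\<^sub>v coords m y))"
    using assms by (simp add: assoc_mult_mat_vec[of _ m m _ m])
  then have "bil m (transpose_mat M * A * M) x y = coords m x \<bullet> (transpose_mat M *\<^sub>v (A *\<^sub>v (M *\<^sub>v coords m y)))"
    using assms by (simp add: bil_eq_scalar_prod)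
  also have "\<dots> = (transpose_mat M *\<^sub>v (A *\<^sub>v (M *\<^sub>v coords m y))) \<bullet> coords m x"
    using assms Av by (intro comm_scalar_prod[of _ m]) simp_all
  also have "\<dots> = (A *\<^sub>v (M *\<^sub>v coords m y)) \<bullet> (M *\<^sub>v coords m x)"
    by (rule transpose_vec_mult_scalar[OF assms(1) _ Av]) simp
  also have "\<dots> = (M *\<^sub>v coords m x) \<bullet> (A *\<^sub>v (M *\<^sub>v coords m y))"
    using Av v by (intro comm_scalar_prod[of _ m]) simp_all
  also have "\<dots> = bil m A (matop m M x) (matop m M y)"
    using assms by (simp add: bil_eq_scalar_prod c)
  finally show ?thesis .
qed

lemma bil_alternating:
  assumes two: "(2::'a::field) \<noteq> 0" and J: "J \<in> carrier_mat m m" "transpose_mat J = - J"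
  shows "bil m J x x = (0::'a)"
proof -
  have sk: "J $$ (j, i) = - J $$ (i, j)" if "i < m" "j < m" for i j
    using arg_cong[OF J(2), of "\<lambda>A. A $$ (i, j)"] J(1) that by auto
  have "bil m J x x = (\<Sum>j<m. \<Sum>i<m. coeff x i * J $$ (i, j) * coeff x j)" unfolding bil_def by (rule sum.swap)
  also have "\<dots> = (\<Sum>j<m. \<Sum>i<m. - (coeff x j * J $$ (j, i) * coeff x i))"
  proof (intro sum.cong refl)
    fix i j assume "i \<in> {..<m}" "j \<in> {..<m}"
    then have "J $$ (j, i) = - J $$ (i, j)" by (intro sk) auto
    then show "coeff x i * J $$ (i, j) * coeff x j = - (coeff x j * J $$ (j, i) * coeff x i)" by simp
  qed
  also have "\<dots> = - bil m J x x" by (simp add: bil_def sum_negf)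
  finally have "bil m J x x + bil m J x x = 0" by (rule eq_neg_iff_add_eq_0[THEN iffD1])
  then have "2 * bil m J x x = 0" by (simp only: mult_2)
  then show ?thesis using two by simp
qed

lemma alternating_form_bil:
  fixes J :: "'a::{field,finite} mat"
  assumes two: "(2::'a::{field,finite}) \<noteq> 0" and J: "J \<in> carrier_mat m m" "transpose_mat J = - J"
  shows "alternating_form smult (bil m J)"
  by unfold_locales
    (simp_all add: two smult_add_right smult_add_left bil_add_left bil_add_right bil_smult_left bil_smult_right
      bil_alternating[OF two J])

lemma bil_nondegenerate:
  assumes J: "J \<in> carrier_mat m m" "invertible_mat J" and x: "x \<in> polys_lt m"
    and z: "\<And>y. y \<in> polys_lt m \<Longrightarrow> bil m J x y = 0"
  shows "x = 0"
proof -
  obtain B where B: "J * B = 1\<^sub>m m" "B * J = 1\<^sub>m (dim_row B)"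
    using J unfolding invertible_mat_def inverts_mat_def by auto
  have Bc: "B \<in> carrier_mat m m"
    using arg_cong[OF B(1), of dim_col] arg_cong[OF B(2), of dim_col] J(1) by auto
  have "coeff x i = 0" if i: "i < m" for i
  proof -
    have v: "B *\<^sub>v unit_vec m i \<in> carrier_vec m" using Bc by simp
    have "J *\<^sub>v (B *\<^sub>v unit_vec m i) = unit_vec m i"
      using assoc_mult_mat_vec[OF J(1) Bc, of "unit_vec m i"] B(1) by simp
    then have "bil m J x (of_coords (B *\<^sub>v unit_vec m i)) = coords m x \<bullet> unit_vec m i"
      by (simp add: bil_eq_scalar_prod[OF J(1)] coords_of_coords[OF v])
    then show ?thesis using z[OF of_coords_polys_lt[OF v]] i by (simp add: coords_def)
  qed
  moreover have "coeff x i = 0" if "\<not> i < m" for i using x that by (simp add: polys_lt_def)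
  ultimately show ?thesis by (intro poly_eqI) (metis coeff_0)
qed

text \<open>\<open>J^-1 M^t J\<close> is a left inverse of \<open>M\<close>, hence a two-sided
  one.\<close>

lemma invertible_of_congruence:
  fixes J :: "'a::field mat"
  assumes J: "J \<in> carrier_mat m m" "invertible_mat J" and M: "M \<in> carrier_mat m m"
    and e: "transpose_mat M * J * M = J"
  shows "invertible_mat M"
proof -
  obtain B where B: "J * B = 1\<^sub>m m" "B * J = 1\<^sub>m (dim_row B)"
    using J unfolding invertible_mat_def inverts_mat_def by auto
  have Bc: "B \<in> carrier_mat m m"
    using arg_cong[OF B(1), of dim_col] arg_cong[OF B(2), of dim_col] J(1) by auto
  define L where "L = B * transpose_mat M * J"
  have Lc: "L \<in> carrier_mat m m" using Bc M J(1) by (simp add: L_def)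
  have "L * M = B * (transpose_mat M * J * M)"
    unfolding L_def using Bc M J(1) by (simp add: assoc_mult_mat[of _ m m _ m _ m])
  also have "\<dots> = 1\<^sub>m m" unfolding e using B(2) Bc by simp
  finally have LM: "L * M = 1\<^sub>m m" .
  then have "M * L = 1\<^sub>m m" using mat_mult_left_right_inverse[OF Lc M] by simp
  then show ?thesis using LM Lc M unfolding invertible_mat_def inverts_mat_def by auto
qed

section \<open>The isometry group of the coefficient space as a matrix group\<close>

context
  fixes m :: nat and J :: "'a::{field,finite} mat"
  assumes two: "(2::'a) \<noteq> 0" and J: "J \<in> carrier_mat m m" "invertible_mat J" "transpose_mat J = - J"
begin

interpretation form: alternating_form smult "bil m J"
  by (rule alternating_form_bil[OF two J(1,3)])

lemma subspace_polys_lt: "form.subspace (polys_lt m)"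
  by (rule form.subspaceI) (auto simp: polys_lt_def)

lemma polys_lt_expansion: "(p :: 'a poly) \<in> polys_lt m \<Longrightarrow> (\<Sum>i<m. smult (coeff p i) (monom 1 i)) = p"
proof (intro poly_eqI)
  fix k assume p: "p \<in> polys_lt m"
  have "coeff (\<Sum>i<m. smult (coeff p i) (monom 1 i)) k = (\<Sum>i<m. if i = k then coeff p k else 0)"
    unfolding coeff_sum by (intro sum.cong refl) auto
  also have "\<dots> = coeff p k" using p by (simp add: polys_lt_def)
  finally show "coeff (\<Sum>i<m. smult (coeff p i) (monom 1 i)) k = coeff p k" .
qed

lemma span_monom: "form.span (monom 1 ` {..<m}) = polys_lt m"
proof
  show "form.span (monom 1 ` {..<m}) \<subseteq> polys_lt m"
    by (rule form.span_minimal[OF _ subspace_polys_lt]) (auto simp: polys_lt_def)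
  show "polys_lt m \<subseteq> form.span (monom 1 ` {..<m})"
  proof
    fix p :: "'a poly" assume "p \<in> polys_lt m"
    then have "p = (\<Sum>i<m. smult (coeff p i) (monom 1 i))" by (simp add: polys_lt_expansion)
    also have "\<dots> \<in> form.span (monom 1 ` {..<m})"
      by (intro form.span_sum form.span_scale form.span_base) auto
    finally show "p \<in> form.span (monom 1 ` {..<m})" .
  qed
qed

lemma nondeg_polys_lt: "form.nondeg (bil m J) (polys_lt m)"
  unfolding form.nondeg_def
  using subspace_polys_lt finite_polys_lt by (auto intro!: bil_nondegenerate[OF J(1,2)])

lemma lin_on_matop:
  assumes "M \<in> carrier_mat m m"
  shows "form.lin_on (polys_lt m) (matop m M)"
proof -
  have s: "x + y \<in> polys_lt m" "smult c x \<in> polys_lt m" if "x \<in> polys_lt m" "y \<in> polys_lt m" for x y :: "'a poly" and c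
    using that by (auto simp: polys_lt_def)
  show ?thesis
    unfolding form.lin_on_def
  proof (intro conjI ballI allI)
    fix x y :: "'a poly" and c assume x: "x \<in> polys_lt m" and y: "y \<in> polys_lt m"
    show "matop m M (x + y) = matop m M x + matop m M y"
      by (rule poly_eqI) (simp add: coeff_matop[OF assms] s x y distrib_left sum.distrib)
  next
    fix x :: "'a poly" and c assume x: "x \<in> polys_lt m"
    show "matop m M x \<in> polys_lt m" by (rule matop_polys_lt[OF assms x])
    show "matop m M (smult c x) = smult c (matop m M x)"
      by (rule poly_eqI) (simp add: coeff_matop[OF assms] s[OF x x] x sum_distrib_left mult_ac)
  qed
qed

lemma tr_matop:
  assumes M: "M \<in> carrier_mat m m"
  shows "form.tr (polys_lt m) (matop m M) = mat_trace M"
proof -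
  have e: "monom 1 i \<in> (polys_lt m :: 'a poly set)" if "i < m" for i using that by (simp add: polys_lt_def)
  have "form.tr (polys_lt m) (matop m M) = (\<Sum>i<m. coeff (matop m M (monom 1 i)) i)"
    by (rule form.tr_dual(3)[OF _ span_monom lin_on_matop[OF M]]) auto
  also have "\<dots> = (\<Sum>i<m. M $$ (i, i))"
    by (rule sum.cong[OF refl])
      (simp add: coeff_matop[OF M e] if_distrib[of "\<lambda>x. _ * x"] sum.delta cong: if_cong)
  finally show ?thesis using M by (simp add: mat_trace_def)
qed

lemma bij_betw_matop:
  "bij_betw (matop m) {M \<in> carrier_mat m m. invertible_mat M \<and> transpose_mat M * J * M = J} (form.Sp (bil m J) (polys_lt m))"
proof (rule bij_betw_imageI)
  let ?G = "{M \<in> carrier_mat m m. invertible_mat M \<and> transpose_mat M * J * M = J}"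
  show "inj_on (matop m) ?G" by (rule inj_onI) (use matop_inj in blast)
  have e: "monom 1 i \<in> (polys_lt m :: 'a poly set)" if "i < m" for i using that by (simp add: polys_lt_def)
  have iff: "transpose_mat M * J * M = J \<longleftrightarrow> (\<forall>x\<in>polys_lt m. \<forall>y\<in>polys_lt m. bil m J (matop m M x) (matop m M y) = bil m J x y)"
    if M: "M \<in> carrier_mat m m" for M
  proof
    assume "transpose_mat M * J * M = J"
    then show "\<forall>x\<in>polys_lt m. \<forall>y\<in>polys_lt m. bil m J (matop m M x) (matop m M y) = bil m J x y"
      using bil_congruence[OF M J(1)] by simp
  next
    assume a: "\<forall>x\<in>polys_lt m. \<forall>y\<in>polys_lt m. bil m J (matop m M x) (matop m M y) = bil m J x y"
    show "transpose_mat M * J * M = J"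
    proof (rule eq_matI)
      fix i j assume "i < dim_row J" "j < dim_col J"
      then have ij: "i < m" "j < m" using J(1) by auto
      show "(transpose_mat M * J * M) $$ (i, j) = J $$ (i, j)"
        using a[rule_format, OF e[OF ij(1)] e[OF ij(2)]] bil_congruence[OF M J(1) e[OF ij(1)] e[OF ij(2)]]
        by (simp only: bil_monom[OF ij])
    qed (use M J(1) in auto)
  qed
  show "matop m ` ?G = form.Sp (bil m J) (polys_lt m)"
  proof (intro equalityI subsetI)
    fix T assume "T \<in> matop m ` ?G"
    then obtain M where M: "M \<in> carrier_mat m m" "transpose_mat M * J * M = J" "T = matop m M" by blast
    show "T \<in> form.Sp (bil m J) (polys_lt m)"
      unfolding form.Sp_def M(3) using lin_on_matop[OF M(1)] iff[OF M(1)] M(2) by (auto simp: matop_def)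
  next
    fix T assume T: "T \<in> form.Sp (bil m J) (polys_lt m)"
    define M where "M = mat m m (\<lambda>(i, j). coeff (T (monom 1 j)) i)"
    have M: "M \<in> carrier_mat m m" by (simp add: M_def)
    have TM: "T = matop m M"
    proof
      fix p
      show "T p = matop m M p"
      proof (cases "p \<in> polys_lt m")
        case True
        have sm: "smult c (monom 1 i) \<in> polys_lt m" if "i < m" for i and c :: 'a using that by (auto simp: polys_lt_def)
        have "T p = T (\<Sum>i<m. smult (coeff p i) (monom 1 i))" using polys_lt_expansion[OF True] by simp
        also have "\<dots> = (\<Sum>i<m. T (smult (coeff p i) (monom 1 i)))"
          by (rule form.lin_on_sum[OF form.SpD(1)[OF T] subspace_polys_lt]) (use sm in auto)
        also have "\<dots> = (\<Sum>i<m. smult (coeff p i) (T (monom 1 i)))"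
          by (rule sum.cong[OF refl]) (use form.lin_onD(3)[OF form.SpD(1)[OF T] e] in auto)
        finally have Tp: "T p = (\<Sum>i<m. smult (coeff p i) (T (monom 1 i)))" .
        have "T p \<in> polys_lt m" by (rule form.SpD(4)[OF T True])
        then have hi: "coeff (T p) i = 0" if "\<not> i < m" for i using that by (simp add: polys_lt_def)
        show ?thesis
        proof (rule poly_eqI)
          fix i
          show "coeff (T p) i = coeff (matop m M p) i"
          proof (cases "i < m")
            case i: True
            have "coeff (T p) i = (\<Sum>j<m. M $$ (i, j) * coeff p j)"
              unfolding Tp coeff_sum using i by (intro sum.cong refl) (simp add: M_def mult.commute)
            then show ?thesis using i by (simp add: coeff_matop[OF M True])
          qed (simp add: coeff_matop[OF M True] hi)
        qed
      next
        case False
        then show ?thesis using form.SpD(2)[OF T] by (simp add: matop_def)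
      qed
    qed
    have "transpose_mat M * J * M = J" unfolding iff[OF M] using form.SpD(3)[OF T] TM by simp
    then show "T \<in> matop m ` ?G" using TM M invertible_of_congruence[OF J(1,2) M] by blast
  qed
qed

end

section \<open>Additive characters\<close>

text \<open>Translation by 1 permutes the field, so the sum of all elements equals itself plus
  \<open>CARD('a)\<close>.\<close>

lemma of_nat_CARD: "of_nat CARD('a) = (0 :: 'a::{field,finite})"
proof -
  have "(\<Sum>x\<in>UNIV. x) = (\<Sum>x\<in>(UNIV :: 'a set). x + 1)"
    by (rule sum.reindex_bij_witness[of _ "\<lambda>x. x + 1" "\<lambda>x. x - 1"]) auto
  then show ?thesis by (simp add: sum.distrib)
qed

lemma of_nat_coprime_nonzero:
  assumes p: "of_nat p = (0 :: 'a::field)" and c: "coprime c p"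
  shows "of_nat c \<noteq> (0 :: 'a)"
proof
  assume "of_nat c = (0 :: 'a)"
  then have "CHAR('a) dvd gcd c p" using p by (simp add: of_nat_eq_0_iff_char_dvd)
  then have "CHAR('a) = 1" using c by simp
  then show False by simp
qed

text \<open>Closure under addition gives negatives, as \<open>- x = (p - 1) x\<close>. Maximality is
  a property of the \<open>H\<close> for which the locale is interpreted in
  \<open>additive_character_exists\<close>.\<close>

locale maximal_subgroup =
  fixes p :: nat and H :: "'a::{field,finite} set"
  assumes prime: "prime p" and char: "of_nat p = (0::'a)"
    and zero: "0 \<in> H" and add: "x \<in> H \<Longrightarrow> y \<in> H \<Longrightarrow> x + y \<in> H"
begin

lemma nat_mult: "x \<in> H \<Longrightarrow> of_nat n * x \<in> H"
  by (induction n) (auto simp: zero distrib_right intro: add)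

lemma neg: "x \<in> H \<Longrightarrow> - x \<in> H"
proof -
  assume x: "x \<in> H"
  have "of_nat (p - 1) = (- 1 :: 'a)" using char prime_gt_0_nat[OF prime] by (simp add: of_nat_diff)
  then show ?thesis using nat_mult[OF x, of "p - 1"] by simp
qed

text \<open>A multiplier prime to \<open>p\<close> could be inverted modulo \<open>p\<close>, which
  would bring \<open>v\<close> into \<open>H\<close>; so \<open>v\<close> has order \<open>p\<close>
  modulo \<open>H\<close>.\<close>

lemma dvd_of_mem:
  assumes v: "v \<notin> H" and m: "of_nat m * v \<in> H"
  shows "p dvd m"
proof (rule ccontr)
  assume "\<not> p dvd m"
  then have "coprime m p" using prime prime_imp_coprime coprime_commute by blast
  then obtain x y where "m * x = Suc (p * y)"
    using coprime_bezout_strong[of m p] prime_gt_1_nat[OF prime] by auto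
  then have "of_nat (m * x) = (1 :: 'a)" using char by simp
  moreover have "of_nat x * (of_nat m * v) = of_nat (m * x) * v" by (simp add: mult_ac)
  ultimately have e: "of_nat x * (of_nat m * v) = v" by simp
  show False using nat_mult[OF m, of x] v unfolding e by blast
qed

end

text \<open>Extend a maximal proper subgroup \<open>H\<close> by some \<open>v\<close> outside it; the character is trivial on \<open>H\<close>
  and maps \<open>v\<close> to a primitive \<open>p\<close>-th root of unity.\<close>

lemma additive_character_exists:
  assumes p: "prime p" and char: "of_nat p = (0 :: 'a::{field,finite})"
  obtains \<psi> :: "'a::{field,finite} \<Rightarrow> complex" and w where
    "\<And>x y. \<psi> (x + y) = \<psi> x * \<psi> y" "\<And>x. cmod (\<psi> x) = 1" "\<psi> w \<noteq> 1"
proof -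
  define Hs where "Hs = {H :: 'a set. H \<noteq> UNIV \<and> 0 \<in> H \<and> (\<forall>x\<in>H. \<forall>y\<in>H. x + y \<in> H)}"
  have "(1::'a) \<in> UNIV - {0}" by simp
  then have "{0::'a} \<noteq> UNIV" by blast
  then have "{0} \<in> Hs" by (auto simp: Hs_def)
  moreover have "finite Hs" by simp
  ultimately obtain H where H: "H \<in> Hs" and max: "\<And>H'. H' \<in> Hs \<Longrightarrow> H \<subseteq> H' \<Longrightarrow> H = H'"
    using finite_has_maximal[of Hs] by blast
  interpret maximal_subgroup p H by unfold_locales (use p char H in \<open>auto simp: Hs_def\<close>)
  obtain v where v: "v \<notin> H" using H by (auto simp: Hs_def)
  \<comment> \<open>\<open>G\<close> is generated by \<open>H\<close> and \<open>v\<close>; being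
    strictly larger than \<open>H\<close> and closed under addition, it is everything by
    maximality.\<close>
  define G where "G = {h + of_nat m * v | h m. h \<in> H}"
  have "H \<subseteq> G"
  proof
    fix h assume "h \<in> H"
    moreover have "h = h + of_nat 0 * v" by simp
    ultimately show "h \<in> G" unfolding G_def by blast
  qed
  moreover have "v \<in> G"
  proof -
    have "v = 0 + of_nat 1 * v" by simp
    then show ?thesis unfolding G_def using zero by blast
  qed
  ultimately have "H \<subset> G" using v by blast
  then have "G \<notin> Hs" using max[of G] by blast
  moreover have "0 \<in> G" using zero \<open>H \<subseteq> G\<close> by blast
  moreover have "x + y \<in> G" if "x \<in> G" "y \<in> G" for x y
  proof -
    from that obtain h m h' m' where "x = h + of_nat m * v" "y = h' + of_nat m' * v" "h \<in> H" "h' \<in> H"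
      unfolding G_def by blast
    moreover from this have "x + y = (h + h') + of_nat (m + m') * v" by (simp add: algebra_simps)
    ultimately show ?thesis unfolding G_def using add by blast
  qed
  ultimately have "G = UNIV" by (auto simp: Hs_def)
  then have ex: "\<exists>m. \<exists>h\<in>H. x = h + of_nat m * v" for x unfolding G_def by blast
  define \<mu> where "\<mu> = (\<lambda>x. SOME m. \<exists>h\<in>H. x = h + of_nat m * v)"
  have mu: "\<exists>h\<in>H. x = h + of_nat (\<mu> x) * v" for x unfolding \<mu>_def by (rule someI_ex[OF ex])
  define \<zeta> where "\<zeta> = cis (2 * pi / p)"
  have p0: "p > 1" using p by (rule prime_gt_1_nat)
  have zp: "\<zeta> ^ p = 1" using p0 by (simp add: \<zeta>_def DeMoivre)
  \<comment> \<open>The multiple of \<open>v\<close> is determined modulo \<open>p\<close>, and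
    \<open>\<zeta> ^ p = 1\<close>, so the arbitrary choice in \<open>\<mu>\<close> is
    harmless.\<close>
  have zeq: "\<zeta> ^ m = \<zeta> ^ m'" if "h \<in> H" "h' \<in> H" "h + of_nat m * v = h' + of_nat m' * v" for h h' m m'
  proof -
    have *: "\<zeta> ^ m = \<zeta> ^ m'" if le: "m \<le> m'" and h: "h \<in> H" "h' \<in> H" "h + of_nat m * v = h' + of_nat m' * v" for h h' m m'
    proof -
      have "of_nat (m' - m) * v = h + - h'" using h(3) le by (simp add: of_nat_diff algebra_simps)
      then have "of_nat (m' - m) * v \<in> H" using add[OF h(1) neg[OF h(2)]] by simp
      then have "p dvd m' - m" by (rule dvd_of_mem[OF v])
      then obtain k where "m' - m = p * k" ..
      then have "m' = m + p * k" using le by linarith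
      then show ?thesis by (simp add: power_add power_mult zp)
    qed
    show ?thesis
    proof (cases "m \<le> m'")
      case False
      then show ?thesis using *[of m' m h' h] that by simp
    qed (rule *[OF _ that])
  qed
  define \<psi> where "\<psi> = (\<lambda>x. \<zeta> ^ \<mu> x)"
  have psi: "\<psi> (h + of_nat m * v) = \<zeta> ^ m" if "h \<in> H" for h m
  proof -
    obtain h' where h': "h' \<in> H" "h + of_nat m * v = h' + of_nat (\<mu> (h + of_nat m * v)) * v" using mu by blast
    show ?thesis unfolding \<psi>_def by (rule zeq[OF h'(1) that h'(2)[symmetric]])
  qed
  show thesis
  proof (rule that[of \<psi> v])
    fix x y
    obtain h m h' m' where xy: "x = h + of_nat m * v" "y = h' + of_nat m' * v" "h \<in> H" "h' \<in> H" using ex by metis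
    then have e: "x + y = (h + h') + of_nat (m + m') * v" by (simp add: algebra_simps)
    have "\<psi> (x + y) = \<zeta> ^ (m + m')" unfolding e by (rule psi[OF add[OF xy(3,4)]])
    moreover have "\<psi> x = \<zeta> ^ m" "\<psi> y = \<zeta> ^ m'" unfolding xy(1,2) by (rule psi[OF xy(3)], rule psi[OF xy(4)])
    ultimately show "\<psi> (x + y) = \<psi> x * \<psi> y" by (simp add: power_add)
  next
    show "cmod (\<psi> x) = 1" for x by (simp add: \<psi>_def \<zeta>_def norm_power)
    have "\<psi> v = \<zeta>" using psi[OF zero, of 1] by simp
    moreover have "\<zeta> \<noteq> 1"
    proof
      assume "\<zeta> = 1"
      then have "cos (2 * pi / p) = 1" by (simp add: \<zeta>_def complex_eq_iff)
      then obtain k :: int where "2 * pi / p = real_of_int k * 2 * pi" unfolding cos_one_2pi_int by blast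
      then have "real_of_int k * real p = 1" using p0 by (simp add: field_simps)
      then have "real_of_int (k * int p) = real_of_int 1" by simp
      then have "k * int p = 1" unfolding of_int_eq_iff .
      then show False using p0 by (simp add: zmult_eq_1_iff)
    qed
    ultimately show "\<psi> v \<noteq> 1" by simp
  qed
qed

text \<open>For \<open>x \<noteq> 0\<close>, shifting \<open>t\<close> by \<open>w / x\<close>
  multiplies the sum by \<open>\<psi> w\<close>, which is not 1.\<close>

lemma character_orthogonality:
  fixes \<psi> :: "'a::{field,finite} \<Rightarrow> complex"
  assumes add: "\<And>x y. \<psi> (x + y) = \<psi> x * \<psi> y" and w: "\<psi> w \<noteq> 1" and z: "\<psi> 0 = 1"
  shows "(\<Sum>t\<in>UNIV. \<psi> (t * x)) = (if x = 0 then of_nat CARD('a) else 0)"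
proof (cases "x = 0")
  case False
  have "(\<Sum>t\<in>UNIV. \<psi> (t * x)) = (\<Sum>t\<in>UNIV. \<psi> ((t + w / x) * x))"
    by (rule sum.reindex_bij_witness[of _ "\<lambda>t. t + w / x" "\<lambda>t. t - w / x"]) auto
  also have "\<dots> = (\<Sum>t\<in>UNIV. \<psi> w * \<psi> (t * x))"
  proof (rule sum.cong[OF refl])
    fix t
    have "(t + w / x) * x = w + t * x" using False by (simp add: distrib_right)
    then show "\<psi> ((t + w / x) * x) = \<psi> w * \<psi> (t * x)" by (simp only: add)
  qed
  also have "\<dots> = \<psi> w * (\<Sum>t\<in>UNIV. \<psi> (t * x))" by (rule sum_distrib_left[symmetric])
  finally have "(1 - \<psi> w) * (\<Sum>t\<in>UNIV. \<psi> (t * x)) = 0" by (simp add: left_diff_distrib)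
  then show ?thesis using w False by simp
qed (simp add: z)

section \<open>Fourier inversion\<close>

lemma symp_group_bij:
  fixes J :: "'a::{field,finite} mat"
  assumes "(2::'a) \<noteq> 0" "J \<in> carrier_mat (2 * n) (2 * n)" "invertible_mat J" "transpose_mat J = - J"
  shows "bij_betw (matop (2 * n)) (symp_group n J) (finite_field_space.Sp smult (bil (2 * n) J) (polys_lt (2 * n)))"
  using bij_betw_matop[OF assms] by (simp add: symp_group_def)

lemma symp_group_character_bound:
  fixes \<psi> :: "'a::{field,finite} \<Rightarrow> complex" and J :: "'a mat" and b :: "nat \<Rightarrow> nat"
  assumes two: "(2::'a) \<noteq> 0" and J: "J \<in> carrier_mat (2 * n) (2 * n)" "invertible_mat J" "transpose_mat J = - J"
    and psi: "\<And>x y. \<psi> (x + y) = \<psi> x * \<psi> y" "\<And>x. cmod (\<psi> x) = 1" "\<psi> w \<noteq> 1"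
    and b: "\<And>i j. i < j \<Longrightarrow> j < k \<Longrightarrow> b i < b j" "\<And>i. i < k \<Longrightarrow> b i > 0" "\<And>i. i < k \<Longrightarrow> of_nat (b i) \<noteq> (0::'a)"
    and t: "i1 < k" "t i1 \<noteq> 0"
  shows "cmod ((\<Sum>M\<in>symp_group n J. \<psi> (\<Sum>i<k. t i * mat_trace (M ^\<^sub>m b i))) / of_nat (card (symp_group n J)))
    \<le> real CARD('a) powr (- (real n ^ 2) / (2 * real (b (k - 1)))) * real CARD('a) powr (real n / 2)
      * (1 + 1 / (real CARD('a) ^ 2 - 1)) ^ n * real ((n + 2 * b (k - 1) - 1) choose n)"
proof -
  have "\<psi> 0 = \<psi> 0 * \<psi> 0" using psi(1)[of 0 0] by simp
  moreover have "\<psi> 0 \<noteq> 0" using psi(2)[of 0] by auto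
  ultimately have psi0: "\<psi> 0 = 1" by simp
  interpret form: alternating_form smult "bil (2 * n) J"
    by (rule alternating_form_bil[OF two J(1,3)])
  interpret c: trace_character smult "bil (2 * n) J" \<psi> k t b
    by unfold_locales (use psi psi0 b two in \<open>auto simp: Suc_le_eq\<close>)
  define S where "S = (polys_lt (2 * n) :: 'a poly set)"
  have S: "form.nondeg (bil (2 * n) J) S" "card S = CARD('a) ^ (2 * n)"
    unfolding S_def by (rule nondeg_polys_lt[OF two J]) (rule card_polys_lt)
  define I where "I = {i. i < k \<and> t i \<noteq> 0}"
  \<comment> \<open>As \<open>b\<close> increases, the largest index with a nonzero \<open>t\<close>
    carries the strictly largest active exponent.\<close>
  define i0 where "i0 = Max I"
  have fI: "finite I" "I \<noteq> {}" using t by (auto simp: I_def)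
  have i0: "i0 < k" "t i0 \<noteq> 0" using Max_in[OF fI] by (auto simp: i0_def I_def)
  have lt: "b i < b i0" if "i < k" "i \<noteq> i0" "t i \<noteq> 0" for i
  proof -
    have "i \<le> i0" unfolding i0_def using that fI by (intro Max_ge) (auto simp: I_def)
    then show ?thesis using that i0 by (intro b(1)) auto
  qed
  have le: "b i0 \<le> b (k - 1)" 
  proof (cases "i0 = k - 1")
    case False
    then show ?thesis using b(1)[of i0 "k - 1"] i0(1) by linarith
  qed simp
  have bij: "bij_betw (matop (2 * n)) (symp_group n J) (form.Sp (bil (2 * n) J) S)"
    unfolding S_def by (rule symp_group_bij[OF two J])
  have chi: "c.chi S (matop (2 * n) M) = \<psi> (\<Sum>i<k. t i * mat_trace (M ^\<^sub>m b i))" if "M \<in> symp_group n J" for M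
  proof -
    have M: "M \<in> carrier_mat (2 * n) (2 * n)" using that by (simp add: symp_group_def)
    show ?thesis
      unfolding c.chi_def S_def matop_pow[OF M, symmetric] tr_matop[OF two J pow_carrier_mat[OF M]] ..
  qed
  have "c.EE S = (\<Sum>M\<in>symp_group n J. \<psi> (\<Sum>i<k. t i * mat_trace (M ^\<^sub>m b i))) / of_nat (card (symp_group n J))"
    unfolding c.EE_def sum.reindex_bij_betw[OF bij, symmetric] bij_betw_same_card[OF bij, symmetric]
    by (simp add: chi)
  then show ?thesis using c.EE_bound[OF i0 lt b(3)[OF i0(1)] psi(3) le S] by simp
qed

text \<open>Fourier inversion on \<open>F^k\<close>: the frequency zero contributes
  \<open>q^-k\<close>, and each of the other \<open>q^k - 1\<close> frequencies contributes at most
  \<open>q^-k * B\<close> in modulus.\<close>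

lemma probability_minus_uniform_le:
  fixes \<psi> :: "'a::{field,finite} \<Rightarrow> complex" and f :: "'m \<Rightarrow> nat \<Rightarrow> 'a" and k :: nat
  assumes G: "finite G" "G \<noteq> {}"
    and psi: "\<And>x y. \<psi> (x + y) = \<psi> x * \<psi> y" "\<And>x. cmod (\<psi> x) = 1" "\<psi> w \<noteq> 1"
    and E: "\<And>t i. i < k \<Longrightarrow> t i \<noteq> 0 \<Longrightarrow> cmod ((\<Sum>M\<in>G. \<psi> (\<Sum>i<k. t i * f M i)) / of_nat (card G)) \<le> B"
    and B: "B \<ge> 0"
  shows "\<bar>real (card {M \<in> G. \<forall>i<k. f M i = a i}) / real (card G) - 1 / real CARD('a) ^ k\<bar> \<le> B"
proof -
  define Q where "Q = real CARD('a)"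
  have Q: "Q > 0" by (simp add: Q_def)
  have cG: "card G > 0" using G by (simp add: card_gt_0_iff)
  have "\<psi> 0 = \<psi> 0 * \<psi> 0" using psi(1)[of 0 0] by simp
  moreover have "\<psi> 0 \<noteq> 0" using psi(2)[of 0] by auto
  ultimately have psi0: "\<psi> 0 = 1" by simp
  have psi_sum: "\<psi> (\<Sum>i\<in>A. g i) = (\<Prod>i\<in>A. \<psi> (g i))" if "finite A" for A :: "nat set" and g
    using that by (induction A) (auto simp: psi0 psi(1))
  define T where "T = PiE {..<k} (\<lambda>_. UNIV :: 'a set)"
  define t0 where "t0 = (\<lambda>i\<in>{..<k}. 0 :: 'a)"
  have T: "finite T" "t0 \<in> T" "card T = CARD('a) ^ k" by (auto simp: T_def t0_def card_PiE intro: finite_PiE)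
  define E where "E = (\<lambda>t. (\<Sum>M\<in>G. \<psi> (\<Sum>i<k. t i * f M i)) / of_nat (card G))"
  define C where "C = {M \<in> G. \<forall>i<k. f M i = a i}"
  have fourier: "(\<Sum>t\<in>T. \<psi> (\<Sum>i<k. t i * (f M i - a i))) = (if \<forall>i<k. f M i = a i then of_real (Q ^ k) else 0)" for M
  proof -
    have "(\<Sum>t\<in>T. \<psi> (\<Sum>i<k. t i * (f M i - a i))) = (\<Sum>t\<in>T. \<Prod>i<k. \<psi> (t i * (f M i - a i)))"
      by (simp add: psi_sum)
    also have "\<dots> = (\<Prod>i<k. \<Sum>c\<in>UNIV. \<psi> (c * (f M i - a i)))"
      unfolding T_def by (rule prod_sum_PiE[symmetric]) auto
    also have "\<dots> = (\<Prod>i<k. if f M i = a i then of_real Q else 0)"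
      unfolding character_orthogonality[OF psi(1,3) psi0] by (simp add: Q_def cong: if_cong)
    finally show ?thesis by (auto simp: prod_zero_iff)
  qed
  have "of_real (Q ^ k) * of_nat (card C) = (\<Sum>M\<in>G. if \<forall>i<k. f M i = a i then of_real (Q ^ k) else (0::complex))"
    unfolding C_def using G(1) by (simp add: sum.If_cases Int_def mult.commute)
  also have "\<dots> = (\<Sum>M\<in>G. \<Sum>t\<in>T. \<psi> (\<Sum>i<k. t i * (f M i - a i)))" by (simp only: fourier)
  also have "\<dots> = (\<Sum>t\<in>T. \<Sum>M\<in>G. \<psi> (\<Sum>i<k. t i * (f M i - a i)))" by (rule sum.swap)
  also have "\<dots> = (\<Sum>t\<in>T. of_nat (card G) * (\<psi> (- (\<Sum>i<k. t i * a i)) * E t))"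
  proof (rule sum.cong[OF refl])
    fix t
    have "\<psi> (\<Sum>i<k. t i * (f M i - a i)) = \<psi> (- (\<Sum>i<k. t i * a i)) * \<psi> (\<Sum>i<k. t i * f M i)" for M
      by (simp add: psi(1)[symmetric] right_diff_distrib sum_subtractf)
    then show "(\<Sum>M\<in>G. \<psi> (\<Sum>i<k. t i * (f M i - a i))) = of_nat (card G) * (\<psi> (- (\<Sum>i<k. t i * a i)) * E t)"
      using cG by (simp add: E_def sum_distrib_left[symmetric])
  qed
  also have "\<dots> = of_nat (card G) * (\<Sum>t\<in>T. \<psi> (- (\<Sum>i<k. t i * a i)) * E t)" by (rule sum_distrib_left[symmetric])
  finally have eq: "of_real (Q ^ k) * of_nat (card C) / of_nat (card G) = (\<Sum>t\<in>T. \<psi> (- (\<Sum>i<k. t i * a i)) * E t)"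
    using cG by (simp add: field_simps)
  have "\<psi> (- (\<Sum>i<k. t0 i * a i)) * E t0 = 1" using cG by (simp add: t0_def E_def psi0)
  then have "complex_of_real (Q ^ k * (real (card C) / real (card G)) - 1) = (\<Sum>t\<in>T - {t0}. \<psi> (- (\<Sum>i<k. t i * a i)) * E t)"
    using eq sum.remove[OF T(1,2), of "\<lambda>t. \<psi> (- (\<Sum>i<k. t i * a i)) * E t"] by simp
  then have "\<bar>Q ^ k * (real (card C) / real (card G)) - 1\<bar> = cmod (\<Sum>t\<in>T - {t0}. \<psi> (- (\<Sum>i<k. t i * a i)) * E t)"
    by (metis norm_of_real)
  also have "\<dots> \<le> (\<Sum>t\<in>T - {t0}. B)"
  proof (rule sum_norm_le)
    fix t assume t: "t \<in> T - {t0}"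
    have "\<exists>i<k. t i \<noteq> 0"
    proof (rule ccontr)
      assume "\<not> (\<exists>i<k. t i \<noteq> 0)"
      then have "t = t0" using t unfolding T_def t0_def by (intro ext) (auto simp: PiE_def extensional_def restrict_def)
      then show False using t by simp
    qed
    then obtain i where "i < k" "t i \<noteq> 0" by blast
    then show "cmod (\<psi> (- (\<Sum>i<k. t i * a i)) * E t) \<le> B"
      using assms(6)[of i t] unfolding norm_mult psi(2) E_def by simp
  qed
  also have "\<dots> \<le> (\<Sum>t\<in>T. B)" using T(1) B by (intro sum_mono2) auto
  also have "\<dots> = Q ^ k * B" by (simp add: T(3) Q_def)
  finally have 1: "\<bar>Q ^ k * (real (card C) / real (card G)) - 1\<bar> \<le> Q ^ k * B" .
  have "Q ^ k * \<bar>real (card C) / real (card G) - 1 / Q ^ k\<bar> = \<bar>Q ^ k * (real (card C) / real (card G) - 1 / Q ^ k)\<bar>"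
    using Q by (simp only: abs_mult) simp
  also have "Q ^ k * (real (card C) / real (card G) - 1 / Q ^ k) = Q ^ k * (real (card C) / real (card G)) - 1"
    using Q by (simp add: right_diff_distrib)
  finally have "Q ^ k * \<bar>real (card C) / real (card G) - 1 / Q ^ k\<bar> \<le> Q ^ k * B" using 1 by simp
  then show ?thesis using Q unfolding C_def[symmetric] Q_def[symmetric] by (simp only: mult_le_cancel_left_pos zero_less_power)
qed

text \<open>Indices run from 0, so \<open>b (k - 1)\<close> is the largest exponent; every nonzero
  frequency is bounded with this same exponent.\<close>

theorem theorem6p22:
  fixes p r q n k :: nat
    and J :: "'a::{field,finite} mat"
    and b :: "nat \<Rightarrow> nat" and a :: "nat \<Rightarrow> 'a"
  assumes "prime p" and "r \<ge> 1" and "card (UNIV :: 'a set) = q" and "q = p ^ r" and "odd p"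
    and "n \<ge> 1"
    and "J \<in> carrier_mat (2*n) (2*n)" and "invertible_mat J" and "transpose_mat J = - J"
    and "k \<ge> 1"
    and "\<And>i j. i < j \<Longrightarrow> j < k \<Longrightarrow> b i < b j"
    and "\<And>i. i < k \<Longrightarrow> b i > 0 \<and> coprime (b i) p"
  shows "\<bar>real (card {M \<in> symp_group n J. \<forall>i<k. mat_trace (M ^\<^sub>m b i) = a i})
            / real (card (symp_group n J)) - real q powr (- real k)\<bar>
         \<le> real q powr (- (real n ^ 2) / (2 * real (b (k - 1))))
           * real q powr (real n / 2)
           * (1 + 1 / (real q ^ 2 - 1)) ^ n
           * real ((n - 1 + 2 * b (k - 1)) choose n)"
proof -
  \<comment> \<open>\<open>q = p^r\<close> vanishes in the field, hence so does \<open>p\<close>;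
    this makes 2 and all \<open>b i\<close> invertible.\<close>
  have "(of_nat p :: 'a) ^ r = 0" using of_nat_CARD[where 'a = 'a] assms(3,4) by simp
  then have p0: "of_nat p = (0::'a)" by simp
  have two: "(2::'a) \<noteq> 0" using of_nat_coprime_nonzero[OF p0, of 2] assms(5) by simp
  obtain \<psi> :: "'a \<Rightarrow> complex" and w where psi: "\<And>x y. \<psi> (x + y) = \<psi> x * \<psi> y" "\<And>x. cmod (\<psi> x) = 1" "\<psi> w \<noteq> 1"
    using additive_character_exists[OF assms(1) p0] by metis
  have b: "\<And>i. i < k \<Longrightarrow> b i > 0" "\<And>i. i < k \<Longrightarrow> of_nat (b i) \<noteq> (0::'a)"
    using assms(12) of_nat_coprime_nonzero[OF p0] by blast+
  interpret form: alternating_form smult "bil (2 * n) J"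
    by (rule alternating_form_bil[OF two assms(7,9)])
  note bij = symp_group_bij[OF two assms(7-9)]
  have G: "finite (symp_group n J)" "symp_group n J \<noteq> {}"
    using bij_betw_finite[OF bij] form.finite_Sp[of "polys_lt (2 * n)"] form.Sp_id[of "polys_lt (2 * n)"] bij_betw_imp_surj_on[OF bij]
    by (auto simp: finite_polys_lt)
  have q: "real q > 0" using assms(3) by (metis finite_UNIV_card_ge_0 finite of_nat_0_less_iff)
  have q1: "real q ^ 2 \<ge> 1" using q by simp
  define B where "B = real CARD('a) powr (- (real n ^ 2) / (2 * real (b (k - 1)))) * real CARD('a) powr (real n / 2)
      * (1 + 1 / (real CARD('a) ^ 2 - 1)) ^ n * real ((n + 2 * b (k - 1) - 1) choose n)"
  have "B \<ge> 0" unfolding B_def assms(3) using q1 by (intro mult_nonneg_nonneg zero_le_power) auto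
  have "\<bar>real (card {M \<in> symp_group n J. \<forall>i<k. mat_trace (M ^\<^sub>m b i) = a i}) / real (card (symp_group n J))
      - 1 / real CARD('a) ^ k\<bar> \<le> B"
    by (rule probability_minus_uniform_le[OF G psi _ \<open>B \<ge> 0\<close>])
      (unfold B_def, rule symp_group_character_bound[OF two assms(7-9) psi assms(11) b])
  moreover have "1 / real CARD('a) ^ k = real q powr (- real k)"
    unfolding assms(3) using q by (simp add: powr_minus_divide powr_realpow)
  moreover have "n + 2 * b (k - 1) - 1 = n - 1 + 2 * b (k - 1)" using assms(6) by simp
  ultimately show ?thesis unfolding B_def assms(3) by simp
qed

end
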